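(* Let $H$ be a semisimple Hopf algebra over a field $\Bbbk$ and let $A$ be an $H$-semiprimitive partial $H$-module algebra. If $A$ is locally finite (every finite subset of $A$ is contained in a finite-dimensional subalgebra), then the partial smash product $\underline{A\#H}$ is semiprimitive, i.e. its Jacobson radical is zero.
   Context: All algebras are associative and unital over a field $\Bbbk$. $H$ is a Hopf algebra over $\Bbbk$ with comultiplication $\Delta(h)=\sum h_1\otimes h_2$. "Semisimple" means semisimple as an algebra. A (left) partial $H$-module algebra is an algebra $A$ with a $\Bbbk$-linear map $H\otimes A\to A$, $h\otimes a\mapsto h\cdot a$, such that for all $a,b\in A$, $h,g\in H$: $1_H\cdot a=a$ and $h\cdot(a(g\cdot b))=\sum (h_1\cdot a)((h_2g)\cdot b)$. An ideal $I$ of $A$ is $H$-stable if $H\cdot I\subseteq I$; then $A/I$ is a partial $H$-module algebra via $h\cdot(a+I)=(h\cdot a)+I$. The vector space $A\otimes H$ with product $(a\# h)(b\# g)=\sum a(h_1\cdot b)\# h_2g$ (writing $a\#h$ for $a\otimes h$) is an associative algebra $A\#H$. The partial smash product is $\underline{A\#H}:=(A\#H)(1_A\#1_H)$, which is spanned by the elements $\underline{a\#h}:=\sum a(h_1\cdot 1_A)\#h_2$ and is a unital algebra with identity $1_A\#1_H$. A right partial $(A,H)$-module is a right $A$-module $M$ with a $\Bbbk$-linear map $M\otimes H\to M$, $m\otimes h\mapsto m\blacktriangleleft h$, such that $m\blacktriangleleft 1_H=m$ and $((m\blacktriangleleft h)a)\blacktriangleleft g=\sum (m(h_1\cdot a))\blacktriangleleft(h_2g)$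 for all $m\in M$, $a\in A$, $h,g\in H$. It is irreducible if $M\ne 0$ and its only partial $(A,H)$-submodules are $0$ and $M$. A right $H$-primitive ideal of $A$ is an $H$-stable ideal $I$ such that $A/I$ has a faithful (annihilator zero in $A/I$) irreducible right partial $(A/I,H)$-module; equivalently, $I$ is the annihilator in $A$ of an irreducible right partial $(A,H)$-module. The $H$-Jacobson radical $J_H(A)$ is the intersection of all right $H$-primitive ideals of $A$ (the analogous left-handed definition gives the same ideal). $A$ is $H$-semiprimitive if $J_H(A)=0$. *)

theory Defs
  imports
    "Jordan_Normal_Form.VS_Connect"
    "HOL-Algebra.QuotRing"
    "HOL-Algebra.Subrings"
    "HOL-Library.Poly_Mapping"
begin

text \<open>The ground field is a type \<open>'k :: field\<close>, used through the ring record
  \<open>class_ring\<close>. Vector spaces and algebras are \<^typ>\<open>('k, 'v) module\<close> records with explicit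
  carriers, so that quotients, subalgebras and the zero algebra are covered.\<close>

locale algebra_over_field = vectorspace "class_ring :: 'k::field ring" A + ring A
  for A :: "('k::field, 'a) module" +
  assumes smult_mult_left:
      "\<lbrakk>x \<in> carrier A; y \<in> carrier A\<rbrakk> \<Longrightarrow> (c \<odot>\<^bsub>A\<^esub> x) \<otimes>\<^bsub>A\<^esub> y = c \<odot>\<^bsub>A\<^esub> (x \<otimes>\<^bsub>A\<^esub> y)"
    and smult_mult_right:
      "\<lbrakk>x \<in> carrier A; y \<in> carrier A\<rbrakk> \<Longrightarrow> x \<otimes>\<^bsub>A\<^esub> (c \<odot>\<^bsub>A\<^esub> y) = c \<odot>\<^bsub>A\<^esub> (x \<otimes>\<^bsub>A\<^esub> y)"

abbreviation linear_maps :: "('k::field, 'v) module \<Rightarrow> ('k, 'w) module \<Rightarrow> ('v \<Rightarrow> 'w) set" where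
  "linear_maps \<equiv> LinearCombinations.module_hom class_ring"

definition bilinear_map ::
  "('k::field, 'v) module \<Rightarrow> ('k, 'w) module \<Rightarrow> ('k, 'x) module \<Rightarrow> ('v \<Rightarrow> 'w \<Rightarrow> 'x) \<Rightarrow> bool" where
  "bilinear_map V W X f \<longleftrightarrow>
     (\<forall>v\<in>carrier V. f v \<in> linear_maps W X) \<and>
     (\<forall>w\<in>carrier W. (\<lambda>v. f v w) \<in> linear_maps V X)"


section \<open>Tensor products\<close>

text \<open>The tensor product is the free vector space on \<open>carrier V \<times> carrier W\<close> modulo the
  bilinearity relations; its elements are cosets.\<close>

type_synonym ('k, 'v, 'w) tensor = "('v \<times> 'w \<Rightarrow>\<^sub>0 'k) set"

definition tensor_free :: "('k::field, 'v) module \<Rightarrow> ('k, 'w) module \<Rightarrow> ('v \<times> 'w \<Rightarrow>\<^sub>0 'k) set" where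
  "tensor_free V W = {p. Poly_Mapping.keys p \<subseteq> carrier V \<times> carrier W}"

inductive_set tensor_null :: "('k::field, 'v) module \<Rightarrow> ('k, 'w) module \<Rightarrow> ('v \<times> 'w \<Rightarrow>\<^sub>0 'k) set"
  for V W where
  add_left: "\<lbrakk>v \<in> carrier V; v' \<in> carrier V; w \<in> carrier W\<rbrakk> \<Longrightarrow>
    Poly_Mapping.single (v \<oplus>\<^bsub>V\<^esub> v', w) 1 - Poly_Mapping.single (v, w) 1
      - Poly_Mapping.single (v', w) 1 \<in> tensor_null V W"
| add_right: "\<lbrakk>v \<in> carrier V; w \<in> carrier W; w' \<in> carrier W\<rbrakk> \<Longrightarrow>
    Poly_Mapping.single (v, w \<oplus>\<^bsub>W\<^esub> w') 1 - Poly_Mapping.single (v, w) 1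
      - Poly_Mapping.single (v, w') 1 \<in> tensor_null V W"
| smult_left: "\<lbrakk>v \<in> carrier V; w \<in> carrier W\<rbrakk> \<Longrightarrow>
    Poly_Mapping.single (c \<odot>\<^bsub>V\<^esub> v, w) 1 - Poly_Mapping.single (v, w) c \<in> tensor_null V W"
| smult_right: "\<lbrakk>v \<in> carrier V; w \<in> carrier W\<rbrakk> \<Longrightarrow>
    Poly_Mapping.single (v, c \<odot>\<^bsub>W\<^esub> w) 1 - Poly_Mapping.single (v, w) c \<in> tensor_null V W"
| zero: "0 \<in> tensor_null V W"
| add: "\<lbrakk>p \<in> tensor_null V W; q \<in> tensor_null V W\<rbrakk> \<Longrightarrow> p + q \<in> tensor_null V W"
| smult: "p \<in> tensor_null V W \<Longrightarrow> Poly_Mapping.map ((*) c) p \<in> tensor_null V W"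

definition tensor_class ::
  "('k::field, 'v) module \<Rightarrow> ('k, 'w) module \<Rightarrow> ('v \<times> 'w \<Rightarrow>\<^sub>0 'k) \<Rightarrow> ('k, 'v, 'w) tensor" where
  "tensor_class V W p = {q \<in> tensor_free V W. q - p \<in> tensor_null V W}"

definition tensor_elem ::
  "('k::field, 'v) module \<Rightarrow> ('k, 'w) module \<Rightarrow> 'v \<Rightarrow> 'w \<Rightarrow> ('k, 'v, 'w) tensor" where
  "tensor_elem V W v w = tensor_class V W (Poly_Mapping.single (v, w) 1)"

text \<open>Only a vector space; the multiplicative fields are irrelevant here.\<close>

definition tensor_space ::
  "('k::field, 'v) module \<Rightarrow> ('k, 'w) module \<Rightarrow> ('k, ('k, 'v, 'w) tensor) module" where
  "tensor_space V W =
     \<lparr>carrier = tensor_class V W ` tensor_free V W,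
      mult = undefined, one = undefined,
      zero = tensor_class V W 0,
      add = (\<lambda>s t. \<Union>p\<in>s. \<Union>q\<in>t. tensor_class V W (p + q)),
      smult = (\<lambda>c t. \<Union>p\<in>t. tensor_class V W (Poly_Mapping.map ((*) c) p))\<rparr>"

definition tensor_eval ::
  "('k::field, 'x) module \<Rightarrow> ('v \<Rightarrow> 'w \<Rightarrow> 'x) \<Rightarrow> ('v \<times> 'w \<Rightarrow>\<^sub>0 'k) \<Rightarrow> 'x" where
  "tensor_eval X f p =
     (\<Oplus>\<^bsub>X\<^esub>z\<in>Poly_Mapping.keys p. Poly_Mapping.lookup p z \<odot>\<^bsub>X\<^esub> f (fst z) (snd z))"

text \<open>For bilinear \<open>f : V \<times> W \<rightarrow> X\<close>, \<open>tensor_lift X f\<close> is the induced linear map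
  \<open>V \<otimes> W \<rightarrow> X\<close>, since \<open>tensor_eval X f\<close> is then constant on cosets. In particular the Sweedler sum of \<open>f h\<^sub>1 h\<^sub>2\<close> is
  \<open>tensor_lift X f (\<Delta> h)\<close>.\<close>

definition tensor_lift ::
  "('k::field, 'x) module \<Rightarrow> ('v \<Rightarrow> 'w \<Rightarrow> 'x) \<Rightarrow> ('k, 'v, 'w) tensor \<Rightarrow> 'x" where
  "tensor_lift X f t = (THE x. \<forall>p\<in>t. x = tensor_eval X f p)"

definition tensor_algebra ::
  "('k::field, 'a) module \<Rightarrow> ('k, 'b) module \<Rightarrow> ('k, ('k, 'a, 'b) tensor) module" where
  "tensor_algebra A B = (tensor_space A B)
     \<lparr>mult := (\<lambda>s t.
        tensor_lift (tensor_space A B)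
          (\<lambda>a b. tensor_lift (tensor_space A B)
             (\<lambda>a' b'. tensor_elem A B (a \<otimes>\<^bsub>A\<^esub> a') (b \<otimes>\<^bsub>B\<^esub> b')) t) s),
      one := tensor_elem A B \<one>\<^bsub>A\<^esub> \<one>\<^bsub>B\<^esub>\<rparr>"


section \<open>Hopf algebras and partial actions\<close>

locale hopf_algebra = algebra_over_field H
  for H :: "('k::field, 'h) module" +
  fixes \<Delta> :: "'h \<Rightarrow> ('k, 'h, 'h) tensor"
    and \<epsilon> :: "'h \<Rightarrow> 'k"
    and S :: "'h \<Rightarrow> 'h"
  assumes comult_linear: "\<Delta> \<in> linear_maps H (tensor_space H H)"
    and comult_hom: "\<Delta> \<in> Ring.ring_hom H (tensor_algebra H H)"
    and counit_hom: "\<epsilon> \<in> Ring.ring_hom H class_ring"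
    and counit_smult: "h \<in> carrier H \<Longrightarrow> \<epsilon> (c \<odot>\<^bsub>H\<^esub> h) = c * \<epsilon> h"
    and antipode_linear: "S \<in> linear_maps H H"
    and coassoc: "h \<in> carrier H \<Longrightarrow>
      tensor_lift (tensor_space H (tensor_space H H))
        (\<lambda>h1 h2. tensor_lift (tensor_space H (tensor_space H H))
           (\<lambda>h11 h12. tensor_elem H (tensor_space H H) h11 (tensor_elem H H h12 h2)) (\<Delta> h1)) (\<Delta> h)
      = tensor_lift (tensor_space H (tensor_space H H))
        (\<lambda>h1 h2. tensor_elem H (tensor_space H H) h1 (\<Delta> h2)) (\<Delta> h)"
    and counit_left: "h \<in> carrier H \<Longrightarrow> tensor_lift H (\<lambda>h1 h2. \<epsilon> h1 \<odot>\<^bsub>H\<^esub> h2) (\<Delta> h) = h"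
    and counit_right: "h \<in> carrier H \<Longrightarrow> tensor_lift H (\<lambda>h1 h2. \<epsilon> h2 \<odot>\<^bsub>H\<^esub> h1) (\<Delta> h) = h"
    and antipode_left: "h \<in> carrier H \<Longrightarrow>
      tensor_lift H (\<lambda>h1 h2. S h1 \<otimes>\<^bsub>H\<^esub> h2) (\<Delta> h) = \<epsilon> h \<odot>\<^bsub>H\<^esub> \<one>\<^bsub>H\<^esub>"
    and antipode_right: "h \<in> carrier H \<Longrightarrow>
      tensor_lift H (\<lambda>h1 h2. h1 \<otimes>\<^bsub>H\<^esub> S h2) (\<Delta> h) = \<epsilon> h \<odot>\<^bsub>H\<^esub> \<one>\<^bsub>H\<^esub>"

locale partial_module_algebra = algebra_over_field A
  for H :: "('k::field, 'h) module"
    and \<Delta> :: "'h \<Rightarrow> ('k, 'h, 'h) tensor"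
    and A :: "('k, 'a) module" +
  fixes act :: "'h \<Rightarrow> 'a \<Rightarrow> 'a"
  assumes act_bilinear: "bilinear_map H A A act"
    and act_one: "a \<in> carrier A \<Longrightarrow> act \<one>\<^bsub>H\<^esub> a = a"
    and act_mult: "\<lbrakk>h \<in> carrier H; g \<in> carrier H; a \<in> carrier A; b \<in> carrier A\<rbrakk> \<Longrightarrow>
      act h (a \<otimes>\<^bsub>A\<^esub> act g b) =
        tensor_lift A (\<lambda>h1 h2. act h1 a \<otimes>\<^bsub>A\<^esub> act (h2 \<otimes>\<^bsub>H\<^esub> g) b) (\<Delta> h)"

definition smash_product ::
  "('k::field, 'h) module \<Rightarrow> ('h \<Rightarrow> ('k, 'h, 'h) tensor) \<Rightarrow> ('k, 'a) module \<Rightarrow> ('h \<Rightarrow> 'a \<Rightarrow> 'a)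
    \<Rightarrow> ('k, ('k, 'a, 'h) tensor) module" where
  "smash_product H \<Delta> A act = (tensor_space A H)
     \<lparr>mult := (\<lambda>s t.
        tensor_lift (tensor_space A H)
          (\<lambda>a h. tensor_lift (tensor_space A H)
             (\<lambda>b g. tensor_lift (tensor_space A H)
                (\<lambda>h1 h2. tensor_elem A H (a \<otimes>\<^bsub>A\<^esub> act h1 b) (h2 \<otimes>\<^bsub>H\<^esub> g)) (\<Delta> h)) t) s),
      one := tensor_elem A H \<one>\<^bsub>A\<^esub> \<one>\<^bsub>H\<^esub>\<rparr>"

text \<open>In \<open>smash_product\<close> the field \<open>one\<close> holds \<open>1\<^sub>A # 1\<^sub>H\<close>, in general only a left identity there,
  but the identity of the algebra \<open>(A # H)(1\<^sub>A # 1\<^sub>H)\<close>.\<close>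

definition partial_smash_product ::
  "('k::field, 'h) module \<Rightarrow> ('h \<Rightarrow> ('k, 'h, 'h) tensor) \<Rightarrow> ('k, 'a) module \<Rightarrow> ('h \<Rightarrow> 'a \<Rightarrow> 'a)
    \<Rightarrow> ('k, ('k, 'a, 'h) tensor) module" where
  "partial_smash_product H \<Delta> A act =
     (let P = smash_product H \<Delta> A act
      in P\<lparr>carrier := {t \<otimes>\<^bsub>P\<^esub> tensor_elem A H \<one>\<^bsub>A\<^esub> \<one>\<^bsub>H\<^esub> | t. t \<in> carrier P}\<rparr>)"


section \<open>Quotients, partial modules and the \<open>H\<close>-radical\<close>

definition H_stable ::
  "('k::field, 'h) module \<Rightarrow> ('h \<Rightarrow> 'a \<Rightarrow> 'a) \<Rightarrow> 'a set \<Rightarrow> bool" where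
  "H_stable H act I \<longleftrightarrow> (\<forall>h\<in>carrier H. \<forall>a\<in>I. act h a \<in> I)"

definition quotient_algebra ::
  "('k::field, 'a) module \<Rightarrow> 'a set \<Rightarrow> ('k, 'a set) module" where
  "quotient_algebra A I =
     ring.extend (A Quot I) (module.fields (\<lambda>c X. \<Union>a\<in>X. I +>\<^bsub>A\<^esub> (c \<odot>\<^bsub>A\<^esub> a)))"

definition quotient_action ::
  "('k::field, 'a) module \<Rightarrow> 'a set \<Rightarrow> ('h \<Rightarrow> 'a \<Rightarrow> 'a) \<Rightarrow> 'h \<Rightarrow> 'a set \<Rightarrow> 'a set" where
  "quotient_action A I act h X = (\<Union>a\<in>X. I +>\<^bsub>A\<^esub> act h a)"

text \<open>\<open>ract m a\<close> is the right \<open>A\<close>-action \<open>m a\<close>, and \<open>hact m h\<close> is \<open>m\<close> acted on by \<open>h\<close>.\<close>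

locale right_partial_module = vectorspace "class_ring :: 'k::field ring" M
  for H :: "('k::field, 'h) module"
    and \<Delta> :: "'h \<Rightarrow> ('k::field, 'h, 'h) tensor"
    and A :: "('k::field, 'a) module"
    and act :: "'h \<Rightarrow> 'a \<Rightarrow> 'a"
    and M :: "('k::field, 'm) module" +
  fixes ract :: "'m \<Rightarrow> 'a \<Rightarrow> 'm"
    and hact :: "'m \<Rightarrow> 'h \<Rightarrow> 'm"
  assumes ract_bilinear: "bilinear_map M A M ract"
    and ract_one: "m \<in> carrier M \<Longrightarrow> ract m \<one>\<^bsub>A\<^esub> = m"
    and ract_mult: "\<lbrakk>m \<in> carrier M; a \<in> carrier A; b \<in> carrier A\<rbrakk> \<Longrightarrow>
      ract m (a \<otimes>\<^bsub>A\<^esub> b) = ract (ract m a) b"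
    and hact_bilinear: "bilinear_map M H M hact"
    and hact_one: "m \<in> carrier M \<Longrightarrow> hact m \<one>\<^bsub>H\<^esub> = m"
    and hact_ract: "\<lbrakk>m \<in> carrier M; a \<in> carrier A; h \<in> carrier H; g \<in> carrier H\<rbrakk> \<Longrightarrow>
      hact (ract (hact m h) a) g =
        tensor_lift M (\<lambda>h1 h2. hact (ract m (act h1 a)) (h2 \<otimes>\<^bsub>H\<^esub> g)) (\<Delta> h)"

definition partial_submodule ::
  "('k::field, 'h) module \<Rightarrow> ('k, 'a) module \<Rightarrow> ('k, 'm) module \<Rightarrow> ('m \<Rightarrow> 'a \<Rightarrow> 'm)
    \<Rightarrow> ('m \<Rightarrow> 'h \<Rightarrow> 'm) \<Rightarrow> 'm set \<Rightarrow> bool" where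
  "partial_submodule H A M ract hact N \<longleftrightarrow>
     VectorSpace.subspace class_ring N M \<and>
     (\<forall>n\<in>N. \<forall>a\<in>carrier A. ract n a \<in> N) \<and> (\<forall>n\<in>N. \<forall>h\<in>carrier H. hact n h \<in> N)"

definition irreducible_partial_module ::
  "('k::field, 'h) module \<Rightarrow> ('h \<Rightarrow> ('k, 'h, 'h) tensor) \<Rightarrow> ('k, 'a) module \<Rightarrow> ('h \<Rightarrow> 'a \<Rightarrow> 'a)
    \<Rightarrow> ('k, 'm) module \<Rightarrow> ('m \<Rightarrow> 'a \<Rightarrow> 'm) \<Rightarrow> ('m \<Rightarrow> 'h \<Rightarrow> 'm) \<Rightarrow> bool" where
  "irreducible_partial_module H \<Delta> A act M ract hact \<longleftrightarrow>
     right_partial_module H \<Delta> A act M ract hact \<and>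
     carrier M \<noteq> {\<zero>\<^bsub>M\<^esub>} \<and>
     (\<forall>N. partial_submodule H A M ract hact N \<longrightarrow> N = {\<zero>\<^bsub>M\<^esub>} \<or> N = carrier M)"

definition module_annihilator ::
  "('k::field, 'a) module \<Rightarrow> ('k, 'm) module \<Rightarrow> ('m \<Rightarrow> 'a \<Rightarrow> 'm) \<Rightarrow> 'a set" where
  "module_annihilator A M ract = {a \<in> carrier A. \<forall>m\<in>carrier M. ract m a = \<zero>\<^bsub>M\<^esub>}"

text \<open>HOL cannot quantify over modules on all types, so the type \<open>'m\<close> on whose subsets the
  modules live is a parameter. Enlarging \<open>'m\<close> can only shrink \<open>H_jacobson_radical\<close>. An irreducible
  partial module is a quotient of the vector space \<open>A \<otimes> H\<close>, so a type \<open>'m\<close> of at least the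
  cardinality of \<open>('k, 'a, 'h) tensor\<close> gives all \<open>H\<close>-primitive ideals and hence the actual
  \<open>H\<close>-radical. A result that assumes \<open>H_semiprimitive\<close> for an arbitrary \<open>'m\<close> thus applies to every
  \<open>H\<close>-semiprimitive algebra.\<close>

definition right_H_primitive_ideal ::
  "'m itself \<Rightarrow> ('k::field, 'h) module \<Rightarrow> ('h \<Rightarrow> ('k, 'h, 'h) tensor) \<Rightarrow> ('k, 'a) module
    \<Rightarrow> ('h \<Rightarrow> 'a \<Rightarrow> 'a) \<Rightarrow> 'a set \<Rightarrow> bool" where
  "right_H_primitive_ideal _ H \<Delta> A act I \<longleftrightarrow>
     ideal I A \<and> H_stable H act I \<and>
     (\<exists>(M :: ('k, 'm) module) ract hact.
        irreducible_partial_module H \<Delta> (quotient_algebra A I) (quotient_action A I act) M ract hact \<and>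
        module_annihilator (quotient_algebra A I) M ract = {\<zero>\<^bsub>quotient_algebra A I\<^esub>})"

definition H_jacobson_radical ::
  "'m itself \<Rightarrow> ('k::field, 'h) module \<Rightarrow> ('h \<Rightarrow> ('k, 'h, 'h) tensor) \<Rightarrow> ('k, 'a) module
    \<Rightarrow> ('h \<Rightarrow> 'a \<Rightarrow> 'a) \<Rightarrow> 'a set" where
  "H_jacobson_radical T H \<Delta> A act =
     carrier A \<inter> \<Inter>{I. right_H_primitive_ideal T H \<Delta> A act I}"

definition H_semiprimitive ::
  "'m itself \<Rightarrow> ('k::field, 'h) module \<Rightarrow> ('h \<Rightarrow> ('k, 'h, 'h) tensor) \<Rightarrow> ('k, 'a) module
    \<Rightarrow> ('h \<Rightarrow> 'a \<Rightarrow> 'a) \<Rightarrow> bool" where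
  "H_semiprimitive T H \<Delta> A act \<longleftrightarrow> H_jacobson_radical T H \<Delta> A act = {\<zero>\<^bsub>A\<^esub>}"


section \<open>Ring-theoretic notions\<close>

definition right_ideal :: "'r set \<Rightarrow> ('r, 's) ring_scheme \<Rightarrow> bool" where
  "right_ideal I R \<longleftrightarrow> additive_subgroup I R \<and> (\<forall>x\<in>I. \<forall>r\<in>carrier R. x \<otimes>\<^bsub>R\<^esub> r \<in> I)"

text \<open>The regular right module is semisimple: each of its submodules is a direct summand.\<close>

definition semisimple_ring :: "('r, 's) ring_scheme \<Rightarrow> bool" where
  "semisimple_ring R \<longleftrightarrow> ring R \<and>
     (\<forall>I. right_ideal I R \<longrightarrow>
        (\<exists>J. right_ideal J R \<and> I \<inter> J = {\<zero>\<^bsub>R\<^esub>} \<and> I <+>\<^bsub>R\<^esub> J = carrier R))"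

text \<open>The Jacobson radical is the intersection of the maximal right ideals; for the zero ring the
  family is empty, hence the intersection with the carrier.\<close>

definition maximal_right_ideal :: "'r set \<Rightarrow> ('r, 's) ring_scheme \<Rightarrow> bool" where
  "maximal_right_ideal I R \<longleftrightarrow> right_ideal I R \<and> I \<noteq> carrier R \<and>
     (\<forall>J. right_ideal J R \<longrightarrow> I \<subseteq> J \<longrightarrow> J = I \<or> J = carrier R)"

definition jacobson_radical :: "('r, 's) ring_scheme \<Rightarrow> 'r set" where
  "jacobson_radical R = carrier R \<inter> \<Inter>{I. maximal_right_ideal I R}"

definition semiprimitive_ring :: "('r, 's) ring_scheme \<Rightarrow> bool" where
  "semiprimitive_ring R \<longleftrightarrow> jacobson_radical R = {\<zero>\<^bsub>R\<^esub>}"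

text \<open>Subalgebras contain \<open>1\<close>. Local finiteness does not depend on this: adjoining \<open>1\<close> to a
  non-unital finite-dimensional subalgebra keeps it finite-dimensional.\<close>

definition subalgebra_of :: "'a set \<Rightarrow> ('k::field, 'a) module \<Rightarrow> bool" where
  "subalgebra_of B A \<longleftrightarrow> subring B A \<and> (\<forall>c. \<forall>b\<in>B. c \<odot>\<^bsub>A\<^esub> b \<in> B)"

definition locally_finite_algebra :: "('k::field, 'a) module \<Rightarrow> bool" where
  "locally_finite_algebra A \<longleftrightarrow>
     (\<forall>F. finite F \<and> F \<subseteq> carrier A \<longrightarrow>
        (\<exists>B. subalgebra_of B A \<and> F \<subseteq> B \<and> vectorspace.fin_dim class_ring (A\<lparr>carrier := B\<rparr>)))"

end

theory Submission
  imports Defs "HOL-Library.Function_Algebras"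
begin

text \<open>
  A semisimple Hopf algebra has a right integral \<open>t\<close> with \<open>\<epsilon>(t) = 1\<close> and is finite-dimensional, so
  its dual acts on the partial smash product \<open>P\<close> by \<open>D\<^sub>f(a # h) = \<Sum> a # h\<^sub>1 f(h\<^sub>2)\<close>. The crucial point
  is that the Jacobson radical \<open>J(P)\<close> is stable under all \<open>D\<^sub>f\<close>. By local finiteness this reduces to
  the subalgebras \<open>R\<close> of elements of \<open>P\<close> with coefficients in an \<open>H\<close>-stable finite-dimensional
  subalgebra of \<open>A\<close>.

  For such \<open>R\<close> put \<open>J = J(R)\<close>. Every right \<open>R\<close>-module \<open>M\<close> gives a module \<open>M \<otimes> H\<close>, and
  \<open>(M \<otimes> H) \<otimes> H\<close> is a direct sum of copies of \<open>M \<otimes> H\<close>. Let \<open>\<sigma>(C, C')\<close> be the dimension of the socle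
  of \<open>(C/C') \<otimes> H\<close>. Along a chain of submodules the sum of the \<open>\<sigma>\<close> is maximal when the factors are
  semisimple. Applied to a radical series of \<open>M \<otimes> H\<close> over \<open>M J \<otimes> H\<close> and its image under \<open>- \<otimes> H\<close>, this
  forces \<open>- \<otimes> H\<close> to take the semisimple top of \<open>M \<otimes> H\<close> to a semisimple module; splitting \<open>M\<close> off
  \<open>M \<otimes> H\<close> by means of \<open>t\<close> and \<open>\<epsilon>\<close> shows that \<open>(M/M J) \<otimes> H\<close> is semisimple. For \<open>M = R\<close> this says
  that \<open>J\<close> is stable.

  If \<open>x \<in> J(P)\<close> and \<open>(b, b\<^sup>*)\<close> runs through dual bases, then
  \<open>\<Sum>\<^sub>b D\<^bsub>b*\<^esub>(x) (1 # S(b)) = \<xi>(x) # 1\<close> with \<open>\<xi>(a # h) = a (h \<cdot> 1)\<close>, so \<open>\<xi>(x) # 1 \<in> J(P)\<close>. Irreducible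
  partial modules are irreducible over \<open>P\<close>, so \<open>\<xi>(x)\<close> lies in every \<open>H\<close>-primitive ideal and
  vanishes. The same holds for all \<open>D\<^bsub>b*\<^esub>(x)\<close>, and \<open>x = \<Sum>\<^sub>b \<xi>(D\<^bsub>b*\<^esub>(x)) # b\<close>.
\<close>

section \<open>Dimension in function spaces\<close>

text \<open>The obstacle is that \<open>H\<close> acts on \<open>A\<close> only partially:
  \<open>h \<cdot> (g \<cdot> a)\<close> may differ from \<open>(h g) \<cdot> a\<close>, and
  \<open>1 # h\<close> need not lie in the partial smash product. The dual of \<open>H\<close>,
  however, acts there without any such defect, so stability becomes a question about
  \<open>H\<close>-comodule algebras. For these, \<open>- \<otimes> H\<close> is exact, but that it
  preserves semisimplicity is what has to be shown. Counting does it: for a radical series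
  \<open>E\<close> of \<open>M \<otimes> H\<close>, the terms \<open>E \<otimes> H\<close> and the
  images of \<open>dim H\<close> copies of the terms \<open>E\<close> form two chains in
  \<open>(M \<otimes> H) \<otimes> H\<close> with equal ends. The second has semisimple factors, so
  its total \<open>\<sigma>\<close> bounds that of any other chain; factor by factor, though, its
  \<open>\<sigma>\<close> is at most that of the first. Hence refining the first chain cannot raise
  its total, and for the refinement by a socle this means that socle elements lift.

  Modules are sets of functions, so that tensoring with \<open>H\<close> only enlarges the index
  type and the dimension theory for vector spaces on whole types applies throughout.\<close>

interpretation fv: vector_space "\<lambda>(c::'k::field) (w::'i \<Rightarrow> 'k) i. c * w i"
  by unfold_locales (auto simp: fun_eq_iff plus_fun_def algebra_simps)

interpretation fvp: vector_space_pair "\<lambda>(c::'k::field) (w::'i \<Rightarrow> 'k) i. c * w i"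
    "\<lambda>(c::'k::field) (w::'j \<Rightarrow> 'k) i. c * w i"
  by unfold_locales

abbreviation flinear :: "(('i \<Rightarrow> 'k::field) \<Rightarrow> ('j \<Rightarrow> 'k)) \<Rightarrow> bool" where
  "flinear \<equiv> Vector_Spaces.linear (\<lambda>c w i. c * w i) (\<lambda>c w i. c * w i)"

text \<open>\<open>fv.dim\<close> counts a basis with \<open>card\<close>, which is 0 on infinite
  sets; comparisons of dimensions therefore carry this condition.\<close>

definition finite_dim :: "('i \<Rightarrow> 'k::field) set \<Rightarrow> bool" where
  "finite_dim S \<longleftrightarrow> (\<exists>B. finite B \<and> S \<subseteq> fv.span B)"

definition sum_set :: "('i \<Rightarrow> 'k::field) set \<Rightarrow> ('i \<Rightarrow> 'k) set \<Rightarrow> ('i \<Rightarrow> 'k) set" where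
  "sum_set S T = {x + y |x y. x \<in> S \<and> y \<in> T}"

lemma flinearI:
  assumes "\<And>x y. f (x + y) = f x + f y" "\<And>c x. f (\<lambda>i. c * x i) = (\<lambda>i. c * f x i)"
  shows "flinear f"
  using assms by unfold_locales auto

lemma subspaceI:
  assumes "0 \<in> S" "\<And>x y. \<lbrakk>x \<in> S; y \<in> S\<rbrakk> \<Longrightarrow> x + y \<in> S" "\<And>c x. x \<in> S \<Longrightarrow> (\<lambda>i. c * x i) \<in> S"
  shows "fv.subspace S"
  using assms by (simp add: fv.subspace_def)

lemma finite_dim_subset: "\<lbrakk>finite_dim T; S \<subseteq> T\<rbrakk> \<Longrightarrow> finite_dim S"
  unfolding finite_dim_def by blast

lemma finite_dim_independent:
  assumes "finite_dim T" "B \<subseteq> T" "fv.independent B" shows "finite B"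
proof -
  obtain C where "finite C" "T \<subseteq> fv.span C" using assms(1) unfolding finite_dim_def by blast
  then show ?thesis using fv.independent_span_bound[of C B] assms by auto
qed

lemma dim_le_of_finite_dim:
  assumes "finite_dim T" "S \<subseteq> T" shows "fv.dim S \<le> fv.dim T"
proof -
  obtain B where B: "B \<subseteq> T" "fv.independent B" "T \<subseteq> fv.span B" "card B = fv.dim T"
    using fv.basis_exists by blast
  have "finite B" using finite_dim_independent assms(1) B by blast
  then show ?thesis using fv.dim_le_card[of S B] B assms(2) by auto
qed

text \<open>A basis of \<open>S\<close> extended to a basis of \<open>T\<close> cannot grow. This
  turns inequalities between dimensions into equalities of submodules and right ideals.\<close>

lemma subspace_eq_of_dim:
  assumes "finite_dim T" "S \<subseteq> T" "fv.subspace S" "fv.dim T \<le> fv.dim S" shows "S = T"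
proof -
  obtain B where B: "B \<subseteq> S" "fv.independent B" "S \<subseteq> fv.span B" "card B = fv.dim S"
    using fv.basis_exists by blast
  have SB: "fv.span B = S" using B assms(3) by (simp add: fv.span_minimal subset_antisym)
  obtain B' where B': "B \<subseteq> B'" "B' \<subseteq> T" "fv.independent B'" "T \<subseteq> fv.span B'"
    using fv.maximal_independent_subset_extend[of B T] B assms(2) by blast
  have fB': "finite B'" using finite_dim_independent assms(1) B' by blast
  have "card B' = fv.dim T" using B' fv.basis_card_eq_dim by blast
  then have "card B' \<le> card B" using B assms(4) by simp
  then have "B = B'" by (rule card_seteq[OF fB' B'(1)])
  then show ?thesis using SB B' assms(2) by auto
qed

lemma dim_zero [simp]: "fv.dim {0 :: 'i \<Rightarrow> 'k::field} = 0"
  using fv.dim_le_card[of "{0}" "{} :: ('i \<Rightarrow> 'k) set"] by simp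

lemma subspace_sum_set: "\<lbrakk>fv.subspace S; fv.subspace T\<rbrakk> \<Longrightarrow> fv.subspace (sum_set S T)"
  unfolding sum_set_def by (rule fv.subspace_sums)

lemma sum_set_least: "\<lbrakk>fv.subspace V; S \<subseteq> V; T \<subseteq> V\<rbrakk> \<Longrightarrow> sum_set S T \<subseteq> V"
  unfolding sum_set_def using fv.subspace_add by blast

lemma sum_setI: "\<lbrakk>x \<in> S; y \<in> T\<rbrakk> \<Longrightarrow> x + y \<in> sum_set S T"
  unfolding sum_set_def by blast

lemma sum_set_upper1: "fv.subspace T \<Longrightarrow> S \<subseteq> sum_set S T"
  using sum_setI[of _ S 0 T] fv.subspace_0[of T] by auto

lemma sum_set_upper2: "fv.subspace S \<Longrightarrow> T \<subseteq> sum_set S T"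
  using sum_setI[of 0 S _ T] fv.subspace_0[of S] by auto

lemma sum_setE:
  assumes "z \<in> sum_set S T" obtains x y where "x \<in> S" "y \<in> T" "z = x + y"
  using assms unfolding sum_set_def by blast

lemma finite_dim_sum_set:
  assumes "finite_dim S" "finite_dim T" shows "finite_dim (sum_set S T)"
proof -
  obtain A B where A: "finite A" "S \<subseteq> fv.span A" and B: "finite B" "T \<subseteq> fv.span B"
    using assms unfolding finite_dim_def by blast
  have "sum_set S T \<subseteq> fv.span (A \<union> B)"
    by (rule sum_set_least) (use A B fv.span_mono in \<open>auto, blast+\<close>)
  then show ?thesis using A B unfolding finite_dim_def by blast
qed

text \<open>A basis \<open>B\<close> of the intersection extends to bases \<open>C\<close> of
  \<open>S\<close> and \<open>D\<close> of \<open>T\<close>; these meet exactly in \<open>B\<close>,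
  and their union is a basis of the sum.\<close>

lemma dim_sum_set_Int:
  assumes "fv.subspace S" "fv.subspace T" "finite_dim S" "finite_dim T"
  shows "fv.dim (sum_set S T) + fv.dim (S \<inter> T) = fv.dim S + fv.dim T"
proof -
  obtain B where B: "B \<subseteq> S \<inter> T" "fv.independent B" "S \<inter> T \<subseteq> fv.span B" "card B = fv.dim (S \<inter> T)"
    using fv.basis_exists by blast
  obtain C where C: "B \<subseteq> C" "C \<subseteq> S" "fv.independent C" "S \<subseteq> fv.span C"
    using fv.maximal_independent_subset_extend[of B S] B by blast
  obtain D where D: "B \<subseteq> D" "D \<subseteq> T" "fv.independent D" "T \<subseteq> fv.span D"
    using fv.maximal_independent_subset_extend[of B T] B by blast
  have fin: "finite C" "finite D"
    using finite_dim_independent assms C D by blast+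
  have Sp: "fv.span B = S \<inter> T" "fv.span C = S" "fv.span D = T"
    using B C D assms fv.span_minimal fv.subspace_inter by (metis subset_antisym)+
  have CD: "C \<inter> D = B"
  proof
    show "C \<inter> D \<subseteq> B"
    proof
      fix y assume y: "y \<in> C \<inter> D"
      then have "y \<in> fv.span B" using Sp fv.span_base C D by blast
      show "y \<in> B"
      proof (rule ccontr)
        assume "y \<notin> B"
        then have "B \<subseteq> C - {y}" using C(1) by blast
        then have "y \<in> fv.span (C - {y})" using \<open>y \<in> fv.span B\<close> fv.span_mono by blast
        then show False using C(3) y unfolding fv.dependent_def by blast
      qed
    qed
  qed (use C D in blast)
  have span: "fv.span (C \<union> D) = sum_set S T"
    unfolding fv.span_Un Sp sum_set_def by blast
  obtain E where E: "C \<subseteq> E" "E \<subseteq> C \<union> D" "fv.independent E" "C \<union> D \<subseteq> fv.span E"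
    using fv.maximal_independent_subset_extend[of C "C \<union> D"] C by blast
  \<comment> \<open>\<open>E\<close> is a basis of the sum that contains \<open>C\<close>. If it
    missed \<open>d\<close>, then \<open>d = x + y\<close> with \<open>x\<close> in the span of
    \<open>C\<close> and \<open>y\<close> in that of \<open>D - {d}\<close>; so \<open>x\<close>
    lies in both \<open>S\<close> and \<open>T\<close>, hence in the span of \<open>B\<close>, and
    \<open>d\<close> would depend on the rest of \<open>D\<close>.\<close>
  have "d \<in> E" if d: "d \<in> D" for d
  proof (rule ccontr)
    assume dE: "d \<notin> E"
    have "d \<in> fv.span (C \<union> (E - C))" using E d by (simp add: Un_absorb1 subset_iff)
    then obtain x y where xy: "d = x + y" "x \<in> fv.span C" "y \<in> fv.span (E - C)"
      unfolding fv.span_Un by blast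
    have sub: "E - C \<subseteq> D - {d}" using E dE by blast
    then have y: "y \<in> fv.span (D - {d})" using xy fv.span_mono by blast
    moreover have "fv.span (D - {d}) \<subseteq> T" using D fv.span_mono[of "D - {d}" D] Sp by auto
    ultimately have "y \<in> T" by blast
    moreover have "d \<in> T" using d D by blast
    ultimately have "x \<in> T" using xy fv.subspace_diff[OF assms(2)] by (metis add_diff_cancel_right')
    then have "x \<in> fv.span B" using xy Sp by blast
    moreover have "B \<subseteq> D - {d}" using E C D dE by blast
    ultimately have "x \<in> fv.span (D - {d})" using fv.span_mono by blast
    then have "d \<in> fv.span (D - {d})" using xy y fv.span_add by blast
    then show False using D(3) d unfolding fv.dependent_def by blast
  qed
  then have disj: "fv.independent (C \<union> D)" using E subset_antisym[of E "C \<union> D"] by auto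
  have "fv.dim (sum_set S T) = card (C \<union> D)"
    using disj span fv.dim_span_eq_card_independent by metis
  moreover have "fv.dim S = card C" "fv.dim T = card D"
    using C D Sp fv.dim_span_eq_card_independent by metis+
  moreover have "card (C \<union> D) + card (C \<inter> D) = card C + card D"
    using card_Un_Int[OF fin] by simp
  ultimately show ?thesis using CD B by simp
qed

lemma finite_dim_image:
  assumes "flinear f" "finite_dim S" shows "finite_dim (f ` S)"
proof -
  obtain B where "finite B" "S \<subseteq> fv.span B" using assms unfolding finite_dim_def by blast
  then have "f ` S \<subseteq> fv.span (f ` B)"
    using fvp.linear_span_image[OF assms(1), of B] by blast
  then show ?thesis using \<open>finite B\<close> unfolding finite_dim_def by blast
qed

lemma subspace_image: "\<lbrakk>flinear f; fv.subspace S\<rbrakk> \<Longrightarrow> fv.subspace (f ` S)"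
  by (rule fvp.linear_subspace_image)

lemma dim_image_inj:
  assumes "flinear f" "inj_on f S" "fv.subspace S" shows "fv.dim (f ` S) = fv.dim S"
proof -
  interpret lf: Vector_Spaces.linear "\<lambda>c w i. c * w i" "\<lambda>c w i. c * w i" f by fact
  obtain B where B: "B \<subseteq> S" "fv.independent B" "S \<subseteq> fv.span B" "card B = fv.dim S"
    using fv.basis_exists[of S] by blast
  then have "fv.span B = S" using assms(3) by (simp add: fv.span_minimal subset_antisym)
  moreover have "card (f ` B) = card B" using card_image inj_on_subset[OF assms(2) B(1)] by blast
  ultimately show ?thesis
    by (metis B(2,4) assms(2) lf.dependent_inj_imageD lf.span_image fv.dim_eq_card_independent fv.dim_span)
qed

lemma finite_dim_finite_support:
  assumes "finite F" shows "finite_dim {w :: 'i \<Rightarrow> 'k::field. \<forall>i. i \<notin> F \<longrightarrow> w i = 0}"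
proof -
  let ?e = "\<lambda>j::'i. (\<lambda>i. if i = j then 1 else 0) :: 'i \<Rightarrow> 'k"
  have "w \<in> fv.span (?e ` F)" if "\<forall>i. i \<notin> F \<longrightarrow> w i = 0" for w :: "'i \<Rightarrow> 'k"
  proof -
    have "w = (\<Sum>j\<in>F. (\<lambda>i. w j * ?e j i))"
    proof
      fix i
      have "(\<Sum>j\<in>F. (\<lambda>i. w j * ?e j i)) i = (\<Sum>j\<in>F. w j * ?e j i)"
        using assms by (induction F rule: finite_induct) auto
      also have "\<dots> = (\<Sum>j\<in>F. if i = j then w j else 0)" by (rule sum.cong) auto
      also have "\<dots> = w i" using assms that by (simp add: sum.delta)
      finally show "w i = (\<Sum>j\<in>F. (\<lambda>i. w j * ?e j i)) i" by simp
    qed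
    also have "\<dots> \<in> fv.span (?e ` F)"
    proof (rule fv.span_sum)
      show "(\<lambda>i. w j * ?e j i) \<in> fv.span (?e ` F)" if "j \<in> F" for j
        by (rule fv.span_scale, rule fv.span_base) (use that in blast)
    qed
    finally show ?thesis .
  qed
  then show ?thesis unfolding finite_dim_def using assms by (intro exI[of _ "?e ` F"]) auto
qed

section \<open>Finite powers\<close>

definition slice :: "('c \<times> 'i \<Rightarrow> 'k) \<Rightarrow> 'c \<Rightarrow> 'i \<Rightarrow> 'k" where
  "slice w a = (\<lambda>i. w (a, i))"

text \<open>The direct power of \<open>S\<close> with index set \<open>I\<close>: the coordinates of
  \<open>S \<otimes> H\<close> when \<open>I\<close> indexes a basis of \<open>H\<close>. Entries
  outside \<open>I\<close> must vanish, which makes the dimension \<open>card I\<close> times that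
  of \<open>S\<close>.\<close>

definition power_set :: "'c set \<Rightarrow> ('i \<Rightarrow> 'k::field) set \<Rightarrow> ('c \<times> 'i \<Rightarrow> 'k) set" where
  "power_set I S = {w. (\<forall>a\<in>I. slice w a \<in> S) \<and> (\<forall>a. a \<notin> I \<longrightarrow> slice w a = 0)}"

lemma slice_add [simp]: "slice (v + w) a = slice v a + slice w a"
  and slice_zero [simp]: "slice 0 a = 0"
  and slice_scale [simp]: "slice (\<lambda>i. c * w i) a = (\<lambda>i. c * slice w a i)"
  by (auto simp: slice_def fun_eq_iff)

lemma slice_eqI: "(\<And>a. slice v a = slice w a) \<Longrightarrow> v = w"
  by (auto simp: slice_def fun_eq_iff)

lemma power_set_mono: "S \<subseteq> T \<Longrightarrow> power_set I S \<subseteq> power_set I T"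
  unfolding power_set_def by blast

lemma power_set_Int: "power_set I (S \<inter> T) = power_set I S \<inter> power_set I T"
  unfolding power_set_def by blast

lemma subspace_power_set: "fv.subspace S \<Longrightarrow> fv.subspace (power_set I S)"
  unfolding power_set_def
  by (rule subspaceI; simp add: fv.subspace_0 fv.subspace_add fv.subspace_scale; simp add: zero_fun_def)

definition put :: "'c \<Rightarrow> ('i \<Rightarrow> 'k::field) \<Rightarrow> 'c \<times> 'i \<Rightarrow> 'k" where
  "put a x = (\<lambda>(b, i). if b = a then x i else 0)"

lemma slice_put: "slice (put a x) b = (if b = a then x else 0)"
  by (auto simp: slice_def put_def fun_eq_iff)

lemma flinear_put: "flinear (put a)"
  by (rule flinearI) (rule ext, simp add: put_def split: prod.split)+

lemma inj_put: "inj (put a)"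
  by (rule inj_on_inverseI[of _ "\<lambda>w. slice w a"]) (simp add: slice_put)

lemma power_set_insert:
  assumes "a \<notin> I" "fv.subspace S"
  shows "power_set (insert a I) S = sum_set (put a ` S) (power_set I S)"
proof
  show "power_set (insert a I) S \<subseteq> sum_set (put a ` S) (power_set I S)"
  proof
    fix w assume w: "w \<in> power_set (insert a I) S"
    let ?v = "w - put a (slice w a)"
    have s: "slice ?v b = (if b = a then 0 else slice w b)" for b
      by (auto simp: slice_def put_def fun_eq_iff)
    have "?v \<in> power_set I S" using w assms unfolding power_set_def by (auto simp: s)
    moreover have "put a (slice w a) \<in> put a ` S" using w by (auto simp: power_set_def)
    ultimately have "put a (slice w a) + ?v \<in> sum_set (put a ` S) (power_set I S)" by (rule sum_setI[rotated])
    then show "w \<in> sum_set (put a ` S) (power_set I S)" by simp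
  qed
  show "sum_set (put a ` S) (power_set I S) \<subseteq> power_set (insert a I) S"
    using assms by (auto simp: sum_set_def power_set_def slice_put fv.subspace_add fv.subspace_0)
qed

lemma power_set_finite_dim_dim:
  fixes I :: "'c set"
  assumes "finite I" "fv.subspace S" "finite_dim S"
  shows "finite_dim (power_set I S) \<and> fv.dim (power_set I S) = card I * fv.dim S"
  using assms(1)
proof (induction I rule: finite_induct)
  case empty
  have "power_set ({} :: 'c set) S = {0}" by (auto simp: power_set_def intro: slice_eqI)
  then show ?case by (auto simp: finite_dim_def intro: exI[of _ "{}"])
next
  case (insert a I)
  let ?A = "put a ` S" and ?B = "power_set I S"
  have A: "fv.subspace ?A" "finite_dim ?A" "fv.dim ?A = fv.dim S"
    by (rule subspace_image[OF flinear_put assms(2)], rule finite_dim_image[OF flinear_put assms(3)],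
        rule dim_image_inj[OF flinear_put inj_on_subset[OF inj_put] assms(2)]) simp
  have B: "fv.subspace ?B" by (rule subspace_power_set) fact
  have "x = 0" if x: "x \<in> ?A \<inter> ?B" for x
  proof -
    obtain y where y: "x = put a y" using x by auto
    then have "y = slice x a" by (simp add: slice_put)
    moreover have "slice x a = 0" using x insert.hyps by (auto simp: power_set_def)
    ultimately show ?thesis using y by (auto simp: put_def)
  qed
  moreover have "0 \<in> ?A \<inter> ?B" using A(1) B fv.subspace_0 by blast
  ultimately have "?A \<inter> ?B = {0}" by blast
  then have "fv.dim (?A \<inter> ?B) = 0" by simp
  then have "fv.dim (sum_set ?A ?B) = fv.dim S + card I * fv.dim S"
    using dim_sum_set_Int[OF A(1) B A(2)] insert.IH A(3) by simp
  moreover have "finite_dim (sum_set ?A ?B)"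
    using finite_dim_sum_set[OF A(2)] insert.IH by blast
  ultimately show ?case
    unfolding power_set_insert[OF insert.hyps(2) assms(2)] using insert.hyps by simp
qed

lemmas finite_dim_power_set = power_set_finite_dim_dim[THEN conjunct1]
  and dim_power_set = power_set_finite_dim_dim[THEN conjunct2]

section \<open>Right ideals and the Jacobson radical\<close>

context ring begin

text \<open>Negatives come for free, as \<open>- x = x (- 1)\<close>.\<close>

lemma right_idealI:
  assumes "I \<subseteq> carrier R" "\<zero> \<in> I" "\<And>x y. \<lbrakk>x \<in> I; y \<in> I\<rbrakk> \<Longrightarrow> x \<oplus> y \<in> I"
    "\<And>x r. \<lbrakk>x \<in> I; r \<in> carrier R\<rbrakk> \<Longrightarrow> x \<otimes> r \<in> I"
  shows "right_ideal I R"
proof -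
  have "\<ominus> x \<in> I" if "x \<in> I" for x
  proof -
    have "x \<otimes> (\<ominus> \<one>) = \<ominus> x" using that assms(1) by (simp add: r_minus subset_iff)
    then show ?thesis using assms(4)[OF that, of "\<ominus> \<one>"] by simp
  qed
  then have "subgroup I (add_monoid R)"
    using assms by (intro add.subgroupI) (auto simp: a_inv_def)
  then show ?thesis unfolding right_ideal_def using assms(4) by (simp add: additive_subgroupI)
qed

lemma right_idealD:
  assumes "right_ideal I R"
  shows "I \<subseteq> carrier R" "\<zero> \<in> I" "\<And>x y. \<lbrakk>x \<in> I; y \<in> I\<rbrakk> \<Longrightarrow> x \<oplus> y \<in> I"
    "\<And>x r. \<lbrakk>x \<in> I; r \<in> carrier R\<rbrakk> \<Longrightarrow> x \<otimes> r \<in> I"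
  using assms unfolding right_ideal_def
  by (auto simp: additive_subgroup.a_subset additive_subgroup.zero_closed additive_subgroup.a_closed
      dest: additive_subgroup.a_subset)

lemma right_ideal_minus:
  assumes "right_ideal I R" "x \<in> I" "y \<in> I" shows "x \<ominus> y \<in> I"
proof -
  have "\<ominus> y = y \<otimes> (\<ominus> \<one>)" using right_idealD(1)[OF assms(1)] assms(3) by (simp add: r_minus subset_iff)
  then have "\<ominus> y \<in> I" using right_idealD(4)[OF assms(1,3), of "\<ominus> \<one>"] by simp
  then show ?thesis unfolding a_minus_def using right_idealD(3)[OF assms(1,2)] by simp
qed

lemma right_ideal_carrier: "right_ideal (carrier R) R"
  by (rule right_idealI) auto

lemma right_ideal_one: "\<lbrakk>right_ideal I R; \<one> \<in> I\<rbrakk> \<Longrightarrow> I = carrier R"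
  using right_idealD[of I] l_one by (metis subsetI subset_antisym)

lemma right_ideal_add:
  assumes "right_ideal I R" "right_ideal K R"
  shows "right_ideal (I <+>\<^bsub>R\<^esub> K) R" "I \<subseteq> I <+>\<^bsub>R\<^esub> K" "K \<subseteq> I <+>\<^bsub>R\<^esub> K"
proof -
  note I = right_idealD[OF assms(1)] and K = right_idealD[OF assms(2)]
  have mem: "z \<in> I <+>\<^bsub>R\<^esub> K \<longleftrightarrow> (\<exists>x\<in>I. \<exists>y\<in>K. z = x \<oplus> y)" for z
    unfolding set_add_def' by auto
  show "right_ideal (I <+>\<^bsub>R\<^esub> K) R"
  proof (rule right_idealI)
    show "I <+>\<^bsub>R\<^esub> K \<subseteq> carrier R" using I(1) K(1) by (auto simp: mem subset_iff)
    show "\<zero> \<in> I <+>\<^bsub>R\<^esub> K" using I(2) K(2) by (auto simp: mem intro!: bexI[of _ \<zero>])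
    fix z z' assume "z \<in> I <+>\<^bsub>R\<^esub> K" "z' \<in> I <+>\<^bsub>R\<^esub> K"
    then obtain x y x' y' where xy: "x \<in> I" "y \<in> K" "x' \<in> I" "y' \<in> K" "z = x \<oplus> y" "z' = x' \<oplus> y'"
      by (auto simp: mem)
    then have "z \<oplus> z' = (x \<oplus> x') \<oplus> (y \<oplus> y')"
      using I(1) K(1) by (simp add: subset_iff a_ac)
    then show "z \<oplus> z' \<in> I <+>\<^bsub>R\<^esub> K" using xy I(3) K(3) mem by blast
  next
    fix z r assume "z \<in> I <+>\<^bsub>R\<^esub> K" and r: "r \<in> carrier R"
    then obtain x y where xy: "x \<in> I" "y \<in> K" "z = x \<oplus> y" by (auto simp: mem)
    then have "z \<otimes> r = x \<otimes> r \<oplus> y \<otimes> r" using I(1) K(1) r by (simp add: subset_iff l_distr)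
    then show "z \<otimes> r \<in> I <+>\<^bsub>R\<^esub> K" using xy I(4) K(4) r mem by blast
  qed
  show "I \<subseteq> I <+>\<^bsub>R\<^esub> K"
  proof
    fix z assume "z \<in> I"
    moreover have "z = z \<oplus> \<zero>" using \<open>z \<in> I\<close> I(1) by auto
    ultimately show "z \<in> I <+>\<^bsub>R\<^esub> K" using K(2) mem by blast
  qed
  show "K \<subseteq> I <+>\<^bsub>R\<^esub> K"
  proof
    fix z assume "z \<in> K"
    moreover have "z = \<zero> \<oplus> z" using \<open>z \<in> K\<close> K(1) by auto
    ultimately show "z \<in> I <+>\<^bsub>R\<^esub> K" using I(2) mem by blast
  qed
qed

lemma right_ideal_Int: "\<lbrakk>right_ideal I R; right_ideal K R\<rbrakk> \<Longrightarrow> right_ideal (I \<inter> K) R"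
  by (rule right_idealI) (auto dest: right_idealD)

lemma maximal_right_ideal_add:
  assumes "maximal_right_ideal m R" "right_ideal K R" "\<not> K \<subseteq> m"
  shows "m <+>\<^bsub>R\<^esub> K = carrier R"
proof -
  have m: "right_ideal m R" using assms(1) unfolding maximal_right_ideal_def by blast
  have "m <+>\<^bsub>R\<^esub> K = m \<or> m <+>\<^bsub>R\<^esub> K = carrier R"
    using assms(1) right_ideal_add[OF m assms(2)] unfolding maximal_right_ideal_def by blast
  then show ?thesis using right_ideal_add(3)[OF m assms(2)] assms(3) by blast
qed

lemma right_ideal_principal:
  assumes "x \<in> carrier R" shows "right_ideal {x \<otimes> r |r. r \<in> carrier R} R"
proof (rule right_idealI)
  show "\<zero> \<in> {x \<otimes> r |r. r \<in> carrier R}" using assms by (auto intro!: exI[of _ \<zero>])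
next
  fix y z assume "y \<in> {x \<otimes> r |r. r \<in> carrier R}" "z \<in> {x \<otimes> r |r. r \<in> carrier R}"
  then obtain r s where "y = x \<otimes> r" "z = x \<otimes> s" "r \<in> carrier R" "s \<in> carrier R" by blast
  then show "y \<oplus> z \<in> {x \<otimes> r |r. r \<in> carrier R}"
    using assms by (auto intro!: exI[of _ "r \<oplus> s"] simp: r_distr)
next
  fix y s assume "y \<in> {x \<otimes> r |r. r \<in> carrier R}" and s: "s \<in> carrier R"
  then obtain r where "y = x \<otimes> r" "r \<in> carrier R" by blast
  then show "y \<otimes> s \<in> {x \<otimes> r |r. r \<in> carrier R}"
    using assms s by (auto intro!: exI[of _ "r \<otimes> s"] simp: m_assoc)
qed (use assms in auto)

text \<open>Proper means not containing 1, and this condition passes to unions of chains.\<close>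

lemma proper_right_ideal_in_maximal:
  assumes "right_ideal I R" "I \<noteq> carrier R"
  obtains m where "maximal_right_ideal m R" "I \<subseteq> m"
proof -
  let ?\<A> = "{K. right_ideal K R \<and> I \<subseteq> K \<and> \<one> \<notin> K}"
  have I1: "\<one> \<notin> I" using right_ideal_one assms by blast
  have "\<exists>m\<in>?\<A>. \<forall>X\<in>?\<A>. m \<subseteq> X \<longrightarrow> X = m"
  proof (rule subset_Zorn_nonempty)
    show "?\<A> \<noteq> {}" using assms I1 by blast
    fix \<C> assume \<C>: "\<C> \<noteq> {}" "subset.chain ?\<A> \<C>"
    then have sub: "\<C> \<subseteq> ?\<A>" and lin: "\<And>A B. \<lbrakk>A \<in> \<C>; B \<in> \<C>\<rbrakk> \<Longrightarrow> A \<subseteq> B \<or> B \<subseteq> A"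
      unfolding subset_chain_def by blast+
    have "right_ideal (\<Union>\<C>) R"
    proof (rule right_idealI)
      show "\<Union>\<C> \<subseteq> carrier R" using sub right_idealD(1) by blast
      show "\<zero> \<in> \<Union>\<C>" using sub \<C>(1) right_idealD(2) by blast
      show "x \<otimes> r \<in> \<Union>\<C>" if "x \<in> \<Union>\<C>" "r \<in> carrier R" for x r
        using that sub right_idealD(4) by blast
      fix x y assume "x \<in> \<Union>\<C>" "y \<in> \<Union>\<C>"
      then obtain A B where AB: "A \<in> \<C>" "B \<in> \<C>" "x \<in> A" "y \<in> B" by blast
      then obtain C where "C \<in> \<C>" "x \<in> C" "y \<in> C" using lin by blast
      then show "x \<oplus> y \<in> \<Union>\<C>" using sub right_idealD(3) by blast
    qed
    then show "\<Union>\<C> \<in> ?\<A>" using sub \<C>(1) by blast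
  qed
  then obtain m where "m \<in> ?\<A>" and max: "\<forall>X\<in>?\<A>. m \<subseteq> X \<longrightarrow> X = m" by (rule bexE)
  then have m: "right_ideal m R" "I \<subseteq> m" "\<one> \<notin> m" by simp_all
  have "J = m \<or> J = carrier R" if J: "right_ideal J R" "m \<subseteq> J" for J
  proof (cases "\<one> \<in> J")
    case True then show ?thesis using right_ideal_one[OF J(1)] by simp
  next
    case False then show ?thesis using bspec[OF max, of J] J m(2) by simp
  qed
  moreover have "m \<noteq> carrier R" using m(3) by auto
  ultimately have "maximal_right_ideal m R"
    unfolding maximal_right_ideal_def using m(1) by simp
  then show ?thesis using m that by blast
qed

lemma right_ideal_jacobson: "right_ideal (jacobson_radical R) R"
  unfolding jacobson_radical_def
  by (rule right_idealI) (auto simp: maximal_right_ideal_def dest: right_idealD)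

text \<open>If \<open>1 - x r\<close> has no right inverse, the right ideal it generates lies in a
  maximal one, which contains \<open>x r\<close> and so 1. Conversely, if a maximal \<open>m\<close>
  misses \<open>x\<close>, then \<open>m + x R\<close> contains 1, which puts some
  \<open>1 - x r\<close> into \<open>m\<close>, where it cannot be right invertible. In this
  elementwise form the radicals of an algebra and of a subalgebra can be compared.\<close>

lemma jacobson_radical_iff:
  "x \<in> jacobson_radical R \<longleftrightarrow>
     x \<in> carrier R \<and> (\<forall>r\<in>carrier R. \<exists>s\<in>carrier R. (\<one> \<ominus> x \<otimes> r) \<otimes> s = \<one>)"
proof
  assume x: "x \<in> jacobson_radical R"
  then have xc: "x \<in> carrier R" by (simp add: jacobson_radical_def)
  have "\<exists>s\<in>carrier R. (\<one> \<ominus> x \<otimes> r) \<otimes> s = \<one>" if r: "r \<in> carrier R" for r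
  proof (rule ccontr)
    assume no: "\<not> ?thesis"
    let ?u = "\<one> \<ominus> x \<otimes> r" and ?I = "{(\<one> \<ominus> x \<otimes> r) \<otimes> s |s. s \<in> carrier R}"
    have u: "?u \<in> carrier R" using xc r by simp
    have "?I \<noteq> carrier R"
    proof
      assume "?I = carrier R"
      then have "\<one> \<in> ?I" by simp
      then show False using no by auto
    qed
    then obtain m where m: "maximal_right_ideal m R" "?I \<subseteq> m"
      using proper_right_ideal_in_maximal[OF right_ideal_principal[OF u]] by blast
    then have mr: "right_ideal m R" "m \<noteq> carrier R" unfolding maximal_right_ideal_def by blast+
    have "?u \<otimes> \<one> \<in> ?I" by blast
    then have "?u \<in> m" using m(2) u by auto
    moreover have "x \<otimes> r \<in> m"
      using x m(1) right_idealD(4)[OF mr(1)] r unfolding jacobson_radical_def by blast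
    ultimately have "?u \<oplus> x \<otimes> r \<in> m" using right_idealD(3)[OF mr(1)] by blast
    moreover have "?u \<oplus> x \<otimes> r = \<one>"
      using xc r by (simp add: a_minus_def a_assoc l_neg)
    ultimately show False using right_ideal_one mr by metis
  qed
  then show "x \<in> carrier R \<and> (\<forall>r\<in>carrier R. \<exists>s\<in>carrier R. (\<one> \<ominus> x \<otimes> r) \<otimes> s = \<one>)" using xc by blast
next
  assume x: "x \<in> carrier R \<and> (\<forall>r\<in>carrier R. \<exists>s\<in>carrier R. (\<one> \<ominus> x \<otimes> r) \<otimes> s = \<one>)"
  have "x \<in> m" if m: "maximal_right_ideal m R" for m
  proof (rule ccontr)
    assume "x \<notin> m"
    have mr: "right_ideal m R" "m \<noteq> carrier R" using m unfolding maximal_right_ideal_def by blast+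
    let ?K = "{x \<otimes> r |r. r \<in> carrier R}"
    have "x \<otimes> \<one> \<in> ?K" by blast
    then have "\<not> ?K \<subseteq> m" using \<open>x \<notin> m\<close> x by auto
    then have "m <+>\<^bsub>R\<^esub> ?K = carrier R"
      using maximal_right_ideal_add[OF m right_ideal_principal] x by blast
    then have "\<one> \<in> m <+>\<^bsub>R\<^esub> ?K" by simp
    then obtain y r where y: "y \<in> m" "r \<in> carrier R" "\<one> = y \<oplus> x \<otimes> r"
      unfolding set_add_def' by blast
    have yc: "y \<in> carrier R" using y right_idealD(1)[OF mr(1)] by blast
    have "\<one> \<ominus> x \<otimes> r = y"
      unfolding y(3) using x y(2) yc by (simp add: a_minus_def a_assoc r_neg)
    then obtain s where "s \<in> carrier R" "y \<otimes> s = \<one>" using x y(2) by auto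
    then show False using right_idealD(4)[OF mr(1) y(1)] right_ideal_one mr by metis
  qed
  then show "x \<in> jacobson_radical R" using x unfolding jacobson_radical_def by blast
qed

text \<open>The radical is defined by right ideals, so closure under left factors needs an argument:
  for a maximal right ideal \<open>m\<close>, the elements \<open>y\<close> with \<open>r y\<close>
  in \<open>m\<close> form either all of \<open>R\<close> or again a maximal right ideal, because
  left multiplication by \<open>r\<close> embeds the quotient by it into the simple module
  \<open>R/m\<close>.\<close>

lemma jacobson_radical_left_mult:
  assumes "x \<in> jacobson_radical R" "r \<in> carrier R" shows "r \<otimes> x \<in> jacobson_radical R"
proof -
  have xc: "x \<in> carrier R" using assms by (simp add: jacobson_radical_def)
  have "r \<otimes> x \<in> m" if m: "maximal_right_ideal m R" for m
  proof -
    have mr: "right_ideal m R" "m \<noteq> carrier R" using m unfolding maximal_right_ideal_def by blast+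
    let ?n = "{y \<in> carrier R. r \<otimes> y \<in> m}"
    note D = right_idealD[OF mr(1)]
    have n: "right_ideal ?n R"
      by (rule right_idealI) (use D assms(2) in \<open>auto simp: r_distr m_assoc[symmetric]\<close>)
    show ?thesis
    proof (cases "?n = carrier R")
      case True then show ?thesis using xc by blast
    next
      case False
      have "maximal_right_ideal ?n R"
        unfolding maximal_right_ideal_def
      proof (intro conjI allI impI)
        fix J assume J: "right_ideal J R" "?n \<subseteq> J"
        note DJ = right_idealD[OF J(1)]
        show "J = ?n \<or> J = carrier R"
        proof (rule disjCI)
          assume "J \<noteq> carrier R"
          show "J = ?n"
          proof (rule ccontr)
            assume "J \<noteq> ?n"
            then obtain j where j: "j \<in> J" "r \<otimes> j \<notin> m" using J DJ(1) by blast
            let ?K = "{(r \<otimes> j) \<otimes> s |s. s \<in> carrier R}"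
            have rj: "r \<otimes> j \<in> carrier R" using assms(2) j DJ(1) by blast
            have "(r \<otimes> j) \<otimes> \<one> \<in> ?K" by blast
            then have "\<not> ?K \<subseteq> m" using j rj by auto
            then have e: "m <+>\<^bsub>R\<^esub> ?K = carrier R"
              using maximal_right_ideal_add[OF m right_ideal_principal[OF rj]] by blast
            \<comment> \<open>Since \<open>m + r j R\<close> is everything,
              \<open>r z = y + r j s\<close> with \<open>y\<close> in \<open>m\<close>; so
              \<open>z - j s\<close> lies in \<open>?n\<close>, which is part of
              \<open>J\<close>.\<close>
            have "z \<in> J" if z: "z \<in> carrier R" for z
            proof -
              have "r \<otimes> z \<in> m <+>\<^bsub>R\<^esub> ?K" using e z assms(2) by simp
              then obtain y s where ys: "y \<in> m" "s \<in> carrier R" "r \<otimes> z = y \<oplus> (r \<otimes> j) \<otimes> s"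
                unfolding set_add_def' by blast
              have yc: "y \<in> carrier R" using ys D(1) by blast
              have js: "j \<otimes> s \<in> carrier R" using j DJ(1) ys by blast
              have "r \<otimes> (z \<ominus> j \<otimes> s) = r \<otimes> z \<ominus> (r \<otimes> j) \<otimes> s"
                using assms(2) z js j DJ(1) ys(2) by (simp add: a_minus_def r_distr r_minus m_assoc subset_iff)
              also have "\<dots> = y" unfolding ys(3) using yc rj ys(2) by (simp add: a_minus_def a_assoc r_neg)
              finally have "z \<ominus> j \<otimes> s \<in> ?n" using ys(1) z js by simp
              then have "z \<ominus> j \<otimes> s \<oplus> j \<otimes> s \<in> J" using J(2) DJ(3,4) j ys(2) by blast
              then show "z \<in> J" using z js by (simp add: a_minus_def a_assoc l_neg)
            qed
            then show False using \<open>J \<noteq> carrier R\<close> DJ(1) by blast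
          qed
        qed
      qed (use n False in auto)
      then show ?thesis using assms(1) unfolding jacobson_radical_def by blast
    qed
  qed
  then show ?thesis using assms xc unfolding jacobson_radical_def by blast
qed

end

section \<open>Modules over finite-dimensional algebras\<close>

text \<open>Finite dimension is expressed by an injective linear map \<open>\<iota>\<close> into a
  function space, which makes \<open>fv.dim\<close> available for subsets of an explicit
  carrier.\<close>

locale fd_algebra = algebra_over_field R for R :: "('k::field, 'r) module" (structure) +
  fixes \<iota> :: "'r \<Rightarrow> 'j \<Rightarrow> 'k"
  assumes inj_\<iota>: "inj_on \<iota> (carrier R)"
    and \<iota>_add: "\<lbrakk>x \<in> carrier R; y \<in> carrier R\<rbrakk> \<Longrightarrow> \<iota> (x \<oplus> y) = \<iota> x + \<iota> y"
    and \<iota>_smult: "x \<in> carrier R \<Longrightarrow> \<iota> (c \<odot>\<^bsub>R\<^esub> x) = (\<lambda>i. c * \<iota> x i)"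
    and finite_dim_\<iota>: "finite_dim (\<iota> ` carrier R)"
begin

abbreviation jac :: "'r set" where "jac \<equiv> jacobson_radical R"

lemma smult_one_mult:
  assumes "x \<in> carrier R" shows "c \<odot>\<^bsub>R\<^esub> x = x \<otimes> (c \<odot>\<^bsub>R\<^esub> \<one>)"
  using smult_mult_right[of x "\<one>" c] assms by simp

lemma smult_closed' [simp]: "x \<in> carrier R \<Longrightarrow> c \<odot>\<^bsub>R\<^esub> x \<in> carrier R"
  using smult_closed[of c x] by simp

lemma right_ideal_subspace:
  assumes "right_ideal K R" shows "fv.subspace (\<iota> ` K)"
proof (rule subspaceI)
  note K = right_idealD[OF assms]
  have "\<iota> (\<zero> \<oplus> \<zero>) = \<iota> \<zero> + \<iota> \<zero>" by (rule \<iota>_add) auto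
  then have "\<iota> \<zero> = 0" by simp
  then show "0 \<in> \<iota> ` K" using K(2) by (metis imageI)
  show "x + y \<in> \<iota> ` K" if xy: "x \<in> \<iota> ` K" "y \<in> \<iota> ` K" for x y
  proof -
    obtain u v where uv: "u \<in> K" "v \<in> K" "x = \<iota> u" "y = \<iota> v" using xy by blast
    then have "x + y = \<iota> (u \<oplus> v)" using \<iota>_add[OF subsetD[OF K(1) uv(1)] subsetD[OF K(1) uv(2)]] by simp
    then show ?thesis using K(3)[OF uv(1,2)] by blast
  qed
  show "(\<lambda>i. c * x i) \<in> \<iota> ` K" if "x \<in> \<iota> ` K" for c x
  proof -
    obtain z where z: "z \<in> K" "x = \<iota> z" using \<open>x \<in> \<iota> ` K\<close> by blast
    then have "z \<in> carrier R" using K(1) by blast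
    then have "c \<odot>\<^bsub>R\<^esub> z \<in> K" using smult_one_mult[of z c] K(4)[OF z(1), of "c \<odot>\<^bsub>R\<^esub> \<one>"] by simp
    then show ?thesis using \<iota>_smult[OF \<open>z \<in> carrier R\<close>, of c] z by (metis imageI)
  qed
qed

lemma right_ideal_eq_of_dim:
  assumes "right_ideal K R" "right_ideal K' R" "K' \<subseteq> K" "fv.dim (\<iota> ` K) \<le> fv.dim (\<iota> ` K')"
  shows "K' = K"
proof -
  have "\<iota> ` K' = \<iota> ` K"
  proof (rule subspace_eq_of_dim)
    show "finite_dim (\<iota> ` K)"
      by (rule finite_dim_subset[OF finite_dim_\<iota>]) (use right_idealD(1)[OF assms(1)] in blast)
  qed (use assms right_ideal_subspace in auto)
  then show ?thesis
    using inj_on_image_eq_iff[OF inj_\<iota>] right_idealD(1) assms(1,2) by metis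
qed

text \<open>Modulo the radical, \<open>K\<close> is a complement of \<open>m\<close>. It is found as
  a right ideal of least dimension among those that contain \<open>jac\<close> and do not lie in
  \<open>m\<close>. This takes the place of the structure theory of semisimple rings when
  complements of submodules are built.\<close>

lemma maximal_right_ideal_complement:
  assumes m: "maximal_right_ideal m R"
  obtains K where "right_ideal K R" "K \<inter> m = jac" "\<not> K \<subseteq> m"
proof -
  let ?P = "\<lambda>K. right_ideal K R \<and> jac \<subseteq> K \<and> \<not> K \<subseteq> m"
  have mr: "right_ideal m R" "m \<noteq> carrier R" using m unfolding maximal_right_ideal_def by blast+
  have "?P (carrier R)"
    using mr right_idealD(1)[OF mr(1)] right_ideal_carrier by (auto simp: jacobson_radical_def)
  then have "\<exists>K. ?P K \<and> (\<forall>K'. ?P K' \<longrightarrow> fv.dim (\<iota> ` K) \<le> fv.dim (\<iota> ` K'))"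
    by (rule ex_has_least_nat)
  then obtain K where K: "?P K" and min: "\<forall>K'. ?P K' \<longrightarrow> fv.dim (\<iota> ` K) \<le> fv.dim (\<iota> ` K')"
    by (elim exE conjE[of "?P _"]) (rule that)
  note DK = right_idealD[OF conjunct1[OF K]]
  have "z \<in> jac" if z: "z \<in> K" "z \<in> m" for z
  proof (rule ccontr)
    assume "z \<notin> jac"
    have zc: "z \<in> carrier R" using z DK(1) by blast
    obtain m' where m': "maximal_right_ideal m' R" "z \<notin> m'"
      using \<open>z \<notin> jac\<close> zc unfolding jacobson_radical_def by blast
    have mr': "right_ideal m' R" using m' unfolding maximal_right_ideal_def by blast
    have J': "jac \<subseteq> K \<inter> m'" using K m' unfolding jacobson_radical_def by blast
    \<comment> \<open>\<open>K \<inter> m'\<close> contains the radical but not \<open>z\<close>, so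
      it is smaller than \<open>K\<close>, and minimality forces it into \<open>m\<close>.\<close>
    have "K \<inter> m' \<subseteq> m"
    proof (rule ccontr)
      assume "\<not> K \<inter> m' \<subseteq> m"
      moreover have ri: "right_ideal (K \<inter> m') R" using right_ideal_Int K mr' by blast
      ultimately have "fv.dim (\<iota> ` K) \<le> fv.dim (\<iota> ` (K \<inter> m'))" using J' min by simp
      then have "K \<inter> m' = K" by (rule right_ideal_eq_of_dim[OF conjunct1[OF K] ri Int_lower1])
      then show False using z m' by blast
    qed
    obtain k where k: "k \<in> K" "k \<notin> m" using K by blast
    let ?Z = "{z \<otimes> r |r. r \<in> carrier R}"
    have "z \<otimes> \<one> \<in> ?Z" by blast
    then have "\<not> ?Z \<subseteq> m'" using m' zc by auto
    then have e: "m' <+>\<^bsub>R\<^esub> ?Z = carrier R"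
      using maximal_right_ideal_add[OF m'(1) right_ideal_principal[OF zc]] by blast
    have kc: "k \<in> carrier R" using k DK(1) by blast
    \<comment> \<open>Both summands of \<open>k = y + z s\<close> turn out to lie in
      \<open>m\<close>: \<open>z s\<close> because \<open>z\<close> does, and
      \<open>y = k - z s\<close> as an element of \<open>K \<inter> m'\<close>.\<close>
    obtain y s where ys: "y \<in> m'" "s \<in> carrier R" "k = y \<oplus> z \<otimes> s"
      using e kc unfolding set_add_def' by blast
    have yc: "y \<in> carrier R" using ys right_idealD(1)[OF mr'] by blast
    have zs: "z \<otimes> s \<in> K" "z \<otimes> s \<in> m" using z ys DK(4) right_idealD(4)[OF mr(1)] by blast+
    have "k \<ominus> z \<otimes> s = y" unfolding ys(3) using yc zc ys(2) by (simp add: a_minus_def a_assoc r_neg)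
    then have "y \<in> K" using right_ideal_minus[OF conjunct1[OF K] k(1) zs(1)] by simp
    then have "y \<in> m" using ys(1) \<open>K \<inter> m' \<subseteq> m\<close> by blast
    then have "k \<in> m" using ys(3) zs(2) right_idealD(3)[OF mr(1)] by blast
    then show False using k by blast
  qed
  moreover have "jac \<subseteq> m" using m unfolding jacobson_radical_def by blast
  ultimately have "K \<inter> m = jac" using K by blast
  then show ?thesis using K that by blast
qed

end

section \<open>Submodules, complements and radical series of finite-dimensional modules\<close>

locale fd_module = fd_algebra R \<iota> for R :: "('k::field, 'r) module" (structure) and \<iota> :: "'r \<Rightarrow> 'j \<Rightarrow> 'k" +
  fixes X :: "('i \<Rightarrow> 'k) set" and act :: "('i \<Rightarrow> 'k) \<Rightarrow> 'r \<Rightarrow> 'i \<Rightarrow> 'k"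
  assumes subspace_X: "fv.subspace X" and finite_dim_X: "finite_dim X"
    and act_closed: "\<lbrakk>x \<in> X; r \<in> carrier R\<rbrakk> \<Longrightarrow> act x r \<in> X"
    and act_add: "\<lbrakk>x \<in> X; y \<in> X; r \<in> carrier R\<rbrakk> \<Longrightarrow> act (x + y) r = act x r + act y r"
    and act_scale: "\<lbrakk>x \<in> X; r \<in> carrier R\<rbrakk> \<Longrightarrow> act (\<lambda>i. c * x i) r = (\<lambda>i. c * act x r i)"
    and act_add_right: "\<lbrakk>x \<in> X; r \<in> carrier R; s \<in> carrier R\<rbrakk> \<Longrightarrow> act x (r \<oplus> s) = act x r + act x s"
    and act_smult_right: "\<lbrakk>x \<in> X; r \<in> carrier R\<rbrakk> \<Longrightarrow> act x (c \<odot>\<^bsub>R\<^esub> r) = (\<lambda>i. c * act x r i)"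
    and act_mult: "\<lbrakk>x \<in> X; r \<in> carrier R; s \<in> carrier R\<rbrakk> \<Longrightarrow> act x (r \<otimes> s) = act (act x r) s"
    and act_one: "x \<in> X \<Longrightarrow> act x \<one> = x"
begin

definition submodule :: "('i \<Rightarrow> 'k) set \<Rightarrow> bool" where
  "submodule C \<longleftrightarrow> fv.subspace C \<and> C \<subseteq> X \<and> (\<forall>x\<in>C. \<forall>r\<in>carrier R. act x r \<in> C)"

lemma submoduleD:
  assumes "submodule C" shows "fv.subspace C" "C \<subseteq> X" "\<And>x r. \<lbrakk>x \<in> C; r \<in> carrier R\<rbrakk> \<Longrightarrow> act x r \<in> C"
    "finite_dim C" "0 \<in> C" "\<And>x y. \<lbrakk>x \<in> C; y \<in> C\<rbrakk> \<Longrightarrow> x + y \<in> C" "\<And>x y. \<lbrakk>x \<in> C; y \<in> C\<rbrakk> \<Longrightarrow> x - y \<in> C"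
    "\<And>c x. x \<in> C \<Longrightarrow> (\<lambda>i. c * x i) \<in> C"
  using assms finite_dim_subset[OF finite_dim_X]
  by (auto simp: submodule_def fv.subspace_0 fv.subspace_add fv.subspace_diff fv.subspace_scale)

lemma submodule_X: "submodule X"
  unfolding submodule_def using subspace_X act_closed by blast

lemma submodule_Int: "\<lbrakk>submodule C; submodule D\<rbrakk> \<Longrightarrow> submodule (C \<inter> D)"
  unfolding submodule_def using fv.subspace_inter by blast

lemma submodule_sum_set:
  assumes "submodule C" "submodule D" shows "submodule (sum_set C D)"
  unfolding submodule_def
proof (intro conjI ballI)
  note C = submoduleD[OF assms(1)] and D = submoduleD[OF assms(2)]
  show "fv.subspace (sum_set C D)" by (rule subspace_sum_set[OF C(1) D(1)])
  show "sum_set C D \<subseteq> X" by (rule sum_set_least[OF subspace_X C(2) D(2)])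
  fix x r assume x: "x \<in> sum_set C D" and r: "r \<in> carrier R"
  from x obtain y z where yz: "y \<in> C" "z \<in> D" "x = y + z" by (rule sum_setE)
  then have "act x r = act y r + act z r" using act_add C(2) D(2) r by blast
  then show "act x r \<in> sum_set C D" using C(3) D(3) yz r sum_setI by metis
qed

lemma submodule_eq_of_dim:
  assumes "submodule C" "submodule D" "C \<subseteq> D" "fv.dim D \<le> fv.dim C" shows "C = D"
  by (rule subspace_eq_of_dim[OF submoduleD(4)[OF assms(2)] assms(3) submoduleD(1)[OF assms(1)] assms(4)])

lemma submodule_dim_le: "\<lbrakk>submodule D; C \<subseteq> D\<rbrakk> \<Longrightarrow> fv.dim C \<le> fv.dim D"
  by (rule dim_le_of_finite_dim[OF submoduleD(4)])

lemma ex_max_dim_submodule: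
  assumes "P D0" "\<And>D. P D \<Longrightarrow> submodule D"
  shows "\<exists>D. P D \<and> (\<forall>E. P E \<longrightarrow> fv.dim E \<le> fv.dim D)"
proof (rule ex_has_greatest_nat[of P D0 fv.dim "Suc (fv.dim X)"])
  show "\<forall>E. P E \<longrightarrow> fv.dim E < Suc (fv.dim X)"
    using submodule_dim_le[OF submodule_X submoduleD(2)[OF assms(2)]] by (simp add: less_Suc_eq_le)
qed (rule assms(1))

lemma act_zero: "r \<in> carrier R \<Longrightarrow> act 0 r = 0"
proof -
  assume r: "r \<in> carrier R"
  have "act (0 + 0) r = act 0 r + act 0 r" by (rule act_add) (use r subspace_X fv.subspace_0 in auto)
  then show ?thesis by simp
qed

lemma act_sum:
  assumes "finite F" "\<And>a. a \<in> F \<Longrightarrow> f a \<in> X" "r \<in> carrier R"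
  shows "act (\<Sum>a\<in>F. f a) r = (\<Sum>a\<in>F. act (f a) r)"
  using assms(1,2)
proof (induction F rule: finite_induct)
  case (insert a F)
  have "sum f F \<in> X" by (rule fv.subspace_sum[OF subspace_X]) (simp add: insert.prems)
  then have "act (f a + sum f F) r = act (f a) r + act (sum f F) r"
    by (intro act_add) (simp_all add: insert.prems assms(3))
  moreover have "act (sum f F) r = (\<Sum>a\<in>F. act (f a) r)"
    by (rule insert.IH) (simp add: insert.prems)
  ultimately show ?case by (simp only: sum.insert[OF insert.hyps])
qed (simp add: act_zero assms(3))

lemma act_annihilator:
  assumes "submodule C" "v \<in> X" shows "right_ideal {r \<in> carrier R. act v r \<in> C} R"
proof (rule right_idealI)
  note C = submoduleD[OF assms(1)]
  have "act v (\<zero> \<oplus> \<zero>) = act v \<zero> + act v \<zero>" by (rule act_add_right) (use assms in auto)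
  then have "act v \<zero> = 0" by simp
  then show "\<zero> \<in> {r \<in> carrier R. act v r \<in> C}" using C(5) by simp
qed (use submoduleD[OF assms(1)] assms(2) act_add_right act_mult in auto)

lemma submodule_cyclic:
  assumes "v \<in> X" "right_ideal K R" shows "submodule {act v k |k. k \<in> K}"
  unfolding submodule_def
proof (intro conjI ballI)
  note KD = right_idealD[OF assms(2)]
  let ?V = "{act v k |k. k \<in> K}"
  show "fv.subspace ?V"
  proof (rule subspaceI)
    have "act v \<zero> = 0" using act_add_right[OF assms(1), of "\<zero>" "\<zero>"] by simp
    then show "0 \<in> ?V" using KD(2) by force
  next
    fix x y assume "x \<in> ?V" "y \<in> ?V"
    then obtain k l where "k \<in> K" "l \<in> K" "x = act v k" "y = act v l" by blast
    then show "x + y \<in> ?V"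
      using KD(3)[of k l] act_add_right[OF assms(1) subsetD[OF KD(1)] subsetD[OF KD(1)], of k l]
      by (intro CollectI exI[of _ "k \<oplus> l"]) simp
  next
    fix c x assume "x \<in> ?V"
    then obtain k where k: "k \<in> K" "x = act v k" by blast
    then have "c \<odot>\<^bsub>R\<^esub> k \<in> K"
      using smult_one_mult[of k c] KD(1) KD(4)[of k "c \<odot>\<^bsub>R\<^esub> \<one>"] by auto
    then show "(\<lambda>i. c * x i) \<in> ?V"
      using k act_smult_right[OF assms(1) subsetD[OF KD(1) k(1)], of c]
      by (intro CollectI exI[of _ "c \<odot>\<^bsub>R\<^esub> k"]) simp
  qed
  show "?V \<subseteq> X" using act_closed[OF assms(1)] KD(1) by blast
  fix x r assume "x \<in> ?V" and r: "r \<in> carrier R"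
  then obtain k where k: "k \<in> K" "x = act v k" by blast
  then have "act x r = act v (k \<otimes> r)" using act_mult[OF assms(1), of k r] KD(1) r by auto
  then show "act x r \<in> ?V" using KD(4)[OF k(1) r] by blast
qed

lemma exists_maximal_submodule:
  assumes "submodule G" "submodule C" "G \<subset> C"
  obtains D where "submodule D" "G \<subseteq> D" "D \<subset> C"
    "\<And>E. \<lbrakk>submodule E; D \<subseteq> E; E \<subseteq> C\<rbrakk> \<Longrightarrow> E = D \<or> E = C"
proof -
  let ?P = "\<lambda>D. submodule D \<and> G \<subseteq> D \<and> D \<subset> C"
  have "?P G" using assms by simp
  moreover have "\<And>D. ?P D \<Longrightarrow> submodule D" by simp
  ultimately have "\<exists>D. ?P D \<and> (\<forall>E. ?P E \<longrightarrow> fv.dim E \<le> fv.dim D)"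
    by (rule ex_max_dim_submodule[of ?P])
  then obtain D where D: "?P D" and max: "\<forall>E. ?P E \<longrightarrow> fv.dim E \<le> fv.dim D"
    by (elim exE conjE[of "?P _"]) (rule that)
  have "E = D \<or> E = C" if E: "submodule E" "D \<subseteq> E" "E \<subseteq> C" for E
  proof (rule disjCI)
    assume "E \<noteq> C"
    then have "?P E" using D E by blast
    then have "fv.dim E \<le> fv.dim D" using max by simp
    then show "E = D" using submodule_eq_of_dim[of D E] D E by blast
  qed
  then show ?thesis using D that by blast
qed

text \<open>A form of Nakayama's lemma. Let \<open>D\<close> be maximal in \<open>C\<close> above
  \<open>G\<close>; for \<open>v\<close> outside \<open>D\<close> the annihilator of
  \<open>v\<close> modulo \<open>D\<close> is a maximal right ideal, so the radical sends
  \<open>v\<close> into \<open>D\<close>.\<close>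

lemma exists_submodule_jacobson:
  assumes "submodule G" "submodule C" "G \<subset> C"
  obtains D where "submodule D" "G \<subseteq> D" "D \<subset> C" "\<And>x j. \<lbrakk>x \<in> C; j \<in> jac\<rbrakk> \<Longrightarrow> act x j \<in> D"
proof -
  obtain D where D: "submodule D" "G \<subseteq> D" "D \<subset> C"
    and max: "\<And>E. \<lbrakk>submodule E; D \<subseteq> E; E \<subseteq> C\<rbrakk> \<Longrightarrow> E = D \<or> E = C"
    using exists_maximal_submodule[OF assms] by blast
  note DD = submoduleD[OF D(1)] and DC = submoduleD[OF assms(2)]
  have "act v j \<in> D" if v: "v \<in> C" and j: "j \<in> jac" for v j
  proof (cases "v \<in> D")
    case True then show ?thesis using DD(3) j by (simp add: jacobson_radical_def)
  next
    case False
    let ?I = "{r \<in> carrier R. act v r \<in> D}"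
    have vX: "v \<in> X" using v DC(2) by blast
    have I: "right_ideal ?I R" by (rule act_annihilator[OF D(1) vX])
    have one: "\<one> \<notin> ?I" using False act_one[OF vX] by simp
    have "K = ?I \<or> K = carrier R" if K: "right_ideal K R" "?I \<subseteq> K" for K
    proof (rule disjCI)
      assume nK: "K \<noteq> carrier R"
      note KD = right_idealD[OF K(1)]
      let ?V = "{act v k |k. k \<in> K}"
      have sV: "submodule ?V" by (rule submodule_cyclic[OF vX K(1)])
      have sE: "submodule (sum_set D ?V)" by (rule submodule_sum_set[OF D(1) sV])
      have sub: "D \<subseteq> sum_set D ?V" "?V \<subseteq> sum_set D ?V"
        by (rule sum_set_upper1[OF submoduleD(1)[OF sV]], rule sum_set_upper2[OF DD(1)])
      have "?V \<subseteq> C" using DC(3)[OF v] KD(1) by blast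
      then have EC: "sum_set D ?V \<subseteq> C" using sum_set_least[OF DC(1), of D ?V] D(3) by blast
      have "sum_set D ?V \<noteq> C"
      proof
        assume "sum_set D ?V = C"
        \<comment> \<open>From \<open>v = d + v k\<close> it follows that \<open>1 - k\<close>
          annihilates \<open>v\<close> modulo \<open>D\<close>, hence lies in \<open>K\<close>; so
          \<open>K\<close> contains 1.\<close>
        then obtain d k where dk: "d \<in> D" "k \<in> K" "v = d + act v k" using v by (auto elim!: sum_setE)
        have kc: "k \<in> carrier R" using dk KD(1) by blast
        have "act v (\<one> \<ominus> k \<oplus> k) = act v (\<one> \<ominus> k) + act v k" by (rule act_add_right[OF vX]) (use kc in auto)
        moreover have "\<one> \<ominus> k \<oplus> k = \<one>" using kc by (simp add: a_minus_def a_assoc l_neg)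
        ultimately have "v = act v (\<one> \<ominus> k) + act v k" using act_one[OF vX] by simp
        then have "act v (\<one> \<ominus> k) = d" using dk(3) by (metis add_right_cancel)
        then have "\<one> \<ominus> k \<in> K" using dk(1) kc K(2) by auto
        then have "\<one> \<in> K" using KD(3)[OF _ dk(2)] \<open>\<one> \<ominus> k \<oplus> k = \<one>\<close> by metis
        then show False using right_ideal_one[OF K(1)] nK by blast
      qed
      then have "sum_set D ?V = D" using max[OF sE sub(1) EC] by blast
      then show "K = ?I" using sub(2) K(2) KD(1) by blast
    qed
    moreover have "?I \<noteq> carrier R" using one by blast
    ultimately have "maximal_right_ideal ?I R" unfolding maximal_right_ideal_def using I by blast
    then show ?thesis using j unfolding jacobson_radical_def by blast
  qed
  then show ?thesis using D that by blast
qed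

text \<open>Being killed by the radical, \<open>C/G\<close> is semisimple. A maximal
  \<open>D\<close> that meets \<open>C'\<close> only in \<open>G\<close> is the complement: if some
  \<open>v\<close> were missed by \<open>C' + D\<close>, then
  \<open>maximal_right_ideal_complement\<close> would supply a right ideal \<open>K\<close> such
  that \<open>v K\<close> can be added to \<open>D\<close>.\<close>

lemma submodule_complement:
  assumes "submodule G" "submodule C'" "submodule C" "G \<subseteq> C'" "C' \<subseteq> C"
    and kill: "\<And>x j. \<lbrakk>x \<in> C; j \<in> jac\<rbrakk> \<Longrightarrow> act x j \<in> G"
  obtains D where "submodule D" "D \<subseteq> C" "D \<inter> C' = G" "sum_set C' D = C"
proof -
  let ?P = "\<lambda>D. submodule D \<and> G \<subseteq> D \<and> D \<subseteq> C \<and> D \<inter> C' = G"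
  have "?P G" using assms by blast
  moreover have "\<And>D. ?P D \<Longrightarrow> submodule D" by simp
  ultimately have "\<exists>D. ?P D \<and> (\<forall>E. ?P E \<longrightarrow> fv.dim E \<le> fv.dim D)"
    by (rule ex_max_dim_submodule[of ?P])
  then obtain D where D: "?P D" and max: "\<forall>E. ?P E \<longrightarrow> fv.dim E \<le> fv.dim D"
    by (elim exE conjE[of "?P _"]) (rule that)
  note DD = submoduleD[OF conjunct1[OF D]] and DC = submoduleD[OF assms(3)] and DC' = submoduleD[OF assms(2)]
  note DG = submoduleD[OF assms(1)]
  let ?B = "sum_set C' D"
  have sB: "submodule ?B" using submodule_sum_set assms(2) D by blast
  have "C \<subseteq> ?B"
  proof (rule ccontr)
    assume "\<not> C \<subseteq> ?B"
    then obtain v where v: "v \<in> C" "v \<notin> ?B" by blast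
    then have vX: "v \<in> X" using DC(2) by blast
    let ?L = "{r \<in> carrier R. act v r \<in> ?B}"
    have "right_ideal ?L R" by (rule act_annihilator[OF sB vX])
    moreover have "?L \<noteq> carrier R"
    proof
      assume e: "?L = carrier R"
      have "\<one> \<in> ?L" unfolding e by simp
      then show False using v act_one[OF vX] by simp
    qed
    ultimately obtain m where m: "maximal_right_ideal m R" "?L \<subseteq> m"
      using proper_right_ideal_in_maximal by blast
    \<comment> \<open>\<open>?L\<close> consists of the ring elements that move \<open>v\<close>
      into \<open>C' + D\<close>. As \<open>K\<close> meets it only inside the radical, which sends
      \<open>v\<close> into \<open>G\<close>, adding \<open>v K\<close> to \<open>D\<close> does not
      enlarge the intersection with \<open>C'\<close>.\<close>
    obtain K where K: "right_ideal K R" "K \<inter> m = jac" "\<not> K \<subseteq> m"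
      using maximal_right_ideal_complement[OF m(1)] by blast
    note KD = right_idealD[OF K(1)]
    let ?V = "{act v k |k. k \<in> K}"
    have sV: "submodule ?V" by (rule submodule_cyclic[OF vX K(1)])
    let ?E = "sum_set D ?V"
    have sE: "submodule ?E" using submodule_sum_set D sV by blast
    have sub: "D \<subseteq> ?E" "?V \<subseteq> ?E"
      by (rule sum_set_upper1[OF submoduleD(1)[OF sV]], rule sum_set_upper2[OF DD(1)])
    have "?V \<subseteq> C" using DC(3)[OF v(1)] KD(1) by blast
    then have EC: "?E \<subseteq> C" using sum_set_least[OF DC(1), of D ?V] D by blast
    have "x \<in> G" if x: "x \<in> ?E" "x \<in> C'" for x
    proof -
      obtain d k where dk: "d \<in> D" "k \<in> K" "x = d + act v k" using x(1) by (auto elim!: sum_setE)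
      have kc: "k \<in> carrier R" using dk KD(1) by blast
      have "- d \<in> D" using DD(7)[OF DD(5) dk(1)] by simp
      then have "x + (- d) \<in> ?B" using x(2) by (rule sum_setI[rotated])
      then have "k \<in> ?L" using dk(3) kc by simp
      then have "k \<in> jac" using K(2) m(2) dk(2) by blast
      then have "act v k \<in> G" using kill v by blast
      then have "x \<in> D" using dk D DD(6) by blast
      then show ?thesis using x D by blast
    qed
    then have "?P ?E" using sE sub(1) D EC assms(4) by blast
    then have "fv.dim ?E \<le> fv.dim D" using max by simp
    then have "D = ?E" by (rule submodule_eq_of_dim[OF conjunct1[OF D] sE sub(1)])
    then have "K \<subseteq> ?L" using sub(2) sum_set_upper2[OF DC'(1), of D] KD(1) by blast
    then show False using K(3) m(2) by blast
  qed
  moreover have "?B \<subseteq> C" using sum_set_least[OF DC(1) assms(5)] D by blast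
  ultimately show ?thesis using D that by blast
qed

definition radical_step :: "('i \<Rightarrow> 'k) set \<Rightarrow> ('i \<Rightarrow> 'k) set \<Rightarrow> ('i \<Rightarrow> 'k) set" where
  "radical_step G C = sum_set G (fv.span {act x j |x j. x \<in> C \<and> j \<in> jac})"

lemma submodule_radical_step:
  assumes "submodule G" "submodule C" shows "submodule (radical_step G C)"
proof -
  let ?S = "{act x j |x j. x \<in> C \<and> j \<in> jac}"
  have jR: "jac \<subseteq> carrier R" by (auto simp: jacobson_radical_def)
  have SX: "?S \<subseteq> X" using submoduleD(2)[OF assms(2)] act_closed jR by blast
  have VX: "fv.span ?S \<subseteq> X" by (rule fv.span_minimal[OF SX subspace_X])
  have "act y r \<in> fv.span ?S" if r: "r \<in> carrier R" and y: "y \<in> fv.span ?S" for y r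
  proof -
    have "fv.subspace {y \<in> X. act y r \<in> fv.span ?S}"
      by (rule subspaceI)
        (use subspace_X r in \<open>auto simp: fv.subspace_0 act_zero fv.span_zero act_add fv.subspace_add
          fv.span_add act_scale fv.subspace_scale fv.span_scale\<close>)
    moreover have "?S \<subseteq> {y \<in> X. act y r \<in> fv.span ?S}"
    proof
      fix z assume z: "z \<in> ?S"
      then obtain x j where xj: "x \<in> C" "j \<in> jac" "z = act x j" by blast
      then have "act z r = act x (j \<otimes> r)"
        using act_mult[OF subsetD[OF submoduleD(2)[OF assms(2)] xj(1)] subsetD[OF jR xj(2)] r] by simp
      moreover have "j \<otimes> r \<in> jac" using right_idealD(4)[OF right_ideal_jacobson xj(2) r] .
      ultimately have "act z r \<in> ?S" using xj(1) by blast
      then have "act z r \<in> fv.span ?S" by (rule fv.span_base)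
      then show "z \<in> {y \<in> X. act y r \<in> fv.span ?S}" using subsetD[OF SX z] by simp
    qed
    ultimately have "fv.span ?S \<subseteq> {y \<in> X. act y r \<in> fv.span ?S}" by (rule fv.span_minimal[rotated])
    then show ?thesis using y by blast
  qed
  then have "submodule (fv.span ?S)" unfolding submodule_def using VX fv.subspace_span by blast
  then show ?thesis unfolding radical_step_def using submodule_sum_set assms(1) by blast
qed

lemma radical_step_upper:
  "G \<subseteq> radical_step G C" "submodule G \<Longrightarrow> \<lbrakk>x \<in> C; j \<in> jac\<rbrakk> \<Longrightarrow> act x j \<in> radical_step G C"
proof -
  show "G \<subseteq> radical_step G C"
    unfolding radical_step_def by (rule sum_set_upper1[OF fv.subspace_span])
  assume "submodule G" "x \<in> C" "j \<in> jac"
  then have "act x j \<in> fv.span {act x j |x j. x \<in> C \<and> j \<in> jac}" by (intro fv.span_base) blast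
  then show "act x j \<in> radical_step G C"
    unfolding radical_step_def using sum_set_upper2[OF submoduleD(1)[OF \<open>submodule G\<close>]] by blast
qed

lemma radical_step_least:
  assumes "submodule D" "G \<subseteq> D" "\<And>x j. \<lbrakk>x \<in> C; j \<in> jac\<rbrakk> \<Longrightarrow> act x j \<in> D"
  shows "radical_step G C \<subseteq> D"
  unfolding radical_step_def
  by (rule sum_set_least[OF submoduleD(1)[OF assms(1)] assms(2)], rule fv.span_minimal)
    (use assms submoduleD in auto)

text \<open>The radical series of \<open>C/G\<close>, lifted to \<open>C\<close>.\<close>

definition radical_chain :: "('i \<Rightarrow> 'k) set \<Rightarrow> ('i \<Rightarrow> 'k) set \<Rightarrow> nat \<Rightarrow> ('i \<Rightarrow> 'k) set" where
  "radical_chain G C n = (radical_step G ^^ n) C"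

lemma radical_chain_0: "radical_chain G C 0 = C"
  and radical_chain_Suc: "radical_chain G C (Suc n) = radical_step G (radical_chain G C n)"
  by (simp_all add: radical_chain_def)

lemma submodule_radical_chain:
  "\<lbrakk>submodule G; submodule C\<rbrakk> \<Longrightarrow> submodule (radical_chain G C n)"
  by (induction n) (simp_all add: radical_chain_0 radical_chain_Suc submodule_radical_step)

lemma radical_chain_lower: "G \<subseteq> C \<Longrightarrow> G \<subseteq> radical_chain G C n"
  by (cases n) (auto simp: radical_chain_0 radical_chain_Suc dest: subsetD[OF radical_step_upper(1)])

lemma radical_chain_decreasing:
  assumes "submodule G" "submodule C" "G \<subseteq> C"
  shows "radical_chain G C (Suc n) \<subseteq> radical_chain G C n"
  unfolding radical_chain_Suc
  by (rule radical_step_least)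
    (use submodule_radical_chain[OF assms(1,2)] radical_chain_lower[OF assms(3)] submoduleD(3)
      in \<open>auto simp: jacobson_radical_def\<close>)

text \<open>By \<open>exists_submodule_jacobson\<close> every step lowers the dimension until
  \<open>G\<close> is reached.\<close>

lemma radical_chain_reaches:
  assumes "submodule G" "submodule C" "G \<subseteq> C"
  obtains N where "radical_chain G C N = G"
proof -
  have "radical_chain G C n = G \<or> fv.dim (radical_chain G C n) + n \<le> fv.dim C" for n
  proof (induction n)
    case (Suc n)
    let ?E = "radical_chain G C n" and ?E' = "radical_chain G C (Suc n)"
    have sm: "submodule ?E" "submodule ?E'" using submodule_radical_chain[OF assms(1,2)] by blast+
    have le: "G \<subseteq> ?E" "G \<subseteq> ?E'" "?E' \<subseteq> ?E"
      using radical_chain_lower[OF assms(3)] radical_chain_decreasing[OF assms] by blast+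
    show ?case
    proof (cases "?E = G")
      case True then show ?thesis using le by blast
    next
      case False
      then have "G \<subset> ?E" using le by blast
      then obtain D where D: "submodule D" "G \<subseteq> D" "D \<subset> ?E" "\<And>x j. \<lbrakk>x \<in> ?E; j \<in> jac\<rbrakk> \<Longrightarrow> act x j \<in> D"
        using exists_submodule_jacobson[OF assms(1) sm(1)] by blast
      then have "?E' \<subseteq> D" unfolding radical_chain_Suc by (intro radical_step_least) auto
      then have "?E' \<noteq> ?E" using D(3) by blast
      then have "fv.dim ?E' < fv.dim ?E"
        using submodule_eq_of_dim[OF sm(2,1) le(3)] submodule_dim_le[OF sm(1) le(3)] by linarith
      then show ?thesis using Suc.IH False by linarith
    qed
  qed (simp add: radical_chain_0)
  from this[of "Suc (fv.dim C)"] show ?thesis using that by force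
qed

end

section \<open>Comodule algebras in coordinates\<close>

lemma fun_sum_apply: "(\<Sum>a\<in>A. f a) i = (\<Sum>a\<in>A. f a i)"
  by (induction A rule: infinite_finite_induct) simp_all

lemma triple_ext: "(\<And>a b c. f (a, b, c) = g (a, b, c)) \<Longrightarrow> f = g"
  by auto

lemma power_set_sum_set:
  assumes "w \<in> power_set I (sum_set S T)"
  shows "w \<in> sum_set (power_set I S) (power_set I T)"
proof -
  have "\<forall>a\<in>I. \<exists>y. y \<in> S \<and> slice w a - y \<in> T"
  proof
    fix a assume "a \<in> I"
    then have "slice w a \<in> sum_set S T" using assms unfolding power_set_def by blast
    then obtain y z where "y \<in> S" "z \<in> T" "slice w a = y + z" by (rule sum_setE)
    then show "\<exists>y. y \<in> S \<and> slice w a - y \<in> T" by (intro exI[of _ y]) simp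
  qed
  then obtain y where y: "\<And>a. a \<in> I \<Longrightarrow> y a \<in> S" "\<And>a. a \<in> I \<Longrightarrow> slice w a - y a \<in> T"
    by (auto dest!: bchoice)
  let ?y = "\<lambda>(a, i). if a \<in> I then y a i else 0"
  have s1: "slice ?y a = (if a \<in> I then y a else 0)" for a by (auto simp: slice_def)
  have s2: "slice (w - ?y) a = slice w a - slice ?y a" for a by (auto simp: slice_def)
  have "?y \<in> power_set I S" using y(1) by (simp add: power_set_def s1)
  moreover have "w - ?y \<in> power_set I T"
    using y(2) assms by (simp add: power_set_def s1 s2)
  ultimately have "?y + (w - ?y) \<in> sum_set (power_set I S) (power_set I T)" by (rule sum_setI)
  then show ?thesis by simp
qed

text \<open>The field as a vector space over itself: the target of \<open>linear_maps\<close> has to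
  be a module record, and \<open>class_ring\<close> is only a ring record.\<close>

definition ground :: "('k::field, 'k) module" where
  "ground = \<lparr>carrier = UNIV, mult = (*), one = 1, zero = 0, add = (+), smult = (*)\<rparr>"

lemma linear_functional_iff:
  "f \<in> linear_maps V ground \<longleftrightarrow>
     (\<forall>x\<in>carrier V. \<forall>y\<in>carrier V. f (x \<oplus>\<^bsub>V\<^esub> y) = f x + f y) \<and>
     (\<forall>c. \<forall>x\<in>carrier V. f (c \<odot>\<^bsub>V\<^esub> x) = c * f x)"
  by (auto simp: LinearCombinations.module_hom_def ground_def)

text \<open>An algebra with a coaction of a finite-dimensional Hopf algebra \<open>H\<close>, in coordinates: \<open>I\<close> indexes
  a basis of \<open>H\<close>, and for a right \<open>R\<close>-module \<open>M\<close> the maps \<open>\<Lambda> a b\<close> give the \<open>R\<close>-action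
  \<open>(m \<otimes> a) r = \<Sum>\<^sub>b m (\<Lambda> a b r) \<otimes> b\<close> on \<open>M \<otimes> H\<close>. The scalars \<open>t\<close>, \<open>\<epsilon>\<close> are the coordinates of a right
  integral and of the counit, and \<open>\<kappa>\<close>, \<open>\<kappa>'\<close> those of the mutually inverse maps
  \<open>a \<otimes> g \<mapsto> \<Sum> g a\<^sub>1 \<otimes> a\<^sub>2\<close> and \<open>a \<otimes> g \<mapsto> \<Sum> g S(a\<^sub>1) \<otimes> a\<^sub>2\<close>.
  Vector equations are stated through all functionals \<open>f\<close>, to have plain sums instead of \<^const>\<open>finsum\<close>.\<close>

locale comodule_algebra = fd_algebra R \<iota>
  for R :: "('k::field, 'r) module" (structure) and \<iota> :: "'r \<Rightarrow> 'j \<Rightarrow> 'k" +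
  fixes I :: "'c set" and \<Lambda> :: "'c \<Rightarrow> 'c \<Rightarrow> 'r \<Rightarrow> 'r" and t \<epsilon> :: "'c \<Rightarrow> 'k"
    and \<kappa> \<kappa>' :: "'c \<Rightarrow> 'c \<Rightarrow> 'c \<Rightarrow> 'c \<Rightarrow> 'k"
  assumes finite_I: "finite I"
    and \<Lambda>_closed: "\<lbrakk>a \<in> I; b \<in> I; r \<in> carrier R\<rbrakk> \<Longrightarrow> \<Lambda> a b r \<in> carrier R"
    and \<Lambda>_add: "\<lbrakk>a \<in> I; b \<in> I; r \<in> carrier R; s \<in> carrier R\<rbrakk> \<Longrightarrow> \<Lambda> a b (r \<oplus> s) = \<Lambda> a b r \<oplus> \<Lambda> a b s"
    and \<Lambda>_smult: "\<lbrakk>a \<in> I; b \<in> I; r \<in> carrier R\<rbrakk> \<Longrightarrow> \<Lambda> a b (c \<odot>\<^bsub>R\<^esub> r) = c \<odot>\<^bsub>R\<^esub> \<Lambda> a b r"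
    and \<Lambda>_one: "\<lbrakk>a \<in> I; b \<in> I\<rbrakk> \<Longrightarrow> \<Lambda> a b \<one> = (if a = b then \<one> else \<zero>)"
    and \<Lambda>_mult: "\<lbrakk>f \<in> linear_maps R ground; a \<in> I; b \<in> I; r \<in> carrier R; s \<in> carrier R\<rbrakk> \<Longrightarrow>
      f (\<Lambda> a b (r \<otimes> s)) = (\<Sum>c\<in>I. f (\<Lambda> a c r \<otimes> \<Lambda> c b s))"
    and integral: "\<lbrakk>f \<in> linear_maps R ground; b \<in> I; r \<in> carrier R\<rbrakk> \<Longrightarrow>
      (\<Sum>a\<in>I. t a * f (\<Lambda> a b r)) = t b * f r"
    and counit: "\<lbrakk>f \<in> linear_maps R ground; a \<in> I; r \<in> carrier R\<rbrakk> \<Longrightarrow>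
      (\<Sum>b\<in>I. \<epsilon> b * f (\<Lambda> a b r)) = \<epsilon> a * f r"
    and counit_integral: "(\<Sum>a\<in>I. \<epsilon> a * t a) = 1"
    and \<kappa>_intertwines: "\<lbrakk>f \<in> linear_maps R ground; a \<in> I; g \<in> I; x \<in> I; b \<in> I; r \<in> carrier R\<rbrakk> \<Longrightarrow>
      (\<Sum>x'\<in>I. \<Sum>b'\<in>I. \<kappa> a g x' b' * f (\<Lambda> x' x (\<Lambda> b' b r))) = (\<Sum>a'\<in>I. \<kappa> a' g x b * f (\<Lambda> a a' r))"
    and \<kappa>_inverse: "\<lbrakk>a \<in> I; g \<in> I; a' \<in> I; g' \<in> I\<rbrakk> \<Longrightarrow>
      (\<Sum>x\<in>I. \<Sum>b\<in>I. \<kappa>' x b a' g' * \<kappa> a g x b) = (if a = a' \<and> g = g' then 1 else 0)"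
begin

text \<open>The index type \<open>'i\<close> is not fixed by the locale, so iterating this one
  constant yields the actions on \<open>(M \<otimes> H) \<otimes> H\<close> and beyond.\<close>

definition Mact :: "(('i \<Rightarrow> 'k) \<Rightarrow> 'r \<Rightarrow> 'i \<Rightarrow> 'k) \<Rightarrow> ('c \<times> 'i \<Rightarrow> 'k) \<Rightarrow> 'r \<Rightarrow> 'c \<times> 'i \<Rightarrow> 'k" where
  "Mact act w r = (\<lambda>(b, i). if b \<in> I then \<Sum>a\<in>I. act (slice w a) (\<Lambda> a b r) i else 0)"

lemma slice_Mact:
  "slice (Mact act w r) b = (if b \<in> I then \<Sum>a\<in>I. act (slice w a) (\<Lambda> a b r) else 0)"
  by (auto simp: slice_def Mact_def fun_sum_apply fun_eq_iff)

text \<open>\<open>\<theta>\<close> identifies the direct sum of \<open>dim H\<close> copies of the module \<open>M \<otimes> H\<close> with \<open>(M \<otimes> H) \<otimes> H\<close>.\<close>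

definition \<theta> :: "('c \<times> ('c \<times> 'i) \<Rightarrow> 'k) \<Rightarrow> 'c \<times> ('c \<times> 'i) \<Rightarrow> 'k" where
  "\<theta> w = (\<lambda>(b, x, i). if b \<in> I \<and> x \<in> I then \<Sum>a\<in>I. \<Sum>g\<in>I. \<kappa> a g x b * w (g, a, i) else 0)"

definition \<theta>' :: "('c \<times> ('c \<times> 'i) \<Rightarrow> 'k) \<Rightarrow> 'c \<times> ('c \<times> 'i) \<Rightarrow> 'k" where
  "\<theta>' w = (\<lambda>(g, a, i). if g \<in> I \<and> a \<in> I then \<Sum>x\<in>I. \<Sum>b\<in>I. \<kappa>' x b a g * w (b, x, i) else 0)"

lemma flinear_\<theta>: "flinear \<theta>" and flinear_\<theta>': "flinear \<theta>'"
  by (rule flinearI; rule triple_ext; simp add: \<theta>_def \<theta>'_def sum.distrib sum_distrib_left algebra_simps)+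

text \<open>This is \<open>\<kappa>_inverse\<close> once the four sums are reordered so that those
  over \<open>x\<close> and \<open>b\<close> are innermost. One composition is enough, because
  finite dimension then makes \<open>\<theta>\<close> bijective.\<close>

lemma \<theta>'_\<theta>:
  fixes w :: "'c \<times> 'c \<times> 'i \<Rightarrow> 'k"
  assumes w: "w \<in> power_set I (power_set I C)" shows "\<theta>' (\<theta> w) = w"
proof (rule triple_ext)
  fix g' a' :: 'c and i :: 'i
  let ?p = "(g', a', i)"
  show "\<theta>' (\<theta> w) ?p = w ?p"
  proof (cases "g' \<in> I \<and> a' \<in> I")
    case True
    have "\<theta>' (\<theta> w) ?p = (\<Sum>x\<in>I. \<Sum>b\<in>I. \<kappa>' x b a' g' * (\<Sum>a\<in>I. \<Sum>g\<in>I. \<kappa> a g x b * w (g, a, i)))"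
      using True by (simp add: \<theta>'_def \<theta>_def)
    also have "\<dots> = (\<Sum>x\<in>I. \<Sum>b\<in>I. \<Sum>a\<in>I. \<Sum>g\<in>I. \<kappa>' x b a' g' * \<kappa> a g x b * w (g, a, i))"
      by (simp add: sum_distrib_left mult.assoc)
    also have "\<dots> = (\<Sum>x\<in>I. \<Sum>a\<in>I. \<Sum>g\<in>I. \<Sum>b\<in>I. \<kappa>' x b a' g' * \<kappa> a g x b * w (g, a, i))"
    proof (rule sum.cong[OF refl])
      fix x
      have "(\<Sum>b\<in>I. \<Sum>a\<in>I. \<Sum>g\<in>I. \<kappa>' x b a' g' * \<kappa> a g x b * w (g, a, i))
        = (\<Sum>a\<in>I. \<Sum>b\<in>I. \<Sum>g\<in>I. \<kappa>' x b a' g' * \<kappa> a g x b * w (g, a, i))" by (rule sum.swap)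
      also have "\<dots> = (\<Sum>a\<in>I. \<Sum>g\<in>I. \<Sum>b\<in>I. \<kappa>' x b a' g' * \<kappa> a g x b * w (g, a, i))"
        by (rule sum.cong[OF refl], rule sum.swap)
      finally show "(\<Sum>b\<in>I. \<Sum>a\<in>I. \<Sum>g\<in>I. \<kappa>' x b a' g' * \<kappa> a g x b * w (g, a, i))
        = (\<Sum>a\<in>I. \<Sum>g\<in>I. \<Sum>b\<in>I. \<kappa>' x b a' g' * \<kappa> a g x b * w (g, a, i))" .
    qed
    also have "\<dots> = (\<Sum>a\<in>I. \<Sum>x\<in>I. \<Sum>g\<in>I. \<Sum>b\<in>I. \<kappa>' x b a' g' * \<kappa> a g x b * w (g, a, i))"
      by (rule sum.swap)
    also have "\<dots> = (\<Sum>a\<in>I. \<Sum>g\<in>I. \<Sum>x\<in>I. \<Sum>b\<in>I. \<kappa>' x b a' g' * \<kappa> a g x b * w (g, a, i))"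
      by (rule sum.cong[OF refl], rule sum.swap)
    also have "\<dots> = (\<Sum>a\<in>I. \<Sum>g\<in>I. (\<Sum>x\<in>I. \<Sum>b\<in>I. \<kappa>' x b a' g' * \<kappa> a g x b) * w (g, a, i))"
      by (simp add: sum_distrib_right)
    also have "\<dots> = (\<Sum>a\<in>I. \<Sum>g\<in>I. (if a = a' \<and> g = g' then 1 else 0) * w (g, a, i))"
      by (intro sum.cong refl arg_cong2[of _ _ _ _ "(*)"] \<kappa>_inverse) (use True in auto)
    also have "\<dots> = (\<Sum>a\<in>I. if a = a' then (\<Sum>g\<in>I. if g = g' then w (g, a, i) else 0) else 0)"
      by (intro sum.cong refl) (auto intro!: sum.cong sum.neutral)
    also have "\<dots> = w (g', a', i)" using True finite_I by (simp add: sum.delta)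
    finally show ?thesis .
  next
    case False
    have "w (g', a', i) = slice (slice w g') a' i" by (simp add: slice_def)
    moreover have "slice (slice w g') a' = 0"
    proof (cases "g' \<in> I")
      case True
      then have "slice w g' \<in> power_set I C" using w by (simp add: power_set_def)
      then show ?thesis using True False by (simp add: power_set_def)
    next
      case False
      then have "slice w g' = 0" using w by (simp add: power_set_def)
      then show ?thesis by simp
    qed
    ultimately show ?thesis using False by (auto simp: \<theta>'_def)
  qed
qed

lemma slice_slice_\<theta>:
  assumes "b \<in> I" "x \<in> I"
  shows "slice (slice (\<theta> w) b) x = (\<Sum>a\<in>I. \<Sum>g\<in>I. (\<lambda>i. \<kappa> a g x b * slice (slice w g) a i))"
  using assms by (auto simp: slice_def \<theta>_def fun_sum_apply fun_eq_iff)

lemma \<theta>_closed: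
  assumes "w \<in> power_set I (power_set I C)" "fv.subspace C"
  shows "\<theta> w \<in> power_set I (power_set I C)"
proof -
  have 1: "slice (slice (\<theta> w) b) x \<in> C" if "b \<in> I" "x \<in> I" for b x
    unfolding slice_slice_\<theta>[OF that]
    by (intro fv.subspace_sum[OF assms(2)] fv.subspace_scale[OF assms(2)])
      (use assms(1) in \<open>simp add: power_set_def\<close>)
  have 2: "slice (slice (\<theta> w) b) x = 0" if "x \<notin> I" for b x
    using that by (auto simp: slice_def \<theta>_def)
  have 3: "slice (\<theta> w) b = 0" if "b \<notin> I" for b
    using that by (auto simp: slice_def \<theta>_def)
  show ?thesis unfolding power_set_def using 1 2 3 by simp
qed

text \<open>\<open>\<theta>\<close> mixes only the two \<open>H\<close>-indices and leaves the
  coordinates of \<open>C\<close> alone, so it maps this space injectively into itself, hence onto.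
  This is why the two chains compared in \<open>jacobson_kills_power\<close> have equal
  ends.\<close>

lemma \<theta>_image:
  assumes "fv.subspace C" "finite_dim C"
  shows "\<theta> ` power_set I (power_set I C) = power_set I (power_set I C)"
proof (rule subspace_eq_of_dim)
  let ?P = "power_set I (power_set I C)"
  have sub: "fv.subspace ?P" by (intro subspace_power_set assms(1))
  show "finite_dim ?P"
    by (intro finite_dim_power_set subspace_power_set finite_I assms)
  show "\<theta> ` ?P \<subseteq> ?P" using \<theta>_closed assms(1) by blast
  show "fv.subspace (\<theta> ` ?P)" by (rule subspace_image[OF flinear_\<theta> sub])
  have "inj_on \<theta> ?P" by (rule inj_on_inverseI[of _ \<theta>']) (rule \<theta>'_\<theta>)
  then show "fv.dim ?P \<le> fv.dim (\<theta> ` ?P)" using dim_image_inj[OF flinear_\<theta> _ sub] by simp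
qed

end

locale comodule_module = comodule_algebra R \<iota> I \<Lambda> t \<epsilon> \<kappa> \<kappa>' + fd_module R \<iota> X act
  for R :: "('k::field, 'r) module" (structure) and \<iota> :: "'r \<Rightarrow> 'j \<Rightarrow> 'k"
    and I :: "'c set" and \<Lambda> :: "'c \<Rightarrow> 'c \<Rightarrow> 'r \<Rightarrow> 'r" and t \<epsilon> :: "'c \<Rightarrow> 'k"
    and \<kappa> \<kappa>' :: "'c \<Rightarrow> 'c \<Rightarrow> 'c \<Rightarrow> 'c \<Rightarrow> 'k"
    and X :: "('i \<Rightarrow> 'k) set" and act :: "('i \<Rightarrow> 'k) \<Rightarrow> 'r \<Rightarrow> 'i \<Rightarrow> 'k"
begin

text \<open>Each coordinate of \<open>x r\<close> is a functional of \<open>r\<close>; through these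
  functionals the equations of \<open>comodule_algebra\<close> reach the modules.\<close>

lemma act_functional: "x \<in> X \<Longrightarrow> (\<lambda>r. act x r i) \<in> linear_maps R ground"
  by (simp add: linear_functional_iff act_add_right act_smult_right)

lemma slice_closed: "\<lbrakk>w \<in> power_set I C; C \<subseteq> X\<rbrakk> \<Longrightarrow> slice w a \<in> X"
  using fv.subspace_0[OF subspace_X] by (cases "a \<in> I") (auto simp: power_set_def)

lemma Mact_closed:
  assumes "fd_module.submodule R X act C" "w \<in> power_set I C" "r \<in> carrier R"
  shows "Mact act w r \<in> power_set I C"
  unfolding power_set_def
proof (intro CollectI conjI allI ballI impI)
  note C = submoduleD[OF assms(1)]
  fix b assume b: "b \<in> I"
  show "slice (Mact act w r) b \<in> C"
    unfolding slice_Mact using b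
    by (simp, intro fv.subspace_sum[OF C(1)] C(3) \<Lambda>_closed)
      (use assms(2,3) in \<open>auto simp: power_set_def\<close>)
qed (simp add: slice_Mact)

lemma Mact_add:
  assumes "v \<in> power_set I X" "w \<in> power_set I X" "r \<in> carrier R"
  shows "Mact act (v + w) r = Mact act v r + Mact act w r"
  by (rule slice_eqI)
    (simp add: slice_Mact act_add slice_closed[OF assms(1)] slice_closed[OF assms(2)] \<Lambda>_closed assms(3) sum.distrib)

text \<open>\<open>M \<otimes> H\<close> satisfies the assumptions of the same locale over a larger
  index type, so every result can be interpreted again for it and for
  \<open>(M \<otimes> H) \<otimes> H\<close>.\<close>

lemma comodule_module_power: "comodule_module R \<iota> I \<Lambda> t \<epsilon> \<kappa> \<kappa>' (power_set I X) (Mact act)"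
proof unfold_locales
  show "fv.subspace (power_set I X)" by (rule subspace_power_set[OF subspace_X])
  show "finite_dim (power_set I X)" by (rule finite_dim_power_set[OF finite_I subspace_X finite_dim_X])
  show "Mact act x r \<in> power_set I X" if "x \<in> power_set I X" "r \<in> carrier R" for x r
    by (rule Mact_closed[OF submodule_X that])
  show "Mact act (x + y) r = Mact act x r + Mact act y r"
    if "x \<in> power_set I X" "y \<in> power_set I X" "r \<in> carrier R" for x y r
    by (rule Mact_add[OF that])
  show "Mact act (\<lambda>i. c * x i) r = (\<lambda>i. c * Mact act x r i)"
    if "x \<in> power_set I X" "r \<in> carrier R" for c x r
    by (rule ext) (auto simp: Mact_def act_scale slice_closed[OF that(1)] \<Lambda>_closed that(2) sum_distrib_left)
  show "Mact act x (r \<oplus> s) = Mact act x r + Mact act x s"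
    if "x \<in> power_set I X" "r \<in> carrier R" "s \<in> carrier R" for x r s
    by (rule ext) (auto simp: Mact_def \<Lambda>_add act_add_right slice_closed[OF that(1)] \<Lambda>_closed that(2,3) sum.distrib)
  show "Mact act x (c \<odot>\<^bsub>R\<^esub> r) = (\<lambda>i. c * Mact act x r i)"
    if "x \<in> power_set I X" "r \<in> carrier R" for x r c
    by (rule ext) (auto simp: Mact_def \<Lambda>_smult act_smult_right slice_closed[OF that(1)] \<Lambda>_closed that(2) sum_distrib_left)
  show "Mact act x (r \<otimes> s) = Mact act (Mact act x r) s"
    if x: "x \<in> power_set I X" and rs: "r \<in> carrier R" "s \<in> carrier R" for x r s
  proof
    fix p :: "'c \<times> 'i" obtain b i where p: "p = (b, i)" by (cases p)
    show "Mact act x (r \<otimes> s) p = Mact act (Mact act x r) s p"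
    proof (cases "b \<in> I")
      case b: True
      note sx = slice_closed[OF x subset_refl]
      have "Mact act x (r \<otimes> s) p = (\<Sum>a\<in>I. act (slice x a) (\<Lambda> a b (r \<otimes> s)) i)"
        using b by (simp add: Mact_def p)
      also have "\<dots> = (\<Sum>a\<in>I. \<Sum>c\<in>I. act (slice x a) (\<Lambda> a c r \<otimes> \<Lambda> c b s) i)"
        by (rule sum.cong[OF refl], rule \<Lambda>_mult[OF act_functional[OF sx] _ b rs])
      also have "\<dots> = (\<Sum>a\<in>I. \<Sum>c\<in>I. act (act (slice x a) (\<Lambda> a c r)) (\<Lambda> c b s) i)"
        using sx rs b by (intro sum.cong refl) (simp add: act_mult \<Lambda>_closed)
      also have "\<dots> = (\<Sum>c\<in>I. \<Sum>a\<in>I. act (act (slice x a) (\<Lambda> a c r)) (\<Lambda> c b s) i)"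
        by (rule sum.swap)
      also have "\<dots> = (\<Sum>c\<in>I. act (slice (Mact act x r) c) (\<Lambda> c b s) i)"
      proof (rule sum.cong[OF refl])
        fix c assume c: "c \<in> I"
        have "act (\<Sum>a\<in>I. act (slice x a) (\<Lambda> a c r)) (\<Lambda> c b s) = (\<Sum>a\<in>I. act (act (slice x a) (\<Lambda> a c r)) (\<Lambda> c b s))"
          by (rule act_sum[OF finite_I]) (use sx rs b c in \<open>auto simp: act_closed \<Lambda>_closed\<close>)
        then show "(\<Sum>a\<in>I. act (act (slice x a) (\<Lambda> a c r)) (\<Lambda> c b s) i) = act (slice (Mact act x r) c) (\<Lambda> c b s) i"
          using c by (simp add: slice_Mact fun_sum_apply)
      qed
      finally show ?thesis using b by (simp add: Mact_def p)
    qed (simp add: Mact_def p)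
  qed
  show "Mact act x \<one> = x" if x: "x \<in> power_set I X" for x
  proof (rule slice_eqI)
    fix b
    note sx = slice_closed[OF x subset_refl]
    have z: "act y \<zero> = 0" if "y \<in> X" for y
      using act_add_right[OF that, of "\<zero>" "\<zero>"] by simp
    show "slice (Mact act x \<one>) b = slice x b"
    proof (cases "b \<in> I")
      case True
      then have "slice (Mact act x \<one>) b = (\<Sum>a\<in>I. if a = b then slice x a else 0)"
        by (simp add: slice_Mact) (rule sum.cong[OF refl], simp add: \<Lambda>_one act_one sx z)
      also have "\<dots> = slice x b" using True finite_I by simp
      finally show ?thesis .
    qed (use x in \<open>simp add: slice_Mact power_set_def\<close>)
  qed
qed

text \<open>The componentwise action on a direct sum of copies of the module, as opposed to the
  twisted action \<open>Mact\<close> on the same space.\<close>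

definition copact :: "('c \<times> 'i \<Rightarrow> 'k) \<Rightarrow> 'r \<Rightarrow> 'c \<times> 'i \<Rightarrow> 'k" where
  "copact w r = (\<lambda>(g, i). if g \<in> I then act (slice w g) r i else 0)"

lemma slice_copact: "slice (copact w r) g = (if g \<in> I then act (slice w g) r else 0)"
  by (auto simp: slice_def copact_def)

lemma copact_closed:
  assumes "submodule C" "w \<in> power_set I C" "r \<in> carrier R" shows "copact w r \<in> power_set I C"
  using assms(2,3) submoduleD(3)[OF assms(1)] by (simp add: power_set_def slice_copact)

end

context comodule_module begin

interpretation P: comodule_module R \<iota> I \<Lambda> t \<epsilon> \<kappa> \<kappa>' "power_set I X" "Mact act"
  by (rule comodule_module_power)

text \<open>In Hopf terms, \<open>\<theta>\<close> sends \<open>m \<otimes> a\<close> in copy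
  \<open>g\<close> to the sum of \<open>(m \<otimes> g a1) \<otimes> a2\<close>. This respects the
  actions because the comultiplication is multiplicative; \<open>\<kappa>_intertwines\<close> is
  that fact in coordinates.\<close>

lemma \<theta>_hom:
  assumes w: "w \<in> power_set I (power_set I X)" and r: "r \<in> carrier R"
  shows "Mact (Mact act) (\<theta> w) r = \<theta> (P.copact w r)"
proof (rule triple_ext)
  fix b x :: 'c and i :: 'i
  let ?l = "Mact (Mact act) (\<theta> w) r (b, x, i)"
  show "?l = \<theta> (P.copact w r) (b, x, i)"
  proof (cases "b \<in> I \<and> x \<in> I")
    case True
    then have b: "b \<in> I" and x: "x \<in> I" by auto
    have sw: "slice (slice w g) a \<in> X" for g a
      using slice_closed[OF _ subset_refl] P.slice_closed[OF w subset_refl] by blast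
    have s\<theta>: "slice (slice (\<theta> w) b') x' \<in> X" for b' x'
      using slice_closed[OF _ subset_refl] P.slice_closed[OF \<theta>_closed[OF w subspace_X] subset_refl] by blast
    have 1: "act (slice (slice (\<theta> w) b') x') q i
        = (\<Sum>a\<in>I. \<Sum>g\<in>I. \<kappa> a g x' b' * act (slice (slice w g) a) q i)"
      if "b' \<in> I" "x' \<in> I" "q \<in> carrier R" for b' x' q
    proof -
      have sc: "(\<lambda>i. \<kappa> a g x' b' * slice (slice w g) a i) \<in> X" for a g
        by (rule fv.subspace_scale[OF subspace_X sw])
      have "act (slice (slice (\<theta> w) b') x') q
          = (\<Sum>a\<in>I. act (\<Sum>g\<in>I. (\<lambda>i. \<kappa> a g x' b' * slice (slice w g) a i)) q)"
        unfolding slice_slice_\<theta>[OF that(1,2)]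
        by (rule act_sum[OF finite_I _ that(3)]) (intro fv.subspace_sum[OF subspace_X] sc)
      also have "\<dots> = (\<Sum>a\<in>I. \<Sum>g\<in>I. act (\<lambda>i. \<kappa> a g x' b' * slice (slice w g) a i) q)"
        by (rule sum.cong[OF refl], rule act_sum[OF finite_I sc that(3)])
      also have "\<dots> = (\<Sum>a\<in>I. \<Sum>g\<in>I. (\<lambda>i. \<kappa> a g x' b' * act (slice (slice w g) a) q i))"
        by (intro sum.cong refl act_scale[OF sw that(3)])
      finally show ?thesis by (simp add: fun_sum_apply)
    qed
    have "?l
        = (\<Sum>b'\<in>I. \<Sum>x'\<in>I. act (slice (slice (\<theta> w) b') x') (\<Lambda> x' x (\<Lambda> b' b r)) i)"
      using True by (simp add: Mact_def)
    also have "\<dots> = (\<Sum>b'\<in>I. \<Sum>x'\<in>I. \<Sum>a\<in>I. \<Sum>g\<in>I. \<kappa> a g x' b' * act (slice (slice w g) a) (\<Lambda> x' x (\<Lambda> b' b r)) i)"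
      by (intro sum.cong refl 1) (use b x r in \<open>auto intro: \<Lambda>_closed\<close>)
    also have "\<dots> = (\<Sum>x'\<in>I. \<Sum>b'\<in>I. \<Sum>a\<in>I. \<Sum>g\<in>I. \<kappa> a g x' b' * act (slice (slice w g) a) (\<Lambda> x' x (\<Lambda> b' b r)) i)"
      by (rule sum.swap)
    also have "\<dots> = (\<Sum>x'\<in>I. \<Sum>a\<in>I. \<Sum>b'\<in>I. \<Sum>g\<in>I. \<kappa> a g x' b' * act (slice (slice w g) a) (\<Lambda> x' x (\<Lambda> b' b r)) i)"
      by (rule sum.cong[OF refl], rule sum.swap)
    also have "\<dots> = (\<Sum>x'\<in>I. \<Sum>a\<in>I. \<Sum>g\<in>I. \<Sum>b'\<in>I. \<kappa> a g x' b' * act (slice (slice w g) a) (\<Lambda> x' x (\<Lambda> b' b r)) i)"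
      by (rule sum.cong[OF refl], rule sum.cong[OF refl], rule sum.swap)
    also have "\<dots> = (\<Sum>a\<in>I. \<Sum>x'\<in>I. \<Sum>g\<in>I. \<Sum>b'\<in>I. \<kappa> a g x' b' * act (slice (slice w g) a) (\<Lambda> x' x (\<Lambda> b' b r)) i)"
      by (rule sum.swap)
    also have "\<dots> = (\<Sum>a\<in>I. \<Sum>g\<in>I. \<Sum>x'\<in>I. \<Sum>b'\<in>I. \<kappa> a g x' b' * act (slice (slice w g) a) (\<Lambda> x' x (\<Lambda> b' b r)) i)"
      by (rule sum.cong[OF refl], rule sum.swap)
    \<comment> \<open>The two inner sums now form the left side of
      \<open>\<kappa>_intertwines\<close> for the functional that takes coordinate \<open>i\<close>
      of the action.\<close>
    also have "\<dots> = (\<Sum>a\<in>I. \<Sum>g\<in>I. \<Sum>a'\<in>I. \<kappa> a' g x b * act (slice (slice w g) a) (\<Lambda> a a' r) i)"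
      by (intro sum.cong refl \<kappa>_intertwines[OF act_functional[OF sw] _ _ x b r])
    also have "\<dots> = (\<Sum>a\<in>I. \<Sum>a'\<in>I. \<Sum>g\<in>I. \<kappa> a' g x b * act (slice (slice w g) a) (\<Lambda> a a' r) i)"
      by (rule sum.cong[OF refl], rule sum.swap)
    also have "\<dots> = (\<Sum>a'\<in>I. \<Sum>a\<in>I. \<Sum>g\<in>I. \<kappa> a' g x b * act (slice (slice w g) a) (\<Lambda> a a' r) i)"
      by (rule sum.swap)
    also have "\<dots> = (\<Sum>a'\<in>I. \<Sum>g\<in>I. \<Sum>a\<in>I. \<kappa> a' g x b * act (slice (slice w g) a) (\<Lambda> a a' r) i)"
      by (rule sum.cong[OF refl], rule sum.swap)
    also have "\<dots> = (\<Sum>a'\<in>I. \<Sum>g\<in>I. \<kappa> a' g x b * (\<Sum>a\<in>I. act (slice (slice w g) a) (\<Lambda> a a' r) i))"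
      by (simp add: sum_distrib_left)
    also have "\<dots> = \<theta> (P.copact w r) (b, x, i)"
      using True by (simp add: \<theta>_def P.copact_def Mact_def cong: sum.cong)
    finally show ?thesis .
  qed (auto simp: Mact_def \<theta>_def)
qed

end

section \<open>Counting homomorphisms into subquotients\<close>

context comodule_module begin

text \<open>\<open>br C C'\<close> is the preimage in \<open>C \<otimes> H\<close> of the socle of \<open>(C/C') \<otimes> H\<close>, and
  \<open>\<sigma> C C'\<close> is the dimension of that socle.\<close>

definition br :: "('i \<Rightarrow> 'k) set \<Rightarrow> ('i \<Rightarrow> 'k) set \<Rightarrow> ('c \<times> 'i \<Rightarrow> 'k) set" where
  "br C C' = {w \<in> power_set I C. \<forall>j\<in>jac. Mact act w j \<in> power_set I C'}"

definition \<sigma> :: "('i \<Rightarrow> 'k) set \<Rightarrow> ('i \<Rightarrow> 'k) set \<Rightarrow> nat" where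
  "\<sigma> C C' = fv.dim (br C C') - card I * fv.dim C'"

lemma jac_carrier: "j \<in> jac \<Longrightarrow> j \<in> carrier R"
  by (simp add: jacobson_radical_def)

lemma brI: "\<lbrakk>w \<in> power_set I C; \<And>j. j \<in> jac \<Longrightarrow> Mact act w j \<in> power_set I C'\<rbrakk> \<Longrightarrow> w \<in> br C C'"
  by (simp add: br_def)

lemma brD: "w \<in> br C C' \<Longrightarrow> w \<in> power_set I C" "\<lbrakk>w \<in> br C C'; j \<in> jac\<rbrakk> \<Longrightarrow> Mact act w j \<in> power_set I C'"
  by (simp_all add: br_def)

lemma power_submodule:
  assumes "submodule C"
  shows "fv.subspace (power_set I C)" "finite_dim (power_set I C)" "power_set I C \<subseteq> power_set I X"
    "fv.dim (power_set I C) = card I * fv.dim C"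
  by (rule subspace_power_set[OF submoduleD(1)[OF assms]],
      rule finite_dim_power_set[OF finite_I submoduleD(1,4)[OF assms]],
      rule power_set_mono[OF submoduleD(2)[OF assms]],
      rule dim_power_set[OF finite_I submoduleD(1,4)[OF assms]])

lemma br_properties:
  assumes "submodule C" "submodule C'"
  shows "fv.subspace (br C C')" "finite_dim (br C C')"
proof -
  interpret P: comodule_module R \<iota> I \<Lambda> t \<epsilon> \<kappa> \<kappa>' "power_set I X" "Mact act"
    by (rule comodule_module_power)
  note pC = power_submodule[OF assms(1)] and pC' = power_submodule[OF assms(2)]
  show "fv.subspace (br C C')"
  proof (rule subspaceI)
    show "0 \<in> br C C'"
      by (rule brI) (simp_all add: fv.subspace_0[OF pC(1)] fv.subspace_0[OF pC'(1)] P.act_zero jac_carrier)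
    show "v + w \<in> br C C'" if vw: "v \<in> br C C'" "w \<in> br C C'" for v w
    proof (rule brI)
      show "v + w \<in> power_set I C" by (rule fv.subspace_add[OF pC(1) brD(1)[OF vw(1)] brD(1)[OF vw(2)]])
      fix j assume j: "j \<in> jac"
      have "Mact act (v + w) j = Mact act v j + Mact act w j"
        by (rule Mact_add) (use brD(1)[OF vw(1)] brD(1)[OF vw(2)] pC(3) j jac_carrier in auto)
      then show "Mact act (v + w) j \<in> power_set I C'"
        using fv.subspace_add[OF pC'(1) brD(2)[OF vw(1) j] brD(2)[OF vw(2) j]] by simp
    qed
    show "(\<lambda>i. c * v i) \<in> br C C'" if v: "v \<in> br C C'" for c v
    proof (rule brI)
      show "(\<lambda>i. c * v i) \<in> power_set I C" by (rule fv.subspace_scale[OF pC(1) brD(1)[OF v]])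
      fix j assume j: "j \<in> jac"
      have "Mact act (\<lambda>i. c * v i) j = (\<lambda>i. c * Mact act v j i)"
        by (rule P.act_scale) (use brD(1)[OF v] pC(3) j jac_carrier in auto)
      then show "Mact act (\<lambda>i. c * v i) j \<in> power_set I C'"
        using fv.subspace_scale[OF pC'(1) brD(2)[OF v j]] by simp
    qed
  qed
  show "finite_dim (br C C')" by (rule finite_dim_subset[OF pC(2)]) (auto dest: brD)
qed

lemma power_subset_br:
  assumes "submodule C'" "C' \<subseteq> C" shows "power_set I C' \<subseteq> br C C'"
proof
  fix w assume w: "w \<in> power_set I C'"
  show "w \<in> br C C'"
    by (rule brI) (use w power_set_mono[OF assms(2)] Mact_closed[OF assms(1) w] jac_carrier in auto)
qed

text \<open>The truncated subtraction in \<open>\<sigma>\<close> loses nothing here, as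
  \<open>br C C'\<close> contains \<open>C' \<otimes> H\<close>.\<close>

lemma dim_br:
  assumes "submodule C" "submodule C'" "C' \<subseteq> C"
  shows "fv.dim (br C C') = \<sigma> C C' + card I * fv.dim C'"
proof -
  have "fv.dim (power_set I C') \<le> fv.dim (br C C')"
    by (rule dim_le_of_finite_dim[OF br_properties(2)[OF assms(1,2)] power_subset_br[OF assms(2,3)]])
  then show ?thesis using power_submodule(4)[OF assms(2)] by (simp add: \<sigma>_def)
qed

lemma \<sigma>_self:
  assumes "submodule C" shows "\<sigma> C C = 0"
proof -
  have "fv.dim (br C C) \<le> fv.dim (power_set I C)"
    by (rule dim_le_of_finite_dim[OF power_submodule(2)[OF assms]]) (auto dest: brD)
  then show ?thesis using power_submodule(4)[OF assms] by (simp add: \<sigma>_def)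
qed

text \<open>Left exactness of the socle: \<open>C/C'\<close> has a submodule isomorphic to
  \<open>(C \<inter> G)/(C' \<inter> G)\<close> with quotient \<open>(C + G)/(C' + G)\<close>, and
  tensoring with \<open>H\<close> is exact. On preimages this is the dimension formula for
  \<open>br C C'\<close> and \<open>G \<otimes> H\<close>.\<close>

lemma \<sigma>_Int_sum:
  assumes C: "submodule C" and C': "submodule C'" "C' \<subseteq> C" and G: "submodule G"
  shows "\<sigma> C C' \<le> \<sigma> (C \<inter> G) (C' \<inter> G) + \<sigma> (sum_set C G) (sum_set C' G)"
proof -
  note mono = submoduleD(1)[OF G]
  let ?A = "br C C'" and ?P = "power_set I G"
  have sG: "submodule (C \<inter> G)" "submodule (C' \<inter> G)" "submodule (sum_set C G)" "submodule (sum_set C' G)"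
    using submodule_Int submodule_sum_set C C' G by blast+
  have le: "C' \<inter> G \<subseteq> C \<inter> G" "sum_set C' G \<subseteq> sum_set C G"
    using C'(2) by (auto simp: sum_set_def)
  have 1: "?A \<inter> ?P \<subseteq> br (C \<inter> G) (C' \<inter> G)"
  proof
    fix w assume w: "w \<in> ?A \<inter> ?P"
    show "w \<in> br (C \<inter> G) (C' \<inter> G)"
    proof (rule brI)
      show "w \<in> power_set I (C \<inter> G)" using w brD(1) by (auto simp: power_set_Int)
      show "Mact act w j \<in> power_set I (C' \<inter> G)" if "j \<in> jac" for j
        using w brD(2)[OF _ that] Mact_closed[OF G _ jac_carrier[OF that]] by (auto simp: power_set_Int)
    qed
  qed
  have 2: "sum_set ?A ?P \<subseteq> br (sum_set C G) (sum_set C' G)"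
  proof
    fix w assume "w \<in> sum_set ?A ?P"
    then obtain u v where uv: "u \<in> ?A" "v \<in> ?P" "w = u + v" by (rule sum_setE)
    show "w \<in> br (sum_set C G) (sum_set C' G)"
    proof (rule brI)
      have "u \<in> power_set I (sum_set C G)" "v \<in> power_set I (sum_set C G)"
        using brD(1)[OF uv(1)] uv(2) power_set_mono[OF sum_set_upper1[OF submoduleD(1)[OF G], of C]]
          power_set_mono[OF sum_set_upper2[OF submoduleD(1)[OF C], of G]] by blast+
      then show "w \<in> power_set I (sum_set C G)"
        unfolding uv(3) by (rule fv.subspace_add[OF power_submodule(1)[OF sG(3)]])
      fix j assume j: "j \<in> jac"
      have "Mact act w j = Mact act u j + Mact act v j"
        unfolding uv(3) by (rule Mact_add)
          (use brD(1)[OF uv(1)] uv(2) power_submodule(3)[OF C] power_submodule(3)[OF G] jac_carrier[OF j] in auto)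
      moreover have "Mact act u j \<in> power_set I (sum_set C' G)"
        using brD(2)[OF uv(1) j] power_set_mono[OF sum_set_upper1[OF submoduleD(1)[OF G], of C']] by blast
      moreover have "Mact act v j \<in> power_set I (sum_set C' G)"
        using Mact_closed[OF G uv(2) jac_carrier[OF j]]
          power_set_mono[OF sum_set_upper2[OF submoduleD(1)[OF C'(1)], of G]] by blast
      ultimately show "Mact act w j \<in> power_set I (sum_set C' G)"
        using fv.subspace_add[OF power_submodule(1)[OF sG(4)]] by metis
    qed
  qed
  have "fv.dim (sum_set ?A ?P) + fv.dim (?A \<inter> ?P) = fv.dim ?A + fv.dim ?P"
    by (rule dim_sum_set_Int[OF br_properties(1)[OF C C'(1)] power_submodule(1)[OF G]
        br_properties(2)[OF C C'(1)] power_submodule(2)[OF G]])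
  moreover have "fv.dim (sum_set ?A ?P) \<le> fv.dim (br (sum_set C G) (sum_set C' G))"
    by (rule dim_le_of_finite_dim[OF br_properties(2)[OF sG(3,4)] 2])
  moreover have "fv.dim (?A \<inter> ?P) \<le> fv.dim (br (C \<inter> G) (C' \<inter> G))"
    by (rule dim_le_of_finite_dim[OF br_properties(2)[OF sG(1,2)] 1])
  moreover have "card I * fv.dim (sum_set C' G) + card I * fv.dim (C' \<inter> G) = card I * fv.dim C' + card I * fv.dim G"
    using dim_sum_set_Int[OF submoduleD(1)[OF C'(1)] submoduleD(1)[OF G] submoduleD(4)[OF C'(1)] submoduleD(4)[OF G]]
    by (metis distrib_left)
  ultimately show ?thesis
    using dim_br[OF C C'] dim_br[OF sG(1,2) le(1)] dim_br[OF sG(3,4) le(2)] power_submodule(4)[OF G]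
    by linarith
qed

text \<open>Since \<open>C/G\<close> is killed by the radical, \<open>C'\<close> has a complement
  \<open>D\<close> modulo \<open>G\<close>; so each socle element of
  \<open>(C/C') \<otimes> H\<close> lifts to a socle element of
  \<open>(C/G) \<otimes> H\<close>.\<close>

lemma \<sigma>_semisimple:
  assumes G: "submodule G" and C': "submodule C'" and C: "submodule C" and le: "G \<subseteq> C'" "C' \<subseteq> C"
    and kill: "\<And>x j. \<lbrakk>x \<in> C; j \<in> jac\<rbrakk> \<Longrightarrow> act x j \<in> G"
  shows "\<sigma> C C' + \<sigma> C' G \<le> \<sigma> C G"
proof -
  obtain D where D: "submodule D" "D \<subseteq> C" "D \<inter> C' = G" "sum_set C' D = C"
    using submodule_complement[OF G C' C le kill] by blast
  let ?A = "br C G" and ?P = "power_set I C'"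
  have 1: "br C' G \<subseteq> ?A \<inter> ?P"
    using power_set_mono[OF le(2)] by (auto simp: br_def)
  have 3: "?A \<inter> ?P \<subseteq> br C' G" by (auto simp: br_def)
  have 2: "br C C' \<subseteq> sum_set ?A ?P"
  proof
    fix w assume w: "w \<in> br C C'"
    then have "w \<in> power_set I (sum_set C' D)" using brD(1) D(4) by blast
    then have "w \<in> sum_set (power_set I C') (power_set I D)" by (rule power_set_sum_set)
    then obtain y z where yz: "y \<in> power_set I C'" "z \<in> power_set I D" "w = y + z" by (rule sum_setE)
    \<comment> \<open>The component \<open>z\<close> in \<open>D \<otimes> H\<close> is the lift:
      the radical sends it into both \<open>C' \<otimes> H\<close> and \<open>D \<otimes> H\<close>,
      whose intersection is \<open>G \<otimes> H\<close>.\<close>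
    have z: "z \<in> ?A"
    proof (rule brI)
      show "z \<in> power_set I C" using yz(2) power_set_mono[OF D(2)] by blast
      fix j assume j: "j \<in> jac"
      have "Mact act w j = Mact act y j + Mact act z j"
        unfolding yz(3) by (rule Mact_add)
          (use yz power_submodule(3)[OF C'] power_submodule(3)[OF D(1)] jac_carrier[OF j] in auto)
      then have "Mact act z j = Mact act w j - Mact act y j" by simp
      then have "Mact act z j \<in> power_set I C'"
        using fv.subspace_diff[OF power_submodule(1)[OF C'] brD(2)[OF w j]
            Mact_closed[OF C' yz(1) jac_carrier[OF j]]] by simp
      moreover have "Mact act z j \<in> power_set I D" by (rule Mact_closed[OF D(1) yz(2) jac_carrier[OF j]])
      ultimately show "Mact act z j \<in> power_set I G" using power_set_Int[of I D C'] D(3) by blast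
    qed
    show "w \<in> sum_set ?A ?P" unfolding yz(3) using sum_setI[OF z yz(1)] by (simp add: add.commute)
  qed
  have "fv.dim (sum_set ?A ?P) + fv.dim (?A \<inter> ?P) = fv.dim ?A + fv.dim ?P"
    by (rule dim_sum_set_Int[OF br_properties(1)[OF C G] power_submodule(1)[OF C']
        br_properties(2)[OF C G] power_submodule(2)[OF C']])
  moreover have "fv.dim (br C C') \<le> fv.dim (sum_set ?A ?P)"
    by (rule dim_le_of_finite_dim[OF finite_dim_sum_set[OF br_properties(2)[OF C G] power_submodule(2)[OF C']] 2])
  moreover have "?A \<inter> ?P = br C' G" using 1 3 by blast
  ultimately show ?thesis
    using dim_br[OF C G] dim_br[OF C C' le(2)] dim_br[OF C' G le(1)] power_submodule(4)[OF C'] le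
    by (simp add: order_trans[OF le])
qed

lemma \<sigma>_chain_semisimple:
  assumes "\<And>i. submodule (d i)" "\<And>i. d (Suc i) \<subseteq> d i"
    and kill: "\<And>x j. \<lbrakk>x \<in> d 0; j \<in> jac\<rbrakk> \<Longrightarrow> act x j \<in> d k"
  shows "(\<Sum>i<k. \<sigma> (d i) (d (Suc i))) \<le> \<sigma> (d 0) (d k)"
  using kill
proof (induction k)
  case (Suc k)
  have anti: "d k \<subseteq> d 0" using assms(2) lift_Suc_antimono_le[of d 0 k] by blast
  have "(\<Sum>i<k. \<sigma> (d i) (d (Suc i))) \<le> \<sigma> (d 0) (d k)"
    by (rule Suc.IH) (use Suc.prems assms(2) in blast)
  moreover have "\<sigma> (d 0) (d k) + \<sigma> (d k) (d (Suc k)) \<le> \<sigma> (d 0) (d (Suc k))"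
    by (rule \<sigma>_semisimple[OF assms(1) assms(1) assms(1) assms(2) anti Suc.prems])
  ultimately show ?case by simp
qed simp

text \<open>As for Jordan-Hoelder, intersect with and add each term of the chain \<open>g\<close>; on its semisimple
  factors \<open>\<sigma>\<close> is additive.\<close>

lemma \<sigma>_chain_le:
  assumes c: "\<And>i. submodule (c i)" "\<And>i. c (Suc i) \<subseteq> c i"
    and g: "\<And>j. submodule (g j)" "\<And>j. g (Suc j) \<subseteq> g j"
      "\<And>l x j. \<lbrakk>x \<in> g l; j \<in> jac\<rbrakk> \<Longrightarrow> act x j \<in> g (Suc l)"
    and ends: "c 0 = g 0" "c k = g N"
  shows "(\<Sum>i<k. \<sigma> (c i) (c (Suc i))) \<le> (\<Sum>l<N. \<sigma> (g l) (g (Suc l)))"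
proof -
  have ck: "c k \<subseteq> c i" if "i \<le> k" for i
    using lift_Suc_antimono_le[of c i k] c(2) that by blast
  have g0: "g l \<subseteq> g 0" for l using lift_Suc_antimono_le[of g 0 l] g(2) by blast
  have gN: "g N \<subseteq> g l" if "l \<le> N" for l
    using lift_Suc_antimono_le[of g l N] g(2) that by blast
  \<comment> \<open>Downward induction on \<open>l\<close>: the chain \<open>c\<close> cut down to
    \<open>g l\<close> is compared with the part of the chain \<open>g\<close> from \<open>l\<close>
    on.\<close>
  have main: "(\<Sum>i<k. \<sigma> (c i \<inter> g l) (c (Suc i) \<inter> g l)) \<le> (\<Sum>l=l..<N. \<sigma> (g l) (g (Suc l)))" if "l \<le> N" for l
    using that
  proof (induction l rule: inc_induct)
    case base
    have "\<sigma> (c i \<inter> g N) (c (Suc i) \<inter> g N) = 0" if "i < k" for i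
    proof -
      have "c i \<inter> g N = g N" "c (Suc i) \<inter> g N = g N"
        using ck[of i] ck[of "Suc i"] that ends(2) by auto
      then show ?thesis using \<sigma>_self[OF g(1)[of N]] by simp
    qed
    then show ?case by simp
  next
    case (step l)
    \<comment> \<open>\<open>?d\<close> is the chain that \<open>c\<close> induces between
      \<open>g l\<close> and \<open>g (Suc l)\<close>. That factor is semisimple, so
      \<open>\<sigma>_chain_semisimple\<close> bounds the total of \<open>?d\<close>; the remaining
      part lies in \<open>g (Suc l)\<close>, where the induction hypothesis applies.\<close>
    let ?d = "\<lambda>i. sum_set (c i \<inter> g l) (g (Suc l))"
    have sI: "submodule (c i \<inter> g l)" for i by (rule submodule_Int[OF c(1) g(1)])
    have "\<sigma> (c i \<inter> g l) (c (Suc i) \<inter> g l)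
        \<le> \<sigma> (c i \<inter> g (Suc l)) (c (Suc i) \<inter> g (Suc l)) + \<sigma> (?d i) (?d (Suc i))" for i
    proof -
      have "c i \<inter> g l \<inter> g (Suc l) = c i \<inter> g (Suc l)" for i using g(2)[of l] by blast
      moreover have "c (Suc i) \<inter> g l \<subseteq> c i \<inter> g l" using c(2)[of i] by blast
      ultimately show ?thesis using \<sigma>_Int_sum[OF sI sI _ g(1)[of "Suc l"], of "Suc i" i] by simp
    qed
    then have "(\<Sum>i<k. \<sigma> (c i \<inter> g l) (c (Suc i) \<inter> g l))
        \<le> (\<Sum>i<k. \<sigma> (c i \<inter> g (Suc l)) (c (Suc i) \<inter> g (Suc l))) + (\<Sum>i<k. \<sigma> (?d i) (?d (Suc i)))"
      unfolding sum.distrib[symmetric] by (rule sum_mono)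
    also have "\<dots> \<le> (\<Sum>l=Suc l..<N. \<sigma> (g l) (g (Suc l))) + \<sigma> (g l) (g (Suc l))"
    proof (rule add_mono[OF step.IH])
      have d0: "?d 0 = g l"
      proof -
        have "c 0 \<inter> g l = g l" using ends(1) g0[of l] by blast
        moreover have "sum_set (g l) (g (Suc l)) = g l"
          using sum_set_least[OF submoduleD(1)[OF g(1)[of l]] subset_refl g(2)[of l]]
            sum_set_upper1[OF submoduleD(1)[OF g(1)[of "Suc l"]], of "g l"] by blast
        ultimately show ?thesis by simp
      qed
      have dk: "?d k = g (Suc l)"
      proof -
        have "c k \<inter> g l \<subseteq> g (Suc l)" using ends(2) gN[of "Suc l"] step.hyps by auto
        then show ?thesis
          using sum_set_least[OF submoduleD(1)[OF g(1)[of "Suc l"]] _ subset_refl, of "c k \<inter> g l"]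
            sum_set_upper2[OF submoduleD(1)[OF sI[of k]], of "g (Suc l)"] by blast
      qed
      have "(\<Sum>i<k. \<sigma> (?d i) (?d (Suc i))) \<le> \<sigma> (?d 0) (?d k)"
      proof (rule \<sigma>_chain_semisimple)
        show "submodule (?d i)" for i by (rule submodule_sum_set[OF sI g(1)])
        show "?d (Suc i) \<subseteq> ?d i" for i using c(2)[of i] by (auto simp: sum_set_def)
        show "act x j \<in> ?d k" if "x \<in> ?d 0" "j \<in> jac" for x j
          using g(3) that unfolding d0 dk by blast
      qed
      then show "(\<Sum>i<k. \<sigma> (?d i) (?d (Suc i))) \<le> \<sigma> (g l) (g (Suc l))" unfolding d0 dk .
    qed
    also have "\<dots> = (\<Sum>l=l..<N. \<sigma> (g l) (g (Suc l)))"
      using step.hyps by (simp add: sum.atLeast_Suc_lessThan)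
    finally show ?case .
  qed
  have "c i \<inter> g 0 = c i" for i using lift_Suc_antimono_le[of c 0 i] c(2) ends(1) by blast
  then show ?thesis using main[of 0] by (simp add: atLeast0LessThan)
qed

text \<open>The map \<open>id \<otimes> \<epsilon>\<close> from \<open>M \<otimes> H\<close> to
  \<open>M\<close>.\<close>

definition \<eta> :: "('c \<times> 'i \<Rightarrow> 'k) \<Rightarrow> 'i \<Rightarrow> 'k" where
  "\<eta> w = (\<Sum>a\<in>I. (\<lambda>i. \<epsilon> a * slice w a i))"

lemma \<eta>_closed: "\<lbrakk>submodule C; w \<in> power_set I C\<rbrakk> \<Longrightarrow> \<eta> w \<in> C"
  unfolding \<eta>_def
  by (rule fv.subspace_sum[OF submoduleD(1)]) (auto simp: power_set_def intro: submoduleD(8))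

lemma \<eta>_add: "\<eta> (v + w) = \<eta> v + \<eta> w"
  by (rule ext) (simp add: \<eta>_def fun_sum_apply sum.distrib distrib_left)

lemma \<eta>_Mact:
  assumes w: "w \<in> power_set I X" and r: "r \<in> carrier R"
  shows "\<eta> (Mact act w r) = act (\<eta> w) r"
proof
  fix i
  note sw = slice_closed[OF w subset_refl]
  have "\<eta> (Mact act w r) i = (\<Sum>b\<in>I. \<Sum>a\<in>I. \<epsilon> b * act (slice w a) (\<Lambda> a b r) i)"
    by (simp add: \<eta>_def fun_sum_apply slice_Mact sum_distrib_left)
  also have "\<dots> = (\<Sum>a\<in>I. \<Sum>b\<in>I. \<epsilon> b * act (slice w a) (\<Lambda> a b r) i)" by (rule sum.swap)
  also have "\<dots> = (\<Sum>a\<in>I. \<epsilon> a * act (slice w a) r i)"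
    by (intro sum.cong refl counit[OF act_functional[OF sw] _ r])
  also have "\<dots> = act (\<eta> w) r i"
  proof -
    have "act (\<eta> w) r = (\<Sum>a\<in>I. act (\<lambda>i. \<epsilon> a * slice w a i) r)"
      unfolding \<eta>_def by (rule act_sum[OF finite_I fv.subspace_scale[OF subspace_X sw] r])
    then show ?thesis by (simp add: fun_sum_apply act_scale[OF sw r])
  qed
  finally show "\<eta> (Mact act w r) i = act (\<eta> w) r i" .
qed

text \<open>The map \<open>m \<mapsto> m \<otimes> t\<close>; together with \<open>\<eta>\<close> it
  exhibits \<open>M\<close> as a direct summand of \<open>M \<otimes> H\<close>.\<close>

definition ins :: "('i \<Rightarrow> 'k) \<Rightarrow> 'c \<times> 'i \<Rightarrow> 'k" where
  "ins x = (\<lambda>(a, i). if a \<in> I then t a * x i else 0)"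

lemma slice_ins: "slice (ins x) a = (if a \<in> I then (\<lambda>i. t a * x i) else 0)"
  by (auto simp: slice_def ins_def)

lemma ins_closed: "\<lbrakk>fv.subspace C; x \<in> C\<rbrakk> \<Longrightarrow> ins x \<in> power_set I C"
  by (simp add: power_set_def slice_ins fv.subspace_scale)

lemma \<eta>_ins: "\<eta> (ins x) = x"
proof
  fix i
  have "\<eta> (ins x) i = (\<Sum>a\<in>I. \<epsilon> a * slice (ins x) a i)"
    by (simp only: \<eta>_def fun_sum_apply)
  also have "\<dots> = (\<Sum>a\<in>I. (\<epsilon> a * t a) * x i)"
    by (rule sum.cong[OF refl]) (simp add: slice_ins)
  also have "\<dots> = x i" by (simp only: sum_distrib_right[symmetric] counit_integral mult_1)
  finally show "\<eta> (ins x) i = x i" .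
qed

text \<open>In Sweedler form, \<open>(m \<otimes> t) r\<close> is the sum of
  \<open>m r0 \<otimes> t r1\<close>, and \<open>t r1 = \<epsilon>(r1) t\<close> because
  \<open>t\<close> is a right integral.\<close>

lemma Mact_ins:
  assumes x: "x \<in> X" and r: "r \<in> carrier R"
  shows "Mact act (ins x) r = ins (act x r)"
proof
  fix p :: "'c \<times> 'i" obtain b i where p: "p = (b, i)" by (cases p)
  show "Mact act (ins x) r p = ins (act x r) p"
  proof (cases "b \<in> I")
    case True
    have "Mact act (ins x) r p = (\<Sum>a\<in>I. t a * act x (\<Lambda> a b r) i)"
      using True by (simp add: Mact_def p slice_ins act_scale[OF x] \<Lambda>_closed r)
    also have "\<dots> = t b * act x r i" by (rule integral[OF act_functional[OF x] True r])
    finally show ?thesis using True by (simp add: ins_def p)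
  qed (simp add: Mact_def ins_def p)
qed

text \<open>If \<open>\<sigma>\<close> is additive along the socle, then every socle element of the quotient lifts, so
  the quotient is its own socle.\<close>

lemma semisimple_of_\<sigma>:
  assumes C: "submodule C" and C': "submodule C'" "C' \<subseteq> C"
    and S: "S = {x \<in> C. \<forall>j\<in>jac. act x j \<in> C'}"
    and le: "\<sigma> C S + \<sigma> S C' \<le> \<sigma> C C'"
  shows "S = C"
proof (rule ccontr)
  assume "S \<noteq> C"
  note CD = submoduleD[OF C] and CD' = submoduleD[OF C'(1)]
  have sS: "submodule S"
    unfolding submodule_def
  proof (intro conjI ballI)
    show "fv.subspace S"
      by (rule subspaceI)
        (use CD(2) in \<open>auto simp: S CD(5,6,8) CD'(5,6,8) act_zero jac_carrier act_add act_scale subset_iff\<close>)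
    show "S \<subseteq> X" using CD(2) S by blast
    fix x r assume x: "x \<in> S" and r: "r \<in> carrier R"
    have xX: "x \<in> X" using x S CD(2) by blast
    have "act (act x r) j \<in> C'" if j: "j \<in> jac" for j
    proof -
      have "act (act x r) j = act x (r \<otimes> j)" by (rule act_mult[OF xX r jac_carrier[OF j], symmetric])
      then show ?thesis using x S jacobson_radical_left_mult[OF j r] by auto
    qed
    then show "act x r \<in> S" using x S CD(3)[OF _ r] by blast
  qed
  have SC: "S \<subseteq> C" and C'S: "C' \<subseteq> S"
    using S C' CD'(3) jac_carrier by blast+
  let ?A = "br C C'" and ?P = "power_set I S"
  have int: "?A \<inter> ?P \<subseteq> br S C'" by (auto simp: br_def)
  have sum: "sum_set ?A ?P \<subseteq> br C S"
  proof (rule sum_set_least[OF br_properties(1)[OF C sS]])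
    show "?A \<subseteq> br C S" using power_set_mono[OF C'S] by (auto simp: br_def)
    show "?P \<subseteq> br C S" by (rule power_subset_br[OF sS SC])
  qed
  have "fv.dim (sum_set ?A ?P) + fv.dim (?A \<inter> ?P) = fv.dim ?A + fv.dim ?P"
    by (rule dim_sum_set_Int[OF br_properties(1)[OF C C'(1)] power_submodule(1)[OF sS]
        br_properties(2)[OF C C'(1)] power_submodule(2)[OF sS]])
  moreover have "fv.dim (?A \<inter> ?P) \<le> fv.dim (br S C')"
    by (rule dim_le_of_finite_dim[OF br_properties(2)[OF sS C'(1)] int])
  ultimately have "fv.dim (br C S) \<le> fv.dim (sum_set ?A ?P)"
    using le dim_br[OF C C'] dim_br[OF C sS SC] dim_br[OF sS C'(1) C'S] power_submodule(4)[OF sS] by linarith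
  \<comment> \<open>The assumed inequality leaves no room: modulo \<open>S \<otimes> H\<close>,
    every element of \<open>C \<otimes> H\<close> that the radical sends into
    \<open>S \<otimes> H\<close> is represented by one that it sends into
    \<open>C' \<otimes> H\<close>.\<close>
  then have eq: "sum_set ?A ?P = br C S"
    by (rule subspace_eq_of_dim[OF br_properties(2)[OF C sS] sum
          subspace_sum_set[OF br_properties(1)[OF C C'(1)] power_submodule(1)[OF sS]]])
  have "S \<subset> C" using SC \<open>S \<noteq> C\<close> by blast
  then obtain N where N: "radical_chain S C N = S" using radical_chain_reaches[OF sS C SC] by blast
  \<comment> \<open>The last term before \<open>S\<close> in the radical series of \<open>C\<close>
    over \<open>S\<close> supplies a \<open>w\<close> outside \<open>S\<close> that the radical
    sends into \<open>S\<close>.\<close>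
  define m where "m = (LEAST m. radical_chain S C m = S)"
  have m: "radical_chain S C m = S" unfolding m_def by (rule LeastI[of "\<lambda>m. radical_chain S C m = S", OF N])
  have "m \<noteq> 0"
  proof
    assume "m = 0"
    then show False using m \<open>S \<noteq> C\<close> radical_chain_0[of S C] by simp
  qed
  then obtain m' where m': "m = Suc m'" using not0_implies_Suc by blast
  let ?E = "radical_chain S C m'"
  have "?E \<noteq> S" using not_less_Least[of m' "\<lambda>m. radical_chain S C m = S"] m' unfolding m_def by simp
  moreover have "S \<subseteq> ?E" by (rule radical_chain_lower[OF SC])
  ultimately obtain w where w: "w \<in> ?E" "w \<notin> S" by blast
  have "?E \<subseteq> C"
    using lift_Suc_antimono_le[of "radical_chain S C" 0 m'] radical_chain_decreasing[OF sS C SC]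
    by (auto simp: radical_chain_0)
  then have wC: "w \<in> C" using w by blast
  then have wX: "w \<in> X" using CD(2) by blast
  have wj: "act w j \<in> S" if "j \<in> jac" for j
    using radical_step_upper(2)[OF sS w(1) that] m unfolding m' radical_chain_Suc by simp
  \<comment> \<open>As \<open>ins\<close> is a module map, \<open>w \<otimes> t\<close> is a socle
    element over \<open>S\<close>. Splitting it by \<open>eq\<close> and applying
    \<open>\<eta>\<close> shows that \<open>w\<close> was in \<open>S\<close> after all.\<close>
  have "ins w \<in> br C S"
    by (rule brI) (use ins_closed[OF CD(1) wC] ins_closed[OF submoduleD(1)[OF sS] wj]
        Mact_ins[OF wX jac_carrier] in auto)
  then have "ins w \<in> sum_set ?A ?P" using eq by simp
  then obtain u s where us: "u \<in> ?A" "s \<in> ?P" "ins w = u + s" by (rule sum_setE)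
  have "w = \<eta> u + \<eta> s" using \<eta>_ins[of w] us(3) \<eta>_add by metis
  moreover have "\<eta> s \<in> S" by (rule \<eta>_closed[OF sS us(2)])
  moreover have "\<eta> u \<in> S"
  proof -
    have uX: "u \<in> power_set I X" using brD(1)[OF us(1)] power_submodule(3)[OF C] by blast
    have "act (\<eta> u) j \<in> C'" if "j \<in> jac" for j
      using \<eta>_Mact[OF uX jac_carrier[OF that]] \<eta>_closed[OF C'(1) brD(2)[OF us(1) that]] by simp
    then show ?thesis using \<eta>_closed[OF C brD(1)[OF us(1)]] S by blast
  qed
  ultimately have "w \<in> S" using submoduleD(6)[OF sS] by simp
  then show False using w(2) by blast
qed

end

section \<open>Stability of the Jacobson radical\<close>

context comodule_algebra begin

lemma \<theta>_zero: "\<theta> 0 = 0" and \<theta>'_zero: "\<theta>' 0 = 0"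
  by (rule triple_ext; simp add: \<theta>_def \<theta>'_def)+

lemma \<theta>_sum: "\<theta> (sum f A) = (\<Sum>a\<in>A. \<theta> (f a))"
proof -
  interpret l: Vector_Spaces.linear "\<lambda>c w i. c * w i" "\<lambda>c w i. c * w i" \<theta> by (rule flinear_\<theta>)
  show ?thesis by (rule l.sum)
qed

end

context comodule_module begin

interpretation P: comodule_module R \<iota> I \<Lambda> t \<epsilon> \<kappa> \<kappa>' "power_set I X" "Mact act"
  by (rule comodule_module_power)

lemma flinear_\<eta>: "flinear \<eta>"
proof (rule flinearI[OF \<eta>_add], rule ext)
  fix c x i
  have "\<eta> (\<lambda>i. c * x i) i = (\<Sum>a\<in>I. \<epsilon> a * (c * slice x a i))"
    by (simp only: \<eta>_def fun_sum_apply slice_scale)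
  also have "\<dots> = (\<Sum>a\<in>I. c * (\<epsilon> a * slice x a i))" by (simp only: mult.left_commute)
  also have "\<dots> = c * \<eta> x i" by (simp only: \<eta>_def fun_sum_apply sum_distrib_left)
  finally show "\<eta> (\<lambda>i. c * x i) i = c * \<eta> x i" .
qed

interpretation lin_\<eta>: Vector_Spaces.linear "\<lambda>c w i. c * w i" "\<lambda>c w i. c * w i" \<eta>
  by (rule flinear_\<eta>)

lemmas \<eta>_zero = lin_\<eta>.zero and \<eta>_scale = lin_\<eta>.scale and \<eta>_sum = lin_\<eta>.sum

lemma submodule_power: "submodule C \<Longrightarrow> P.submodule (power_set I C)"
  using power_submodule(1,3)[of C] Mact_closed[of C] by (simp add: P.submodule_def)

text \<open>By means of \<open>\<theta>\<close>, as many copies of the socle of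
  \<open>(E/E') \<otimes> H\<close> as \<open>I\<close> has elements embed into the socle of
  \<open>((E/E') \<otimes> H) \<otimes> H\<close>.\<close>

lemma \<sigma>_power_ge:
  assumes E: "submodule E" "submodule E'" "E' \<subseteq> E"
  shows "card I * \<sigma> E E' \<le> P.\<sigma> (power_set I E) (power_set I E')"
proof -
  note pE = submodule_power[OF E(1)] and pE' = submodule_power[OF E(2)]
  let ?B = "power_set I (br E E')"
  note sB = subspace_power_set[OF br_properties(1)[OF E(1,2)], of I]
  have BX: "w \<in> power_set I (power_set I E)" if "w \<in> ?B" for w
    using that brD(1) by (auto simp: power_set_def)
  have "\<theta> ` ?B \<subseteq> P.br (power_set I E) (power_set I E')"
  proof
    fix v assume "v \<in> \<theta> ` ?B"
    then obtain w where w: "w \<in> ?B" "v = \<theta> w" by blast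
    have wX: "w \<in> power_set I (power_set I X)"
      using BX[OF w(1)] power_set_mono[OF power_submodule(3)[OF E(1)]] by blast
    show "v \<in> P.br (power_set I E) (power_set I E')"
    proof (rule P.brI)
      show "v \<in> power_set I (power_set I E)"
        unfolding w(2) by (rule \<theta>_closed[OF BX[OF w(1)] submoduleD(1)[OF E(1)]])
      fix j assume j: "j \<in> jac"
      have "Mact act (slice w g) j \<in> power_set I E'" if "g \<in> I" for g
        by (rule brD(2)[OF _ j, of _ E]) (use w(1) that in \<open>simp add: power_set_def\<close>)
      then have "P.copact w j \<in> power_set I (power_set I E')"
        by (simp add: power_set_def[of I "power_set I E'"] P.slice_copact)
      then show "Mact (Mact act) v j \<in> power_set I (power_set I E')"
        unfolding w(2) \<theta>_hom[OF wX jac_carrier[OF j]] by (rule \<theta>_closed[OF _ submoduleD(1)[OF E(2)]])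
    qed
  qed
  then have "fv.dim (\<theta> ` ?B) \<le> fv.dim (P.br (power_set I E) (power_set I E'))"
    by (rule dim_le_of_finite_dim[OF P.br_properties(2)[OF pE pE']])
  moreover have "fv.dim (\<theta> ` ?B) = fv.dim ?B"
    by (rule dim_image_inj[OF flinear_\<theta> _ sB]) (rule inj_on_inverseI[of _ \<theta>'], rule \<theta>'_\<theta>, rule BX)
  moreover have "fv.dim ?B = card I * fv.dim (br E E')"
    by (rule dim_power_set[OF finite_I br_properties[OF E(1,2)]])
  ultimately have "card I * (\<sigma> E E' + card I * fv.dim E')
      \<le> P.\<sigma> (power_set I E) (power_set I E') + card I * fv.dim (power_set I E')"
    using dim_br[OF E] P.dim_br[OF pE pE' power_set_mono[OF E(3)]] by simp
  then show ?thesis using power_submodule(4)[OF E(2)] by (simp add: algebra_simps)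
qed

end

section \<open>Two chains in the double tensor product and the semisimplicity of the top\<close>

context comodule_module begin

text \<open>The context is opened anew so that the interpretation also provides
  \<open>\<sigma>_power_ge\<close> for \<open>M \<otimes> H\<close>.\<close>

interpretation P: comodule_module R \<iota> I \<Lambda> t \<epsilon> \<kappa> \<kappa>' "power_set I X" "Mact act"
  by (rule comodule_module_power)

interpretation Q: comodule_module R \<iota> I \<Lambda> t \<epsilon> \<kappa> \<kappa>' "power_set I (power_set I X)" "Mact (Mact act)"
  by (rule P.comodule_module_power)

text \<open>\<open>E\<close> need not have the form \<open>C \<otimes> H\<close>, so this image may
  differ from \<open>power_set I E\<close> itself. It is a submodule because \<open>\<theta>\<close>
  carries the componentwise action on copies of \<open>E\<close> to the twisted one.\<close>

lemma submodule_\<theta>_image: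
  assumes "P.submodule E" shows "Q.submodule (\<theta> ` power_set I E)"
  unfolding Q.submodule_def
proof (intro conjI ballI)
  note E = P.submoduleD[OF assms]
  have EX: "power_set I E \<subseteq> power_set I (power_set I X)" by (rule power_set_mono[OF E(2)])
  show "fv.subspace (\<theta> ` power_set I E)" by (rule subspace_image[OF flinear_\<theta> subspace_power_set[OF E(1)]])
  show "\<theta> ` power_set I E \<subseteq> power_set I (power_set I X)"
    using EX \<theta>_closed[OF _ subspace_X] by blast
  fix x r assume "x \<in> \<theta> ` power_set I E" and r: "r \<in> carrier R"
  then obtain w where w: "w \<in> power_set I E" "x = \<theta> w" by blast
  have "Mact (Mact act) x r = \<theta> (P.copact w r)" unfolding w(2) by (rule \<theta>_hom[OF _ r]) (use w EX in blast)
  then show "Mact (Mact act) x r \<in> \<theta> ` power_set I E"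
    using P.copact_closed[OF assms w(1) r] by blast
qed

text \<open>The factor in question is a direct sum of copies of \<open>E/E'\<close>, one for each
  element of \<open>I\<close>, and the socle after tensoring with \<open>H\<close> is computed copy
  by copy.\<close>

lemma \<sigma>_\<theta>_image_le:
  assumes E: "P.submodule E" "P.submodule E'" "E' \<subseteq> E"
  shows "Q.\<sigma> (\<theta> ` power_set I E) (\<theta> ` power_set I E') \<le> card I * P.\<sigma> E E'"
proof -
  let ?G = "\<theta> ` power_set I E" and ?G' = "\<theta> ` power_set I E'"
  note G = submodule_\<theta>_image[OF E(1)] and G' = submodule_\<theta>_image[OF E(2)]
  have EX: "power_set I E \<subseteq> power_set I (power_set I X)" "power_set I E' \<subseteq> power_set I (power_set I X)"
    by (rule power_set_mono[OF P.submoduleD(2)[OF E(1)]], rule power_set_mono[OF P.submoduleD(2)[OF E(2)]])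
  have inj: "inj_on \<theta> (power_set I (power_set I X))"
    by (rule inj_on_inverseI[of _ \<theta>']) (rule \<theta>'_\<theta>)
  \<comment> \<open>\<open>\<Psi>\<close> undoes \<open>\<theta>\<close> in each outer slice and
    then exchanges the slice index with the index of the copy, so that a socle element falls apart
    into its components in the single copies.\<close>
  define \<Psi> :: "('c \<times> 'c \<times> 'c \<times> 'i \<Rightarrow> 'k) \<Rightarrow> 'c \<times> 'c \<times> 'c \<times> 'i \<Rightarrow> 'k"
    where "\<Psi> w = (\<lambda>(g, b, i). \<theta>' (slice w b) (g, i))" for w
  have lin: "flinear \<Psi>"
  proof (rule flinearI)
    interpret l: Vector_Spaces.linear "\<lambda>c w i. c * w i" "\<lambda>c w i. c * w i" \<theta>' by (rule flinear_\<theta>')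
    show "\<Psi> (x + y) = \<Psi> x + \<Psi> y" for x y by (auto simp: \<Psi>_def l.add)
    show "\<Psi> (\<lambda>i. c * x i) = (\<lambda>i. c * \<Psi> x i)" for c x by (auto simp: \<Psi>_def l.scale)
  qed
  have repr: "\<exists>v\<in>power_set I E. slice w b = \<theta> v" if "w \<in> power_set I ?G" for w b
  proof (cases "b \<in> I")
    case True
    then have "slice w b \<in> ?G" using that by (simp add: power_set_def[of I ?G])
    then show ?thesis by blast
  next
    case False
    then have "slice w b = 0" using that by (simp add: power_set_def)
    moreover have "0 \<in> power_set I E"
      using fv.subspace_0[OF subspace_power_set[OF P.submoduleD(1)[OF E(1)]]] .
    ultimately show ?thesis using \<theta>_zero by metis
  qed
  have slice_\<Psi>: "slice (slice (\<Psi> w) g) b = slice (\<theta>' (slice w b)) g" for w g b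
    by (auto simp: slice_def \<Psi>_def)
  have inj\<Psi>: "inj_on \<Psi> (Q.br ?G ?G')"
  proof (rule inj_onI)
    fix v w assume v: "v \<in> Q.br ?G ?G'" and w: "w \<in> Q.br ?G ?G'" and eq: "\<Psi> v = \<Psi> w"
    show "v = w"
    proof (rule slice_eqI)
      fix b
      obtain x y where x: "x \<in> power_set I E" "slice v b = \<theta> x" and y: "y \<in> power_set I E" "slice w b = \<theta> y"
        using repr[OF Q.brD(1)[OF v], of b] repr[OF Q.brD(1)[OF w], of b] by blast
      have "\<theta>' (slice v b) = \<theta>' (slice w b)"
        by (rule slice_eqI) (metis eq slice_\<Psi>)
      then have "x = y" using x y \<theta>'_\<theta> EX(1) by (metis subsetD)
      then show "slice v b = slice w b" using x y by simp
    qed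
  qed
  have "\<Psi> ` Q.br ?G ?G' \<subseteq> power_set I (P.br E E')"
  proof
    fix u assume "u \<in> \<Psi> ` Q.br ?G ?G'"
    then obtain w where w: "w \<in> Q.br ?G ?G'" "u = \<Psi> w" by blast
    obtain v where v: "\<And>b. v b \<in> power_set I E" "\<And>b. slice w b = \<theta> (v b)"
      using repr[OF Q.brD(1)[OF w(1)]] by metis
    have \<theta>'w: "\<theta>' (slice w b) = v b" for b using v \<theta>'_\<theta> EX(1) by (metis subsetD)
    have vX: "v b \<in> power_set I (power_set I X)" for b using v(1) EX(1) by blast
    have vz: "v b = 0" if "b \<notin> I" for b
    proof -
      have "slice w b = 0" using that Q.brD(1)[OF w(1)] by (simp add: power_set_def)
      then show ?thesis using \<theta>'w[of b] \<theta>'_zero by metis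
    qed
    have "slice u g \<in> P.br E E'" if g: "g \<in> I" for g
    proof (rule P.brI)
      show "slice u g \<in> power_set I E"
        unfolding power_set_def w(2)
        using v(1) g vz by (auto simp: slice_\<Psi> \<theta>'w power_set_def)
      fix j assume j: "j \<in> jac"
      have jR: "j \<in> carrier R" by (rule jac_carrier[OF j])
      have "slice (Mact (Mact act) (slice u g) j) b' \<in> E'" if b': "b' \<in> I" for b'
      proof -
        \<comment> \<open>By \<open>\<theta>_hom\<close>, slice \<open>b'\<close> of
          \<open>w j\<close> is \<open>\<theta>\<close> of a sum of componentwise actions.
          Injectivity of \<open>\<theta>\<close> puts this sum into the copies of
          \<open>E'\<close>.\<close>
        let ?z = "\<Sum>b\<in>I. P.copact (v b) (\<Lambda> b b' j)"
        have zX: "?z \<in> power_set I (power_set I X)"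
          by (rule fv.subspace_sum[OF Q.subspace_X]) (use P.copact_closed[OF P.submodule_X vX \<Lambda>_closed[OF _ b' jR]] in auto)
        have "slice (Mact (Mact (Mact act)) w j) b' = (\<Sum>b\<in>I. Mact (Mact act) (\<theta> (v b)) (\<Lambda> b b' j))"
          using b' v(2) by (simp add: slice_Mact)
        also have "\<dots> = (\<Sum>b\<in>I. \<theta> (P.copact (v b) (\<Lambda> b b' j)))"
          by (intro sum.cong refl \<theta>_hom[OF vX \<Lambda>_closed[OF _ b' jR]])
        also have "\<dots> = \<theta> ?z"
          by (rule \<theta>_sum[symmetric])
        finally have "slice (Mact (Mact (Mact act)) w j) b' = \<theta> ?z" .
        moreover have "slice (Mact (Mact (Mact act)) w j) b' \<in> ?G'"
          using Q.brD(2)[OF w(1) j] b' by (simp add: power_set_def[of I ?G'])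
        ultimately have "\<theta> ?z \<in> ?G'" by simp
        then have "?z \<in> power_set I E'" using inj_on_image_mem_iff[OF inj zX EX(2)] by blast
        then have "slice ?z g \<in> E'" using g by (simp add: power_set_def)
        moreover have "slice ?z g = (\<Sum>b\<in>I. Mact act (slice (v b) g) (\<Lambda> b b' j))"
        proof -
          have "slice (sum f I) g = (\<Sum>b\<in>I. slice (f b) g)" for f :: "'c \<Rightarrow> 'c \<times> 'c \<times> 'i \<Rightarrow> 'k"
            by (auto simp: slice_def fun_sum_apply)
          then show ?thesis using g by (simp add: P.slice_copact)
        qed
        ultimately show ?thesis using b' by (simp add: slice_Mact w(2) slice_\<Psi> \<theta>'w)
      qed
      then show "Mact (Mact act) (slice u g) j \<in> power_set I E'"
        by (simp add: power_set_def slice_Mact)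
    qed
    moreover have "slice u g = 0" if "g \<notin> I" for g
      using that v(1) by (intro slice_eqI) (simp add: w(2) slice_\<Psi> \<theta>'w power_set_def)
    ultimately show "u \<in> power_set I (P.br E E')" by (simp add: power_set_def[of I "P.br E E'"])
  qed
  then have "fv.dim (\<Psi> ` Q.br ?G ?G') \<le> fv.dim (power_set I (P.br E E'))"
    by (rule dim_le_of_finite_dim[OF finite_dim_power_set[OF finite_I P.br_properties[OF E(1,2)]]])
  moreover have "fv.dim (\<Psi> ` Q.br ?G ?G') = fv.dim (Q.br ?G ?G')"
    by (rule dim_image_inj[OF lin inj\<Psi> Q.br_properties(1)[OF G G']])
  moreover have "fv.dim (power_set I (P.br E E')) = card I * fv.dim (P.br E E')"
    by (rule dim_power_set[OF finite_I P.br_properties[OF E(1,2)]])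
  moreover have "fv.dim ?G' = card I * fv.dim E'"
    using dim_image_inj[OF flinear_\<theta> inj_on_subset[OF inj EX(2)] subspace_power_set[OF P.submoduleD(1)[OF E(2)]]]
      dim_power_set[OF finite_I P.submoduleD(1,4)[OF E(2)]] by simp
  ultimately have "Q.\<sigma> ?G ?G' + card I * (card I * fv.dim E') \<le> card I * (P.\<sigma> E E' + card I * fv.dim E')"
    using P.dim_br[OF E] Q.dim_br[OF G G' image_mono[OF power_set_mono[OF E(3)]]] by simp
  then show ?thesis by (simp add: algebra_simps)
qed

text \<open>The core of the stability proof: semisimplicity of \<open>X/J\<close> passes to
  \<open>(X/J) \<otimes> H\<close>. Comparing two chains in
  \<open>(X \<otimes> H) \<otimes> H\<close> settles the matter for the top of
  \<open>X \<otimes> H\<close>, and \<open>ins\<close> and \<open>\<eta>\<close> carry the answer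
  back to \<open>X/J\<close>.\<close>

lemma jacobson_kills_power:
  assumes J: "submodule J" and top: "\<And>x j. \<lbrakk>x \<in> X; j \<in> jac\<rbrakk> \<Longrightarrow> act x j \<in> J"
    and w: "w \<in> power_set I X" and j: "j \<in> jac"
  shows "Mact act w j \<in> power_set I J"
proof -
  let ?Y = "power_set I X" and ?J = "power_set I J"
  define E where "E = P.radical_chain ?J ?Y"
  have J': "P.submodule ?J" by (rule submodule_power[OF J])
  have JY: "?J \<subseteq> ?Y" by (rule power_submodule(3)[OF J])
  obtain N0 where N0: "E N0 = ?J" unfolding E_def by (rule P.radical_chain_reaches[OF J' P.submodule_X JY])
  have smE: "P.submodule (E i)" and decE: "E (Suc i) \<subseteq> E i" and lowE: "?J \<subseteq> E i" for i
    unfolding E_def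
    by (rule P.submodule_radical_chain[OF J' P.submodule_X], rule P.radical_chain_decreasing[OF J' P.submodule_X JY],
        rule P.radical_chain_lower[OF JY])
  \<comment> \<open>One step more than \<open>N0\<close>, so that there is a first factor even when
    \<open>N0 = 0\<close>.\<close>
  define N where "N = Suc N0"
  have N: "E N = ?J" using decE[of N0] lowE[of N] N0 unfolding N_def by blast
  have killE: "Mact act x j \<in> E (Suc i)" if "x \<in> E i" "j \<in> jac" for x j i
    using that P.radical_step_upper(2)[OF J'] unfolding E_def P.radical_chain_Suc by blast
  \<comment> \<open>\<open>F\<close> applies \<open>- \<otimes> H\<close> to the radical series,
    whereas \<open>G\<close> takes copies of it, so that the factors of \<open>G\<close> remain
    semisimple.\<close>
  define F where "F = (\<lambda>i. power_set I (E i))"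
  define G where "G = (\<lambda>i. \<theta> ` power_set I (E i))"
  define S where "S = {x \<in> F 0. \<forall>j\<in>jac. Mact (Mact act) x j \<in> F (Suc 0)}"
  have smF: "Q.submodule (F i)" for i unfolding F_def by (rule P.submodule_power[OF smE])
  have decF: "F (Suc i) \<subseteq> F i" for i unfolding F_def by (rule power_set_mono[OF decE])
  have smG: "Q.submodule (G i)" for i unfolding G_def by (rule submodule_\<theta>_image[OF smE])
  have decG: "G (Suc i) \<subseteq> G i" for i unfolding G_def by (rule image_mono[OF power_set_mono[OF decE]])
  have killG: "Mact (Mact act) x j \<in> G (Suc l)" if xj: "x \<in> G l" "j \<in> jac" for l x j
  proof -
    obtain v where v: "v \<in> power_set I (E l)" "x = \<theta> v" using xj(1) unfolding G_def by blast
    have "v \<in> power_set I (power_set I X)" using v(1) power_set_mono[OF P.submoduleD(2)[OF smE]] by blast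
    then have "Mact (Mact act) x j = \<theta> (P.copact v j)" unfolding v(2) by (rule \<theta>_hom[OF _ jac_carrier[OF xj(2)]])
    moreover have "P.copact v j \<in> power_set I (E (Suc l))"
      using v(1) killE[OF _ xj(2)] by (simp add: power_set_def P.slice_copact)
    ultimately show ?thesis unfolding G_def by blast
  qed
  have smS: "Q.submodule S"
  proof -
    note CD = Q.submoduleD[OF smF[of 0]] and CD' = Q.submoduleD[OF smF[of "Suc 0"]]
    show ?thesis
      unfolding Q.submodule_def
    proof (intro conjI ballI)
      show "fv.subspace S"
        by (rule subspaceI)
          (use CD(2) in \<open>auto simp: S_def CD(5,6,8) CD'(5,6,8) Q.act_zero jac_carrier Q.act_add Q.act_scale subset_iff\<close>)
      show "S \<subseteq> power_set I (power_set I X)" using CD(2) S_def by blast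
      fix x r assume x: "x \<in> S" and r: "r \<in> carrier R"
      have xX: "x \<in> power_set I (power_set I X)" using x CD(2) unfolding S_def by blast
      have "Mact (Mact act) (Mact (Mact act) x r) j \<in> F (Suc 0)" if j: "j \<in> jac" for j
      proof -
        have "Mact (Mact act) x (r \<otimes> j) \<in> F (Suc 0)"
          using x jacobson_radical_left_mult[OF j r] unfolding S_def by blast
        then show ?thesis using Q.act_mult[OF xX r jac_carrier[OF j]] by simp
      qed
      then show "Mact (Mact act) x r \<in> S" using x CD(3)[OF _ r] by (simp add: S_def)
    qed
  qed
  have FS: "F (Suc 0) \<subseteq> S"
    using decF[of 0] Q.submoduleD(3)[OF smF] jac_carrier unfolding S_def by blast
  \<comment> \<open>\<open>F\<close> refined by \<open>S\<close>, the preimage of the socle of its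
    first factor.\<close>
  define c where "c = (\<lambda>i. case i of 0 \<Rightarrow> F 0 | Suc 0 \<Rightarrow> S | Suc (Suc i) \<Rightarrow> F (Suc i))"
  have c_simps: "c 0 = F 0" "c (Suc 0) = S" "c (Suc (Suc i)) = F (Suc i)" for i by (simp_all add: c_def)
  have E0: "E 0 = ?Y" unfolding E_def P.radical_chain_0 ..
  have full: "\<theta> ` power_set I (power_set I C) = power_set I (power_set I C)" if "submodule C" for C
    by (rule \<theta>_image[OF submoduleD(1,4)[OF that]])
  have chain: "(\<Sum>i<Suc N. Q.\<sigma> (c i) (c (Suc i))) \<le> (\<Sum>l<N. Q.\<sigma> (G l) (G (Suc l)))"
  proof (rule Q.\<sigma>_chain_le)
    show "Q.submodule (c i)" for i by (cases i rule: nat.exhaust; cases "i - 1") (auto simp: c_def smF smS split: nat.split)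
    show "c (Suc i) \<subseteq> c i" for i
      using FS decF by (cases i; cases "i - 1") (auto simp: c_def S_def split: nat.splits dest: subsetD)
    show "c 0 = G 0" unfolding c_simps F_def G_def E0 by (rule full[OF submodule_X, symmetric])
    show "c (Suc N) = G N" unfolding N_def c_simps unfolding N_def[symmetric] F_def G_def N
      by (rule full[OF J, symmetric])
  qed (fact smG decG killG)+
  \<comment> \<open>\<open>G\<close> has the maximal total, yet none of its factors contributes more
    than the corresponding factor of \<open>F\<close>.\<close>
  have "(\<Sum>l<N. Q.\<sigma> (G l) (G (Suc l))) \<le> (\<Sum>l<N. Q.\<sigma> (F l) (F (Suc l)))"
  proof (rule sum_mono)
    fix l
    show "Q.\<sigma> (G l) (G (Suc l)) \<le> Q.\<sigma> (F l) (F (Suc l))"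
      using \<sigma>_\<theta>_image_le[OF smE smE decE, of l] P.\<sigma>_power_ge[OF smE smE decE, of l]
      unfolding F_def G_def by linarith
  qed
  moreover have "(\<Sum>i<Suc N. Q.\<sigma> (c i) (c (Suc i)))
      = Q.\<sigma> (F 0) S + Q.\<sigma> S (F (Suc 0)) + (\<Sum>l<N0. Q.\<sigma> (F (Suc l)) (F (Suc (Suc l))))"
    unfolding N_def sum.lessThan_Suc_shift by (simp add: c_simps)
  moreover have "(\<Sum>l<N. Q.\<sigma> (F l) (F (Suc l)))
      = Q.\<sigma> (F 0) (F (Suc 0)) + (\<Sum>l<N0. Q.\<sigma> (F (Suc l)) (F (Suc (Suc l))))"
    unfolding N_def sum.lessThan_Suc_shift by simp
  \<comment> \<open>The factors below \<open>F (Suc 0)\<close> occur on both sides and cancel; what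
    is left concerns the refined first factor.\<close>
  ultimately have "Q.\<sigma> (F 0) S + Q.\<sigma> S (F (Suc 0)) \<le> Q.\<sigma> (F 0) (F (Suc 0))" using chain by linarith
  then have SF: "S = F 0" by (rule Q.semisimple_of_\<sigma>[OF smF smF decF S_def])
  \<comment> \<open>\<open>v\<close> is the image of \<open>w\<close> under
    \<open>ins \<otimes> id\<close>. Applying \<open>\<eta>\<close> to the slices of
    \<open>v j\<close> gives back \<open>w j\<close>, because \<open>ins\<close> is a module
    map.\<close>
  define v :: "'c \<times> 'c \<times> 'i \<Rightarrow> 'k" where "v = (\<lambda>(a, p). if a \<in> I then ins (slice w a) p else 0)"
  have sv: "slice v a = (if a \<in> I then ins (slice w a) else 0)" for a
    by (auto simp: v_def slice_def)
  have sw: "slice w a \<in> X" for a by (rule slice_closed[OF w subset_refl])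
  have "v \<in> F 0"
    unfolding F_def E0 by (simp add: power_set_def[of I "power_set I X"] sv ins_closed[OF subspace_X sw])
  then have vj: "Mact (Mact act) v j \<in> F (Suc 0)" using SF j unfolding S_def by blast
  \<comment> \<open>\<open>E (Suc 0)\<close> is generated by \<open>J \<otimes> H\<close> and the
    products of \<open>X \<otimes> H\<close> with the radical; \<open>\<eta>\<close> sends both into
    \<open>J\<close>, the latter by the hypothesis \<open>top\<close>.\<close>
  have E1: "\<eta> x \<in> J" if "x \<in> E (Suc 0)" for x
  proof -
    let ?D = "{x \<in> power_set I X. \<eta> x \<in> J}"
    have "P.submodule ?D"
      unfolding P.submodule_def
    proof (intro conjI ballI)
      show "fv.subspace ?D"
        by (rule subspaceI)
          (simp_all add: \<eta>_zero \<eta>_scale \<eta>_add submoduleD(5,6,8)[OF J] fv.subspace_0[OF P.subspace_X]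
            fv.subspace_add[OF P.subspace_X] fv.subspace_scale[OF P.subspace_X])
      fix x r assume "x \<in> ?D" "r \<in> carrier R"
      then show "Mact act x r \<in> ?D" using \<eta>_Mact submoduleD(3)[OF J] P.act_closed by simp
    qed blast
    moreover have "?J \<subseteq> ?D" using JY \<eta>_closed[OF J] by blast
    moreover have "Mact act x j \<in> ?D" if "x \<in> E 0" "j \<in> jac" for x j
      using that E0 P.act_closed jac_carrier \<eta>_Mact top \<eta>_closed[OF submodule_X] by simp
    ultimately have "P.radical_step ?J (E 0) \<subseteq> ?D" by (rule P.radical_step_least)
    then have "E (Suc 0) \<subseteq> ?D" unfolding E_def P.radical_chain_Suc .
    then show ?thesis using that by blast
  qed
  have "slice (Mact act w j) b \<in> J" if b: "b \<in> I" for b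
  proof -
    have "slice (Mact (Mact act) v j) b = (\<Sum>a\<in>I. Mact act (ins (slice w a)) (\<Lambda> a b j))"
      using b by (simp add: slice_Mact sv)
    also have "\<dots> = (\<Sum>a\<in>I. ins (act (slice w a) (\<Lambda> a b j)))"
      by (intro sum.cong refl Mact_ins[OF sw] \<Lambda>_closed b jac_carrier[OF j])
    finally have "\<eta> (slice (Mact (Mact act) v j) b) = \<eta> (\<Sum>a\<in>I. ins (act (slice w a) (\<Lambda> a b j)))" by simp
    also have "\<dots> = (\<Sum>a\<in>I. act (slice w a) (\<Lambda> a b j))"
      by (simp only: \<eta>_sum \<eta>_ins)
    also have "\<dots> = slice (Mact act w j) b" using b by (simp add: slice_Mact)
    finally have "slice (Mact act w j) b = \<eta> (slice (Mact (Mact act) v j) b)" by simp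
    moreover have "slice (Mact (Mact act) v j) b \<in> E (Suc 0)"
      using vj b unfolding F_def by (simp add: power_set_def)
    ultimately show ?thesis using E1 by simp
  qed
  then show ?thesis by (simp add: power_set_def slice_Mact)
qed

end

section \<open>The regular module and stability in the finite-dimensional case\<close>

context comodule_algebra begin

definition reg :: "('j \<Rightarrow> 'k) \<Rightarrow> 'r \<Rightarrow> 'j \<Rightarrow> 'k" where
  "reg x r = \<iota> (inv_into (carrier R) \<iota> x \<otimes> r)"

lemma reg_\<iota> [simp]: "x \<in> carrier R \<Longrightarrow> reg (\<iota> x) r = \<iota> (x \<otimes> r)"
  by (simp add: reg_def inv_into_f_f[OF inj_\<iota>])

lemma comodule_module_reg: "comodule_module R \<iota> I \<Lambda> t \<epsilon> \<kappa> \<kappa>' (\<iota> ` carrier R) reg"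
proof unfold_locales
  show "fv.subspace (\<iota> ` carrier R)" by (rule right_ideal_subspace[OF right_ideal_carrier])
  show "finite_dim (\<iota> ` carrier R)" by (rule finite_dim_\<iota>)
  show "reg (x + y) r = reg x r + reg y r" if xy: "x \<in> \<iota> ` carrier R" "y \<in> \<iota> ` carrier R" "r \<in> carrier R" for x y r
  proof -
    obtain u v where uv: "u \<in> carrier R" "v \<in> carrier R" "x = \<iota> u" "y = \<iota> v" using xy by blast
    then have "x + y = \<iota> (u \<oplus> v)" by (simp add: \<iota>_add)
    then have "reg (x + y) r = \<iota> ((u \<oplus> v) \<otimes> r)" using uv(1,2) by simp
    then show ?thesis using uv xy(3) by (simp add: l_distr \<iota>_add)
  qed
  show "reg (\<lambda>i. c * x i) r = (\<lambda>i. c * reg x r i)" if x: "x \<in> \<iota> ` carrier R" "r \<in> carrier R" for c x r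
  proof -
    obtain u where u: "u \<in> carrier R" "x = \<iota> u" using x by blast
    then have "(\<lambda>i. c * x i) = \<iota> (c \<odot>\<^bsub>R\<^esub> u)" by (simp add: \<iota>_smult)
    then have "reg (\<lambda>i. c * x i) r = \<iota> ((c \<odot>\<^bsub>R\<^esub> u) \<otimes> r)" using u(1) by simp
    then show ?thesis using u x(2) by (simp add: smult_mult_left \<iota>_smult)
  qed
qed (auto simp: r_distr \<iota>_add smult_mult_right \<iota>_smult m_assoc)

text \<open>In the regular module, the component at \<open>b\<close> of
  \<open>(1 \<otimes> a) j\<close> is \<open>\<Lambda> a b j\<close>, so
  \<open>jacobson_kills_power\<close> applied to \<open>1 \<otimes> a\<close> gives the
  claim.\<close>

lemma jacobson_radical_stable:
  assumes j: "j \<in> jac" and a: "a \<in> I" "b \<in> I" shows "\<Lambda> a b j \<in> jac"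
proof -
  interpret M: comodule_module R \<iota> I \<Lambda> t \<epsilon> \<kappa> \<kappa>' "\<iota> ` carrier R" reg by (rule comodule_module_reg)
  have jR: "jac \<subseteq> carrier R" by (auto simp: jacobson_radical_def)
  have sJ: "M.submodule (\<iota> ` jac)"
    unfolding M.submodule_def
    using right_ideal_subspace[OF right_ideal_jacobson] jR right_idealD(4)[OF right_ideal_jacobson] by auto
  have "Mact reg (put a (\<iota> \<one>)) j \<in> power_set I (\<iota> ` jac)"
  proof (rule M.jacobson_kills_power[OF sJ _ _ j])
    show "reg x j \<in> \<iota> ` jac" if "x \<in> \<iota> ` carrier R" "j \<in> jac" for x j
      using that jacobson_radical_left_mult by auto
    show "put a (\<iota> \<one>) \<in> power_set I (\<iota> ` carrier R)"
      using a fv.subspace_0[OF M.subspace_X] by (auto simp: power_set_def slice_put)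
  qed
  then have "slice (Mact reg (put a (\<iota> \<one>)) j) b \<in> \<iota> ` jac" using a(2) by (simp add: power_set_def)
  moreover have "slice (Mact reg (put a (\<iota> \<one>)) j) b = (\<Sum>a'\<in>I. if a' = a then \<iota> (\<Lambda> a b j) else 0)"
    unfolding slice_Mact using a jR j M.act_zero
    by (simp add: slice_put) (rule sum.cong[OF refl], use \<Lambda>_closed in \<open>auto simp: subset_iff\<close>)
  ultimately have "\<iota> (\<Lambda> a b j) \<in> \<iota> ` jac" using a finite_I by (simp add: sum.delta)
  then show ?thesis
    using inj_on_image_mem_iff[OF inj_\<iota> \<Lambda>_closed[OF a subsetD[OF jR j]] jR] by simp
qed

end

section \<open>Tensor products and Sweedler sums\<close>

abbreviation vspace :: "('k::field, 'v) module \<Rightarrow> bool" where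
  "vspace \<equiv> vectorspace class_ring"

lemma vspaceD:
  assumes "vspace V"
  shows "abelian_group V" "\<And>c x. x \<in> carrier V \<Longrightarrow> c \<odot>\<^bsub>V\<^esub> x \<in> carrier V"
    "\<And>x y. \<lbrakk>x \<in> carrier V; y \<in> carrier V\<rbrakk> \<Longrightarrow> x \<oplus>\<^bsub>V\<^esub> y \<in> carrier V"
    "\<zero>\<^bsub>V\<^esub> \<in> carrier V"
    "\<And>c d x. x \<in> carrier V \<Longrightarrow> (c + d) \<odot>\<^bsub>V\<^esub> x = c \<odot>\<^bsub>V\<^esub> x \<oplus>\<^bsub>V\<^esub> d \<odot>\<^bsub>V\<^esub> x"
    "\<And>c x y. \<lbrakk>x \<in> carrier V; y \<in> carrier V\<rbrakk> \<Longrightarrow> c \<odot>\<^bsub>V\<^esub> (x \<oplus>\<^bsub>V\<^esub> y) = c \<odot>\<^bsub>V\<^esub> x \<oplus>\<^bsub>V\<^esub> c \<odot>\<^bsub>V\<^esub> y"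
    "\<And>c d x. x \<in> carrier V \<Longrightarrow> (c * d) \<odot>\<^bsub>V\<^esub> x = c \<odot>\<^bsub>V\<^esub> (d \<odot>\<^bsub>V\<^esub> x)"
    "\<And>x. x \<in> carrier V \<Longrightarrow> 1 \<odot>\<^bsub>V\<^esub> x = x"
    "\<And>x. x \<in> carrier V \<Longrightarrow> 0 \<odot>\<^bsub>V\<^esub> x = \<zero>\<^bsub>V\<^esub>"
    "\<And>c. c \<odot>\<^bsub>V\<^esub> \<zero>\<^bsub>V\<^esub> = \<zero>\<^bsub>V\<^esub>"
proof -
  interpret vectorspace class_ring V by fact
  show "abelian_group V" by (rule abelian_group_axioms)
  show "c \<odot>\<^bsub>V\<^esub> x \<in> carrier V" if "x \<in> carrier V" for c x using smult_closed[of c x] that by simp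
  show "x \<oplus>\<^bsub>V\<^esub> y \<in> carrier V" if "x \<in> carrier V" "y \<in> carrier V" for x y using that by simp
  show "\<zero>\<^bsub>V\<^esub> \<in> carrier V" by simp
  show "(c + d) \<odot>\<^bsub>V\<^esub> x = c \<odot>\<^bsub>V\<^esub> x \<oplus>\<^bsub>V\<^esub> d \<odot>\<^bsub>V\<^esub> x" if "x \<in> carrier V" for c d x
    using smult_l_distr[of c d x] that by simp
  show "c \<odot>\<^bsub>V\<^esub> (x \<oplus>\<^bsub>V\<^esub> y) = c \<odot>\<^bsub>V\<^esub> x \<oplus>\<^bsub>V\<^esub> c \<odot>\<^bsub>V\<^esub> y" if "x \<in> carrier V" "y \<in> carrier V" for c x y
    using smult_r_distr[of c x y] that by simp
  show "(c * d) \<odot>\<^bsub>V\<^esub> x = c \<odot>\<^bsub>V\<^esub> (d \<odot>\<^bsub>V\<^esub> x)" if "x \<in> carrier V" for c d x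
    using smult_assoc1[of c d x] that by simp
  show "1 \<odot>\<^bsub>V\<^esub> x = x" if "x \<in> carrier V" for x using smult_one[of x] that by simp
  show "0 \<odot>\<^bsub>V\<^esub> x = \<zero>\<^bsub>V\<^esub>" if "x \<in> carrier V" for x using lmult_0[of x] that by simp
  show "c \<odot>\<^bsub>V\<^esub> \<zero>\<^bsub>V\<^esub> = \<zero>\<^bsub>V\<^esub>" for c using rmult_0[of c] by simp
qed

lemma vspaceI:
  fixes V :: "('k::field, 'v) module"
  assumes "abelian_group V" "\<And>c x. x \<in> carrier V \<Longrightarrow> c \<odot>\<^bsub>V\<^esub> x \<in> carrier V"
    "\<And>c d x. x \<in> carrier V \<Longrightarrow> (c + d) \<odot>\<^bsub>V\<^esub> x = c \<odot>\<^bsub>V\<^esub> x \<oplus>\<^bsub>V\<^esub> d \<odot>\<^bsub>V\<^esub> x"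
    "\<And>c x y. \<lbrakk>x \<in> carrier V; y \<in> carrier V\<rbrakk> \<Longrightarrow> c \<odot>\<^bsub>V\<^esub> (x \<oplus>\<^bsub>V\<^esub> y) = c \<odot>\<^bsub>V\<^esub> x \<oplus>\<^bsub>V\<^esub> c \<odot>\<^bsub>V\<^esub> y"
    "\<And>c d x. x \<in> carrier V \<Longrightarrow> (c * d) \<odot>\<^bsub>V\<^esub> x = c \<odot>\<^bsub>V\<^esub> (d \<odot>\<^bsub>V\<^esub> x)"
    "\<And>x. x \<in> carrier V \<Longrightarrow> 1 \<odot>\<^bsub>V\<^esub> x = x"
  shows "vspace V"
proof -
  interpret abelian_group V by fact
  show ?thesis
    by unfold_locales
      (use assms in \<open>auto simp: class_ring_simps field_simps intro!: bexI[of _ "inverse _"] bexI[of _ "- _"]\<close>)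
qed

definition pscale :: "'k::field \<Rightarrow> ('z \<Rightarrow>\<^sub>0 'k) \<Rightarrow> 'z \<Rightarrow>\<^sub>0 'k" where
  "pscale c p = Poly_Mapping.map ((*) c) p"

lemma lookup_pscale [simp]: "Poly_Mapping.lookup (pscale c p) z = c * Poly_Mapping.lookup p z"
  unfolding pscale_def by (simp add: Poly_Mapping.map.rep_eq when_def)

lemma keys_pscale: "Poly_Mapping.keys (pscale c p) \<subseteq> Poly_Mapping.keys p"
  by (auto simp: in_keys_iff)

lemma pscale_minus_one: "pscale (- 1) p = - p"
  by (rule poly_mapping_eqI) simp

lemma pscale_single: "pscale c (Poly_Mapping.single z d) = Poly_Mapping.single z (c * d)"
  by (rule poly_mapping_eqI) (simp add: lookup_single when_def)

text \<open>Formal sums are compared over a common index set, since cancellation can make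
  \<open>p + q\<close> have fewer keys than \<open>p\<close> and \<open>q\<close> together.\<close>

lemma tensor_eval_superset:
  assumes X: "vspace X" and S: "finite S" "Poly_Mapping.keys p \<subseteq> S"
    and f: "\<And>z. z \<in> S \<Longrightarrow> f (fst z) (snd z) \<in> carrier X"
  shows "tensor_eval X f p = (\<Oplus>\<^bsub>X\<^esub>z\<in>S. Poly_Mapping.lookup p z \<odot>\<^bsub>X\<^esub> f (fst z) (snd z))"
proof -
  interpret abelian_group X by (rule vspaceD(1)[OF X])
  show ?thesis unfolding tensor_eval_def
    by (rule add.finprod_mono_neutral_cong_left)
      (use S f vspaceD(2,9)[OF X] in \<open>auto simp: in_keys_iff\<close>)
qed

lemma tensor_eval_add:
  assumes X: "vspace X" and pq: "Poly_Mapping.keys p \<subseteq> D" "Poly_Mapping.keys q \<subseteq> D"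
    and f: "\<And>z. z \<in> D \<Longrightarrow> f (fst z) (snd z) \<in> carrier X"
  shows "tensor_eval X f (p + q) = tensor_eval X f p \<oplus>\<^bsub>X\<^esub> tensor_eval X f q"
proof -
  interpret abelian_group X by (rule vspaceD(1)[OF X])
  let ?S = "Poly_Mapping.keys p \<union> Poly_Mapping.keys q"
  have S: "finite ?S" "\<And>z. z \<in> ?S \<Longrightarrow> f (fst z) (snd z) \<in> carrier X" using pq f by auto
  have eval: "tensor_eval X f r = (\<Oplus>\<^bsub>X\<^esub>z\<in>?S. Poly_Mapping.lookup r z \<odot>\<^bsub>X\<^esub> f (fst z) (snd z))"
    if "Poly_Mapping.keys r \<subseteq> ?S" for r
    by (rule tensor_eval_superset[OF X S(1) that]) (rule S(2))
  have "tensor_eval X f (p + q)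
      = (\<Oplus>\<^bsub>X\<^esub>z\<in>?S. Poly_Mapping.lookup (p + q) z \<odot>\<^bsub>X\<^esub> f (fst z) (snd z))"
    by (rule eval[OF Poly_Mapping.keys_add])
  also have "\<dots> = (\<Oplus>\<^bsub>X\<^esub>z\<in>?S. Poly_Mapping.lookup p z \<odot>\<^bsub>X\<^esub> f (fst z) (snd z)
          \<oplus>\<^bsub>X\<^esub> Poly_Mapping.lookup q z \<odot>\<^bsub>X\<^esub> f (fst z) (snd z))"
    by (rule finsum_cong') (use S(2) vspaceD[OF X] in \<open>auto simp: lookup_add\<close>)
  also have "\<dots> = tensor_eval X f p \<oplus>\<^bsub>X\<^esub> tensor_eval X f q"
    unfolding eval[OF Un_upper1] eval[OF Un_upper2]
    by (rule finsum_addf) (use S(2) vspaceD[OF X] in auto)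
  finally show ?thesis .
qed

lemma smult_finsum:
  assumes X: "vspace X" and S: "finite S" "\<And>z. z \<in> S \<Longrightarrow> g z \<in> carrier X"
  shows "c \<odot>\<^bsub>X\<^esub> (\<Oplus>\<^bsub>X\<^esub>z\<in>S. g z) = (\<Oplus>\<^bsub>X\<^esub>z\<in>S. c \<odot>\<^bsub>X\<^esub> g z)"
proof -
  interpret abelian_group X by (rule vspaceD(1)[OF X])
  show ?thesis using S
    by (induction S rule: finite_induct) (simp_all add: Pi_def vspaceD(2,6,10)[OF X])
qed

lemma tensor_eval_pscale:
  assumes X: "vspace X" and p: "Poly_Mapping.keys p \<subseteq> D"
    and f: "\<And>z. z \<in> D \<Longrightarrow> f (fst z) (snd z) \<in> carrier X"
  shows "tensor_eval X f (pscale c p) = c \<odot>\<^bsub>X\<^esub> tensor_eval X f p"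
proof -
  interpret abelian_group X by (rule vspaceD(1)[OF X])
  let ?S = "Poly_Mapping.keys p"
  have S: "finite ?S" "\<And>z. z \<in> ?S \<Longrightarrow> f (fst z) (snd z) \<in> carrier X" using p f by auto
  have "tensor_eval X f (pscale c p)
      = (\<Oplus>\<^bsub>X\<^esub>z\<in>?S. Poly_Mapping.lookup (pscale c p) z \<odot>\<^bsub>X\<^esub> f (fst z) (snd z))"
    by (rule tensor_eval_superset[OF X S(1) keys_pscale]) (rule S(2))
  also have "\<dots> = (\<Oplus>\<^bsub>X\<^esub>z\<in>?S. c \<odot>\<^bsub>X\<^esub> (Poly_Mapping.lookup p z \<odot>\<^bsub>X\<^esub> f (fst z) (snd z)))"
    by (rule finsum_cong') (use S(2) vspaceD[OF X] in auto)
  also have "\<dots> = c \<odot>\<^bsub>X\<^esub> tensor_eval X f p"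
    unfolding tensor_eval_def by (rule smult_finsum[OF X S(1), symmetric]) (use S(2) vspaceD(2)[OF X] in auto)
  finally show ?thesis .
qed

lemma tensor_eval_single:
  assumes X: "vspace X" and f: "f v w \<in> carrier X"
  shows "tensor_eval X f (Poly_Mapping.single (v, w) c) = c \<odot>\<^bsub>X\<^esub> f v w"
proof -
  interpret abelian_group X by (rule vspaceD(1)[OF X])
  show ?thesis
    using tensor_eval_superset[OF X, of "{(v, w)}" "Poly_Mapping.single (v, w) c" f] f vspaceD(2)[OF X]
    by simp
qed

lemma tensor_eval_closed:
  assumes X: "vspace X" and p: "Poly_Mapping.keys p \<subseteq> D"
    and f: "\<And>z. z \<in> D \<Longrightarrow> f (fst z) (snd z) \<in> carrier X"
  shows "tensor_eval X f p \<in> carrier X"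
proof -
  interpret abelian_group X by (rule vspaceD(1)[OF X])
  show ?thesis unfolding tensor_eval_def by (rule finsum_closed) (use p f vspaceD(2)[OF X] in auto)
qed

lemma linear_mapsI:
  assumes "\<And>x. x \<in> carrier V \<Longrightarrow> f x \<in> carrier W"
    "\<And>x y. \<lbrakk>x \<in> carrier V; y \<in> carrier V\<rbrakk> \<Longrightarrow> f (x \<oplus>\<^bsub>V\<^esub> y) = f x \<oplus>\<^bsub>W\<^esub> f y"
    "\<And>c x. x \<in> carrier V \<Longrightarrow> f (c \<odot>\<^bsub>V\<^esub> x) = c \<odot>\<^bsub>W\<^esub> f x"
  shows "f \<in> linear_maps V W"
  using assms by (auto simp: LinearCombinations.module_hom_def)

lemma linear_mapsD:
  assumes "f \<in> linear_maps V W"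
  shows "\<And>x. x \<in> carrier V \<Longrightarrow> f x \<in> carrier W"
    "\<And>x y. \<lbrakk>x \<in> carrier V; y \<in> carrier V\<rbrakk> \<Longrightarrow> f (x \<oplus>\<^bsub>V\<^esub> y) = f x \<oplus>\<^bsub>W\<^esub> f y"
    "\<And>c x. x \<in> carrier V \<Longrightarrow> f (c \<odot>\<^bsub>V\<^esub> x) = c \<odot>\<^bsub>W\<^esub> f x"
  using assms by (auto simp: LinearCombinations.module_hom_def)

lemma bilinear_mapI:
  assumes "\<And>v. v \<in> carrier V \<Longrightarrow> (\<lambda>w. f v w) \<in> linear_maps W X"
    "\<And>w. w \<in> carrier W \<Longrightarrow> (\<lambda>v. f v w) \<in> linear_maps V X"
  shows "bilinear_map V W X f"
  using assms by (simp add: bilinear_map_def)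

lemma bilinear_mapD:
  assumes "bilinear_map V W X f"
  shows "\<And>v. v \<in> carrier V \<Longrightarrow> (\<lambda>w. f v w) \<in> linear_maps W X"
    "\<And>w. w \<in> carrier W \<Longrightarrow> (\<lambda>v. f v w) \<in> linear_maps V X"
    "\<And>v w. \<lbrakk>v \<in> carrier V; w \<in> carrier W\<rbrakk> \<Longrightarrow> f v w \<in> carrier X"
  using assms by (auto simp: bilinear_map_def dest: linear_mapsD(1))

locale tensor_pair =
  fixes V :: "('k::field, 'v) module" and W :: "('k, 'w) module"
  assumes V: "vspace V" and W: "vspace W"
begin

abbreviation "tfree \<equiv> tensor_free V W"
abbreviation "tnull \<equiv> tensor_null V W"
abbreviation "tcls \<equiv> tensor_class V W"
abbreviation "T \<equiv> tensor_space V W"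

lemma tnull_keys: "p \<in> tnull \<Longrightarrow> Poly_Mapping.keys p \<subseteq> carrier V \<times> carrier W"
proof (induction rule: tensor_null.induct)
  case (add_left v v' w)
  then show ?case using keys_diff[of "Poly_Mapping.single (v \<oplus>\<^bsub>V\<^esub> v', w) 1 - Poly_Mapping.single (v, w) 1" "Poly_Mapping.single (v', w) 1"]
      keys_diff[of "Poly_Mapping.single (v \<oplus>\<^bsub>V\<^esub> v', w) 1" "Poly_Mapping.single (v, w) 1"] vspaceD(3)[OF V]
    by (auto split: if_splits)
next
  case (add_right v w w')
  then show ?case using keys_diff[of "Poly_Mapping.single (v, w \<oplus>\<^bsub>W\<^esub> w') 1 - Poly_Mapping.single (v, w) 1" "Poly_Mapping.single (v, w') 1"]
      keys_diff[of "Poly_Mapping.single (v, w \<oplus>\<^bsub>W\<^esub> w') 1" "Poly_Mapping.single (v, w) 1"] vspaceD(3)[OF W]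
    by (auto split: if_splits)
next
  case (smult_left v w c)
  then show ?case using keys_diff[of "Poly_Mapping.single (c \<odot>\<^bsub>V\<^esub> v, w) 1" "Poly_Mapping.single (v, w) c"] vspaceD(2)[OF V]
    by (auto split: if_splits)
next
  case (smult_right v w c)
  then show ?case using keys_diff[of "Poly_Mapping.single (v, c \<odot>\<^bsub>W\<^esub> w) 1" "Poly_Mapping.single (v, w) c"] vspaceD(2)[OF W]
    by (auto split: if_splits)
next
  case (add p q)
  then show ?case using Poly_Mapping.keys_add[of p q] by blast
next
  case (smult p c)
  then show ?case using keys_pscale[of c p] by (auto simp: pscale_def)
qed simp

lemma tnull_pscale: "p \<in> tnull \<Longrightarrow> pscale c p \<in> tnull"
  unfolding pscale_def by (rule tensor_null.smult)

lemma tnull_minus: "\<lbrakk>p \<in> tnull; q \<in> tnull\<rbrakk> \<Longrightarrow> p - q \<in> tnull"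
  using tensor_null.add[of p V W "- q"] tnull_pscale[of q "- 1"] by (simp add: pscale_minus_one)

lemma tfree_add: "\<lbrakk>p \<in> tfree; q \<in> tfree\<rbrakk> \<Longrightarrow> p + q \<in> tfree"
  unfolding tensor_free_def using Poly_Mapping.keys_add[of p q] by blast

lemma tfree_pscale: "p \<in> tfree \<Longrightarrow> pscale c p \<in> tfree"
  unfolding tensor_free_def using keys_pscale[of c p] by blast

lemma tfree_zero: "0 \<in> tfree" by (simp add: tensor_free_def)

lemma tfree_single: "\<lbrakk>v \<in> carrier V; w \<in> carrier W\<rbrakk> \<Longrightarrow> Poly_Mapping.single (v, w) c \<in> tfree"
  by (simp add: tensor_free_def)

lemma tcls_eq_iff:
  assumes "p \<in> tfree" "q \<in> tfree" shows "tcls p = tcls q \<longleftrightarrow> p - q \<in> tnull"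
proof
  assume "tcls p = tcls q"
  moreover have "p \<in> tcls p" using assms by (simp add: tensor_class_def tensor_null.zero)
  ultimately show "p - q \<in> tnull" by (simp add: tensor_class_def)
next
  assume d: "p - q \<in> tnull"
  have "r - p \<in> tnull \<longleftrightarrow> r - q \<in> tnull" for r
  proof
    assume "r - p \<in> tnull"
    then have "(r - p) + (p - q) \<in> tnull" using d by (rule tensor_null.add)
    then show "r - q \<in> tnull" by simp
  next
    assume "r - q \<in> tnull"
    then have "(r - q) - (p - q) \<in> tnull" using d by (rule tnull_minus)
    then show "r - p \<in> tnull" by simp
  qed
  then show "tcls p = tcls q" by (simp add: tensor_class_def)
qed

lemma tcls_self: "p \<in> tfree \<Longrightarrow> p \<in> tcls p"
  by (simp add: tensor_class_def tensor_null.zero)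

lemma T_simps: "carrier T = tcls ` tfree" "\<zero>\<^bsub>T\<^esub> = tcls 0"
  by (simp_all add: tensor_space_def)

lemma T_add:
  assumes "p \<in> tfree" "q \<in> tfree" shows "tcls p \<oplus>\<^bsub>T\<^esub> tcls q = tcls (p + q)"
proof -
  have "tcls (p' + q') = tcls (p + q)" if "p' \<in> tcls p" "q' \<in> tcls q" for p' q'
  proof -
    have "p' - p \<in> tnull" "q' - q \<in> tnull" "p' \<in> tfree" "q' \<in> tfree" using that by (auto simp: tensor_class_def)
    then have "(p' - p) + (q' - q) \<in> tnull" "p' + q' \<in> tfree" by (auto intro: tensor_null.add tfree_add)
    then show ?thesis using tcls_eq_iff[of "p' + q'" "p + q"] assms tfree_add by (simp add: algebra_simps)
  qed
  then have "(\<Union>p'\<in>tcls p. \<Union>q'\<in>tcls q. tcls (p' + q')) = tcls (p + q)"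
    using tcls_self[OF assms(1)] tcls_self[OF assms(2)] by blast
  then show ?thesis by (simp add: tensor_space_def)
qed

lemma T_smult:
  assumes "p \<in> tfree" shows "c \<odot>\<^bsub>T\<^esub> tcls p = tcls (pscale c p)"
proof -
  have "tcls (pscale c p') = tcls (pscale c p)" if "p' \<in> tcls p" for p'
  proof -
    have "p' - p \<in> tnull" "p' \<in> tfree" using that by (auto simp: tensor_class_def)
    then have "pscale c (p' - p) \<in> tnull" "pscale c p' \<in> tfree" by (auto intro: tnull_pscale tfree_pscale)
    moreover have "pscale c (p' - p) = pscale c p' - pscale c p"
      by (rule poly_mapping_eqI) (simp add: lookup_minus algebra_simps)
    ultimately show ?thesis using tcls_eq_iff[of "pscale c p'" "pscale c p"] assms tfree_pscale by simp
  qed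
  then have "(\<Union>p'\<in>tcls p. tcls (pscale c p')) = tcls (pscale c p)"
    using tcls_self[OF assms] by blast
  then show ?thesis by (simp add: tensor_space_def pscale_def)
qed

lemma vspace_T: "vspace T"
proof (rule vspaceI)
  show "abelian_group T"
  proof (rule abelian_groupI)
    fix x y z assume "x \<in> carrier T" "y \<in> carrier T" "z \<in> carrier T"
    then show "x \<oplus>\<^bsub>T\<^esub> y \<oplus>\<^bsub>T\<^esub> z = x \<oplus>\<^bsub>T\<^esub> (y \<oplus>\<^bsub>T\<^esub> z)"
      by (auto simp: T_simps T_add tfree_add add.assoc)
  next
    fix x assume "x \<in> carrier T"
    then obtain p where p: "p \<in> tfree" "x = tcls p" by (auto simp: T_simps)
    then have "tcls (pscale (- 1) p) \<oplus>\<^bsub>T\<^esub> x = \<zero>\<^bsub>T\<^esub>"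
      by (simp add: T_add tfree_pscale T_simps pscale_minus_one)
        (metis T_add add.left_inverse pscale_minus_one tfree_pscale)
    then show "\<exists>y\<in>carrier T. y \<oplus>\<^bsub>T\<^esub> x = \<zero>\<^bsub>T\<^esub>" using p tfree_pscale by (auto simp: T_simps)
  qed (auto simp: T_simps T_add tfree_add tfree_zero add.commute)
  fix c d :: 'k and x y assume x: "x \<in> carrier T"
  then obtain p where p: "p \<in> tfree" "x = tcls p" by (auto simp: T_simps)
  show "c \<odot>\<^bsub>T\<^esub> x \<in> carrier T" using p by (simp add: T_smult T_simps tfree_pscale)
  show "(c + d) \<odot>\<^bsub>T\<^esub> x = c \<odot>\<^bsub>T\<^esub> x \<oplus>\<^bsub>T\<^esub> d \<odot>\<^bsub>T\<^esub> x"
  proof -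
    have "pscale (c + d) p = pscale c p + pscale d p"
      by (rule poly_mapping_eqI) (simp add: lookup_add algebra_simps)
    then show ?thesis using p by (simp add: T_smult T_add tfree_pscale)
  qed
  show "(c * d) \<odot>\<^bsub>T\<^esub> x = c \<odot>\<^bsub>T\<^esub> (d \<odot>\<^bsub>T\<^esub> x)"
  proof -
    have "pscale (c * d) p = pscale c (pscale d p)"
      by (rule poly_mapping_eqI) simp
    then show ?thesis using p by (simp add: T_smult tfree_pscale)
  qed
  show "1 \<odot>\<^bsub>T\<^esub> x = x"
  proof -
    have "pscale 1 p = p" by (rule poly_mapping_eqI) simp
    then show ?thesis using p by (simp add: T_smult)
  qed
  assume "y \<in> carrier T"
  then obtain q where q: "q \<in> tfree" "y = tcls q" by (auto simp: T_simps)
  have "pscale c (p + q) = pscale c p + pscale c q"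
    by (rule poly_mapping_eqI) (simp add: lookup_add algebra_simps)
  then show "c \<odot>\<^bsub>T\<^esub> (x \<oplus>\<^bsub>T\<^esub> y) = c \<odot>\<^bsub>T\<^esub> x \<oplus>\<^bsub>T\<^esub> c \<odot>\<^bsub>T\<^esub> y"
    using p q by (simp add: T_smult T_add tfree_pscale tfree_add)
qed

abbreviation telem (infixl "\<boxtimes>" 75) where "v \<boxtimes> w \<equiv> tensor_elem V W v w"

lemma telem_closed: "\<lbrakk>v \<in> carrier V; w \<in> carrier W\<rbrakk> \<Longrightarrow> v \<boxtimes> w \<in> carrier T"
  by (simp add: tensor_elem_def T_simps tfree_single)

lemma bilinear_telem: "bilinear_map V W T (tensor_elem V W)"
proof (rule bilinear_mapI; rule linear_mapsI)
  note VD = vspaceD[OF V] and WD = vspaceD[OF W]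
  have diff_add: "Poly_Mapping.single a (1::'k) - (Poly_Mapping.single b 1 + Poly_Mapping.single c 1)
      = Poly_Mapping.single a 1 - Poly_Mapping.single b 1 - Poly_Mapping.single c 1" for a b c :: "'v \<times> 'w"
    by (simp add: algebra_simps)
  fix v w c assume v: "v \<in> carrier V" and w: "w \<in> carrier W"
  show "v \<boxtimes> w \<in> carrier T" by (rule telem_closed[OF v w])
  show "v \<boxtimes> w \<in> carrier T" by (rule telem_closed[OF v w])
  show "v \<boxtimes> (c \<odot>\<^bsub>W\<^esub> w) = c \<odot>\<^bsub>T\<^esub> (v \<boxtimes> w)"
    using v w WD(2)[OF w, of c] tensor_null.smult_right[OF v w, of c]
    by (simp add: tensor_elem_def T_smult tfree_single pscale_single tcls_eq_iff)
  show "(c \<odot>\<^bsub>V\<^esub> v) \<boxtimes> w = c \<odot>\<^bsub>T\<^esub> (v \<boxtimes> w)"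
    using v w VD(2)[OF v, of c] tensor_null.smult_left[OF v w, of c]
    by (simp add: tensor_elem_def T_smult tfree_single pscale_single tcls_eq_iff)
  fix v' w' assume v': "v' \<in> carrier V" and w': "w' \<in> carrier W"
  show "v \<boxtimes> (w \<oplus>\<^bsub>W\<^esub> w') = v \<boxtimes> w \<oplus>\<^bsub>T\<^esub> v \<boxtimes> w'"
    using v w w' WD(3)[OF w w'] tensor_null.add_right[OF v w w']
    by (simp add: tensor_elem_def T_add tfree_single tcls_eq_iff tfree_add diff_add)
  show "(v \<oplus>\<^bsub>V\<^esub> v') \<boxtimes> w = v \<boxtimes> w \<oplus>\<^bsub>T\<^esub> v' \<boxtimes> w"
    using v w v' VD(3)[OF v v'] tensor_null.add_left[OF v v' w]
    by (simp add: tensor_elem_def T_add tfree_single tcls_eq_iff tfree_add diff_add)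
qed

lemma tfree_induct [consumes 1, case_names zero add]:
  assumes "p \<in> tfree" "Q 0"
    "\<And>p v w c. \<lbrakk>p \<in> tfree; Q p; v \<in> carrier V; w \<in> carrier W\<rbrakk> \<Longrightarrow> Q (Poly_Mapping.single (v, w) c + p)"
  shows "Q p"
  using assms(1)
proof (induction "card (Poly_Mapping.keys p)" arbitrary: p)
  case 0
  then show ?case using assms(2) by simp
next
  case (Suc n)
  have "Poly_Mapping.keys p \<noteq> {}" using Suc.hyps(2) by auto
  then obtain z where z: "z \<in> Poly_Mapping.keys p" by blast
  let ?s = "Poly_Mapping.single z (Poly_Mapping.lookup p z)"
  let ?q = "p - ?s"
  have keys: "Poly_Mapping.keys ?q = Poly_Mapping.keys p - {z}"
  proof (rule Set.set_eqI)
    fix y show "y \<in> Poly_Mapping.keys ?q \<longleftrightarrow> y \<in> Poly_Mapping.keys p - {z}"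
      by (cases "y = z") (simp_all add: in_keys_iff lookup_minus lookup_single)
  qed
  have q: "?q \<in> tfree" using Suc.prems keys by (auto simp: tensor_free_def)
  have "card (Poly_Mapping.keys ?q) = n" using keys z Suc.hyps(2) by simp
  then have "Q ?q" using Suc.hyps(1) q by metis
  moreover have "fst z \<in> carrier V" "snd z \<in> carrier W" using z Suc.prems by (auto simp: tensor_free_def)
  ultimately have "Q (Poly_Mapping.single (fst z, snd z) (Poly_Mapping.lookup p z) + ?q)" by (intro assms(3) q)
  then show ?case by simp
qed

text \<open>The generators of \<open>tensor_null\<close> are the bilinearity relations, which
  \<open>f\<close> satisfies. Evaluation is thus constant on cosets, and the definite description in
  \<open>tensor_lift\<close> denotes its value.\<close>

lemma tensor_eval_null:
  assumes X: "vspace X" and f: "bilinear_map V W X f" and p: "p \<in> tnull"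
  shows "tensor_eval X f p = \<zero>\<^bsub>X\<^esub>"
proof -
  interpret abelian_group X by (rule vspaceD(1)[OF X])
  note fD = bilinear_mapD[OF f] and XD = vspaceD[OF X] and VD = vspaceD[OF V] and WD = vspaceD[OF W]
  have fc: "\<And>z. z \<in> carrier V \<times> carrier W \<Longrightarrow> f (fst z) (snd z) \<in> carrier X" using fD(3) by auto
  have diff: "tensor_eval X f (p - q) = tensor_eval X f p \<ominus>\<^bsub>X\<^esub> tensor_eval X f q"
    if "Poly_Mapping.keys p \<subseteq> carrier V \<times> carrier W" "Poly_Mapping.keys q \<subseteq> carrier V \<times> carrier W" for p q
  proof -
    have k: "Poly_Mapping.keys (p - q) \<subseteq> carrier V \<times> carrier W" using keys_diff[of p q] that by blast
    have "tensor_eval X f ((p - q) + q) = tensor_eval X f (p - q) \<oplus>\<^bsub>X\<^esub> tensor_eval X f q"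
      by (rule tensor_eval_add[where f=f, OF X k that(2) fc])
    then show ?thesis
      using tensor_eval_closed[where f=f, OF X k fc] tensor_eval_closed[where f=f, OF X that(2) fc]
      by (simp add: a_minus_def a_assoc r_neg)
  qed
  have single: "tensor_eval X f (Poly_Mapping.single (v, w) c) = c \<odot>\<^bsub>X\<^esub> f v w"
    if "v \<in> carrier V" "w \<in> carrier W" for v w c by (rule tensor_eval_single[where f=f, OF X fD(3)[OF that]])
  have ks: "Poly_Mapping.keys (Poly_Mapping.single (v, w) c) \<subseteq> carrier V \<times> carrier W"
    if "v \<in> carrier V" "w \<in> carrier W" for v w and c :: 'k using that by simp
  have kd: "Poly_Mapping.keys (p - q) \<subseteq> carrier V \<times> carrier W"
    if "Poly_Mapping.keys p \<subseteq> carrier V \<times> carrier W" "Poly_Mapping.keys q \<subseteq> carrier V \<times> carrier W" for p q :: "('v \<times> 'w) \<Rightarrow>\<^sub>0 'k"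
    using keys_diff[of p q] that by blast
  show ?thesis using p
  proof (induction rule: tensor_null.induct)
    case (add_left v v' w)
    have c: "f v w \<in> carrier X" "f v' w \<in> carrier X" using add_left fD(3) by auto
    show ?case
      using add_left c linear_mapsD(2)[OF fD(2)[OF add_left(3)] add_left(1,2)]
      by (simp add: diff kd ks single VD(3) XD(8)) (simp add: a_minus_def a_ac r_neg minus_add r_neg2)
  next
    case (add_right v w w')
    have c: "f v w \<in> carrier X" "f v w' \<in> carrier X" using add_right fD(3) by auto
    show ?case
      using add_right c linear_mapsD(2)[OF fD(1)[OF add_right(1)] add_right(2,3)]
      by (simp add: diff kd ks single WD(3) XD(8)) (simp add: a_minus_def a_ac r_neg minus_add r_neg2)
  next
    case (smult_left v w c)
    then show ?case using fD(3)[OF smult_left] linear_mapsD(3)[OF fD(2)[OF smult_left(2)] smult_left(1)]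
      by (simp add: diff ks single VD(2) XD(2,8) r_neg a_minus_def)
  next
    case (smult_right v w c)
    then show ?case using fD(3)[OF smult_right] linear_mapsD(3)[OF fD(1)[OF smult_right(1)] smult_right(2)]
      by (simp add: diff ks single WD(2) XD(2,8) r_neg a_minus_def)
  next
    case zero
    show ?case by (simp add: tensor_eval_def)
  next
    case (add p q)
    then show ?case using tensor_eval_add[where f=f, OF X tnull_keys tnull_keys fc, of p q] by simp
  next
    case (smult p c)
    then show ?case using tensor_eval_pscale[where f=f, OF X tnull_keys fc, of p c] XD(10) by (simp add: pscale_def)
  qed
qed

lemma tensor_eval_tcls:
  assumes X: "vspace X" and f: "bilinear_map V W X f" and p: "p \<in> tfree" and q: "q \<in> tcls p"
  shows "tensor_eval X f q = tensor_eval X f p"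
proof -
  interpret abelian_group X by (rule vspaceD(1)[OF X])
  note fD = bilinear_mapD[OF f]
  have fc: "\<And>z. z \<in> carrier V \<times> carrier W \<Longrightarrow> f (fst z) (snd z) \<in> carrier X" using fD(3) by auto
  have d: "q - p \<in> tnull" using q by (simp add: tensor_class_def)
  have pk: "Poly_Mapping.keys p \<subseteq> carrier V \<times> carrier W" using p by (simp add: tensor_free_def)
  have "tensor_eval X f ((q - p) + p) = tensor_eval X f (q - p) \<oplus>\<^bsub>X\<^esub> tensor_eval X f p"
    by (rule tensor_eval_add[where f=f, OF X tnull_keys[OF d] pk fc])
  then show ?thesis using tensor_eval_null[OF X f d] tensor_eval_closed[where f=f, OF X pk fc] by simp
qed

lemma tensor_lift_tcls:
  assumes "vspace X" "bilinear_map V W X f" "p \<in> tfree"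
  shows "tensor_lift X f (tcls p) = tensor_eval X f p"
  unfolding tensor_lift_def
proof (rule the_equality)
  show "\<forall>q\<in>tcls p. tensor_eval X f p = tensor_eval X f q"
    using tensor_eval_tcls[OF assms] by metis
  show "x = tensor_eval X f p" if "\<forall>q\<in>tcls p. x = tensor_eval X f q" for x
    using that tcls_self[OF assms(3)] by (rule bspec)
qed

lemma tensor_lift_linear:
  assumes X: "vspace X" and f: "bilinear_map V W X f"
  shows "tensor_lift X f \<in> linear_maps T X"
proof (rule linear_mapsI)
  note fD = bilinear_mapD[OF f]
  have fc: "\<And>z. z \<in> carrier V \<times> carrier W \<Longrightarrow> f (fst z) (snd z) \<in> carrier X" using fD(3) by auto
  have k: "Poly_Mapping.keys p \<subseteq> carrier V \<times> carrier W" if "p \<in> tfree" for p using that by (simp add: tensor_free_def)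
  fix x y c assume "x \<in> carrier T"
  then obtain p where p: "p \<in> tfree" "x = tcls p" by (auto simp: T_simps)
  show "tensor_lift X f x \<in> carrier X"
    using tensor_eval_closed[where f=f, OF X k[OF p(1)] fc] tensor_lift_tcls[OF X f p(1)] p(2) by simp
  show "tensor_lift X f (c \<odot>\<^bsub>T\<^esub> x) = c \<odot>\<^bsub>X\<^esub> tensor_lift X f x"
    using tensor_eval_pscale[where f=f, OF X k[OF p(1)] fc, of c] p
    by (simp add: T_smult tensor_lift_tcls[OF X f] tfree_pscale)
  assume "y \<in> carrier T"
  then obtain q where q: "q \<in> tfree" "y = tcls q" by (auto simp: T_simps)
  show "tensor_lift X f (x \<oplus>\<^bsub>T\<^esub> y) = tensor_lift X f x \<oplus>\<^bsub>X\<^esub> tensor_lift X f y"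
    using tensor_eval_add[where f=f, OF X k[OF p(1)] k[OF q(1)] fc] p q
    by (simp add: T_add tensor_lift_tcls[OF X f] tfree_add)
qed

lemma tensor_lift_elem:
  assumes "vspace X" "bilinear_map V W X f" "v \<in> carrier V" "w \<in> carrier W"
  shows "tensor_lift X f (v \<boxtimes> w) = f v w"
  using tensor_lift_tcls[OF assms(1,2) tfree_single[OF assms(3,4)], of 1]
    tensor_eval_single[where f=f, OF assms(1) bilinear_mapD(3)[OF assms(2-4)]] vspaceD(8)[OF assms(1) bilinear_mapD(3)[OF assms(2-4)]]
  by (simp add: tensor_elem_def)

text \<open>Scalars are absorbed into the first factor, so sums of pure tensors suffice.\<close>

lemma tensor_induct [consumes 1, case_names zero add]:
  assumes "x \<in> carrier T" "Q \<zero>\<^bsub>T\<^esub>"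
    "\<And>x v w. \<lbrakk>x \<in> carrier T; Q x; v \<in> carrier V; w \<in> carrier W\<rbrakk> \<Longrightarrow> Q (v \<boxtimes> w \<oplus>\<^bsub>T\<^esub> x)"
  shows "Q x"
proof -
  obtain p where p: "p \<in> tfree" "x = tcls p" using assms(1) by (auto simp: T_simps)
  have "Q (tcls p)" using p(1)
  proof (induction rule: tfree_induct)
    case zero
    then show ?case using assms(2) by (simp add: T_simps)
  next
    case (add p v w c)
    have cv: "c \<odot>\<^bsub>V\<^esub> v \<in> carrier V" using vspaceD(2)[OF V add.hyps(2)] .
    have "tcls (Poly_Mapping.single (v, w) c) = (c \<odot>\<^bsub>V\<^esub> v) \<boxtimes> w"
      using tensor_null.smult_left[OF add.hyps(2,3), of c] tnull_pscale[of _ "-1"] add.hyps(2,3) cv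
      by (simp add: tensor_elem_def tcls_eq_iff tfree_single eq_commute[of "tcls (Poly_Mapping.single (v, w) c)"])
    moreover have "Q ((c \<odot>\<^bsub>V\<^esub> v) \<boxtimes> w \<oplus>\<^bsub>T\<^esub> tcls p)"
      by (rule assms(3)) (use add.hyps add.IH cv in \<open>auto simp: T_simps\<close>)
    ultimately show ?case using T_add[OF tfree_single[OF add.hyps(2,3)] add.hyps(1), of c] by simp
  qed
  then show ?thesis using p by simp
qed

lemma linear_map_zero:
  assumes "f \<in> linear_maps V' W'" "vspace V'" "vspace W'" shows "f \<zero>\<^bsub>V'\<^esub> = \<zero>\<^bsub>W'\<^esub>"
  using linear_mapsD(3)[OF assms(1) vspaceD(4)[OF assms(2)], of 0] vspaceD(10)[OF assms(2)]
    vspaceD(9)[OF assms(3) linear_mapsD(1)[OF assms(1) vspaceD(4)[OF assms(2)]]] by simp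

text \<open>Uniqueness in the universal property; it reduces identities between linear maps to pure
  tensors.\<close>

lemma tensor_ext:
  assumes "\<phi> \<in> linear_maps T X" "\<psi> \<in> linear_maps T X" "vspace X"
    and eq: "\<And>v w. \<lbrakk>v \<in> carrier V; w \<in> carrier W\<rbrakk> \<Longrightarrow> \<phi> (v \<boxtimes> w) = \<psi> (v \<boxtimes> w)"
    and x: "x \<in> carrier T"
  shows "\<phi> x = \<psi> x"
  using x
proof (induction rule: tensor_induct)
  case zero
  show ?case using linear_map_zero[OF assms(1) vspace_T assms(3)] linear_map_zero[OF assms(2) vspace_T assms(3)] by simp
next
  case (add x v w)
  then show ?case
    using add.IH linear_mapsD(2)[OF assms(1) telem_closed[OF add.hyps(2,3)] add.hyps(1)]
      linear_mapsD(2)[OF assms(2) telem_closed[OF add.hyps(2,3)] add.hyps(1)] eq[OF add.hyps(2,3)] by simp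
qed

end

subsection \<open>Linear maps\<close>

lemma lm_id: "(\<lambda>x. x) \<in> linear_maps V V"
  by (rule linear_mapsI) auto

lemma lm_comp:
  assumes "f \<in> linear_maps W X" "g \<in> linear_maps V W" shows "(\<lambda>x. f (g x)) \<in> linear_maps V X"
  using linear_mapsD[OF assms(1)] linear_mapsD[OF assms(2)] by (intro linear_mapsI) auto

lemma lm_bil_left:
  assumes "bilinear_map V W X f" "g \<in> linear_maps U V" "w \<in> carrier W"
  shows "(\<lambda>x. f (g x) w) \<in> linear_maps U X"
  by (rule lm_comp[OF bilinear_mapD(2)[OF assms(1,3)] assms(2)])

lemma lm_bil_right:
  assumes "bilinear_map V W X f" "g \<in> linear_maps U W" "v \<in> carrier V"
  shows "(\<lambda>x. f v (g x)) \<in> linear_maps U X"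
  by (rule lm_comp[OF bilinear_mapD(1)[OF assms(1,3)] assms(2)])

lemma lm_smult:
  assumes "g \<in> linear_maps V X" "vspace X" shows "(\<lambda>x. c \<odot>\<^bsub>X\<^esub> g x) \<in> linear_maps V X"
proof (rule linear_mapsI)
  note g = linear_mapsD[OF assms(1)] and X = vspaceD[OF assms(2)]
  fix x y d assume x: "x \<in> carrier V"
  show "c \<odot>\<^bsub>X\<^esub> g x \<in> carrier X" using g(1) x X(2) by blast
  show "c \<odot>\<^bsub>X\<^esub> g (d \<odot>\<^bsub>V\<^esub> x) = d \<odot>\<^bsub>X\<^esub> (c \<odot>\<^bsub>X\<^esub> g x)"
    using g(3)[OF x, of d] X(7)[OF g(1)[OF x], of c d] X(7)[OF g(1)[OF x], of d c] by (simp add: mult.commute)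
  assume y: "y \<in> carrier V"
  show "c \<odot>\<^bsub>X\<^esub> g (x \<oplus>\<^bsub>V\<^esub> y) = c \<odot>\<^bsub>X\<^esub> g x \<oplus>\<^bsub>X\<^esub> c \<odot>\<^bsub>X\<^esub> g y"
    using g(2)[OF x y] X(6)[OF g(1)[OF x] g(1)[OF y]] by simp
qed

lemma ground_simps [simp]:
  "carrier ground = UNIV" "x \<oplus>\<^bsub>ground\<^esub> y = x + y" "c \<odot>\<^bsub>ground\<^esub> x = c * x" "\<zero>\<^bsub>ground\<^esub> = 0"
  by (simp_all add: ground_def)

lemma vspace_ground: "vspace ground"
proof (rule vspaceI)
  show "abelian_group (ground :: ('k::field, 'k) module)"
    by (rule abelian_groupI) (auto intro: exI[of _ "- _"] simp: add.assoc add.commute)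
qed (auto simp: algebra_simps)

lemma lm_functional:
  assumes "f \<in> linear_maps V ground" "vspace X" "v \<in> carrier X" shows "(\<lambda>x. f x \<odot>\<^bsub>X\<^esub> v) \<in> linear_maps V X"
  by (rule linear_mapsI)
    (use linear_mapsD[OF assms(1)] vspaceD(2,5,7)[OF assms(2)] assms(3) in auto)

lemma bil_functional_smult_right:
  assumes "f \<in> linear_maps V ground" "vspace X" "vspace W" "g \<in> linear_maps W X"
  shows "bilinear_map V W X (\<lambda>v w. f v \<odot>\<^bsub>X\<^esub> g w)"
  by (rule bilinear_mapI[OF lm_smult[OF assms(4,2)] lm_functional[OF assms(1,2) linear_mapsD(1)[OF assms(4)]]])

lemma bil_functional_smult_left:
  assumes "f \<in> linear_maps W ground" "vspace X" "vspace V" "g \<in> linear_maps V X"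
  shows "bilinear_map V W X (\<lambda>v w. f w \<odot>\<^bsub>X\<^esub> g v)"
  by (rule bilinear_mapI[OF lm_functional[OF assms(1,2) linear_mapsD(1)[OF assms(4)]] lm_smult[OF assms(4,2)]])

lemma lm_finsum:
  assumes X: "vspace X" and F: "finite F" "\<And>i. i \<in> F \<Longrightarrow> g i \<in> linear_maps V X"
  shows "(\<lambda>x. \<Oplus>\<^bsub>X\<^esub>i\<in>F. g i x) \<in> linear_maps V X"
proof (rule linear_mapsI)
  interpret abelian_group X by (rule vspaceD(1)[OF X])
  have c: "g i x \<in> carrier X" if "i \<in> F" "x \<in> carrier V" for i x using linear_mapsD(1)[OF F(2)] that by blast
  fix x y c' assume x: "x \<in> carrier V"
  show "(\<Oplus>\<^bsub>X\<^esub>i\<in>F. g i x) \<in> carrier X" by (rule finsum_closed) (use c x in auto)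
  show "(\<Oplus>\<^bsub>X\<^esub>i\<in>F. g i (c' \<odot>\<^bsub>V\<^esub> x)) = c' \<odot>\<^bsub>X\<^esub> (\<Oplus>\<^bsub>X\<^esub>i\<in>F. g i x)"
  proof -
    have "(\<Oplus>\<^bsub>X\<^esub>i\<in>F. g i (c' \<odot>\<^bsub>V\<^esub> x)) = (\<Oplus>\<^bsub>X\<^esub>i\<in>F. c' \<odot>\<^bsub>X\<^esub> g i x)"
      by (rule finsum_cong') (use c x linear_mapsD(3)[OF F(2)] vspaceD(2)[OF X] in auto)
    then show ?thesis using smult_finsum[OF X F(1), of "\<lambda>i. g i x" c'] c x by simp
  qed
  assume y: "y \<in> carrier V"
  have "(\<Oplus>\<^bsub>X\<^esub>i\<in>F. g i (x \<oplus>\<^bsub>V\<^esub> y)) = (\<Oplus>\<^bsub>X\<^esub>i\<in>F. g i x \<oplus>\<^bsub>X\<^esub> g i y)"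
    by (rule finsum_cong') (use c x y linear_mapsD(2)[OF F(2)] in auto)
  then show "(\<Oplus>\<^bsub>X\<^esub>i\<in>F. g i (x \<oplus>\<^bsub>V\<^esub> y)) = (\<Oplus>\<^bsub>X\<^esub>i\<in>F. g i x) \<oplus>\<^bsub>X\<^esub> (\<Oplus>\<^bsub>X\<^esub>i\<in>F. g i y)"
    using finsum_addf[of "\<lambda>i. g i x" F "\<lambda>i. g i y"] c x y by auto
qed

lemma linear_map_finsum:
  assumes "f \<in> linear_maps V X" "vspace V" "vspace X" "finite F" "\<And>i. i \<in> F \<Longrightarrow> g i \<in> carrier V"
  shows "f (\<Oplus>\<^bsub>V\<^esub>i\<in>F. g i) = (\<Oplus>\<^bsub>X\<^esub>i\<in>F. f (g i))"
proof -
  interpret V: abelian_group V by (rule vspaceD(1)[OF assms(2)])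
  interpret X: abelian_group X by (rule vspaceD(1)[OF assms(3)])
  have f0: "f \<zero>\<^bsub>V\<^esub> = \<zero>\<^bsub>X\<^esub>"
    using linear_mapsD(3)[OF assms(1) V.zero_closed, of 0] vspaceD(9)[OF assms(2) V.zero_closed]
      vspaceD(9)[OF assms(3) linear_mapsD(1)[OF assms(1) V.zero_closed]] by simp
  show ?thesis using assms(4,5)
  proof (induction F rule: finite_induct)
    case (insert i F)
    have "f (g i \<oplus>\<^bsub>V\<^esub> (\<Oplus>\<^bsub>V\<^esub>i\<in>F. g i)) = f (g i) \<oplus>\<^bsub>X\<^esub> f (\<Oplus>\<^bsub>V\<^esub>i\<in>F. g i)"
      by (rule linear_mapsD(2)[OF assms(1)]) (use insert.prems in auto)
    then show ?case using insert linear_mapsD(1)[OF assms(1)]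
      by (simp add: V.finsum_insert X.finsum_insert Pi_def)
  qed (simp add: f0)
qed

lemma functional_finsum:
  assumes "f \<in> linear_maps V ground" "vspace V" "finite F" "\<And>i. i \<in> F \<Longrightarrow> g i \<in> carrier V"
  shows "f (\<Oplus>\<^bsub>V\<^esub>i\<in>F. g i) = (\<Sum>i\<in>F. f (g i))"
proof -
  interpret V: abelian_group V by (rule vspaceD(1)[OF assms(2)])
  have f0: "f \<zero>\<^bsub>V\<^esub> = 0"
    using linear_mapsD(3)[OF assms(1) V.zero_closed, of 0] vspaceD(9)[OF assms(2) V.zero_closed] by simp
  show ?thesis using assms(3,4)
    by (induction F rule: finite_induct) (simp_all add: f0 V.finsum_insert Pi_def linear_mapsD(2)[OF assms(1)])
qed

context tensor_pair begin

text \<open>Linear dependence on a parameter of the integrand with the tensor held fixed; this is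
  what makes nested lifts, and with them nested Sweedler sums, multilinear.\<close>

lemma lm_lift_param:
  assumes X: "vspace X" and f: "\<And>x. x \<in> carrier Y \<Longrightarrow> bilinear_map V W X (f x)"
    and lin: "\<And>v w. \<lbrakk>v \<in> carrier V; w \<in> carrier W\<rbrakk> \<Longrightarrow> (\<lambda>x. f x v w) \<in> linear_maps Y X"
    and Y: "vspace Y" and s: "s \<in> carrier T"
  shows "(\<lambda>x. tensor_lift X (f x) s) \<in> linear_maps Y X"
  using s
proof (induction rule: tensor_induct)
  interpret X: abelian_group X by (rule vspaceD(1)[OF X])
  note L = tensor_lift_linear[OF X f]
  {
    case zero
    show ?case
    proof (rule linear_mapsI)
      fix x y c assume x: "x \<in> carrier Y"
      have z: "tensor_lift X (f x) \<zero>\<^bsub>T\<^esub> = \<zero>\<^bsub>X\<^esub>" if "x \<in> carrier Y" for x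
        by (rule linear_map_zero[OF L[OF that] vspace_T X])
      show "tensor_lift X (f x) \<zero>\<^bsub>T\<^esub> \<in> carrier X" using z[OF x] by simp
      show "tensor_lift X (f (c \<odot>\<^bsub>Y\<^esub> x)) \<zero>\<^bsub>T\<^esub> = c \<odot>\<^bsub>X\<^esub> tensor_lift X (f x) \<zero>\<^bsub>T\<^esub>"
        using z[OF x] z[OF vspaceD(2)[OF Y x]] vspaceD(10)[OF X] by simp
      assume y: "y \<in> carrier Y"
      show "tensor_lift X (f (x \<oplus>\<^bsub>Y\<^esub> y)) \<zero>\<^bsub>T\<^esub> = tensor_lift X (f x) \<zero>\<^bsub>T\<^esub> \<oplus>\<^bsub>X\<^esub> tensor_lift X (f y) \<zero>\<^bsub>T\<^esub>"
        using z[OF x] z[OF y] z[OF vspaceD(3)[OF Y x y]] by simp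
    qed
  next
    case (add s v w)
    have e: "tensor_lift X (f x) (v \<boxtimes> w \<oplus>\<^bsub>T\<^esub> s) = f x v w \<oplus>\<^bsub>X\<^esub> tensor_lift X (f x) s" if "x \<in> carrier Y" for x
      using linear_mapsD(2)[OF L[OF that] telem_closed[OF add.hyps(2,3)] add.hyps(1)]
        tensor_lift_elem[OF X f[OF that] add.hyps(2,3)] by simp
    note l1 = linear_mapsD[OF lin[OF add.hyps(2,3)]] and l2 = linear_mapsD[OF add.IH]
    show ?case
    proof (rule linear_mapsI)
      fix x y c assume x: "x \<in> carrier Y"
      show "tensor_lift X (f x) (v \<boxtimes> w \<oplus>\<^bsub>T\<^esub> s) \<in> carrier X" using e[OF x] l1(1)[OF x] l2(1)[OF x] by simp
      show "tensor_lift X (f (c \<odot>\<^bsub>Y\<^esub> x)) (v \<boxtimes> w \<oplus>\<^bsub>T\<^esub> s) = c \<odot>\<^bsub>X\<^esub> tensor_lift X (f x) (v \<boxtimes> w \<oplus>\<^bsub>T\<^esub> s)"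
        using e[OF x] e[OF vspaceD(2)[OF Y x]] l1(3)[OF x] l2(3)[OF x]
          vspaceD(6)[OF X l1(1)[OF x] l2(1)[OF x]] by simp
      assume y: "y \<in> carrier Y"
      show "tensor_lift X (f (x \<oplus>\<^bsub>Y\<^esub> y)) (v \<boxtimes> w \<oplus>\<^bsub>T\<^esub> s)
          = tensor_lift X (f x) (v \<boxtimes> w \<oplus>\<^bsub>T\<^esub> s) \<oplus>\<^bsub>X\<^esub> tensor_lift X (f y) (v \<boxtimes> w \<oplus>\<^bsub>T\<^esub> s)"
        using e[OF x] e[OF y] e[OF vspaceD(3)[OF Y x y]] l1(1,2) l2(1,2) x y by (simp add: X.a_ac)
    qed
  }
qed

lemma tensor_lift_comp:
  assumes "vspace X" "vspace Y" "bilinear_map V W X f" "\<phi> \<in> linear_maps X Y" "s \<in> carrier T"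
  shows "\<phi> (tensor_lift X f s) = tensor_lift Y (\<lambda>v w. \<phi> (f v w)) s"
proof -
  have b: "bilinear_map V W Y (\<lambda>v w. \<phi> (f v w))"
    by (rule bilinear_mapI) (rule lm_comp[OF assms(4)], erule bilinear_mapD[OF assms(3)])+
  show ?thesis
    by (rule tensor_ext[OF lm_comp[OF assms(4) tensor_lift_linear[OF assms(1,3)]]
          tensor_lift_linear[OF assms(2) b] assms(2) _ assms(5)])
      (simp add: tensor_lift_elem[OF assms(1,3)] tensor_lift_elem[OF assms(2) b])
qed

lemma tensor_lift_cong:
  assumes "vspace X" "bilinear_map V W X f" "bilinear_map V W X g" "s \<in> carrier T"
    "\<And>v w. \<lbrakk>v \<in> carrier V; w \<in> carrier W\<rbrakk> \<Longrightarrow> f v w = g v w"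
  shows "tensor_lift X f s = tensor_lift X g s"
  by (rule tensor_ext[OF tensor_lift_linear[OF assms(1,2)] tensor_lift_linear[OF assms(1,3)] assms(1) _ assms(4)])
    (simp add: tensor_lift_elem[OF assms(1,2)] tensor_lift_elem[OF assms(1,3)] assms(5))

end

lemma bilinear_map_cong:
  assumes "bilinear_map V W X f" "vspace V" "vspace W"
    "\<And>v w. \<lbrakk>v \<in> carrier V; w \<in> carrier W\<rbrakk> \<Longrightarrow> f v w = g v w"
  shows "bilinear_map V W X g"
proof (rule bilinear_mapI; rule linear_mapsI)
  note f = bilinear_mapD[OF assms(1)] and e = assms(4) and V = vspaceD[OF assms(2)] and W = vspaceD[OF assms(3)]
  fix v w c assume v: "v \<in> carrier V" and w: "w \<in> carrier W"
  show "g v w \<in> carrier X" "g v w \<in> carrier X" using f(3)[OF v w] e[OF v w] by simp_all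
  show "g v (c \<odot>\<^bsub>W\<^esub> w) = c \<odot>\<^bsub>X\<^esub> g v w"
    using linear_mapsD(3)[OF f(1)[OF v] w, of c] e[OF v w] e[OF v W(2)[OF w]] by simp
  show "g (c \<odot>\<^bsub>V\<^esub> v) w = c \<odot>\<^bsub>X\<^esub> g v w"
    using linear_mapsD(3)[OF f(2)[OF w] v, of c] e[OF v w] e[OF V(2)[OF v] w] by simp
  fix v' w' assume v': "v' \<in> carrier V" and w': "w' \<in> carrier W"
  show "g v (w \<oplus>\<^bsub>W\<^esub> w') = g v w \<oplus>\<^bsub>X\<^esub> g v w'"
    using linear_mapsD(2)[OF f(1)[OF v] w w'] e[OF v w] e[OF v w'] e[OF v W(3)[OF w w']] by simp
  show "g (v \<oplus>\<^bsub>V\<^esub> v') w = g v w \<oplus>\<^bsub>X\<^esub> g v' w"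
    using linear_mapsD(2)[OF f(2)[OF w] v v'] e[OF v w] e[OF v' w] e[OF V(3)[OF v v'] w] by simp
qed

text \<open>A Fubini rule: both sides are linear in \<open>s\<close>, and on a pure tensor the sum
  over \<open>s\<close> reduces to one term.\<close>

lemma tensor_lift_swap:
  assumes P: "tensor_pair V W" and Q: "tensor_pair V' W'" and X: "vspace X"
    and s: "s \<in> carrier (tensor_space V W)" and u: "u \<in> carrier (tensor_space V' W')"
    and f1: "\<And>c d. \<lbrakk>c \<in> carrier V'; d \<in> carrier W'\<rbrakk> \<Longrightarrow> bilinear_map V W X (\<lambda>a b. f a b c d)"
    and f2: "\<And>a b. \<lbrakk>a \<in> carrier V; b \<in> carrier W\<rbrakk> \<Longrightarrow> bilinear_map V' W' X (\<lambda>c d. f a b c d)"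
  shows "tensor_lift X (\<lambda>a b. tensor_lift X (\<lambda>c d. f a b c d) u) s
    = tensor_lift X (\<lambda>c d. tensor_lift X (\<lambda>a b. f a b c d) s) u"
proof -
  interpret P: tensor_pair V W by fact
  interpret Q: tensor_pair V' W' by fact
  have b1: "bilinear_map V W X (\<lambda>a b. tensor_lift X (\<lambda>c d. f a b c d) u)"
  proof (rule bilinear_mapI)
    show "(\<lambda>b. tensor_lift X (\<lambda>c d. f a b c d) u) \<in> linear_maps W X" if "a \<in> carrier V" for a
      by (rule Q.lm_lift_param[OF X _ _ P.W u]) (use that f2 bilinear_mapD(1)[OF f1] in auto)
    show "(\<lambda>a. tensor_lift X (\<lambda>c d. f a b c d) u) \<in> linear_maps V X" if "b \<in> carrier W" for b
      by (rule Q.lm_lift_param[OF X _ _ P.V u]) (use that f2 bilinear_mapD(2)[OF f1] in auto)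
  qed
  have b2: "bilinear_map V' W' X (\<lambda>c d. tensor_lift X (\<lambda>a b. f a b c d) s)" if "s \<in> carrier (tensor_space V W)" for s
  proof (rule bilinear_mapI)
    show "(\<lambda>d. tensor_lift X (\<lambda>a b. f a b c d) s) \<in> linear_maps W' X" if "c \<in> carrier V'" for c
      by (rule P.lm_lift_param[OF X _ _ Q.W]) (use that \<open>s \<in> _\<close> f1 bilinear_mapD(1)[OF f2] in auto)
    show "(\<lambda>c. tensor_lift X (\<lambda>a b. f a b c d) s) \<in> linear_maps V' X" if "d \<in> carrier W'" for d
      by (rule P.lm_lift_param[OF X _ _ Q.V]) (use that \<open>s \<in> _\<close> f1 bilinear_mapD(2)[OF f2] in auto)
  qed
  show ?thesis
  proof (rule P.tensor_ext[OF P.tensor_lift_linear[OF X b1] _ X _ s])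
    show "(\<lambda>s. tensor_lift X (\<lambda>c d. tensor_lift X (\<lambda>a b. f a b c d) s) u) \<in> linear_maps P.T X"
      by (rule Q.lm_lift_param[OF X b2 _ P.vspace_T u]) (auto intro!: P.tensor_lift_linear[OF X f1])
    fix v w assume vw: "v \<in> carrier V" "w \<in> carrier W"
    show "tensor_lift X (\<lambda>a b. tensor_lift X (\<lambda>c d. f a b c d) u) (tensor_elem V W v w)
        = tensor_lift X (\<lambda>c d. tensor_lift X (\<lambda>a b. f a b c d) (tensor_elem V W v w)) u"
      unfolding P.tensor_lift_elem[OF X b1 vw]
      by (rule Q.tensor_lift_cong[OF X f2[OF vw] b2[OF P.telem_closed[OF vw]] u])
        (simp add: P.tensor_lift_elem[OF X f1 vw])
  qed
qed

subsection \<open>Coordinates\<close>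

interpretation pv: vector_space "pscale :: 'k::field \<Rightarrow> ('z \<Rightarrow>\<^sub>0 'k) \<Rightarrow> 'z \<Rightarrow>\<^sub>0 'k"
  by unfold_locales (rule poly_mapping_eqI, simp add: lookup_add algebra_simps)+

text \<open>Take a basis of the kernel of the evaluation map from the free vector space on the carrier
  and extend it by generators.\<close>

lemma ex_coordinates:
  fixes V :: "('k::field, 'v) module"
  assumes V: "vspace V"
  shows "\<exists>\<beta> co. \<beta> \<subseteq> carrier V \<and> (\<forall>b\<in>\<beta>. co b \<in> linear_maps V ground) \<and>
    (\<forall>v\<in>carrier V. finite {b \<in> \<beta>. co b v \<noteq> 0} \<and> v = (\<Oplus>\<^bsub>V\<^esub>b\<in>{b \<in> \<beta>. co b v \<noteq> 0}. co b v \<odot>\<^bsub>V\<^esub> b)) \<and>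
    (\<forall>b\<in>\<beta>. \<forall>b'\<in>\<beta>. co b b' = (if b = b' then 1 else 0))"
proof -
  interpret abelian_group V by (rule vspaceD(1)[OF V])
  \<comment> \<open>The dummy factor \<open>unit\<close> lets \<open>tensor_eval\<close> serve as
    the evaluation of formal sums of vectors.\<close>
  let ?D = "carrier V \<times> (UNIV :: unit set)"
  let ?F = "{p :: ('v \<times> unit) \<Rightarrow>\<^sub>0 'k. Poly_Mapping.keys p \<subseteq> ?D}"
  define ev :: "(('v \<times> unit) \<Rightarrow>\<^sub>0 'k) \<Rightarrow> 'v" where "ev = tensor_eval V (\<lambda>v _. v)"
  define sg :: "'v \<Rightarrow> ('v \<times> unit) \<Rightarrow>\<^sub>0 'k" where "sg v = Poly_Mapping.single (v, ()) 1" for v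
  have ev_closed: "ev p \<in> carrier V" if "p \<in> ?F" for p
    unfolding ev_def by (rule tensor_eval_closed[OF V, of p ?D]) (use that in auto)
  have ev_add: "ev (p + q) = ev p \<oplus>\<^bsub>V\<^esub> ev q" if "p \<in> ?F" "q \<in> ?F" for p q
    unfolding ev_def by (rule tensor_eval_add[OF V, of p ?D q]) (use that in auto)
  have ev_scale: "ev (pscale c p) = c \<odot>\<^bsub>V\<^esub> ev p" if "p \<in> ?F" for c p
    unfolding ev_def by (rule tensor_eval_pscale[OF V, of p ?D]) (use that in auto)
  have ev_sg: "ev (sg v) = v" if "v \<in> carrier V" for v
    unfolding ev_def sg_def using tensor_eval_single[OF V, of "\<lambda>v _. v" v "()" 1] that vspaceD(8)[OF V] by simp
  have ev_0: "ev 0 = \<zero>\<^bsub>V\<^esub>" by (simp add: ev_def tensor_eval_def)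
  have F: "0 \<in> ?F" "\<And>p q. \<lbrakk>p \<in> ?F; q \<in> ?F\<rbrakk> \<Longrightarrow> p + q \<in> ?F" "\<And>c p. p \<in> ?F \<Longrightarrow> pscale c p \<in> ?F"
    "\<And>v. v \<in> carrier V \<Longrightarrow> sg v \<in> ?F"
  proof -
    show "p + q \<in> ?F" if "p \<in> ?F" "q \<in> ?F" for p q using that Poly_Mapping.keys_add[of p q] by blast
    show "pscale c p \<in> ?F" if "p \<in> ?F" for c p using that keys_pscale[of c p] by blast
  qed (auto simp: sg_def)
  have subF: "pv.subspace ?F" unfolding pv.subspace_def using F by blast
  let ?N = "{p \<in> ?F. ev p = \<zero>\<^bsub>V\<^esub>}"
  have subN: "pv.subspace ?N"
    unfolding pv.subspace_def using F ev_0 ev_add ev_scale vspaceD(10)[OF V] by simp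
  obtain BN where BN: "BN \<subseteq> ?N" "pv.independent BN" "?N \<subseteq> pv.span BN"
    using pv.maximal_independent_subset[of ?N] by blast
  obtain B where B: "BN \<subseteq> B" "B \<subseteq> BN \<union> sg ` carrier V" "pv.independent B" "BN \<union> sg ` carrier V \<subseteq> pv.span B"
    using pv.maximal_independent_subset_extend[of BN "BN \<union> sg ` carrier V"] BN(2) by blast
  have spanBN: "pv.span BN = ?N" using BN subN by (simp add: pv.span_minimal subset_antisym)
  \<comment> \<open>The generators added to the kernel basis \<open>BN\<close> give a basis of the
    free space modulo the kernel, which is \<open>V\<close>; \<open>co b\<close> reads off the
    coefficient of the generator \<open>sg b\<close>.\<close>
  define \<beta> where "\<beta> = {v \<in> carrier V. sg v \<in> B - BN}"
  define co where "co b v = pv.representation B (sg v) (sg b)" for b v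
  have inj: "inj sg"
  proof (rule injI)
    fix v w assume "sg v = sg w"
    then have "Poly_Mapping.lookup (sg w) (v, ()) = 1" unfolding sg_def by (metis lookup_single_eq)
    then show "v = w" by (auto simp: sg_def lookup_single when_def split: if_splits)
  qed
  have ev_cancel: "ev d = \<zero>\<^bsub>V\<^esub>" if "d \<in> ?F" "e \<in> ?F" "ev (d + e) = ev e" for d e
  proof -
    have "ev d \<oplus>\<^bsub>V\<^esub> ev e = \<zero>\<^bsub>V\<^esub> \<oplus>\<^bsub>V\<^esub> ev e" using that ev_add[OF that(1,2)] ev_closed by simp
    then show ?thesis using add.right_cancel ev_closed that(1,2) by blast
  qed
  have sgB: "sg v \<in> pv.span B" if "v \<in> carrier V" for v using B(4) that by blast
  have repN: "pv.representation B p (sg b) = 0" if "p \<in> ?N" "b \<in> \<beta>" for p b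
  proof -
    have "pv.representation B p = pv.representation BN p"
      by (rule pv.representation_extend[OF B(3) _ B(1)]) (use that spanBN in blast)
    moreover have "sg b \<notin> BN" using that(2) by (simp add: \<beta>_def)
    ultimately show ?thesis using pv.representation_ne_zero[of BN p "sg b"] by metis
  qed
  have NB: "p \<in> pv.span B" if "p \<in> ?N" for p
    using that spanBN pv.span_mono[OF B(1)] by blast
  have lin: "co b \<in> linear_maps V ground" if b: "b \<in> \<beta>" for b
  proof (rule linear_mapsI)
    fix x y c assume x: "x \<in> carrier V"
    have sx: "pscale c (sg x) \<in> pv.span B" by (rule pv.span_scale[OF sgB[OF x]])
    \<comment> \<open>The failure of \<open>sg\<close> to be linear lies in the kernel of
      evaluation, where the coordinates at \<open>\<beta>\<close> vanish.\<close>
    have n: "sg (c \<odot>\<^bsub>V\<^esub> x) - pscale c (sg x) \<in> ?N"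
    proof -
      have d: "sg (c \<odot>\<^bsub>V\<^esub> x) - pscale c (sg x) \<in> ?F"
        by (rule pv.subspace_diff[OF subF F(4)[OF vspaceD(2)[OF V x]] F(3)[OF F(4)[OF x]]])
      have "ev (sg (c \<odot>\<^bsub>V\<^esub> x) - pscale c (sg x)) = \<zero>\<^bsub>V\<^esub>"
        by (rule ev_cancel[OF d F(3)[OF F(4)[OF x], of c]])
          (simp add: ev_sg[OF vspaceD(2)[OF V x]] ev_scale[OF F(4)[OF x]] ev_sg[OF x])
      then show ?thesis using d by simp
    qed
    have "pv.representation B ((sg (c \<odot>\<^bsub>V\<^esub> x) - pscale c (sg x)) + pscale c (sg x)) (sg b)
        = pv.representation B (sg (c \<odot>\<^bsub>V\<^esub> x) - pscale c (sg x)) (sg b) + pv.representation B (pscale c (sg x)) (sg b)"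
      using pv.representation_add[OF B(3) sx NB[OF n]] by (simp add: add.commute)
    then show "co b (c \<odot>\<^bsub>V\<^esub> x) = c \<odot>\<^bsub>ground\<^esub> co b x"
      using repN[OF n b] pv.representation_scale[OF B(3) sgB[OF x], of c] by (simp add: co_def)
    assume y: "y \<in> carrier V"
    have sxy: "sg x + sg y \<in> pv.span B" by (rule pv.span_add[OF sgB[OF x] sgB[OF y]])
    have n: "sg (x \<oplus>\<^bsub>V\<^esub> y) - (sg x + sg y) \<in> ?N"
    proof -
      have d: "sg (x \<oplus>\<^bsub>V\<^esub> y) - (sg x + sg y) \<in> ?F"
        by (rule pv.subspace_diff[OF subF F(4)[OF vspaceD(3)[OF V x y]] F(2)[OF F(4)[OF x] F(4)[OF y]]])
      have "ev (sg (x \<oplus>\<^bsub>V\<^esub> y) - (sg x + sg y)) = \<zero>\<^bsub>V\<^esub>"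
        by (rule ev_cancel[OF d F(2)[OF F(4)[OF x] F(4)[OF y]]])
          (simp add: ev_sg[OF vspaceD(3)[OF V x y]] ev_add[OF F(4)[OF x] F(4)[OF y]] ev_sg[OF x] ev_sg[OF y])
      then show ?thesis using d by simp
    qed
    have "pv.representation B ((sg (x \<oplus>\<^bsub>V\<^esub> y) - (sg x + sg y)) + (sg x + sg y)) (sg b)
        = pv.representation B (sg (x \<oplus>\<^bsub>V\<^esub> y) - (sg x + sg y)) (sg b) + pv.representation B (sg x + sg y) (sg b)"
      using pv.representation_add[OF B(3) sxy NB[OF n]] by (simp add: add.commute)
    then show "co b (x \<oplus>\<^bsub>V\<^esub> y) = co b x \<oplus>\<^bsub>ground\<^esub> co b y"
      using repN[OF n b] pv.representation_add[OF B(3) sgB[OF y] sgB[OF x]] by (simp add: co_def add.commute)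
  qed simp
  have expand: "finite {b \<in> \<beta>. co b v \<noteq> 0} \<and> v = (\<Oplus>\<^bsub>V\<^esub>b\<in>{b \<in> \<beta>. co b v \<noteq> 0}. co b v \<odot>\<^bsub>V\<^esub> b)"
    if v: "v \<in> carrier V" for v
  proof -
    let ?r = "pv.representation B (sg v)"
    let ?S = "{p. ?r p \<noteq> 0}" and ?C = "{b \<in> \<beta>. co b v \<noteq> 0}"
    have fS: "finite ?S" by (rule pv.finite_representation)
    have SB: "?S \<subseteq> B" using pv.representation_ne_zero by blast
    have img: "sg ` ?C = ?S - BN" using SB B(2) by (auto simp: \<beta>_def co_def)
    have fC: "finite ?C" using finite_imageD[of sg ?C] img fS inj by (simp add: inj_on_subset)
    have sub: "?S \<subseteq> ?F" using SB B(2) BN(1) F(4) by blast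
    have ev_sum: "ev (\<Sum>p\<in>A. pscale (?r p) p) = (\<Oplus>\<^bsub>V\<^esub>p\<in>A. ?r p \<odot>\<^bsub>V\<^esub> ev p) \<and> (\<Sum>p\<in>A. pscale (?r p) p) \<in> ?F"
      if "finite A" "A \<subseteq> ?F" for A
      using that
    proof (induction A rule: finite_induct)
      case (insert p A)
      then have IH: "ev (\<Sum>p\<in>A. pscale (?r p) p) = (\<Oplus>\<^bsub>V\<^esub>p\<in>A. ?r p \<odot>\<^bsub>V\<^esub> ev p)" "(\<Sum>p\<in>A. pscale (?r p) p) \<in> ?F" by auto
      have p: "p \<in> ?F" "A \<subseteq> ?F" using insert.prems by auto
      have "(\<Oplus>\<^bsub>V\<^esub>p\<in>insert p A. ?r p \<odot>\<^bsub>V\<^esub> ev p) = ?r p \<odot>\<^bsub>V\<^esub> ev p \<oplus>\<^bsub>V\<^esub> (\<Oplus>\<^bsub>V\<^esub>p\<in>A. ?r p \<odot>\<^bsub>V\<^esub> ev p)"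
        by (rule finsum_insert) (use insert.hyps p ev_closed vspaceD(2)[OF V] in auto)
      then show ?case
        using ev_add[OF F(3)[OF p(1)] IH(2), of "?r p"] ev_scale[OF p(1), of "?r p"] IH(1) F(2)[OF F(3)[OF p(1)] IH(2), of "?r p"]
        by (simp add: sum.insert[OF insert.hyps])
    qed (simp add: ev_0)
    have "sg v = (\<Sum>p\<in>?S. pscale (?r p) p)"
      using pv.sum_nonzero_representation_eq[OF B(3) sgB[OF v]] by simp
    then have "v = (\<Oplus>\<^bsub>V\<^esub>p\<in>?S. ?r p \<odot>\<^bsub>V\<^esub> ev p)" using ev_sum[OF fS sub] ev_sg[OF v] by simp
    also have "\<dots> = (\<Oplus>\<^bsub>V\<^esub>p\<in>sg ` ?C. ?r p \<odot>\<^bsub>V\<^esub> ev p)"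
    proof (rule add.finprod_mono_neutral_cong_right[OF fS])
      show "sg ` ?C \<subseteq> ?S" using img by blast
      show "?r p \<odot>\<^bsub>V\<^esub> ev p = \<zero>\<^bsub>V\<^esub>" if "p \<in> ?S - sg ` ?C" for p
      proof -
        have "p \<in> BN" using that img by blast
        then show ?thesis using BN(1) vspaceD(10)[OF V] by auto
      qed
      show "(\<lambda>p. ?r p \<odot>\<^bsub>V\<^esub> ev p) \<in> ?S \<rightarrow> carrier V"
        using sub ev_closed vspaceD(2)[OF V] by blast
    qed simp
    also have "\<dots> = (\<Oplus>\<^bsub>V\<^esub>b\<in>?C. ?r (sg b) \<odot>\<^bsub>V\<^esub> ev (sg b))"
      by (rule add.finprod_reindex) (use inj ev_sg vspaceD(2)[OF V] in \<open>auto simp: \<beta>_def inj_on_def\<close>)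
    also have "\<dots> = (\<Oplus>\<^bsub>V\<^esub>b\<in>?C. co b v \<odot>\<^bsub>V\<^esub> b)"
      by (rule finsum_cong') (use ev_sg vspaceD(2)[OF V] in \<open>auto simp: \<beta>_def co_def\<close>)
    finally show ?thesis using fC by blast
  qed
  have dual: "co b b' = (if b = b' then 1 else 0)" if "b \<in> \<beta>" "b' \<in> \<beta>" for b b'
  proof -
    have "sg b' \<in> B" using that by (simp add: \<beta>_def)
    then have "pv.representation B (sg b') = (\<lambda>v. if v = sg b' then 1 else 0)"
      by (rule pv.representation_basis[OF B(3)])
    then show ?thesis using inj by (auto simp: co_def inj_def)
  qed
  have "\<beta> \<subseteq> carrier V" by (auto simp: \<beta>_def)
  then show ?thesis using lin expand dual by (intro exI[of _ \<beta>] exI[of _ co]) simp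
qed

subsection \<open>Sweedler calculus\<close>

definition trilinear ::
  "('k::field, 'u) module \<Rightarrow> ('k, 'v) module \<Rightarrow> ('k, 'w) module \<Rightarrow> ('k, 'x) module \<Rightarrow> ('u \<Rightarrow> 'v \<Rightarrow> 'w \<Rightarrow> 'x) \<Rightarrow> bool" where
  "trilinear U V W X g \<longleftrightarrow>
     (\<forall>u\<in>carrier U. bilinear_map V W X (g u)) \<and>
     (\<forall>v\<in>carrier V. \<forall>w\<in>carrier W. (\<lambda>u. g u v w) \<in> linear_maps U X)"

lemma trilinearI:
  assumes "\<And>u v. \<lbrakk>u \<in> carrier U; v \<in> carrier V\<rbrakk> \<Longrightarrow> (\<lambda>w. g u v w) \<in> linear_maps W X"
    "\<And>u w. \<lbrakk>u \<in> carrier U; w \<in> carrier W\<rbrakk> \<Longrightarrow> (\<lambda>v. g u v w) \<in> linear_maps V X"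
    "\<And>v w. \<lbrakk>v \<in> carrier V; w \<in> carrier W\<rbrakk> \<Longrightarrow> (\<lambda>u. g u v w) \<in> linear_maps U X"
  shows "trilinear U V W X g"
  using assms by (simp add: trilinear_def bilinear_map_def)

lemma trilinearD:
  assumes "trilinear U V W X g"
  shows "\<And>u v. \<lbrakk>u \<in> carrier U; v \<in> carrier V\<rbrakk> \<Longrightarrow> (\<lambda>w. g u v w) \<in> linear_maps W X"
    "\<And>u w. \<lbrakk>u \<in> carrier U; w \<in> carrier W\<rbrakk> \<Longrightarrow> (\<lambda>v. g u v w) \<in> linear_maps V X"
    "\<And>v w. \<lbrakk>v \<in> carrier V; w \<in> carrier W\<rbrakk> \<Longrightarrow> (\<lambda>u. g u v w) \<in> linear_maps U X"
    "\<And>u. u \<in> carrier U \<Longrightarrow> bilinear_map V W X (\<lambda>v w. g u v w)"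
    "\<And>v. v \<in> carrier V \<Longrightarrow> bilinear_map U W X (\<lambda>u w. g u v w)"
    "\<And>w. w \<in> carrier W \<Longrightarrow> bilinear_map U V X (\<lambda>u v. g u v w)"
  using assms by (simp_all add: trilinear_def bilinear_map_def)

context algebra_over_field begin

lemma vspace_A: "vspace A" by (rule vectorspace_axioms)

lemma mult_bilinear: "bilinear_map A A A (\<lambda>x y. x \<otimes>\<^bsub>A\<^esub> y)"
  by (rule bilinear_mapI; rule linear_mapsI)
    (simp_all add: r_distr l_distr smult_mult_left smult_mult_right)

end

context hopf_algebra begin

sublocale HH: tensor_pair H H
  by (rule tensor_pair.intro[OF vspace_A vspace_A])

abbreviation "HT \<equiv> tensor_space H H"

definition sw :: "('k, 'x) module \<Rightarrow> ('h \<Rightarrow> 'h \<Rightarrow> 'x) \<Rightarrow> 'h \<Rightarrow> 'x" where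
  "sw X f h = tensor_lift X f (\<Delta> h)"

lemma \<Delta>_closed: "h \<in> carrier H \<Longrightarrow> \<Delta> h \<in> carrier HT"
  by (rule linear_mapsD(1)[OF comult_linear])

lemma sw_linear:
  assumes "vspace X" "bilinear_map H H X f" shows "(\<lambda>h. sw X f h) \<in> linear_maps H X"
  unfolding sw_def by (rule lm_comp[OF HH.tensor_lift_linear[OF assms] comult_linear])

lemma sw_lm:
  assumes "vspace X" "bilinear_map H H X f" "g \<in> linear_maps Y H"
  shows "(\<lambda>x. sw X f (g x)) \<in> linear_maps Y X"
  by (rule lm_comp[OF sw_linear[OF assms(1,2)] assms(3)])

lemma sw_closed: "\<lbrakk>vspace X; bilinear_map H H X f; h \<in> carrier H\<rbrakk> \<Longrightarrow> sw X f h \<in> carrier X"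
  by (rule linear_mapsD(1)[OF sw_linear])

lemma sw_param:
  assumes "vspace X" "vspace Y" "h \<in> carrier H" "trilinear Y H H X g"
  shows "(\<lambda>x. sw X (g x) h) \<in> linear_maps Y X"
  unfolding sw_def
  by (rule HH.lm_lift_param[OF assms(1) trilinearD(4)[OF assms(4)] trilinearD(3)[OF assms(4)] assms(2) \<Delta>_closed[OF assms(3)]])

lemma sw_hom:
  assumes "vspace X" "vspace Y" "bilinear_map H H X f" "\<phi> \<in> linear_maps X Y" "h \<in> carrier H"
  shows "\<phi> (sw X f h) = sw Y (\<lambda>a b. \<phi> (f a b)) h"
  unfolding sw_def by (rule HH.tensor_lift_comp[OF assms(1-4) \<Delta>_closed[OF assms(5)]])

lemma sw_cong:
  assumes "vspace X" "bilinear_map H H X f" "h \<in> carrier H"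
    "\<And>a b. \<lbrakk>a \<in> carrier H; b \<in> carrier H\<rbrakk> \<Longrightarrow> f a b = g a b"
  shows "sw X f h = sw X g h"
  unfolding sw_def
  by (rule HH.tensor_lift_cong[OF assms(1,2) bilinear_map_cong[OF assms(2) vspace_A vspace_A assms(4)]
        \<Delta>_closed[OF assms(3)] assms(4)])

lemma sw_swap:
  assumes "vspace X" "h \<in> carrier H" "g \<in> carrier H"
    "\<And>c d. \<lbrakk>c \<in> carrier H; d \<in> carrier H\<rbrakk> \<Longrightarrow> bilinear_map H H X (\<lambda>a b. f a b c d)"
    "\<And>a b. \<lbrakk>a \<in> carrier H; b \<in> carrier H\<rbrakk> \<Longrightarrow> bilinear_map H H X (\<lambda>c d. f a b c d)"
  shows "sw X (\<lambda>a b. sw X (\<lambda>c d. f a b c d) g) h = sw X (\<lambda>c d. sw X (\<lambda>a b. f a b c d) h) g"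
  unfolding sw_def
  by (rule tensor_lift_swap[OF HH.tensor_pair_axioms HH.tensor_pair_axioms assms(1)
        \<Delta>_closed[OF assms(2)] \<Delta>_closed[OF assms(3)] assms(4,5)])

lemma sw_one:
  assumes "vspace X" "bilinear_map H H X f" shows "sw X f \<one>\<^bsub>H\<^esub> = f \<one>\<^bsub>H\<^esub> \<one>\<^bsub>H\<^esub>"
proof -
  have "\<Delta> \<one>\<^bsub>H\<^esub> = tensor_elem H H \<one>\<^bsub>H\<^esub> \<one>\<^bsub>H\<^esub>"
    using ring_hom_one[OF comult_hom] by (simp add: tensor_algebra_def)
  then show ?thesis by (simp add: sw_def HH.tensor_lift_elem[OF assms])
qed

text \<open>Multiplicativity of \<open>\<Delta>\<close> is an equation in
  \<open>H \<otimes> H\<close>; the linear map induced by \<open>f\<close> turns it into a rule for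
  arbitrary integrands.\<close>

lemma sw_mult:
  assumes X: "vspace X" and f: "bilinear_map H H X f" and h: "h \<in> carrier H" and g: "g \<in> carrier H"
  shows "sw X f (h \<otimes>\<^bsub>H\<^esub> g) = sw X (\<lambda>a b. sw X (\<lambda>c d. f (a \<otimes>\<^bsub>H\<^esub> c) (b \<otimes>\<^bsub>H\<^esub> d)) g) h"
proof -
  have b1: "bilinear_map H H HT (\<lambda>c d. tensor_elem H H (a \<otimes>\<^bsub>H\<^esub> c) (b \<otimes>\<^bsub>H\<^esub> d))"
    if "a \<in> carrier H" "b \<in> carrier H" for a b
    by (rule bilinear_mapI)
      (use that in \<open>auto intro!: lm_bil_left[OF HH.bilinear_telem] lm_bil_right[OF HH.bilinear_telem] bilinear_mapD(1)[OF mult_bilinear]\<close>)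
  have b2: "bilinear_map H H HT (\<lambda>a b. tensor_elem H H (a \<otimes>\<^bsub>H\<^esub> c) (b \<otimes>\<^bsub>H\<^esub> d))"
    if "c \<in> carrier H" "d \<in> carrier H" for c d
    by (rule bilinear_mapI)
      (use that in \<open>auto intro!: lm_bil_left[OF HH.bilinear_telem] lm_bil_right[OF HH.bilinear_telem] bilinear_mapD(2)[OF mult_bilinear]\<close>)
  have b3: "bilinear_map H H HT (\<lambda>a b. sw HT (\<lambda>c d. tensor_elem H H (a \<otimes>\<^bsub>H\<^esub> c) (b \<otimes>\<^bsub>H\<^esub> d)) g)"
  proof (rule bilinear_mapI)
    show "(\<lambda>b. sw HT (\<lambda>c d. tensor_elem H H (a \<otimes>\<^bsub>H\<^esub> c) (b \<otimes>\<^bsub>H\<^esub> d)) g) \<in> linear_maps H HT" if "a \<in> carrier H" for a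
      by (rule sw_param[OF HH.vspace_T vspace_A g]) (use that b1 bilinear_mapD(1)[OF b2] in \<open>auto simp: trilinear_def\<close>)
    show "(\<lambda>a. sw HT (\<lambda>c d. tensor_elem H H (a \<otimes>\<^bsub>H\<^esub> c) (b \<otimes>\<^bsub>H\<^esub> d)) g) \<in> linear_maps H HT" if "b \<in> carrier H" for b
      by (rule sw_param[OF HH.vspace_T vspace_A g]) (use that b1 bilinear_mapD(2)[OF b2] in \<open>auto simp: trilinear_def\<close>)
  qed
  note L = HH.tensor_lift_linear[OF X f]
  have "\<Delta> (h \<otimes>\<^bsub>H\<^esub> g) = sw HT (\<lambda>a b. sw HT (\<lambda>c d. tensor_elem H H (a \<otimes>\<^bsub>H\<^esub> c) (b \<otimes>\<^bsub>H\<^esub> d)) g) h"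
    using ring_hom_mult[OF comult_hom h g] by (simp add: tensor_algebra_def sw_def)
  then have "sw X f (h \<otimes>\<^bsub>H\<^esub> g)
      = tensor_lift X f (sw HT (\<lambda>a b. sw HT (\<lambda>c d. tensor_elem H H (a \<otimes>\<^bsub>H\<^esub> c) (b \<otimes>\<^bsub>H\<^esub> d)) g) h)"
    by (simp add: sw_def)
  also have "\<dots> = sw X (\<lambda>a b. tensor_lift X f (sw HT (\<lambda>c d. tensor_elem H H (a \<otimes>\<^bsub>H\<^esub> c) (b \<otimes>\<^bsub>H\<^esub> d)) g)) h"
    by (rule sw_hom[OF HH.vspace_T X b3 L h])
  also have "\<dots> = sw X (\<lambda>a b. sw X (\<lambda>c d. f (a \<otimes>\<^bsub>H\<^esub> c) (b \<otimes>\<^bsub>H\<^esub> d)) g) h"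
  proof (rule sw_cong[OF X _ h])
    show "bilinear_map H H X (\<lambda>a b. tensor_lift X f (sw HT (\<lambda>c d. tensor_elem H H (a \<otimes>\<^bsub>H\<^esub> c) (b \<otimes>\<^bsub>H\<^esub> d)) g))"
      by (rule bilinear_mapI) (auto intro: lm_comp[OF L] bilinear_mapD[OF b3])
    fix a b assume ab: "a \<in> carrier H" "b \<in> carrier H"
    have "tensor_lift X f (sw HT (\<lambda>c d. tensor_elem H H (a \<otimes>\<^bsub>H\<^esub> c) (b \<otimes>\<^bsub>H\<^esub> d)) g)
        = sw X (\<lambda>c d. tensor_lift X f (tensor_elem H H (a \<otimes>\<^bsub>H\<^esub> c) (b \<otimes>\<^bsub>H\<^esub> d))) g"
      by (rule sw_hom[OF HH.vspace_T X b1[OF ab] L g])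
    also have "\<dots> = sw X (\<lambda>c d. f (a \<otimes>\<^bsub>H\<^esub> c) (b \<otimes>\<^bsub>H\<^esub> d)) g"
      by (rule sw_cong[OF X _ g])
        (use ab in \<open>auto intro!: bilinear_mapI lm_comp[OF L] bilinear_mapD[OF b1] simp: HH.tensor_lift_elem[OF X f]\<close>)
    finally show "tensor_lift X f (sw HT (\<lambda>c d. tensor_elem H H (a \<otimes>\<^bsub>H\<^esub> c) (b \<otimes>\<^bsub>H\<^esub> d)) g)
        = sw X (\<lambda>c d. f (a \<otimes>\<^bsub>H\<^esub> c) (b \<otimes>\<^bsub>H\<^esub> d)) g" .
  qed
  finally show ?thesis .
qed

lemma sw_bil_left:
  assumes "vspace X" "trilinear H H H X g"
  shows "bilinear_map H H X (\<lambda>h1 h2. sw X (\<lambda>a b. g a b h2) h1)"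
proof (rule bilinear_mapI)
  show "(\<lambda>h2. sw X (\<lambda>a b. g a b h2) h1) \<in> linear_maps H X" if "h1 \<in> carrier H" for h1
    by (rule sw_param[OF assms(1) vspace_A that]) (use trilinearD[OF assms(2)] in \<open>auto intro!: trilinearI\<close>)
  show "(\<lambda>h1. sw X (\<lambda>a b. g a b h2) h1) \<in> linear_maps H X" if "h2 \<in> carrier H" for h2
    by (rule sw_linear[OF assms(1) trilinearD(6)[OF assms(2) that]])
qed

lemma sw_bil_right:
  assumes "vspace X" "trilinear H H H X g"
  shows "bilinear_map H H X (\<lambda>h1 h2. sw X (\<lambda>b c. g h1 b c) h2)"
proof (rule bilinear_mapI)
  show "(\<lambda>h2. sw X (\<lambda>b c. g h1 b c) h2) \<in> linear_maps H X" if "h1 \<in> carrier H" for h1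
    by (rule sw_linear[OF assms(1) trilinearD(4)[OF assms(2) that]])
  show "(\<lambda>h1. sw X (\<lambda>b c. g h1 b c) h2) \<in> linear_maps H X" if "h2 \<in> carrier H" for h2
    by (rule sw_param[OF assms(1) vspace_A that assms(2)])
qed

text \<open>\<open>coassoc\<close> is a single equation in
  \<open>H \<otimes> (H \<otimes> H)\<close>. The linear map \<open>\<Phi>\<close> that
  \<open>g\<close> induces there yields the rule for every trilinear integrand.\<close>

lemma sw_coassoc:
  assumes X: "vspace X" and g: "trilinear H H H X g" and h: "h \<in> carrier H"
  shows "sw X (\<lambda>h1 h2. sw X (\<lambda>a b. g a b h2) h1) h = sw X (\<lambda>h1 h2. sw X (\<lambda>b c. g h1 b c) h2) h"
proof -
  interpret HHH: tensor_pair H HT by (rule tensor_pair.intro[OF vspace_A HH.vspace_T])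
  let ?T3 = "tensor_space H HT"
  let ?e = "\<lambda>a b c. tensor_elem H HT a (tensor_elem H H b c)"
  define \<Phi> where "\<Phi> = tensor_lift X (\<lambda>a t. tensor_lift X (\<lambda>b c. g a b c) t)"
  have bil: "bilinear_map H HT X (\<lambda>a t. tensor_lift X (\<lambda>b c. g a b c) t)"
  proof (rule bilinear_mapI)
    show "(\<lambda>t. tensor_lift X (\<lambda>b c. g a b c) t) \<in> linear_maps HT X" if "a \<in> carrier H" for a
      by (rule HH.tensor_lift_linear[OF X trilinearD(4)[OF g that]])
    show "(\<lambda>a. tensor_lift X (\<lambda>b c. g a b c) t) \<in> linear_maps H X" if "t \<in> carrier HT" for t
      by (rule HH.lm_lift_param[OF X trilinearD(4)[OF g] trilinearD(3)[OF g] vspace_A that])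
  qed
  have \<Phi>: "\<Phi> \<in> linear_maps ?T3 X" unfolding \<Phi>_def by (rule HHH.tensor_lift_linear[OF X bil])
  have \<Phi>_elem: "\<Phi> (tensor_elem H HT a t) = tensor_lift X (\<lambda>b c. g a b c) t"
    if "a \<in> carrier H" "t \<in> carrier HT" for a t
    unfolding \<Phi>_def by (rule HHH.tensor_lift_elem[OF X bil that])
  have \<Phi>_e: "\<Phi> (?e a b c) = g a b c" if "a \<in> carrier H" "b \<in> carrier H" "c \<in> carrier H" for a b c
    using \<Phi>_elem[OF that(1) HH.telem_closed[OF that(2,3)]] HH.tensor_lift_elem[OF X trilinearD(4)[OF g that(1)] that(2,3)] by simp
  have tri: "trilinear H H H ?T3 ?e"
    by (rule trilinearI)
      (auto intro!: lm_bil_right[OF HHH.bilinear_telem] bilinear_mapD[OF HH.bilinear_telem] bilinear_mapD(2)[OF HHH.bilinear_telem])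
  have co: "sw ?T3 (\<lambda>h1 h2. sw ?T3 (\<lambda>a b. ?e a b h2) h1) h = sw ?T3 (\<lambda>h1 h2. tensor_elem H HT h1 (\<Delta> h2)) h"
    using coassoc[OF h] by (simp add: sw_def)
  have bl: "bilinear_map H H ?T3 (\<lambda>h1 h2. sw ?T3 (\<lambda>a b. ?e a b h2) h1)"
    by (rule sw_bil_left[OF HHH.vspace_T tri])
  have br: "bilinear_map H H ?T3 (\<lambda>h1 h2. tensor_elem H HT h1 (\<Delta> h2))"
    by (rule bilinear_mapI)
      (auto intro!: lm_bil_right[OF HHH.bilinear_telem comult_linear] bilinear_mapD(2)[OF HHH.bilinear_telem] \<Delta>_closed)
  have "\<Phi> (sw ?T3 (\<lambda>h1 h2. sw ?T3 (\<lambda>a b. ?e a b h2) h1) h) = sw X (\<lambda>h1 h2. sw X (\<lambda>a b. g a b h2) h1) h"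
  proof -
    have "\<Phi> (sw ?T3 (\<lambda>h1 h2. sw ?T3 (\<lambda>a b. ?e a b h2) h1) h)
        = sw X (\<lambda>h1 h2. \<Phi> (sw ?T3 (\<lambda>a b. ?e a b h2) h1)) h"
      by (rule sw_hom[OF HHH.vspace_T X bl \<Phi> h])
    also have "\<dots> = sw X (\<lambda>h1 h2. sw X (\<lambda>a b. g a b h2) h1) h"
    proof (rule sw_cong[OF X _ h])
      show "bilinear_map H H X (\<lambda>h1 h2. \<Phi> (sw ?T3 (\<lambda>a b. ?e a b h2) h1))"
        by (rule bilinear_mapI) (auto intro: lm_comp[OF \<Phi>] bilinear_mapD[OF bl])
      fix h1 h2 assume hh: "h1 \<in> carrier H" "h2 \<in> carrier H"
      have "\<Phi> (sw ?T3 (\<lambda>a b. ?e a b h2) h1) = sw X (\<lambda>a b. \<Phi> (?e a b h2)) h1"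
        by (rule sw_hom[OF HHH.vspace_T X trilinearD(6)[OF tri hh(2)] \<Phi> hh(1)])
      also have "\<dots> = sw X (\<lambda>a b. g a b h2) h1"
        by (rule sw_cong[OF X _ hh(1)])
          (use hh(2) in \<open>auto intro!: bilinear_mapI lm_comp[OF \<Phi>] bilinear_mapD[OF trilinearD(6)[OF tri]] simp: \<Phi>_e\<close>)
      finally show "\<Phi> (sw ?T3 (\<lambda>a b. ?e a b h2) h1) = sw X (\<lambda>a b. g a b h2) h1" .
    qed
    finally show ?thesis .
  qed
  moreover have "\<Phi> (sw ?T3 (\<lambda>h1 h2. tensor_elem H HT h1 (\<Delta> h2)) h) = sw X (\<lambda>h1 h2. sw X (\<lambda>b c. g h1 b c) h2) h"
  proof -
    have "\<Phi> (sw ?T3 (\<lambda>h1 h2. tensor_elem H HT h1 (\<Delta> h2)) h) = sw X (\<lambda>h1 h2. \<Phi> (tensor_elem H HT h1 (\<Delta> h2))) h"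
      by (rule sw_hom[OF HHH.vspace_T X br \<Phi> h])
    also have "\<dots> = sw X (\<lambda>h1 h2. sw X (\<lambda>b c. g h1 b c) h2) h"
    proof (rule sw_cong[OF X _ h])
      show "bilinear_map H H X (\<lambda>h1 h2. \<Phi> (tensor_elem H HT h1 (\<Delta> h2)))"
        by (rule bilinear_mapI) (auto intro: lm_comp[OF \<Phi>] bilinear_mapD[OF br])
      show "\<Phi> (tensor_elem H HT a (\<Delta> b)) = sw X (\<lambda>b c. g a b c) b" if "a \<in> carrier H" "b \<in> carrier H" for a b
        using \<Phi>_elem[OF that(1) \<Delta>_closed[OF that(2)]] by (simp add: sw_def)
    qed
    finally show ?thesis .
  qed
  ultimately show ?thesis using co by simp
qed

lemma functional_\<epsilon>: "\<epsilon> \<in> linear_maps H ground"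
  using ring_hom_add[OF counit_hom] by (intro linear_mapsI) (auto simp: counit_smult class_ring_simps)

lemma sw_counit_left:
  assumes X: "vspace X" and f: "f \<in> linear_maps H X" and h: "h \<in> carrier H"
  shows "sw X (\<lambda>a b. \<epsilon> a \<odot>\<^bsub>X\<^esub> f b) h = f h"
proof -
  have "f (sw H (\<lambda>a b. \<epsilon> a \<odot>\<^bsub>H\<^esub> b) h) = sw X (\<lambda>a b. f (\<epsilon> a \<odot>\<^bsub>H\<^esub> b)) h"
    by (rule sw_hom[OF vspace_A X bil_functional_smult_right[OF functional_\<epsilon> vspace_A vspace_A lm_id] f h])
  also have "\<dots> = sw X (\<lambda>a b. \<epsilon> a \<odot>\<^bsub>X\<^esub> f b) h"
    by (rule sw_cong[OF X _ h, symmetric, OF bil_functional_smult_right[OF functional_\<epsilon> X vspace_A f]])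
      (simp add: linear_mapsD(3)[OF f])
  finally show ?thesis using counit_left[OF h] by (simp add: sw_def)
qed

lemma sw_counit_right:
  assumes X: "vspace X" and f: "f \<in> linear_maps H X" and h: "h \<in> carrier H"
  shows "sw X (\<lambda>a b. \<epsilon> b \<odot>\<^bsub>X\<^esub> f a) h = f h"
proof -
  have "f (sw H (\<lambda>a b. \<epsilon> b \<odot>\<^bsub>H\<^esub> a) h) = sw X (\<lambda>a b. f (\<epsilon> b \<odot>\<^bsub>H\<^esub> a)) h"
    by (rule sw_hom[OF vspace_A X bil_functional_smult_left[OF functional_\<epsilon> vspace_A vspace_A lm_id] f h])
  also have "\<dots> = sw X (\<lambda>a b. \<epsilon> b \<odot>\<^bsub>X\<^esub> f a) h"
    by (rule sw_cong[OF X _ h, symmetric, OF bil_functional_smult_left[OF functional_\<epsilon> X vspace_A f]])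
      (simp add: linear_mapsD(3)[OF f])
  finally show ?thesis using counit_right[OF h] by (simp add: sw_def)
qed

lemma S_closed: "h \<in> carrier H \<Longrightarrow> S h \<in> carrier H"
  by (rule linear_mapsD(1)[OF antipode_linear])

lemma bil_S_right: "bilinear_map H H H (\<lambda>a b. a \<otimes>\<^bsub>H\<^esub> S b)"
  by (rule bilinear_mapI)
    (auto intro!: lm_bil_right[OF mult_bilinear antipode_linear] bilinear_mapD(2)[OF mult_bilinear] S_closed)

lemma sw_antipode_right:
  assumes X: "vspace X" and f: "f \<in> linear_maps H X" and h: "h \<in> carrier H"
  shows "sw X (\<lambda>a b. f (a \<otimes>\<^bsub>H\<^esub> S b)) h = \<epsilon> h \<odot>\<^bsub>X\<^esub> f \<one>\<^bsub>H\<^esub>"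
  using sw_hom[OF vspace_A X bil_S_right f h] antipode_right[OF h] linear_mapsD(3)[OF f one_closed]
  by (simp add: sw_def)

end

subsection \<open>Semisimple Hopf algebras are finite-dimensional\<close>

context hopf_algebra begin

lemma counit_mult: "\<lbrakk>x \<in> carrier H; y \<in> carrier H\<rbrakk> \<Longrightarrow> \<epsilon> (x \<otimes>\<^bsub>H\<^esub> y) = \<epsilon> x * \<epsilon> y"
  and counit_one: "\<epsilon> \<one>\<^bsub>H\<^esub> = 1"
  using ring_hom_mult[OF counit_hom] ring_hom_one[OF counit_hom] by (auto simp: class_ring_simps)

lemma smult_closed_H: "h \<in> carrier H \<Longrightarrow> c \<odot>\<^bsub>H\<^esub> h \<in> carrier H"
  using vspaceD(2)[OF vspace_A] .

text \<open>Semisimplicity provides a right ideal \<open>J\<close> complementing the kernel of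
  \<open>\<epsilon>\<close>, and \<open>t\<close> is the component of 1 in \<open>J\<close>. The
  element \<open>t g - \<epsilon>(g) t\<close> lies both in \<open>J\<close> and in the kernel, so
  it vanishes.\<close>

lemma exists_integral:
  assumes "semisimple_ring H"
  obtains t where "t \<in> carrier H" "\<epsilon> t = 1" "\<And>g. g \<in> carrier H \<Longrightarrow> t \<otimes>\<^bsub>H\<^esub> g = \<epsilon> g \<odot>\<^bsub>H\<^esub> t"
proof -
  note \<epsilon>D = linear_mapsD(2,3)[OF functional_\<epsilon>]
  let ?I = "{h \<in> carrier H. \<epsilon> h = 0}"
  have \<epsilon>0: "\<epsilon> \<zero>\<^bsub>H\<^esub> = 0" using \<epsilon>D(2)[of "\<zero>\<^bsub>H\<^esub>" 0] vspaceD(10)[OF vspace_A] by simp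
  have I: "right_ideal ?I H"
    by (rule right_idealI) (use \<epsilon>D(1) \<epsilon>0 counit_mult in auto)
  then obtain J where J: "right_ideal J H" "?I \<inter> J = {\<zero>\<^bsub>H\<^esub>}" "?I <+>\<^bsub>H\<^esub> J = carrier H"
    using assms unfolding semisimple_ring_def by blast
  note JD = right_idealD[OF J(1)]
  have "\<one>\<^bsub>H\<^esub> \<in> ?I <+>\<^bsub>H\<^esub> J" using J(3) by simp
  then obtain x t where xt: "x \<in> ?I" "t \<in> J" "\<one>\<^bsub>H\<^esub> = x \<oplus>\<^bsub>H\<^esub> t" unfolding set_add_def' by blast
  have tc: "t \<in> carrier H" using xt JD(1) by blast
  have \<epsilon>t: "\<epsilon> t = 1" using \<epsilon>D(1)[of x t] xt tc counit_one by simp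
  have "t \<otimes>\<^bsub>H\<^esub> g = \<epsilon> g \<odot>\<^bsub>H\<^esub> t" if g: "g \<in> carrier H" for g
  proof -
    let ?d = "t \<otimes>\<^bsub>H\<^esub> g \<ominus>\<^bsub>H\<^esub> \<epsilon> g \<odot>\<^bsub>H\<^esub> t"
    have "\<epsilon> g \<odot>\<^bsub>H\<^esub> t = t \<otimes>\<^bsub>H\<^esub> (\<epsilon> g \<odot>\<^bsub>H\<^esub> \<one>\<^bsub>H\<^esub>)"
      using smult_mult_right[OF tc one_closed, of "\<epsilon> g"] tc by simp
    then have "\<epsilon> g \<odot>\<^bsub>H\<^esub> t \<in> J" using JD(4)[OF xt(2) smult_closed_H[OF one_closed]] by simp
    then have dJ: "?d \<in> J" using right_ideal_minus[OF J(1) JD(4)[OF xt(2) g]] by simp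
    then have dc: "?d \<in> carrier H" using JD(1) by blast
    have e: "?d \<oplus>\<^bsub>H\<^esub> \<epsilon> g \<odot>\<^bsub>H\<^esub> t = t \<otimes>\<^bsub>H\<^esub> g"
      using tc g smult_closed_H[OF tc, of "\<epsilon> g"] by (simp add: a_minus_def a_assoc l_neg)
    have "\<epsilon> ?d + \<epsilon> (\<epsilon> g \<odot>\<^bsub>H\<^esub> t) = \<epsilon> (t \<otimes>\<^bsub>H\<^esub> g)"
      using \<epsilon>D(1)[OF dc smult_closed_H[OF tc, of "\<epsilon> g"]] e by simp
    then have "\<epsilon> ?d = 0" using \<epsilon>D(2)[OF tc, of "\<epsilon> g"] counit_mult[OF tc g] \<epsilon>t by simp
    then have "?d = \<zero>\<^bsub>H\<^esub>" using dJ dc J(2) by blast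
    then show ?thesis using e smult_closed_H[OF tc, of "\<epsilon> g"] by simp
  qed
  then show ?thesis using tc \<epsilon>t that by blast
qed

lemma mult_lm_left: "g \<in> linear_maps Y H \<Longrightarrow> h \<in> carrier H \<Longrightarrow> (\<lambda>x. g x \<otimes>\<^bsub>H\<^esub> h) \<in> linear_maps Y H"
  by (rule lm_bil_left[OF mult_bilinear])

lemma mult_lm_right: "g \<in> linear_maps Y H \<Longrightarrow> h \<in> carrier H \<Longrightarrow> (\<lambda>x. h \<otimes>\<^bsub>H\<^esub> g x) \<in> linear_maps Y H"
  by (rule lm_bil_right[OF mult_bilinear])

text \<open>In Sweedler form: \<open>t1 h \<otimes> t2 = t1 h1 \<otimes> t2 h2 S(h3) =
  \<epsilon>(h1) t1 \<otimes> t2 S(h2) = t1 \<otimes> t2 S(h)\<close>, where the middle equality is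
  \<open>t h1 = \<epsilon>(h1) t\<close>.\<close>

lemma integral_shift:
  assumes X: "vspace X" and F: "bilinear_map H H X F" and h: "h \<in> carrier H"
    and t: "t \<in> carrier H" "\<And>g. g \<in> carrier H \<Longrightarrow> t \<otimes>\<^bsub>H\<^esub> g = \<epsilon> g \<odot>\<^bsub>H\<^esub> t"
  shows "sw X (\<lambda>a b. F (a \<otimes>\<^bsub>H\<^esub> h) b) t = sw X (\<lambda>a b. F a (b \<otimes>\<^bsub>H\<^esub> S h)) t"
proof -
  note FD = bilinear_mapD[OF F]
  have Fk: "bilinear_map H H X (\<lambda>a b. F a (b \<otimes>\<^bsub>H\<^esub> k))" if "k \<in> carrier H" for k
    by (rule bilinear_mapI) (use that in \<open>auto intro!: lm_bil_right[OF F] FD(2) mult_lm_left lm_id\<close>)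
  have lin_k: "(\<lambda>k. sw X (\<lambda>a b. F a (b \<otimes>\<^bsub>H\<^esub> k)) t') \<in> linear_maps H X" if "t' \<in> carrier H" for t'
    by (rule sw_param[OF X vspace_A that], rule trilinearI)
      (auto intro!: lm_bil_right[OF F] FD(2) mult_lm_left mult_lm_right lm_id)
  \<comment> \<open>The Sweedler sum of \<open>G h1 (S h2)\<close> is evaluated twice: the integral
    property gives the right side of the claim, multiplicativity of \<open>\<Delta>\<close> and the
    antipode give the left side.\<close>
  define G where "G = (\<lambda>g k. sw X (\<lambda>a b. F a (b \<otimes>\<^bsub>H\<^esub> k)) (t \<otimes>\<^bsub>H\<^esub> g))"
  have G1: "G g k = \<epsilon> g \<odot>\<^bsub>X\<^esub> sw X (\<lambda>a b. F a (b \<otimes>\<^bsub>H\<^esub> k)) t" if "g \<in> carrier H" "k \<in> carrier H" for g k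
    unfolding G_def t(2)[OF that(1)] by (rule linear_mapsD(3)[OF sw_linear[OF X Fk[OF that(2)]] t(1)])
  have bG: "bilinear_map H H X (\<lambda>a b. G a (S b))"
  proof (rule bilinear_mapI)
    show "(\<lambda>b. G a (S b)) \<in> linear_maps H X" if "a \<in> carrier H" for a
      unfolding G_def by (rule lm_comp[OF lin_k antipode_linear]) (use that t(1) in simp)
    show "(\<lambda>a. G a (S b)) \<in> linear_maps H X" if "b \<in> carrier H" for b
      unfolding G_def by (rule sw_lm[OF X Fk[OF S_closed[OF that]] mult_lm_right[OF lm_id t(1)]])
  qed
  have "sw X (\<lambda>a b. G a (S b)) h = sw X (\<lambda>a b. \<epsilon> a \<odot>\<^bsub>X\<^esub> sw X (\<lambda>u v. F u (v \<otimes>\<^bsub>H\<^esub> S b)) t) h"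
    by (rule sw_cong[OF X bG h]) (simp add: G1 S_closed)
  also have "\<dots> = sw X (\<lambda>a b. F a (b \<otimes>\<^bsub>H\<^esub> S h)) t"
    by (rule sw_counit_left[OF X lm_comp[OF lin_k[OF t(1)] antipode_linear] h])
  finally have R: "sw X (\<lambda>a b. G a (S b)) h = sw X (\<lambda>a b. F a (b \<otimes>\<^bsub>H\<^esub> S h)) t" .
  have b4: "bilinear_map H H X (\<lambda>c d. F (a \<otimes>\<^bsub>H\<^esub> c) (b \<otimes>\<^bsub>H\<^esub> d \<otimes>\<^bsub>H\<^esub> k))"
    if "a \<in> carrier H" "b \<in> carrier H" "k \<in> carrier H" for a b k
    by (rule bilinear_mapI)
      (use that in \<open>auto intro!: lm_bil_right[OF F] lm_bil_left[OF F] mult_lm_left mult_lm_right lm_id\<close>)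
  have tri: "trilinear H H H X (\<lambda>c d e. F (a \<otimes>\<^bsub>H\<^esub> c) (b \<otimes>\<^bsub>H\<^esub> d \<otimes>\<^bsub>H\<^esub> S e))"
    if "a \<in> carrier H" "b \<in> carrier H" for a b
    by (rule trilinearI)
      (use that in \<open>auto intro!: lm_bil_right[OF F] lm_bil_left[OF F] mult_lm_left mult_lm_right lm_id antipode_linear S_closed\<close>)
  have triab: "trilinear H H H X (\<lambda>a b d. F (a \<otimes>\<^bsub>H\<^esub> c) (b \<otimes>\<^bsub>H\<^esub> d \<otimes>\<^bsub>H\<^esub> k))"
    if "c \<in> carrier H" "k \<in> carrier H" for c k
    by (rule trilinearI)
      (use that in \<open>auto intro!: lm_bil_right[OF F] lm_bil_left[OF F] mult_lm_left mult_lm_right lm_id\<close>)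
  have "sw X (\<lambda>a b. G a (S b)) h
      = sw X (\<lambda>x y. sw X (\<lambda>a b. sw X (\<lambda>c d. F (a \<otimes>\<^bsub>H\<^esub> c) (b \<otimes>\<^bsub>H\<^esub> d \<otimes>\<^bsub>H\<^esub> S y)) x) t) h"
    by (rule sw_cong[OF X bG h]) (simp add: G_def sw_mult[OF X Fk t(1)] S_closed)
  also have "\<dots> = sw X (\<lambda>a b. sw X (\<lambda>x y. sw X (\<lambda>c d. F (a \<otimes>\<^bsub>H\<^esub> c) (b \<otimes>\<^bsub>H\<^esub> d \<otimes>\<^bsub>H\<^esub> S y)) x) h) t"
  proof (rule sw_swap[OF X h t(1)])
    fix a b assume ab: "a \<in> carrier H" "b \<in> carrier H"
    show "bilinear_map H H X (\<lambda>x y. sw X (\<lambda>c d. F (a \<otimes>\<^bsub>H\<^esub> c) (b \<otimes>\<^bsub>H\<^esub> d \<otimes>\<^bsub>H\<^esub> S y)) x)"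
      by (rule sw_bil_left[OF X tri[OF ab]])
  next
    fix x y assume xy: "x \<in> carrier H" "y \<in> carrier H"
    show "bilinear_map H H X (\<lambda>a b. sw X (\<lambda>c d. F (a \<otimes>\<^bsub>H\<^esub> c) (b \<otimes>\<^bsub>H\<^esub> d \<otimes>\<^bsub>H\<^esub> S y)) x)"
    proof (rule bilinear_mapI)
      show "(\<lambda>b. sw X (\<lambda>c d. F (a \<otimes>\<^bsub>H\<^esub> c) (b \<otimes>\<^bsub>H\<^esub> d \<otimes>\<^bsub>H\<^esub> S y)) x) \<in> linear_maps H X" if "a \<in> carrier H" for a
        by (rule sw_param[OF X vspace_A xy(1)], rule trilinearI)
          (use that xy S_closed in \<open>auto intro!: lm_bil_right[OF F] lm_bil_left[OF F] mult_lm_left mult_lm_right lm_id\<close>)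
      show "(\<lambda>a. sw X (\<lambda>c d. F (a \<otimes>\<^bsub>H\<^esub> c) (b \<otimes>\<^bsub>H\<^esub> d \<otimes>\<^bsub>H\<^esub> S y)) x) \<in> linear_maps H X" if "b \<in> carrier H" for b
        by (rule sw_param[OF X vspace_A xy(1)], rule trilinearI)
          (use that xy S_closed in \<open>auto intro!: lm_bil_right[OF F] lm_bil_left[OF F] mult_lm_left mult_lm_right lm_id\<close>)
    qed
  qed
  also have "\<dots> = sw X (\<lambda>a b. F (a \<otimes>\<^bsub>H\<^esub> h) b) t"
  proof (rule sw_cong[OF X _ t(1), symmetric])
    show "bilinear_map H H X (\<lambda>a b. F (a \<otimes>\<^bsub>H\<^esub> h) b)"
      by (rule bilinear_mapI) (use h in \<open>auto intro!: lm_bil_left[OF F] FD(1) mult_lm_left lm_id\<close>)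
    fix a b assume ab: "a \<in> carrier H" "b \<in> carrier H"
    have lin: "(\<lambda>k. F (a \<otimes>\<^bsub>H\<^esub> c) (b \<otimes>\<^bsub>H\<^esub> k)) \<in> linear_maps H X" if "c \<in> carrier H" for c
      using ab that by (auto intro!: lm_bil_right[OF F] mult_lm_right lm_id)
    have lin2: "(\<lambda>c. F (a \<otimes>\<^bsub>H\<^esub> c) b) \<in> linear_maps H X"
      using ab by (auto intro!: lm_bil_left[OF F] mult_lm_right lm_id)
    have "sw X (\<lambda>x y. sw X (\<lambda>c d. F (a \<otimes>\<^bsub>H\<^esub> c) (b \<otimes>\<^bsub>H\<^esub> d \<otimes>\<^bsub>H\<^esub> S y)) x) h
        = sw X (\<lambda>x y. sw X (\<lambda>d e. F (a \<otimes>\<^bsub>H\<^esub> x) (b \<otimes>\<^bsub>H\<^esub> d \<otimes>\<^bsub>H\<^esub> S e)) y) h"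
      by (rule sw_coassoc[OF X tri[OF ab] h])
    also have "\<dots> = sw X (\<lambda>x y. \<epsilon> y \<odot>\<^bsub>X\<^esub> F (a \<otimes>\<^bsub>H\<^esub> x) b) h"
    proof (rule sw_cong[OF X sw_bil_right[OF X tri[OF ab]] h])
      fix x y assume xy: "x \<in> carrier H" "y \<in> carrier H"
      have bs: "bilinear_map H H X (\<lambda>d e. F (a \<otimes>\<^bsub>H\<^esub> x) (b \<otimes>\<^bsub>H\<^esub> d \<otimes>\<^bsub>H\<^esub> S e))"
        by (rule trilinearD(4)[OF tri[OF ab] xy(1)])
      have "sw X (\<lambda>d e. F (a \<otimes>\<^bsub>H\<^esub> x) (b \<otimes>\<^bsub>H\<^esub> d \<otimes>\<^bsub>H\<^esub> S e)) y
          = sw X (\<lambda>d e. F (a \<otimes>\<^bsub>H\<^esub> x) (b \<otimes>\<^bsub>H\<^esub> (d \<otimes>\<^bsub>H\<^esub> S e))) y"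
        by (rule sw_cong[OF X bs xy(2)]) (simp add: m_assoc ab S_closed)
      also have "\<dots> = \<epsilon> y \<odot>\<^bsub>X\<^esub> F (a \<otimes>\<^bsub>H\<^esub> x) (b \<otimes>\<^bsub>H\<^esub> \<one>\<^bsub>H\<^esub>)"
        by (rule sw_antipode_right[OF X lin[OF xy(1)] xy(2)])
      finally show "sw X (\<lambda>d e. F (a \<otimes>\<^bsub>H\<^esub> x) (b \<otimes>\<^bsub>H\<^esub> d \<otimes>\<^bsub>H\<^esub> S e)) y = \<epsilon> y \<odot>\<^bsub>X\<^esub> F (a \<otimes>\<^bsub>H\<^esub> x) b"
        using ab by simp
    qed
    also have "\<dots> = F (a \<otimes>\<^bsub>H\<^esub> h) b" by (rule sw_counit_right[OF X lin2 h])
    finally show "F (a \<otimes>\<^bsub>H\<^esub> h) b = sw X (\<lambda>x y. sw X (\<lambda>c d. F (a \<otimes>\<^bsub>H\<^esub> c) (b \<otimes>\<^bsub>H\<^esub> d \<otimes>\<^bsub>H\<^esub> S y)) x) h" by simp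
  qed
  finally show ?thesis using R by simp
qed

text \<open>If \<open>t\<close> is an integral then the span of the left legs of \<open>\<Delta> t\<close> is a right ideal, and it
  contains \<open>1 = t\<^sub>1 S(t\<^sub>2)\<close>.\<close>

lemma finite_basis:
  assumes t: "t \<in> carrier H" "\<epsilon> t = 1" "\<And>g. g \<in> carrier H \<Longrightarrow> t \<otimes>\<^bsub>H\<^esub> g = \<epsilon> g \<odot>\<^bsub>H\<^esub> t"
  obtains \<beta> co where "finite \<beta>" "\<beta> \<subseteq> carrier H" "\<And>b. b \<in> \<beta> \<Longrightarrow> co b \<in> linear_maps H ground"
    "\<And>h. h \<in> carrier H \<Longrightarrow> h = (\<Oplus>\<^bsub>H\<^esub>b\<in>\<beta>. co b h \<odot>\<^bsub>H\<^esub> b)"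
    "\<And>b b'. \<lbrakk>b \<in> \<beta>; b' \<in> \<beta>\<rbrakk> \<Longrightarrow> co b b' = (if b = b' then 1 else 0)"
proof -
  from ex_coordinates[OF vspace_A] obtain \<beta> where "\<exists>co. \<beta> \<subseteq> carrier H \<and> (\<forall>b\<in>\<beta>. co b \<in> linear_maps H ground) \<and>
    (\<forall>v\<in>carrier H. finite {b \<in> \<beta>. co b v \<noteq> 0} \<and> v = (\<Oplus>\<^bsub>H\<^esub>b\<in>{b \<in> \<beta>. co b v \<noteq> 0}. co b v \<odot>\<^bsub>H\<^esub> b)) \<and>
    (\<forall>b\<in>\<beta>. \<forall>b'\<in>\<beta>. co b b' = (if b = b' then 1 else 0))" ..
  then obtain co where all: "\<beta> \<subseteq> carrier H \<and> (\<forall>b\<in>\<beta>. co b \<in> linear_maps H ground) \<and>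
    (\<forall>v\<in>carrier H. finite {b \<in> \<beta>. co b v \<noteq> 0} \<and> v = (\<Oplus>\<^bsub>H\<^esub>b\<in>{b \<in> \<beta>. co b v \<noteq> 0}. co b v \<odot>\<^bsub>H\<^esub> b)) \<and>
    (\<forall>b\<in>\<beta>. \<forall>b'\<in>\<beta>. co b b' = (if b = b' then 1 else 0))" ..
  note \<beta> = all[THEN conjunct1] and co = all[THEN conjunct2, THEN conjunct1, rule_format]
    and dual = all[THEN conjunct2, THEN conjunct2, THEN conjunct2, rule_format]
    and fin = all[THEN conjunct2, THEN conjunct2, THEN conjunct1, rule_format, THEN conjunct1]
    and exp = all[THEN conjunct2, THEN conjunct2, THEN conjunct1, rule_format, THEN conjunct2]
  have expS: "v = (\<Oplus>\<^bsub>H\<^esub>b\<in>B. co b v \<odot>\<^bsub>H\<^esub> b)"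
    if "v \<in> carrier H" "finite B" "B \<subseteq> \<beta>" "{b \<in> \<beta>. co b v \<noteq> 0} \<subseteq> B" for v B
  proof -
    have "(\<Oplus>\<^bsub>H\<^esub>b\<in>{b \<in> \<beta>. co b v \<noteq> 0}. co b v \<odot>\<^bsub>H\<^esub> b) = (\<Oplus>\<^bsub>H\<^esub>b\<in>B. co b v \<odot>\<^bsub>H\<^esub> b)"
    proof (rule add.finprod_mono_neutral_cong_left[OF that(2,4)])
      show "co b v \<odot>\<^bsub>H\<^esub> b = \<zero>\<^bsub>H\<^esub>" if "b \<in> B - {b \<in> \<beta>. co b v \<noteq> 0}" for b
      proof -
        have "b \<in> carrier H" "co b v = 0" using that \<open>B \<subseteq> \<beta>\<close> \<beta> by auto
        then show ?thesis using vspaceD(9)[OF vspace_A] by simp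
      qed
      show "(\<lambda>b. co b v \<odot>\<^bsub>H\<^esub> b) \<in> B \<rightarrow> carrier H" using \<open>B \<subseteq> \<beta>\<close> \<beta> smult_closed_H by auto
    qed simp
    then show ?thesis using exp[OF that(1)] by simp
  qed
  obtain p where p: "p \<in> HH.tfree" "\<Delta> t = HH.tcls p" using \<Delta>_closed[OF t(1)] by (auto simp: HH.T_simps)
  have pk: "Poly_Mapping.keys p \<subseteq> carrier H \<times> carrier H" using p by (simp add: tensor_free_def)
  \<comment> \<open>The finitely many basis vectors that occur in the right legs of a representative
    of \<open>\<Delta> t\<close>. Collecting terms, \<open>\<Delta> t\<close> is the sum of
    \<open>c b \<otimes> b\<close> over \<open>B\<close>, which is what \<open>expand\<close> says
    for arbitrary integrands.\<close>
  define B where "B = (\<Union>z\<in>Poly_Mapping.keys p. {b \<in> \<beta>. co b (snd z) \<noteq> 0})"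
  have B: "finite B" "B \<subseteq> \<beta>" using fin pk by (auto simp: B_def)
  then have BH: "B \<subseteq> carrier H" using \<beta> by blast
  define P where "P = (\<lambda>y. \<Oplus>\<^bsub>H\<^esub>b\<in>B. co b y \<odot>\<^bsub>H\<^esub> b)"
  have linP: "P \<in> linear_maps H H"
    unfolding P_def by (rule lm_finsum[OF vspace_A B(1)]) (use B co BH in \<open>auto intro!: lm_functional[OF _ vspace_A]\<close>)
  define c where "c b = sw H (\<lambda>x y. co b y \<odot>\<^bsub>H\<^esub> x) t" for b
  have bilc: "bilinear_map H H H (\<lambda>x y. co b y \<odot>\<^bsub>H\<^esub> x)" if "b \<in> B" for b
    by (rule bil_functional_smult_left[OF co vspace_A vspace_A lm_id]) (use that B in blast)
  have cH: "c b \<in> carrier H" if "b \<in> B" for b unfolding c_def by (rule sw_closed[OF vspace_A bilc[OF that] t(1)])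
  have expand: "sw X F t = (\<Oplus>\<^bsub>X\<^esub>b\<in>B. F (c b) b)" if X: "vspace X" and F: "bilinear_map H H X F" for X and F :: "'h \<Rightarrow> 'h \<Rightarrow> 'x"
  proof -
    interpret X: abelian_group X by (rule vspaceD(1)[OF X])
    note FD = bilinear_mapD[OF F]
    have FP: "bilinear_map H H X (\<lambda>x y. F x (P y))"
      by (rule bilinear_mapI) (auto intro!: lm_bil_right[OF F linP] FD(2) linear_mapsD(1)[OF linP])
    have "sw X F t = tensor_eval X F p" by (simp add: sw_def p HH.tensor_lift_tcls[OF X F])
    also have "\<dots> = tensor_eval X (\<lambda>x y. F x (P y)) p"
      unfolding tensor_eval_def
    proof (rule X.finsum_cong'[OF refl])
      show "(\<lambda>z. Poly_Mapping.lookup p z \<odot>\<^bsub>X\<^esub> F (fst z) (P (snd z))) \<in> Poly_Mapping.keys p \<rightarrow> carrier X"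
        using pk bilinear_mapD(3)[OF FP] vspaceD(2)[OF X] by (auto simp: Pi_def)
      fix z assume z: "z \<in> Poly_Mapping.keys p"
      have "snd z = P (snd z)" unfolding P_def
        by (rule expS[OF _ B]) (use z pk in \<open>auto simp: B_def\<close>)
      then show "Poly_Mapping.lookup p z \<odot>\<^bsub>X\<^esub> F (fst z) (snd z) = Poly_Mapping.lookup p z \<odot>\<^bsub>X\<^esub> F (fst z) (P (snd z))"
        by simp
    qed
    also have "\<dots> = tensor_lift X (\<lambda>x y. F x (P y)) (\<Delta> t)" by (simp add: p HH.tensor_lift_tcls[OF X FP])
    also have "\<dots> = (\<Oplus>\<^bsub>X\<^esub>b\<in>B. F (tensor_lift H (\<lambda>x y. co b y \<odot>\<^bsub>H\<^esub> x) (\<Delta> t)) b)"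
    proof (rule HH.tensor_ext[OF HH.tensor_lift_linear[OF X FP] _ X _ \<Delta>_closed[OF t(1)]])
      show "(\<lambda>s. \<Oplus>\<^bsub>X\<^esub>b\<in>B. F (tensor_lift H (\<lambda>x y. co b y \<odot>\<^bsub>H\<^esub> x) s) b) \<in> linear_maps HT X"
        by (rule lm_finsum[OF X B(1)])
          (use BH in \<open>auto intro!: lm_comp[OF FD(2)] HH.tensor_lift_linear[OF vspace_A bilc]\<close>)
      fix v w assume vw: "v \<in> carrier H" "w \<in> carrier H"
      have "tensor_lift X (\<lambda>x y. F x (P y)) (tensor_elem H H v w) = F v (P w)"
        by (rule HH.tensor_lift_elem[OF X FP vw])
      also have "\<dots> = (\<Oplus>\<^bsub>X\<^esub>b\<in>B. F v (co b w \<odot>\<^bsub>H\<^esub> b))"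
        unfolding P_def by (rule linear_map_finsum[OF FD(1)[OF vw(1)] vspace_A X B(1)]) (use BH smult_closed_H in auto)
      also have "\<dots> = (\<Oplus>\<^bsub>X\<^esub>b\<in>B. F (tensor_lift H (\<lambda>x y. co b y \<odot>\<^bsub>H\<^esub> x) (tensor_elem H H v w)) b)"
      proof (rule X.finsum_cong'[OF refl])
        show "(\<lambda>b. F (tensor_lift H (\<lambda>x y. co b y \<odot>\<^bsub>H\<^esub> x) (tensor_elem H H v w)) b) \<in> B \<rightarrow> carrier X"
          using BH vw smult_closed_H by (auto intro!: FD(3) simp: HH.tensor_lift_elem[OF vspace_A bilc])
        fix b assume b: "b \<in> B"
        have bc: "b \<in> carrier H" using b BH by blast
        show "F v (co b w \<odot>\<^bsub>H\<^esub> b) = F (tensor_lift H (\<lambda>x y. co b y \<odot>\<^bsub>H\<^esub> x) (tensor_elem H H v w)) b"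
          unfolding HH.tensor_lift_elem[OF vspace_A bilc[OF b] vw]
          by (simp only: linear_mapsD(3)[OF FD(1)[OF vw(1)] bc] linear_mapsD(3)[OF FD(2)[OF bc] vw(1)])
      qed
      finally show "tensor_lift X (\<lambda>x y. F x (P y)) (tensor_elem H H v w)
          = (\<Oplus>\<^bsub>X\<^esub>b\<in>B. F (tensor_lift H (\<lambda>x y. co b y \<odot>\<^bsub>H\<^esub> x) (tensor_elem H H v w)) b)" .
    qed
    finally show ?thesis by (simp add: c_def sw_def)
  qed
  have co_sum: "co d (\<Oplus>\<^bsub>H\<^esub>b\<in>B. g b) = (\<Sum>b\<in>B. co d (g b))" if "d \<in> \<beta>" "\<And>b. b \<in> B \<Longrightarrow> g b \<in> carrier H" for d g
    by (rule functional_finsum[OF co[OF that(1)] vspace_A B(1) that(2)])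
  \<comment> \<open>The basis vectors occurring in the left legs \<open>c b\<close>. A coordinate
    outside \<open>\<gamma>\<close> vanishes on every \<open>c b\<close>, by
    \<open>integral_shift\<close> on every product \<open>c b k\<close>, and then on every
    \<open>h = 1 h\<close>, because 1 is the sum of the \<open>c b S(b)\<close>.\<close>
  define \<gamma> where "\<gamma> = (\<Union>b\<in>B. {d \<in> \<beta>. co d (c b) \<noteq> 0})"
  have fin\<gamma>: "finite \<gamma>" unfolding \<gamma>_def using B fin cH by blast
  have zero_c: "co d (c b) = 0" if "d \<in> \<beta>" "d \<notin> \<gamma>" "b \<in> B" for d b using that by (auto simp: \<gamma>_def)
  have zero_ck: "co d (c b \<otimes>\<^bsub>H\<^esub> k) = 0" if d: "d \<in> \<beta>" "d \<notin> \<gamma>" and b: "b \<in> B" and k: "k \<in> carrier H" for d b k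
  proof -
    have "(\<lambda>x. x \<otimes>\<^bsub>H\<^esub> k) \<in> linear_maps H H" by (rule mult_lm_left[OF lm_id k])
    then have "c b \<otimes>\<^bsub>H\<^esub> k = sw H (\<lambda>x y. (co b y \<odot>\<^bsub>H\<^esub> x) \<otimes>\<^bsub>H\<^esub> k) t"
      unfolding c_def by (rule sw_hom[OF vspace_A vspace_A bilc[OF b] _ t(1)])
    also have "\<dots> = sw H (\<lambda>x y. co b y \<odot>\<^bsub>H\<^esub> (x \<otimes>\<^bsub>H\<^esub> k)) t"
      by (rule sw_cong[OF vspace_A _ t(1), symmetric])
        (use b B k in \<open>auto intro!: bil_functional_smult_left co vspace_A mult_lm_left lm_id simp: smult_mult_left\<close>)
    also have "\<dots> = sw H (\<lambda>x y. co b (y \<otimes>\<^bsub>H\<^esub> S k) \<odot>\<^bsub>H\<^esub> x) t"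
      using integral_shift[OF vspace_A bilc[OF b] k t(1,3)] by simp
    also have "\<dots> = (\<Oplus>\<^bsub>H\<^esub>b'\<in>B. co b (b' \<otimes>\<^bsub>H\<^esub> S k) \<odot>\<^bsub>H\<^esub> c b')"
      by (rule expand[OF vspace_A])
        (use b B k S_closed in \<open>auto intro!: bil_functional_smult_left vspace_A lm_id lm_comp[OF co] mult_lm_left\<close>)
    finally have "co d (c b \<otimes>\<^bsub>H\<^esub> k) = (\<Sum>b'\<in>B. co b (b' \<otimes>\<^bsub>H\<^esub> S k) * co d (c b'))"
      using co_sum[OF d(1)] cH smult_closed_H linear_mapsD(3)[OF co[OF d(1)]] by simp
    then show ?thesis using zero_c[OF d] by simp
  qed
  have zero: "co d h = 0" if d: "d \<in> \<beta>" "d \<notin> \<gamma>" and h: "h \<in> carrier H" for d h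
  proof -
    have "\<one>\<^bsub>H\<^esub> = sw H (\<lambda>a b. a \<otimes>\<^bsub>H\<^esub> S b) t"
      using sw_antipode_right[OF vspace_A lm_id t(1)] t(2) vspaceD(8)[OF vspace_A one_closed] by simp
    also have "\<dots> = (\<Oplus>\<^bsub>H\<^esub>b\<in>B. c b \<otimes>\<^bsub>H\<^esub> S b)" by (rule expand[OF vspace_A bil_S_right])
    finally have "h = (\<Oplus>\<^bsub>H\<^esub>b\<in>B. c b \<otimes>\<^bsub>H\<^esub> S b) \<otimes>\<^bsub>H\<^esub> h" using h by (metis l_one)
    also have "\<dots> = (\<Oplus>\<^bsub>H\<^esub>b\<in>B. c b \<otimes>\<^bsub>H\<^esub> S b \<otimes>\<^bsub>H\<^esub> h)"
      by (rule linear_map_finsum[OF mult_lm_left[OF lm_id h] vspace_A vspace_A B(1)]) (use cH BH S_closed in auto)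
    finally have "co d h = (\<Sum>b\<in>B. co d (c b \<otimes>\<^bsub>H\<^esub> S b \<otimes>\<^bsub>H\<^esub> h))"
      using co_sum[OF d(1), of "\<lambda>b. c b \<otimes>\<^bsub>H\<^esub> S b \<otimes>\<^bsub>H\<^esub> h"] cH BH S_closed h by (metis (no_types, lifting) m_closed subsetD)
    also have "\<dots> = (\<Sum>b\<in>B. 0)"
    proof (rule sum.cong[OF refl])
      fix b assume b: "b \<in> B"
      have "c b \<otimes>\<^bsub>H\<^esub> S b \<otimes>\<^bsub>H\<^esub> h = c b \<otimes>\<^bsub>H\<^esub> (S b \<otimes>\<^bsub>H\<^esub> h)"
        by (rule m_assoc) (use b cH BH S_closed h in auto)
      then show "co d (c b \<otimes>\<^bsub>H\<^esub> S b \<otimes>\<^bsub>H\<^esub> h) = 0"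
        using zero_ck[OF d b] b BH S_closed h by (simp add: subset_iff)
    qed
    finally show ?thesis by simp
  qed
  \<comment> \<open>A basis vector outside \<open>\<gamma>\<close> would have coordinate 0 at
    itself, whereas duality gives 1.\<close>
  have "\<beta> \<subseteq> \<gamma>" using zero dual \<beta> by (metis subsetD subsetI zero_neq_one)
  then have fin\<beta>: "finite \<beta>" using fin\<gamma> finite_subset by blast
  show ?thesis
    by (rule that[OF fin\<beta> \<beta> co _ dual]) (use expS[OF _ fin\<beta>] in auto)
qed

end

subsection \<open>The regular comodule\<close>

lemma finsum_ground:
  assumes "finite C" shows "(\<Oplus>\<^bsub>ground\<^esub>c\<in>C. g c) = (\<Sum>c\<in>C. g c)"
  using functional_finsum[OF lm_id vspace_ground assms, of g] by simp

lemma lm_scale: "f \<in> linear_maps V ground \<Longrightarrow> (\<lambda>x. c * f x) \<in> linear_maps V ground"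
  using lm_smult[OF _ vspace_ground, of f V c] by simp

lemma lm_scale_right: "f \<in> linear_maps V ground \<Longrightarrow> (\<lambda>x. f x * c) \<in> linear_maps V ground"
  using lm_scale[of f V c] by (simp add: mult.commute)

context hopf_algebra begin

lemma sw_finsum:
  assumes X: "vspace X" and C: "finite C" and F: "\<And>c. c \<in> C \<Longrightarrow> bilinear_map H H X (F c)" and h: "h \<in> carrier H"
  shows "sw X (\<lambda>a b. \<Oplus>\<^bsub>X\<^esub>c\<in>C. F c a b) h = (\<Oplus>\<^bsub>X\<^esub>c\<in>C. sw X (F c) h)"
proof -
  interpret X: abelian_group X by (rule vspaceD(1)[OF X])
  have b: "bilinear_map H H X (\<lambda>a b. \<Oplus>\<^bsub>X\<^esub>c\<in>C. F c a b)"
    by (rule bilinear_mapI; rule lm_finsum[OF X C]; rule bilinear_mapD[OF F])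
  show ?thesis unfolding sw_def
  proof (rule HH.tensor_ext[OF HH.tensor_lift_linear[OF X b] _ X _ \<Delta>_closed[OF h]])
    show "(\<lambda>s. \<Oplus>\<^bsub>X\<^esub>c\<in>C. tensor_lift X (F c) s) \<in> linear_maps HT X"
      by (rule lm_finsum[OF X C HH.tensor_lift_linear[OF X F]])
    fix v w assume vw: "v \<in> carrier H" "w \<in> carrier H"
    have "(\<Oplus>\<^bsub>X\<^esub>c\<in>C. tensor_lift X (F c) (tensor_elem H H v w)) = (\<Oplus>\<^bsub>X\<^esub>c\<in>C. F c v w)"
      by (rule X.finsum_cong'[OF refl])
        (use vw in \<open>auto simp: HH.tensor_lift_elem[OF X F] intro: bilinear_mapD(3)[OF F]\<close>)
    then show "tensor_lift X (\<lambda>a b. \<Oplus>\<^bsub>X\<^esub>c\<in>C. F c a b) (tensor_elem H H v w)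
        = (\<Oplus>\<^bsub>X\<^esub>c\<in>C. tensor_lift X (F c) (tensor_elem H H v w))"
      by (simp add: HH.tensor_lift_elem[OF X b vw])
  qed
qed

lemma sw_sum:
  assumes "finite C" "\<And>c. c \<in> C \<Longrightarrow> bilinear_map H H ground (F c)" "h \<in> carrier H"
  shows "sw ground (\<lambda>a b. \<Sum>c\<in>C. F c a b) h = (\<Sum>c\<in>C. sw ground (F c) h)"
  using sw_finsum[OF vspace_ground assms] by (simp add: finsum_ground[OF assms(1)])

lemma sw_scale:
  assumes "bilinear_map H H ground F" "h \<in> carrier H"
  shows "sw ground (\<lambda>a b. c * F a b) h = c * sw ground F h"
  by (rule sw_hom[OF vspace_ground vspace_ground assms(1) lm_scale[OF lm_id] assms(2), symmetric])

lemma sw_in_subspace: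
  assumes X: "vspace X" and F: "bilinear_map H H X F" and h: "h \<in> carrier H"
    and N: "\<zero>\<^bsub>X\<^esub> \<in> N" "\<And>x y. \<lbrakk>x \<in> N; y \<in> N\<rbrakk> \<Longrightarrow> x \<oplus>\<^bsub>X\<^esub> y \<in> N"
    and FN: "\<And>a b. \<lbrakk>a \<in> carrier H; b \<in> carrier H\<rbrakk> \<Longrightarrow> F a b \<in> N"
  shows "sw X F h \<in> N"
  unfolding sw_def using \<Delta>_closed[OF h]
proof (induction rule: HH.tensor_induct)
  case zero
  then show ?case using HH.linear_map_zero[OF HH.tensor_lift_linear[OF X F] HH.vspace_T X] N(1) by simp
next
  case (add x v w)
  then show ?case
    using linear_mapsD(2)[OF HH.tensor_lift_linear[OF X F] HH.telem_closed[OF add.hyps(2,3)] add.hyps(1)]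
      HH.tensor_lift_elem[OF X F add.hyps(2,3)] N(2)[OF FN[OF add.hyps(2,3)] add.IH] by simp
qed

text \<open>\<open>hit f h\<close> is the usual action \<open>f \<rightharpoonup> h\<close> of the dual algebra, whose product is \<open>conv\<close>.\<close>

definition hit :: "('h \<Rightarrow> 'k) \<Rightarrow> 'h \<Rightarrow> 'h" where
  "hit f h = sw H (\<lambda>a b. f b \<odot>\<^bsub>H\<^esub> a) h"

definition conv :: "('h \<Rightarrow> 'k) \<Rightarrow> ('h \<Rightarrow> 'k) \<Rightarrow> 'h \<Rightarrow> 'k" where
  "conv f g h = sw ground (\<lambda>a b. f a * g b) h"

lemma bil_hit: "f \<in> linear_maps H ground \<Longrightarrow> bilinear_map H H H (\<lambda>a b. f b \<odot>\<^bsub>H\<^esub> a)"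
  by (rule bil_functional_smult_left[OF _ vspace_A vspace_A lm_id])

lemma bil_mult_ground:
  "\<lbrakk>f \<in> linear_maps V ground; g \<in> linear_maps W ground\<rbrakk> \<Longrightarrow> bilinear_map V W ground (\<lambda>a b. f a * g b)"
  by (rule bilinear_mapI) (auto intro: lm_scale lm_scale_right)

lemma hit_linear: "f \<in> linear_maps H ground \<Longrightarrow> hit f \<in> linear_maps H H"
  unfolding hit_def by (rule sw_linear[OF vspace_A bil_hit])

lemma conv_linear: "\<lbrakk>f \<in> linear_maps H ground; g \<in> linear_maps H ground\<rbrakk> \<Longrightarrow> conv f g \<in> linear_maps H ground"
  unfolding conv_def by (rule sw_linear[OF vspace_ground bil_mult_ground])

lemma hit_closed: "\<lbrakk>f \<in> linear_maps H ground; h \<in> carrier H\<rbrakk> \<Longrightarrow> hit f h \<in> carrier H"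
  by (rule linear_mapsD(1)[OF hit_linear])

lemma hit_one: "f \<in> linear_maps H ground \<Longrightarrow> hit f \<one>\<^bsub>H\<^esub> = f \<one>\<^bsub>H\<^esub> \<odot>\<^bsub>H\<^esub> \<one>\<^bsub>H\<^esub>"
  unfolding hit_def by (rule sw_one[OF vspace_A bil_hit])

lemma hit_counit: "h \<in> carrier H \<Longrightarrow> hit \<epsilon> h = h"
  unfolding hit_def by (rule sw_counit_right[OF vspace_A lm_id])

text \<open>The comultiplication of \<open>hit f h\<close> is the sum of
  \<open>h1 \<otimes> hit f h2\<close>: by coassociativity \<open>f\<close> may consume the last of
  three legs.\<close>

lemma sw_hit:
  assumes X: "vspace X" and F: "bilinear_map H H X F" and f: "f \<in> linear_maps H ground" and h: "h \<in> carrier H"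
  shows "sw X F (hit f h) = sw X (\<lambda>a b. F a (hit f b)) h"
proof -
  note FD = bilinear_mapD[OF F]
  have tri: "trilinear H H H X (\<lambda>a b c. f c \<odot>\<^bsub>X\<^esub> F a b)"
    by (rule trilinearI) (auto intro!: lm_functional[OF f X] lm_smult[OF _ X] FD)
  have "sw X F (hit f h) = sw X (\<lambda>h1 h2. sw X F (f h2 \<odot>\<^bsub>H\<^esub> h1)) h"
    unfolding hit_def by (rule sw_hom[OF vspace_A X bil_hit[OF f] sw_linear[OF X F] h])
  also have "\<dots> = sw X (\<lambda>h1 h2. sw X (\<lambda>a b. f h2 \<odot>\<^bsub>X\<^esub> F a b) h1) h"
  proof (rule sw_cong[OF X _ h, symmetric])
    show "bilinear_map H H X (\<lambda>h1 h2. sw X (\<lambda>a b. f h2 \<odot>\<^bsub>X\<^esub> F a b) h1)"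
      by (rule sw_bil_left[OF X tri])
    fix a b assume ab: "a \<in> carrier H" "b \<in> carrier H"
    have "sw X F (f b \<odot>\<^bsub>H\<^esub> a) = f b \<odot>\<^bsub>X\<^esub> sw X F a" by (rule linear_mapsD(3)[OF sw_linear[OF X F] ab(1)])
    also have "\<dots> = sw X (\<lambda>x y. f b \<odot>\<^bsub>X\<^esub> F x y) a" by (rule sw_hom[OF X X F lm_smult[OF lm_id X] ab(1)])
    finally show "sw X (\<lambda>x y. f b \<odot>\<^bsub>X\<^esub> F x y) a = sw X F (f b \<odot>\<^bsub>H\<^esub> a)" by simp
  qed
  also have "\<dots> = sw X (\<lambda>h1 h2. sw X (\<lambda>b c. f c \<odot>\<^bsub>X\<^esub> F h1 b) h2) h"
    by (rule sw_coassoc[OF X tri h])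
  also have "\<dots> = sw X (\<lambda>a b. F a (hit f b)) h"
  proof (rule sw_cong[OF X sw_bil_right[OF X tri] h])
    fix a b assume ab: "a \<in> carrier H" "b \<in> carrier H"
    have "F a (hit f b) = sw X (\<lambda>x y. F a (f y \<odot>\<^bsub>H\<^esub> x)) b"
      unfolding hit_def by (rule sw_hom[OF vspace_A X bil_hit[OF f] FD(1)[OF ab(1)] ab(2)])
    also have "\<dots> = sw X (\<lambda>x y. f y \<odot>\<^bsub>X\<^esub> F a x) b"
      by (rule sw_cong[OF X _ ab(2), symmetric])
        (use trilinearD(4)[OF tri ab(1)] linear_mapsD(3)[OF FD(1)[OF ab(1)]] in auto)
    finally show "sw X (\<lambda>x y. f y \<odot>\<^bsub>X\<^esub> F a x) b = F a (hit f b)" by simp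
  qed
  finally show ?thesis .
qed

lemma functional_hit:
  assumes f: "f \<in> linear_maps H ground" and g: "g \<in> linear_maps H ground" and h: "h \<in> carrier H"
  shows "g (hit f h) = conv g f h"
proof -
  have "g (hit f h) = sw ground (\<lambda>a b. g (f b \<odot>\<^bsub>H\<^esub> a)) h"
    unfolding hit_def by (rule sw_hom[OF vspace_A vspace_ground bil_hit[OF f] g h])
  also have "\<dots> = conv g f h"
    unfolding conv_def by (rule sw_cong[OF vspace_ground bil_mult_ground[OF g f] h, symmetric])
      (simp add: linear_mapsD(3)[OF g])
  finally show ?thesis .
qed

lemma hit_hit:
  assumes f: "f \<in> linear_maps H ground" and g: "g \<in> linear_maps H ground" and h: "h \<in> carrier H"
  shows "hit f (hit g h) = hit (conv f g) h"
proof -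
  have "hit f (hit g h) = sw H (\<lambda>a b. f (hit g b) \<odot>\<^bsub>H\<^esub> a) h"
    unfolding hit_def[of f] by (rule sw_hit[OF vspace_A bil_hit[OF f] g h])
  also have "\<dots> = hit (conv f g) h"
    unfolding hit_def[of "conv f g"]
    by (rule sw_cong[OF vspace_A bil_hit[OF conv_linear[OF f g]] h, symmetric]) (simp add: functional_hit[OF g f])
  finally show ?thesis .
qed

text \<open>The families \<open>P\<close> and \<open>Q\<close> present the coproduct of
  \<open>f\<close> in the dual of \<open>H\<close>, and the action of the dual is compatible with
  products. They are parameters so that \<open>lam_mult\<close> can supply them later.\<close>

lemma hit_mult:
  assumes C: "finite C" and f: "f \<in> linear_maps H ground"
    and P: "\<And>c. c \<in> C \<Longrightarrow> P c \<in> linear_maps H ground" and Q: "\<And>c. c \<in> C \<Longrightarrow> Q c \<in> linear_maps H ground"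
    and eq: "\<And>x y. \<lbrakk>x \<in> carrier H; y \<in> carrier H\<rbrakk> \<Longrightarrow> f (x \<otimes>\<^bsub>H\<^esub> y) = (\<Sum>c\<in>C. P c x * Q c y)"
    and h: "h \<in> carrier H" and k: "k \<in> carrier H"
  shows "hit f (h \<otimes>\<^bsub>H\<^esub> k) = (\<Oplus>\<^bsub>H\<^esub>c\<in>C. hit (P c) h \<otimes>\<^bsub>H\<^esub> hit (Q c) k)"
proof -
  let ?G = "\<lambda>c a b. P c b \<odot>\<^bsub>H\<^esub> (a \<otimes>\<^bsub>H\<^esub> hit (Q c) k)"
  have bG: "bilinear_map H H H (?G c)" if "c \<in> C" for c
    by (rule bil_functional_smult_left[OF P[OF that] vspace_A vspace_A mult_lm_left[OF lm_id hit_closed[OF Q[OF that] k]]])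
  have "hit f (h \<otimes>\<^bsub>H\<^esub> k) = sw H (\<lambda>a b. sw H (\<lambda>c d. f (b \<otimes>\<^bsub>H\<^esub> d) \<odot>\<^bsub>H\<^esub> (a \<otimes>\<^bsub>H\<^esub> c)) k) h"
    unfolding hit_def by (rule sw_mult[OF vspace_A bil_hit[OF f] h k])
  also have "\<dots> = sw H (\<lambda>a b. \<Oplus>\<^bsub>H\<^esub>c\<in>C. ?G c a b) h"
  proof (rule sw_cong[OF vspace_A _ h, symmetric])
    show "bilinear_map H H H (\<lambda>a b. \<Oplus>\<^bsub>H\<^esub>c\<in>C. ?G c a b)"
      by (rule bilinear_mapI; rule lm_finsum[OF vspace_A C]; rule bilinear_mapD[OF bG])
    fix a b assume ab: "a \<in> carrier H" "b \<in> carrier H"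
    have cl: "hit (Q c) k \<in> carrier H" "P c b \<odot>\<^bsub>H\<^esub> a \<in> carrier H" if "c \<in> C" for c
      using hit_closed[OF Q[OF that] k] smult_closed_H[OF ab(1)] by auto
    have bc: "bilinear_map H H H (\<lambda>x y. Q c y \<odot>\<^bsub>H\<^esub> (P c b \<odot>\<^bsub>H\<^esub> a \<otimes>\<^bsub>H\<^esub> x))" if "c \<in> C" for c
      by (rule bil_functional_smult_left[OF Q[OF that] vspace_A vspace_A mult_lm_right[OF lm_id cl(2)[OF that]]])
    have "(\<Oplus>\<^bsub>H\<^esub>c\<in>C. ?G c a b) = (\<Oplus>\<^bsub>H\<^esub>c\<in>C. sw H (\<lambda>x y. Q c y \<odot>\<^bsub>H\<^esub> (P c b \<odot>\<^bsub>H\<^esub> a \<otimes>\<^bsub>H\<^esub> x)) k)"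
    proof (rule finsum_cong'[OF refl])
      show "(\<lambda>c. sw H (\<lambda>x y. Q c y \<odot>\<^bsub>H\<^esub> (P c b \<odot>\<^bsub>H\<^esub> a \<otimes>\<^bsub>H\<^esub> x)) k) \<in> C \<rightarrow> carrier H"
        using sw_closed[OF vspace_A bc k] by auto
      fix c assume c: "c \<in> C"
      have "?G c a b = P c b \<odot>\<^bsub>H\<^esub> a \<otimes>\<^bsub>H\<^esub> hit (Q c) k" using smult_mult_left[OF ab(1) cl(1)[OF c]] by simp
      also have "\<dots> = sw H (\<lambda>x y. P c b \<odot>\<^bsub>H\<^esub> a \<otimes>\<^bsub>H\<^esub> (Q c y \<odot>\<^bsub>H\<^esub> x)) k"
        unfolding hit_def by (rule sw_hom[OF vspace_A vspace_A bil_hit[OF Q[OF c]] mult_lm_right[OF lm_id cl(2)[OF c]] k])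
      also have "\<dots> = sw H (\<lambda>x y. Q c y \<odot>\<^bsub>H\<^esub> (P c b \<odot>\<^bsub>H\<^esub> a \<otimes>\<^bsub>H\<^esub> x)) k"
        by (rule sw_cong[OF vspace_A bc[OF c] k, symmetric]) (simp add: smult_mult_right[OF cl(2)[OF c]])
      finally show "?G c a b = sw H (\<lambda>x y. Q c y \<odot>\<^bsub>H\<^esub> (P c b \<odot>\<^bsub>H\<^esub> a \<otimes>\<^bsub>H\<^esub> x)) k" .
    qed
    also have "\<dots> = sw H (\<lambda>x y. \<Oplus>\<^bsub>H\<^esub>c\<in>C. Q c y \<odot>\<^bsub>H\<^esub> (P c b \<odot>\<^bsub>H\<^esub> a \<otimes>\<^bsub>H\<^esub> x)) k"
      by (rule sw_finsum[OF vspace_A C bc k, symmetric])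
    also have "\<dots> = sw H (\<lambda>x y. f (b \<otimes>\<^bsub>H\<^esub> y) \<odot>\<^bsub>H\<^esub> (a \<otimes>\<^bsub>H\<^esub> x)) k"
    proof (rule sw_cong[OF vspace_A _ k, symmetric])
      show "bilinear_map H H H (\<lambda>x y. f (b \<otimes>\<^bsub>H\<^esub> y) \<odot>\<^bsub>H\<^esub> (a \<otimes>\<^bsub>H\<^esub> x))"
        by (rule bil_functional_smult_left[OF lm_comp[OF f mult_lm_right[OF lm_id ab(2)]] vspace_A vspace_A mult_lm_right[OF lm_id ab(1)]])
      fix x y assume xy: "x \<in> carrier H" "y \<in> carrier H"
      have ax: "a \<otimes>\<^bsub>H\<^esub> x \<in> carrier H" using ab xy by simp
      have "(\<Oplus>\<^bsub>H\<^esub>c\<in>C. Q c y \<odot>\<^bsub>H\<^esub> (P c b \<odot>\<^bsub>H\<^esub> a \<otimes>\<^bsub>H\<^esub> x)) = (\<Oplus>\<^bsub>H\<^esub>c\<in>C. (P c b * Q c y) \<odot>\<^bsub>H\<^esub> (a \<otimes>\<^bsub>H\<^esub> x))"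
        by (rule finsum_cong'[OF refl])
          (use smult_closed_H[OF ax] in \<open>auto simp: smult_mult_left[OF ab(1) xy(1)] vspaceD(7)[OF vspace_A ax, symmetric] mult.commute\<close>)
      also have "\<dots> = (\<Sum>c\<in>C. P c b * Q c y) \<odot>\<^bsub>H\<^esub> (a \<otimes>\<^bsub>H\<^esub> x)"
        using linear_map_finsum[OF lm_functional[OF lm_id vspace_A ax] vspace_ground vspace_A C, of "\<lambda>c. P c b * Q c y"]
        by (simp add: finsum_ground[OF C])
      finally show "f (b \<otimes>\<^bsub>H\<^esub> y) \<odot>\<^bsub>H\<^esub> (a \<otimes>\<^bsub>H\<^esub> x) = (\<Oplus>\<^bsub>H\<^esub>c\<in>C. Q c y \<odot>\<^bsub>H\<^esub> (P c b \<odot>\<^bsub>H\<^esub> a \<otimes>\<^bsub>H\<^esub> x))"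
        by (simp add: eq[OF ab(2) xy(2)])
    qed
    finally show "(\<Oplus>\<^bsub>H\<^esub>c\<in>C. ?G c a b) = sw H (\<lambda>c d. f (b \<otimes>\<^bsub>H\<^esub> d) \<odot>\<^bsub>H\<^esub> (a \<otimes>\<^bsub>H\<^esub> c)) k" .
  qed
  also have "\<dots> = (\<Oplus>\<^bsub>H\<^esub>c\<in>C. sw H (?G c) h)" by (rule sw_finsum[OF vspace_A C bG h])
  also have "\<dots> = (\<Oplus>\<^bsub>H\<^esub>c\<in>C. hit (P c) h \<otimes>\<^bsub>H\<^esub> hit (Q c) k)"
  proof (rule finsum_cong'[OF refl])
    show "(\<lambda>c. hit (P c) h \<otimes>\<^bsub>H\<^esub> hit (Q c) k) \<in> C \<rightarrow> carrier H"
      using hit_closed[OF P h] hit_closed[OF Q k] by auto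
    fix c assume c: "c \<in> C"
    have "hit (P c) h \<otimes>\<^bsub>H\<^esub> hit (Q c) k = sw H (\<lambda>a b. (P c b \<odot>\<^bsub>H\<^esub> a) \<otimes>\<^bsub>H\<^esub> hit (Q c) k) h"
      unfolding hit_def[of "P c"]
      by (rule sw_hom[OF vspace_A vspace_A bil_hit[OF P[OF c]] mult_lm_left[OF lm_id hit_closed[OF Q[OF c] k]] h])
    also have "\<dots> = sw H (?G c) h"
      by (rule sw_cong[OF vspace_A bG[OF c] h, symmetric]) (simp add: smult_mult_left hit_closed[OF Q[OF c] k])
    finally show "sw H (?G c) h = hit (P c) h \<otimes>\<^bsub>H\<^esub> hit (Q c) k" by simp
  qed
  finally show ?thesis .
qed

end

section \<open>Matrix coefficients of a finite-dimensional Hopf algebra\<close>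

locale based_hopf_algebra = hopf_algebra H \<Delta> \<epsilon> S
  for H :: "('k::field, 'h) module" and \<Delta> :: "'h \<Rightarrow> ('k, 'h, 'h) tensor" and \<epsilon> :: "'h \<Rightarrow> 'k" and S :: "'h \<Rightarrow> 'h" +
  fixes t :: 'h and \<beta> :: "'h set" and co :: "'h \<Rightarrow> 'h \<Rightarrow> 'k"
  assumes t_closed: "t \<in> carrier H" and counit_t: "\<epsilon> t = 1"
    and t_mult: "g \<in> carrier H \<Longrightarrow> t \<otimes>\<^bsub>H\<^esub> g = \<epsilon> g \<odot>\<^bsub>H\<^esub> t"
    and finite_\<beta>: "finite \<beta>" and \<beta>_closed: "\<beta> \<subseteq> carrier H"
    and co_linear: "b \<in> \<beta> \<Longrightarrow> co b \<in> linear_maps H ground"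
    and co_expand: "h \<in> carrier H \<Longrightarrow> h = (\<Oplus>\<^bsub>H\<^esub>b\<in>\<beta>. co b h \<odot>\<^bsub>H\<^esub> b)"
    and co_dual: "\<lbrakk>b \<in> \<beta>; b' \<in> \<beta>\<rbrakk> \<Longrightarrow> co b b' = (if b = b' then 1 else 0)"
begin

lemma \<beta>_mem: "b \<in> \<beta> \<Longrightarrow> b \<in> carrier H"
  using \<beta>_closed by blast

lemma linear_expand:
  assumes "f \<in> linear_maps H X" "vspace X" "h \<in> carrier H"
  shows "f h = (\<Oplus>\<^bsub>X\<^esub>b\<in>\<beta>. co b h \<odot>\<^bsub>X\<^esub> f b)"
proof -
  interpret X: abelian_group X by (rule vspaceD(1)[OF assms(2)])
  have "f h = f (\<Oplus>\<^bsub>H\<^esub>b\<in>\<beta>. co b h \<odot>\<^bsub>H\<^esub> b)" using co_expand[OF assms(3)] by simp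
  also have "\<dots> = (\<Oplus>\<^bsub>X\<^esub>b\<in>\<beta>. f (co b h \<odot>\<^bsub>H\<^esub> b))"
    by (rule linear_map_finsum[OF assms(1) vspace_A assms(2) finite_\<beta> smult_closed_H[OF \<beta>_mem]])
  also have "\<dots> = (\<Oplus>\<^bsub>X\<^esub>b\<in>\<beta>. co b h \<odot>\<^bsub>X\<^esub> f b)"
    by (rule X.finsum_cong'[OF refl])
      (auto simp: linear_mapsD(3)[OF assms(1) \<beta>_mem] intro!: vspaceD(2)[OF assms(2)] linear_mapsD(1)[OF assms(1)] \<beta>_mem)
  finally show ?thesis .
qed

lemma functional_expand:
  assumes "f \<in> linear_maps H ground" "h \<in> carrier H"
  shows "f h = (\<Sum>b\<in>\<beta>. co b h * f b)"
  using linear_expand[OF assms(1) vspace_ground assms(2)] by (simp add: finsum_ground[OF finite_\<beta>])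

text \<open>The matrix coefficients of the right regular representation, and those of
  \<open>a \<otimes> g \<mapsto> \<Sum> g a\<^sub>1 \<otimes> a\<^sub>2\<close> and \<open>b \<otimes> x \<mapsto> \<Sum> x S(b\<^sub>1) \<otimes> b\<^sub>2\<close>.\<close>

definition lam :: "'h \<Rightarrow> 'h \<Rightarrow> 'h \<Rightarrow> 'k" where
  "lam a b h = co b (a \<otimes>\<^bsub>H\<^esub> h)"

definition kap :: "'h \<Rightarrow> 'h \<Rightarrow> 'h \<Rightarrow> 'h \<Rightarrow> 'k" where
  "kap a g x b = sw ground (\<lambda>u v. co x (g \<otimes>\<^bsub>H\<^esub> u) * co b v) a"

definition kap' :: "'h \<Rightarrow> 'h \<Rightarrow> 'h \<Rightarrow> 'h \<Rightarrow> 'k" where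
  "kap' x b a' g' = sw ground (\<lambda>u v. co g' (x \<otimes>\<^bsub>H\<^esub> S u) * co a' v) b"

lemma lam_linear: "\<lbrakk>a \<in> carrier H; b \<in> \<beta>\<rbrakk> \<Longrightarrow> lam a b \<in> linear_maps H ground"
  unfolding lam_def by (rule lm_comp[OF co_linear mult_lm_right[OF lm_id]])

lemma lam_one: "\<lbrakk>a \<in> \<beta>; b \<in> \<beta>\<rbrakk> \<Longrightarrow> lam a b \<one>\<^bsub>H\<^esub> = (if a = b then 1 else 0)"
  using co_dual[of b a] by (auto simp: lam_def \<beta>_mem)

lemma lam_mult:
  assumes "a \<in> \<beta>" "b \<in> \<beta>" "x \<in> carrier H" "y \<in> carrier H"
  shows "lam a b (x \<otimes>\<^bsub>H\<^esub> y) = (\<Sum>c\<in>\<beta>. lam a c x * lam c b y)"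
proof -
  have "lam a b (x \<otimes>\<^bsub>H\<^esub> y) = co b ((a \<otimes>\<^bsub>H\<^esub> x) \<otimes>\<^bsub>H\<^esub> y)" using assms \<beta>_mem by (simp add: lam_def m_assoc)
  also have "\<dots> = (\<Sum>c\<in>\<beta>. lam a c x * lam c b y)"
    using functional_expand[OF lm_comp[OF co_linear[OF assms(2)] mult_lm_left[OF lm_id assms(4)]], of "a \<otimes>\<^bsub>H\<^esub> x"]
      assms \<beta>_mem by (simp add: lam_def)
  finally show ?thesis .
qed

text \<open>The coordinate at \<open>b\<close> of the equation
  \<open>t h = \<epsilon>(h) t\<close>.\<close>

lemma lam_integral:
  assumes "b \<in> \<beta>" "h \<in> carrier H" shows "(\<Sum>a\<in>\<beta>. co a t * lam a b h) = co b t * \<epsilon> h"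
proof -
  have "(\<Sum>a\<in>\<beta>. co a t * lam a b h) = co b (t \<otimes>\<^bsub>H\<^esub> h)"
    using functional_expand[OF lm_comp[OF co_linear[OF assms(1)] mult_lm_left[OF lm_id assms(2)]] t_closed]
    by (simp add: lam_def)
  then show ?thesis
    using t_mult[OF assms(2)] linear_mapsD(3)[OF co_linear[OF assms(1)] t_closed] by (simp add: mult.commute)
qed

lemma lam_counit:
  assumes "a \<in> carrier H" "h \<in> carrier H" shows "(\<Sum>b\<in>\<beta>. \<epsilon> b * lam a b h) = \<epsilon> a * \<epsilon> h"
  using functional_expand[OF functional_\<epsilon>, of "a \<otimes>\<^bsub>H\<^esub> h"] assms
  by (simp add: lam_def counit_mult mult.commute)

lemma counit_co_t: "(\<Sum>a\<in>\<beta>. \<epsilon> a * co a t) = 1"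
  using functional_expand[OF functional_\<epsilon> t_closed] counit_t by (simp add: mult.commute)

lemma bil_kap:
  assumes "x \<in> \<beta>" "b \<in> \<beta>" "g \<in> carrier H"
  shows "bilinear_map H H ground (\<lambda>u v. co x (g \<otimes>\<^bsub>H\<^esub> u) * co b v)"
  by (rule bil_mult_ground[OF lm_comp[OF co_linear[OF assms(1)] mult_lm_right[OF lm_id assms(3)]] co_linear[OF assms(2)]])

lemma kap_linear:
  assumes "x \<in> \<beta>" "b \<in> \<beta>" "g \<in> carrier H"
  shows "(\<lambda>a. kap a g x b) \<in> linear_maps H ground"
  unfolding kap_def by (rule sw_linear[OF vspace_ground bil_kap[OF assms]])

text \<open>Both sides equal \<open>kap (a h) g x b\<close>: the left one because the coproduct of
  \<open>a h\<close> is the product of the coproducts, the right one by expanding \<open>a h\<close>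
  in the basis.\<close>

lemma kap_intertwines:
  assumes "a \<in> \<beta>" "g \<in> \<beta>" "x \<in> \<beta>" "b \<in> \<beta>" and h: "h \<in> carrier H"
  shows "(\<Sum>x'\<in>\<beta>. \<Sum>b'\<in>\<beta>. kap a g x' b' * conv (lam x' x) (lam b' b) h) = (\<Sum>a'\<in>\<beta>. kap a' g x b * lam a a' h)"
proof -
  have c: "a \<in> carrier H" "g \<in> carrier H" "x \<in> carrier H" "b \<in> carrier H" using assms \<beta>_mem by auto
  note vg = vspace_ground
  have bl: "bilinear_map H H ground (\<lambda>u v. lam x' x u * lam b' b v)" if "x' \<in> carrier H" "b' \<in> carrier H" for x' b'
    by (rule bil_mult_ground[OF lam_linear[OF that(1) assms(3)] lam_linear[OF that(2) assms(4)]])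
  let ?P = "\<lambda>u v p q. co x (g \<otimes>\<^bsub>H\<^esub> (u \<otimes>\<^bsub>H\<^esub> p)) * co b (v \<otimes>\<^bsub>H\<^esub> q)"
  have lin1: "(\<lambda>u. co x (g \<otimes>\<^bsub>H\<^esub> (u \<otimes>\<^bsub>H\<^esub> p))) \<in> linear_maps H ground" if "p \<in> carrier H" for p
    by (rule lm_comp[OF co_linear[OF assms(3)]]) (intro mult_lm_right mult_lm_left lm_id c that)
  have lin2: "(\<lambda>u. co b (u \<otimes>\<^bsub>H\<^esub> p)) \<in> linear_maps H ground" if "p \<in> carrier H" for p
    by (rule lm_comp[OF co_linear[OF assms(4)]]) (intro mult_lm_right mult_lm_left lm_id c that)
  have lin3: "(\<lambda>p. co x (g \<otimes>\<^bsub>H\<^esub> (u \<otimes>\<^bsub>H\<^esub> p))) \<in> linear_maps H ground" if "u \<in> carrier H" for u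
    by (rule lm_comp[OF co_linear[OF assms(3)]]) (intro mult_lm_right mult_lm_left lm_id c that)
  have lin4: "(\<lambda>p. co b (u \<otimes>\<^bsub>H\<^esub> p)) \<in> linear_maps H ground" if "u \<in> carrier H" for u
    by (rule lm_comp[OF co_linear[OF assms(4)]]) (intro mult_lm_right mult_lm_left lm_id c that)
  \<comment> \<open>The coordinates of \<open>g u\<close> and of \<open>v\<close> recombine with the
    matrix coefficients, so that both sums over the basis disappear.\<close>
  have inner: "(\<Sum>x'\<in>\<beta>. \<Sum>b'\<in>\<beta>. (co x' (g \<otimes>\<^bsub>H\<^esub> u) * co b' v) * conv (lam x' x) (lam b' b) h) = sw ground (?P u v) h"
    if uv: "u \<in> carrier H" "v \<in> carrier H" for u v
  proof -
    have "(\<Sum>x'\<in>\<beta>. \<Sum>b'\<in>\<beta>. (co x' (g \<otimes>\<^bsub>H\<^esub> u) * co b' v) * conv (lam x' x) (lam b' b) h)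
        = (\<Sum>x'\<in>\<beta>. \<Sum>b'\<in>\<beta>. sw ground (\<lambda>p q. (co x' (g \<otimes>\<^bsub>H\<^esub> u) * co b' v) * (lam x' x p * lam b' b q)) h)"
      unfolding conv_def by (intro sum.cong refl sw_scale[OF bl h, symmetric] \<beta>_mem)
    also have "\<dots> = sw ground (\<lambda>p q. \<Sum>x'\<in>\<beta>. \<Sum>b'\<in>\<beta>. (co x' (g \<otimes>\<^bsub>H\<^esub> u) * co b' v) * (lam x' x p * lam b' b q)) h"
    proof -
      have bb: "bilinear_map H H ground (\<lambda>p q. (co x' (g \<otimes>\<^bsub>H\<^esub> u) * co b' v) * (lam x' x p * lam b' b q))"
        if "x' \<in> \<beta>" "b' \<in> \<beta>" for x' b'
        by (rule bilinear_mapI) (auto intro!: lm_scale lm_scale_right lam_linear assms \<beta>_mem that)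
      have bs: "bilinear_map H H ground (\<lambda>p q. \<Sum>b'\<in>\<beta>. (co x' (g \<otimes>\<^bsub>H\<^esub> u) * co b' v) * (lam x' x p * lam b' b q))"
        if "x' \<in> \<beta>" for x'
        using lm_finsum[OF vg finite_\<beta> bilinear_mapD(1)[OF bb[OF that]]] lm_finsum[OF vg finite_\<beta> bilinear_mapD(2)[OF bb[OF that]]]
        by (intro bilinear_mapI) (simp_all add: finsum_ground[OF finite_\<beta>])
      show ?thesis by (simp add: sw_sum[OF finite_\<beta> bs h] sw_sum[OF finite_\<beta> bb h])
    qed
    also have "\<dots> = sw ground (?P u v) h"
    proof (rule sw_cong[OF vg _ h, symmetric])
      show "bilinear_map H H ground (?P u v)" by (rule bil_mult_ground[OF lin3[OF uv(1)] lin4[OF uv(2)]])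
      fix p q assume pq: "p \<in> carrier H" "q \<in> carrier H"
      have "(\<Sum>x'\<in>\<beta>. \<Sum>b'\<in>\<beta>. (co x' (g \<otimes>\<^bsub>H\<^esub> u) * co b' v) * (lam x' x p * lam b' b q))
          = (\<Sum>x'\<in>\<beta>. co x' (g \<otimes>\<^bsub>H\<^esub> u) * lam x' x p) * (\<Sum>b'\<in>\<beta>. co b' v * lam b' b q)"
        unfolding sum_product by (intro sum.cong refl) (simp add: mult_ac)
      also have "(\<Sum>x'\<in>\<beta>. co x' (g \<otimes>\<^bsub>H\<^esub> u) * lam x' x p) = co x (g \<otimes>\<^bsub>H\<^esub> u \<otimes>\<^bsub>H\<^esub> p)"
        using functional_expand[OF lm_comp[OF co_linear[OF assms(3)] mult_lm_left[OF lm_id pq(1)]], of "g \<otimes>\<^bsub>H\<^esub> u"] c uv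
        by (simp add: lam_def)
      also have "(\<Sum>b'\<in>\<beta>. co b' v * lam b' b q) = co b (v \<otimes>\<^bsub>H\<^esub> q)"
        using functional_expand[OF lin2[OF pq(2)] uv(2)] by (simp add: lam_def)
      finally show "?P u v p q = (\<Sum>x'\<in>\<beta>. \<Sum>b'\<in>\<beta>. (co x' (g \<otimes>\<^bsub>H\<^esub> u) * co b' v) * (lam x' x p * lam b' b q))"
        using c uv pq by (simp add: m_assoc)
    qed
    finally show ?thesis .
  qed
  have bb: "bilinear_map H H ground (\<lambda>u v. (co x' (g \<otimes>\<^bsub>H\<^esub> u) * co b' v) * conv (lam x' x) (lam b' b) h)"
    if "x' \<in> \<beta>" "b' \<in> \<beta>" for x' b'
    by (rule bilinear_mapI) (auto intro!: lm_scale_right lm_scale co_linear lm_comp[OF co_linear] mult_lm_right lm_id that c)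
  have bs: "bilinear_map H H ground (\<lambda>u v. \<Sum>b'\<in>\<beta>. (co x' (g \<otimes>\<^bsub>H\<^esub> u) * co b' v) * conv (lam x' x) (lam b' b) h)"
    if "x' \<in> \<beta>" for x'
    using lm_finsum[OF vg finite_\<beta> bilinear_mapD(1)[OF bb[OF that]]] lm_finsum[OF vg finite_\<beta> bilinear_mapD(2)[OF bb[OF that]]]
    by (intro bilinear_mapI) (simp_all add: finsum_ground[OF finite_\<beta>])
  have bss: "bilinear_map H H ground (\<lambda>u v. \<Sum>x'\<in>\<beta>. \<Sum>b'\<in>\<beta>. (co x' (g \<otimes>\<^bsub>H\<^esub> u) * co b' v) * conv (lam x' x) (lam b' b) h)"
    using lm_finsum[OF vg finite_\<beta> bilinear_mapD(1)[OF bs]] lm_finsum[OF vg finite_\<beta> bilinear_mapD(2)[OF bs]]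
    by (intro bilinear_mapI) (simp_all add: finsum_ground[OF finite_\<beta>])
  have "(\<Sum>x'\<in>\<beta>. \<Sum>b'\<in>\<beta>. kap a g x' b' * conv (lam x' x) (lam b' b) h)
      = (\<Sum>x'\<in>\<beta>. \<Sum>b'\<in>\<beta>. sw ground (\<lambda>u v. (co x' (g \<otimes>\<^bsub>H\<^esub> u) * co b' v) * conv (lam x' x) (lam b' b) h) a)"
    unfolding kap_def
    by (intro sum.cong refl sw_hom[OF vg vg bil_kap _ c(1), OF _ _ _ lm_scale_right[OF lm_id]] c)
  also have "\<dots> = sw ground (\<lambda>u v. \<Sum>x'\<in>\<beta>. \<Sum>b'\<in>\<beta>. (co x' (g \<otimes>\<^bsub>H\<^esub> u) * co b' v) * conv (lam x' x) (lam b' b) h) a"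
    by (simp add: sw_sum[OF finite_\<beta> bs c(1)] sw_sum[OF finite_\<beta> bb c(1)])
  also have "\<dots> = sw ground (\<lambda>u v. sw ground (?P u v) h) a"
    by (rule sw_cong[OF vg bss c(1) inner])
  also have "\<dots> = kap (a \<otimes>\<^bsub>H\<^esub> h) g x b"
    unfolding kap_def by (rule sw_mult[OF vg bil_kap[OF assms(3,4) c(2)] c(1) h, symmetric])
  also have "\<dots> = (\<Sum>a'\<in>\<beta>. kap a' g x b * lam a a' h)"
    using functional_expand[OF kap_linear[OF assms(3,4) c(2)], of "a \<otimes>\<^bsub>H\<^esub> h"] c h
    by (simp add: lam_def mult.commute)
  finally show ?thesis .
qed

text \<open>In Sweedler form this is \<open>g a1 S(a2) \<otimes> a3 = g \<otimes> a\<close>: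
  coassociativity, the antipode, then the counit.\<close>

lemma kap_inverse:
  assumes "a \<in> \<beta>" "g \<in> \<beta>" "a' \<in> \<beta>" "g' \<in> \<beta>"
  shows "(\<Sum>x\<in>\<beta>. \<Sum>b\<in>\<beta>. kap' x b a' g' * kap a g x b) = (if a = a' \<and> g = g' then 1 else 0)"
proof -
  have c: "a \<in> carrier H" "g \<in> carrier H" using assms \<beta>_mem by auto
  note vg = vspace_ground
  have tri: "trilinear H H H ground (\<lambda>x u v. co g' (x \<otimes>\<^bsub>H\<^esub> S u) * co a' v)"
    by (rule trilinearI)
      (auto intro!: lm_scale lm_scale_right co_linear assms lm_comp[OF co_linear[OF assms(4)]]
        mult_lm_left mult_lm_right antipode_linear lm_id S_closed)
  have lx: "(\<lambda>x. kap' x b a' g') \<in> linear_maps H ground" if "b \<in> carrier H" for b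
    unfolding kap'_def by (rule sw_param[OF vg vspace_A that tri])
  have lb: "(\<lambda>b. kap' x b a' g') \<in> linear_maps H ground" if "x \<in> carrier H" for x
    unfolding kap'_def by (rule sw_linear[OF vg trilinearD(4)[OF tri that]])
  have inner: "(\<Sum>x\<in>\<beta>. \<Sum>b\<in>\<beta>. kap' x b a' g' * (co x (g \<otimes>\<^bsub>H\<^esub> u) * co b v)) = kap' (g \<otimes>\<^bsub>H\<^esub> u) v a' g'"
    if uv: "u \<in> carrier H" "v \<in> carrier H" for u v
  proof -
    have "(\<Sum>x\<in>\<beta>. \<Sum>b\<in>\<beta>. kap' x b a' g' * (co x (g \<otimes>\<^bsub>H\<^esub> u) * co b v))
        = (\<Sum>x\<in>\<beta>. co x (g \<otimes>\<^bsub>H\<^esub> u) * (\<Sum>b\<in>\<beta>. co b v * kap' x b a' g'))"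
      by (simp add: sum_distrib_left mult_ac)
    also have "\<dots> = (\<Sum>x\<in>\<beta>. co x (g \<otimes>\<^bsub>H\<^esub> u) * kap' x v a' g')"
      by (intro sum.cong refl arg_cong2[where f="(*)"] functional_expand[OF lb uv(2), symmetric] \<beta>_mem)
    also have "\<dots> = kap' (g \<otimes>\<^bsub>H\<^esub> u) v a' g'"
      using functional_expand[OF lx[OF uv(2)], of "g \<otimes>\<^bsub>H\<^esub> u"] c uv by simp
    finally show ?thesis .
  qed
  have bb: "bilinear_map H H ground (\<lambda>u v. kap' x b a' g' * (co x (g \<otimes>\<^bsub>H\<^esub> u) * co b v))" if "x \<in> \<beta>" "b \<in> \<beta>" for x b
    by (rule bilinear_mapI) (auto intro!: lm_scale lm_scale_right co_linear lm_comp[OF co_linear] mult_lm_right lm_id that c)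
  have bs: "bilinear_map H H ground (\<lambda>u v. \<Sum>b\<in>\<beta>. kap' x b a' g' * (co x (g \<otimes>\<^bsub>H\<^esub> u) * co b v))" if "x \<in> \<beta>" for x
    using lm_finsum[OF vg finite_\<beta> bilinear_mapD(1)[OF bb[OF that]]] lm_finsum[OF vg finite_\<beta> bilinear_mapD(2)[OF bb[OF that]]]
    by (intro bilinear_mapI) (simp_all add: finsum_ground[OF finite_\<beta>])
  have bss: "bilinear_map H H ground (\<lambda>u v. \<Sum>x\<in>\<beta>. \<Sum>b\<in>\<beta>. kap' x b a' g' * (co x (g \<otimes>\<^bsub>H\<^esub> u) * co b v))"
    using lm_finsum[OF vg finite_\<beta> bilinear_mapD(1)[OF bs]] lm_finsum[OF vg finite_\<beta> bilinear_mapD(2)[OF bs]]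
    by (intro bilinear_mapI) (simp_all add: finsum_ground[OF finite_\<beta>])
  have tri2: "trilinear H H H ground (\<lambda>u p q. co g' (g \<otimes>\<^bsub>H\<^esub> u \<otimes>\<^bsub>H\<^esub> S p) * co a' q)"
    by (rule trilinearI)
      (auto intro!: lm_scale lm_scale_right co_linear assms c lm_comp[OF co_linear[OF assms(4)]]
        mult_lm_left mult_lm_right antipode_linear lm_id S_closed)
  have lf: "(\<lambda>y. co g' (g \<otimes>\<^bsub>H\<^esub> y) * co a' q) \<in> linear_maps H ground" if "q \<in> carrier H" for q
    by (intro lm_scale_right lm_comp[OF co_linear[OF assms(4)]] mult_lm_right lm_id c)
  have "(\<Sum>x\<in>\<beta>. \<Sum>b\<in>\<beta>. kap' x b a' g' * kap a g x b)
      = (\<Sum>x\<in>\<beta>. \<Sum>b\<in>\<beta>. sw ground (\<lambda>u v. kap' x b a' g' * (co x (g \<otimes>\<^bsub>H\<^esub> u) * co b v)) a)"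
    unfolding kap_def by (intro sum.cong refl sw_scale[OF bil_kap c(1), symmetric] c)
  also have "\<dots> = sw ground (\<lambda>u v. \<Sum>x\<in>\<beta>. \<Sum>b\<in>\<beta>. kap' x b a' g' * (co x (g \<otimes>\<^bsub>H\<^esub> u) * co b v)) a"
    by (simp add: sw_sum[OF finite_\<beta> bs c(1)] sw_sum[OF finite_\<beta> bb c(1)])
  also have "\<dots> = sw ground (\<lambda>u v. kap' (g \<otimes>\<^bsub>H\<^esub> u) v a' g') a"
    by (rule sw_cong[OF vg bss c(1) inner])
  also have "\<dots> = sw ground (\<lambda>u v. sw ground (\<lambda>p q. co g' (g \<otimes>\<^bsub>H\<^esub> p \<otimes>\<^bsub>H\<^esub> S q) * co a' v) u) a"
    unfolding kap'_def by (rule sw_coassoc[OF vg tri2 c(1), symmetric])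
  also have "\<dots> = sw ground (\<lambda>u v. \<epsilon> u * (co g' g * co a' v)) a"
  proof (rule sw_cong[OF vg sw_bil_left[OF vg tri2] c(1)])
    fix u v assume uv: "u \<in> carrier H" "v \<in> carrier H"
    have "sw ground (\<lambda>p q. co g' (g \<otimes>\<^bsub>H\<^esub> p \<otimes>\<^bsub>H\<^esub> S q) * co a' v) u
        = sw ground (\<lambda>p q. co g' (g \<otimes>\<^bsub>H\<^esub> (p \<otimes>\<^bsub>H\<^esub> S q)) * co a' v) u"
      by (rule sw_cong[OF vg trilinearD(6)[OF tri2 uv(2)] uv(1)]) (simp add: m_assoc c S_closed)
    also have "\<dots> = \<epsilon> u * (co g' g * co a' v)"
      using sw_antipode_right[OF vg lf[OF uv(2)] uv(1)] c by simp
    finally show "sw ground (\<lambda>p q. co g' (g \<otimes>\<^bsub>H\<^esub> p \<otimes>\<^bsub>H\<^esub> S q) * co a' v) u = \<epsilon> u * (co g' g * co a' v)" .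
  qed
  also have "\<dots> = co g' g * co a' a"
    using sw_counit_left[OF vg lm_scale[OF co_linear[OF assms(3)]] c(1)] by simp
  finally show ?thesis using co_dual[OF assms(4,2)] co_dual[OF assms(3,1)] by auto
qed

end

section \<open>The partial smash product\<close>

locale partial_smash = based_hopf_algebra H \<Delta> \<epsilon> S t \<beta> co + alg: partial_module_algebra H \<Delta> A act
  for H :: "('k::field, 'h) module" and \<Delta> :: "'h \<Rightarrow> ('k, 'h, 'h) tensor" and \<epsilon> :: "'h \<Rightarrow> 'k" and S :: "'h \<Rightarrow> 'h"
    and t :: 'h and \<beta> :: "'h set" and co :: "'h \<Rightarrow> 'h \<Rightarrow> 'k"
    and A :: "('k, 'a) module" and act :: "'h \<Rightarrow> 'a \<Rightarrow> 'a"
begin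

sublocale AH: tensor_pair A H
  by (rule tensor_pair.intro[OF alg.vspace_A vspace_A])

abbreviation AT :: "('k, ('k, 'a, 'h) tensor) module" where "AT \<equiv> tensor_space A H"
abbreviation el :: "'a \<Rightarrow> 'h \<Rightarrow> ('k, 'a, 'h) tensor" where "el \<equiv> tensor_elem A H"
abbreviation e :: "('k, 'a, 'h) tensor" where "e \<equiv> el \<one>\<^bsub>A\<^esub> \<one>\<^bsub>H\<^esub>"

lemmas vAT = AH.vspace_T

definition sm :: "('k, 'a, 'h) tensor \<Rightarrow> ('k, 'a, 'h) tensor \<Rightarrow> ('k, 'a, 'h) tensor" where
  "sm x y = tensor_lift AT (\<lambda>a h. tensor_lift AT (\<lambda>b g.
     sw AT (\<lambda>h1 h2. el (a \<otimes>\<^bsub>A\<^esub> act h1 b) (h2 \<otimes>\<^bsub>H\<^esub> g)) h) y) x"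

lemma act_closed: "\<lbrakk>h \<in> carrier H; a \<in> carrier A\<rbrakk> \<Longrightarrow> act h a \<in> carrier A"
  by (rule bilinear_mapD(3)[OF alg.act_bilinear])

lemma el_closed: "\<lbrakk>a \<in> carrier A; h \<in> carrier H\<rbrakk> \<Longrightarrow> el a h \<in> carrier AT"
  by (rule AH.telem_closed)

lemma e_closed: "e \<in> carrier AT"
  by (rule el_closed[OF alg.one_closed one_closed])

lemma amult_lm_left: "\<lbrakk>g \<in> linear_maps Y A; a \<in> carrier A\<rbrakk> \<Longrightarrow> (\<lambda>x. g x \<otimes>\<^bsub>A\<^esub> a) \<in> linear_maps Y A"
  by (rule lm_bil_left[OF alg.mult_bilinear])

lemma amult_lm_right: "\<lbrakk>g \<in> linear_maps Y A; a \<in> carrier A\<rbrakk> \<Longrightarrow> (\<lambda>x. a \<otimes>\<^bsub>A\<^esub> g x) \<in> linear_maps Y A"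
  by (rule lm_bil_right[OF alg.mult_bilinear])

lemma act_lm_left: "\<lbrakk>g \<in> linear_maps Y H; a \<in> carrier A\<rbrakk> \<Longrightarrow> (\<lambda>x. act (g x) a) \<in> linear_maps Y A"
  by (rule lm_bil_left[OF alg.act_bilinear])

lemma act_lm_right: "\<lbrakk>g \<in> linear_maps Y A; h \<in> carrier H\<rbrakk> \<Longrightarrow> (\<lambda>x. act h (g x)) \<in> linear_maps Y A"
  by (rule lm_bil_right[OF alg.act_bilinear])

lemma el_lm_left: "\<lbrakk>g \<in> linear_maps Y A; h \<in> carrier H\<rbrakk> \<Longrightarrow> (\<lambda>x. el (g x) h) \<in> linear_maps Y AT"
  by (rule lm_bil_left[OF AH.bilinear_telem])

lemma el_lm_right: "\<lbrakk>g \<in> linear_maps Y H; a \<in> carrier A\<rbrakk> \<Longrightarrow> (\<lambda>x. el a (g x)) \<in> linear_maps Y AT"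
  by (rule lm_bil_right[OF AH.bilinear_telem])

lemmas lin = lm_id el_lm_left el_lm_right amult_lm_left amult_lm_right act_lm_left act_lm_right
  mult_lm_left mult_lm_right act_closed el_closed alg.m_closed m_closed

lemma bil_q:
  assumes "a \<in> carrier A" "b \<in> carrier A" "g \<in> carrier H"
  shows "bilinear_map H H AT (\<lambda>h1 h2. el (a \<otimes>\<^bsub>A\<^esub> act h1 b) (h2 \<otimes>\<^bsub>H\<^esub> g))"
  by (rule bilinear_mapI) (intro lin assms; assumption)+

definition q :: "'a \<Rightarrow> 'h \<Rightarrow> 'a \<Rightarrow> 'h \<Rightarrow> ('k, 'a, 'h) tensor" where
  "q a h b g = sw AT (\<lambda>h1 h2. el (a \<otimes>\<^bsub>A\<^esub> act h1 b) (h2 \<otimes>\<^bsub>H\<^esub> g)) h"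

lemma q_lin_a:
  assumes "h \<in> carrier H" "b \<in> carrier A" "g \<in> carrier H" shows "(\<lambda>a. q a h b g) \<in> linear_maps A AT"
  unfolding q_def by (rule sw_param[OF vAT alg.vspace_A assms(1)], rule trilinearI; intro lin assms; assumption)

lemma q_lin_b:
  assumes "a \<in> carrier A" "h \<in> carrier H" "g \<in> carrier H" shows "(\<lambda>b. q a h b g) \<in> linear_maps A AT"
  unfolding q_def by (rule sw_param[OF vAT alg.vspace_A assms(2)], rule trilinearI; intro lin assms; assumption)

lemma q_lin_g:
  assumes "a \<in> carrier A" "h \<in> carrier H" "b \<in> carrier A" shows "(\<lambda>g. q a h b g) \<in> linear_maps H AT"
  unfolding q_def by (rule sw_param[OF vAT vspace_A assms(2)], rule trilinearI; intro lin assms; assumption)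

lemma q_lin_h:
  assumes "a \<in> carrier A" "b \<in> carrier A" "g \<in> carrier H" shows "(\<lambda>h. q a h b g) \<in> linear_maps H AT"
  unfolding q_def by (rule sw_linear[OF vAT bil_q[OF assms]])

lemma q_bil:
  assumes "a \<in> carrier A" "h \<in> carrier H" shows "bilinear_map A H AT (\<lambda>b g. q a h b g)"
  by (rule bilinear_mapI; rule q_lin_b q_lin_g; (rule assms | assumption))

lemma q_lift_bil:
  assumes "y \<in> carrier AT" shows "bilinear_map A H AT (\<lambda>a h. tensor_lift AT (\<lambda>b g. q a h b g) y)"
proof (rule bilinear_mapI)
  show "(\<lambda>h. tensor_lift AT (\<lambda>b g. q a h b g) y) \<in> linear_maps H AT" if "a \<in> carrier A" for a
    by (rule AH.lm_lift_param[OF vAT q_bil[OF that] q_lin_h[OF that] vspace_A assms])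
  show "(\<lambda>a. tensor_lift AT (\<lambda>b g. q a h b g) y) \<in> linear_maps A AT" if "h \<in> carrier H" for h
    by (rule AH.lm_lift_param[OF vAT q_bil[OF _ that] q_lin_a[OF that] alg.vspace_A assms])
qed

lemma sm_bil: "bilinear_map AT AT AT sm"
proof (rule bilinear_mapI)
  show "(\<lambda>y. sm x y) \<in> linear_maps AT AT" if "x \<in> carrier AT" for x
    unfolding sm_def q_def[symmetric]
    by (rule AH.lm_lift_param[OF vAT q_lift_bil AH.tensor_lift_linear[OF vAT q_bil] vAT that])
  show "(\<lambda>x. sm x y) \<in> linear_maps AT AT" if "y \<in> carrier AT" for y
    unfolding sm_def q_def[symmetric] by (rule AH.tensor_lift_linear[OF vAT q_lift_bil[OF that]])
qed

lemma sm_closed: "\<lbrakk>x \<in> carrier AT; y \<in> carrier AT\<rbrakk> \<Longrightarrow> sm x y \<in> carrier AT"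
  by (rule bilinear_mapD(3)[OF sm_bil])

lemma sm_lm_left: "\<lbrakk>g \<in> linear_maps Y AT; y \<in> carrier AT\<rbrakk> \<Longrightarrow> (\<lambda>x. sm (g x) y) \<in> linear_maps Y AT"
  by (rule lm_bil_left[OF sm_bil])

lemma sm_lm_right: "\<lbrakk>g \<in> linear_maps Y AT; y \<in> carrier AT\<rbrakk> \<Longrightarrow> (\<lambda>x. sm y (g x)) \<in> linear_maps Y AT"
  by (rule lm_bil_right[OF sm_bil])

lemma sm_el:
  assumes "a \<in> carrier A" "h \<in> carrier H" "b \<in> carrier A" "g \<in> carrier H"
  shows "sm (el a h) (el b g) = sw AT (\<lambda>h1 h2. el (a \<otimes>\<^bsub>A\<^esub> act h1 b) (h2 \<otimes>\<^bsub>H\<^esub> g)) h"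
proof -
  have "sm (el a h) (el b g) = tensor_lift AT (\<lambda>b g. q a h b g) (el b g)"
    unfolding sm_def q_def[symmetric]
    by (rule AH.tensor_lift_elem[OF vAT q_lift_bil[OF el_closed[OF assms(3,4)]] assms(1,2)])
  then show ?thesis using AH.tensor_lift_elem[OF vAT q_bil[OF assms(1,2)] assms(3,4)] by (simp add: q_def)
qed

lemma sm_el_one:
  assumes "a \<in> carrier A" "b \<in> carrier A" "g \<in> carrier H"
  shows "sm (el a \<one>\<^bsub>H\<^esub>) (el b g) = el (a \<otimes>\<^bsub>A\<^esub> b) g"
  using sm_el[OF assms(1) one_closed assms(2,3)] sw_one[OF vAT bil_q[OF assms]] assms
  by (simp add: alg.act_one)

text \<open>Both sides are the sum of \<open>a (h1 \<cdot> b)(h2 g1 \<cdot> c) # h3 g2 k\<close>. On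
  the right-hand side this needs
  \<open>h \<cdot> (b (g \<cdot> c)) = (h1 \<cdot> b)(h2 g \<cdot> c)\<close>, which is the axiom of
  a partial action.\<close>

lemma sm_assoc_el:
  assumes a: "a \<in> carrier A" and h: "h \<in> carrier H" and b: "b \<in> carrier A" and g: "g \<in> carrier H"
    and c: "c \<in> carrier A" and k: "k \<in> carrier H"
  shows "sm (sm (el a h) (el b g)) (el c k) = sm (el a h) (sm (el b g) (el c k))"
proof -
  let ?F = "\<lambda>h1 u v g1 g2. el ((a \<otimes>\<^bsub>A\<^esub> act h1 b) \<otimes>\<^bsub>A\<^esub> act (u \<otimes>\<^bsub>H\<^esub> g1) c) ((v \<otimes>\<^bsub>H\<^esub> g2) \<otimes>\<^bsub>H\<^esub> k)"
  have bF1: "bilinear_map H H AT (?F h1 u v)" if "h1 \<in> carrier H" "u \<in> carrier H" "v \<in> carrier H" for h1 u v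
    by (rule bilinear_mapI) (intro lin assms that; assumption)+
  have bF2: "bilinear_map H H AT (\<lambda>u v. ?F h1 u v g1 g2)" if "h1 \<in> carrier H" "g1 \<in> carrier H" "g2 \<in> carrier H" for h1 g1 g2
    by (rule bilinear_mapI) (intro lin assms that; assumption)+
  have tF: "trilinear H H H AT (\<lambda>h1 u v. ?F h1 u v g1 g2)" if "g1 \<in> carrier H" "g2 \<in> carrier H" for g1 g2
    by (rule trilinearI) (intro lin assms that; assumption)+
  have tF2: "trilinear H H H AT (\<lambda>x g1 g2. ?F h1 x v g1 g2)" if "h1 \<in> carrier H" "v \<in> carrier H" for h1 v
    by (rule trilinearI) (intro lin assms that; assumption)+
  have tF3: "trilinear H H H AT (\<lambda>x g1 g2. ?F h1 u x g1 g2)" if "h1 \<in> carrier H" "u \<in> carrier H" for h1 u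
    by (rule trilinearI) (intro lin assms that; assumption)+
  have tF4: "trilinear H H H AT (\<lambda>x g1 g2. ?F x u v g1 g2)" if "u \<in> carrier H" "v \<in> carrier H" for u v
    by (rule trilinearI) (intro lin assms that; assumption)+
  let ?G = "\<lambda>h1 u v. sw AT (?F h1 u v) g"
  have tG: "trilinear H H H AT ?G"
    by (rule trilinearI; rule sw_param[OF vAT vspace_A g]; (rule tF2 tF3 tF4; assumption))
  have bab: "bilinear_map H H AT (\<lambda>h1 h2. el (a \<otimes>\<^bsub>A\<^esub> act h1 b) (h2 \<otimes>\<^bsub>H\<^esub> g))" by (rule bil_q[OF a b g])
  have bbc: "bilinear_map H H AT (\<lambda>g1 g2. el (b \<otimes>\<^bsub>A\<^esub> act g1 c) (g2 \<otimes>\<^bsub>H\<^esub> k))" by (rule bil_q[OF b c k])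
  have "sm (sm (el a h) (el b g)) (el c k) = sw AT (\<lambda>h1 h2. sm (el (a \<otimes>\<^bsub>A\<^esub> act h1 b) (h2 \<otimes>\<^bsub>H\<^esub> g)) (el c k)) h"
    unfolding sm_el[OF a h b g]
    by (rule sw_hom[OF vAT vAT bab sm_lm_left[OF lm_id el_closed[OF c k]] h])
  also have "\<dots> = sw AT (\<lambda>h1 h2. sw AT (\<lambda>u v. ?G h1 u v) h2) h"
  proof (rule sw_cong[OF vAT _ h, symmetric])
    show "bilinear_map H H AT (\<lambda>h1 h2. sw AT (\<lambda>u v. ?G h1 u v) h2)" by (rule sw_bil_right[OF vAT tG])
    fix x y assume xy: "x \<in> carrier H" "y \<in> carrier H"
    have ab: "a \<otimes>\<^bsub>A\<^esub> act x b \<in> carrier A" by (intro lin a b xy)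
    show "sw AT (\<lambda>u v. ?G x u v) y = sm (el (a \<otimes>\<^bsub>A\<^esub> act x b) (y \<otimes>\<^bsub>H\<^esub> g)) (el c k)"
      unfolding sm_el[OF ab m_closed[OF xy(2) g] c k]
      by (rule sw_mult[OF vAT bil_q[OF ab c k] xy(2) g, symmetric])
  qed
  also have "\<dots> = sw AT (\<lambda>h1 h2. sw AT (\<lambda>g1 g2. sw AT (\<lambda>u v. ?F h1 u v g1 g2) h2) g) h"
    by (rule sw_cong[OF vAT sw_bil_right[OF vAT tG] h], rule sw_swap[OF vAT _ g]) (use bF1 bF2 in auto)
  also have "\<dots> = sw AT (\<lambda>g1 g2. sw AT (\<lambda>h1 h2. sw AT (\<lambda>u v. ?F h1 u v g1 g2) h2) h) g"
  proof (rule sw_swap[OF vAT h g])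
    show "bilinear_map H H AT (\<lambda>h1 h2. sw AT (\<lambda>u v. ?F h1 u v g1 g2) h2)" if "g1 \<in> carrier H" "g2 \<in> carrier H" for g1 g2
      by (rule sw_bil_right[OF vAT tF[OF that]])
    show "bilinear_map H H AT (\<lambda>g1 g2. sw AT (\<lambda>u v. ?F h1 u v g1 g2) h2)" if "h1 \<in> carrier H" "h2 \<in> carrier H" for h1 h2
    proof (rule bilinear_mapI; rule sw_param[OF vAT vspace_A that(2)]; rule trilinearI)
    qed (intro lin assms that; assumption)+
  qed
  also have "\<dots> = sw AT (\<lambda>g1 g2. sm (el a h) (el (b \<otimes>\<^bsub>A\<^esub> act g1 c) (g2 \<otimes>\<^bsub>H\<^esub> k))) g"
  proof (rule sw_cong[OF vAT _ g, symmetric])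
    show "bilinear_map H H AT (\<lambda>g1 g2. sm (el a h) (el (b \<otimes>\<^bsub>A\<^esub> act g1 c) (g2 \<otimes>\<^bsub>H\<^esub> k)))"
      by (rule bilinear_mapI; rule sm_lm_right[OF _ el_closed[OF a h]]) (intro lin assms; assumption)+
    fix g1 g2 assume gg: "g1 \<in> carrier H" "g2 \<in> carrier H"
    have bc: "b \<otimes>\<^bsub>A\<^esub> act g1 c \<in> carrier A" by (intro lin b c gg)
    have g2k: "g2 \<otimes>\<^bsub>H\<^esub> k \<in> carrier H" using gg k by simp
    have "sm (el a h) (el (b \<otimes>\<^bsub>A\<^esub> act g1 c) (g2 \<otimes>\<^bsub>H\<^esub> k))
        = sw AT (\<lambda>h1 h2. el (a \<otimes>\<^bsub>A\<^esub> act h1 (b \<otimes>\<^bsub>A\<^esub> act g1 c)) (h2 \<otimes>\<^bsub>H\<^esub> (g2 \<otimes>\<^bsub>H\<^esub> k))) h"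
      by (rule sm_el[OF a h bc g2k])
    also have "\<dots> = sw AT (\<lambda>h1 h2. sw AT (\<lambda>u v. ?F u v h2 g1 g2) h1) h"
    proof (rule sw_cong[OF vAT bil_q[OF a bc g2k] h])
      fix x y assume xy: "x \<in> carrier H" "y \<in> carrier H"
      have ba: "bilinear_map H H A (\<lambda>u v. act u b \<otimes>\<^bsub>A\<^esub> act (v \<otimes>\<^bsub>H\<^esub> g1) c)"
        by (rule bilinear_mapI) (intro lin assms gg; assumption)+
      have "el (a \<otimes>\<^bsub>A\<^esub> act x (b \<otimes>\<^bsub>A\<^esub> act g1 c)) (y \<otimes>\<^bsub>H\<^esub> (g2 \<otimes>\<^bsub>H\<^esub> k))
          = sw AT (\<lambda>u v. el (a \<otimes>\<^bsub>A\<^esub> (act u b \<otimes>\<^bsub>A\<^esub> act (v \<otimes>\<^bsub>H\<^esub> g1) c)) (y \<otimes>\<^bsub>H\<^esub> (g2 \<otimes>\<^bsub>H\<^esub> k))) x"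
        unfolding alg.act_mult[OF xy(1) gg(1) b c] sw_def[symmetric]
        by (rule sw_hom[OF alg.vspace_A vAT ba el_lm_left[OF amult_lm_right[OF lm_id a]] xy(1)]) (intro lin xy gg k)
      also have "\<dots> = sw AT (\<lambda>u v. ?F u v y g1 g2) x"
        by (rule sw_cong[OF vAT _ xy(1), symmetric])
          (use trilinearD(6)[OF tF[OF gg] xy(2)] a b c k xy gg in \<open>auto simp: alg.m_assoc m_assoc act_closed\<close>)
      finally show "el (a \<otimes>\<^bsub>A\<^esub> act x (b \<otimes>\<^bsub>A\<^esub> act g1 c)) (y \<otimes>\<^bsub>H\<^esub> (g2 \<otimes>\<^bsub>H\<^esub> k)) = sw AT (\<lambda>u v. ?F u v y g1 g2) x" .
    qed
    also have "\<dots> = sw AT (\<lambda>h1 h2. sw AT (\<lambda>u v. ?F h1 u v g1 g2) h2) h"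
      by (rule sw_coassoc[OF vAT tF[OF gg] h])
    finally show "sm (el a h) (el (b \<otimes>\<^bsub>A\<^esub> act g1 c) (g2 \<otimes>\<^bsub>H\<^esub> k)) = sw AT (\<lambda>h1 h2. sw AT (\<lambda>u v. ?F h1 u v g1 g2) h2) h" .
  qed
  also have "\<dots> = sm (el a h) (sm (el b g) (el c k))"
    unfolding sm_el[OF b g c k]
    by (rule sw_hom[OF vAT vAT bbc sm_lm_right[OF lm_id el_closed[OF a h]] g, symmetric])
  finally show ?thesis .
qed

lemma sm_assoc:
  assumes x: "x \<in> carrier AT" and y: "y \<in> carrier AT" and z: "z \<in> carrier AT"
  shows "sm (sm x y) z = sm x (sm y z)"
proof -
  have 1: "sm (sm (el a h) (el b g)) z = sm (el a h) (sm (el b g) z)"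
    if "a \<in> carrier A" "h \<in> carrier H" "b \<in> carrier A" "g \<in> carrier H" for a h b g
    by (rule AH.tensor_ext[OF _ _ vAT _ z])
      (intro sm_lm_right lm_id sm_closed el_closed that sm_assoc_el; assumption)+
  have 2: "sm (sm (el a h) y) z = sm (el a h) (sm y z)" if "a \<in> carrier A" "h \<in> carrier H" for a h
    by (rule AH.tensor_ext[OF _ _ vAT _ y])
      (intro sm_lm_right sm_lm_left lm_id sm_closed el_closed that 1 z; assumption)+
  show ?thesis
    by (rule AH.tensor_ext[OF _ _ vAT _ x])
      (intro sm_lm_left lm_id sm_closed el_closed 2 y z; assumption)+
qed

lemma sm_e_left:
  assumes "x \<in> carrier AT" shows "sm e x = x"
  by (rule AH.tensor_ext[OF sm_lm_right[OF lm_id e_closed] lm_id vAT _ assms])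
    (simp add: sm_el_one)

abbreviation SP :: "('k, ('k, 'a, 'h) tensor) module" where
  "SP \<equiv> partial_smash_product H \<Delta> A act"

lemma SP_simps:
  "carrier SP = {sm x e |x. x \<in> carrier AT}" "x \<otimes>\<^bsub>SP\<^esub> y = sm x y" "\<one>\<^bsub>SP\<^esub> = e"
  "x \<oplus>\<^bsub>SP\<^esub> y = x \<oplus>\<^bsub>AT\<^esub> y" "\<zero>\<^bsub>SP\<^esub> = \<zero>\<^bsub>AT\<^esub>" "c \<odot>\<^bsub>SP\<^esub> x = c \<odot>\<^bsub>AT\<^esub> x"
  by (simp_all add: partial_smash_product_def smash_product_def Let_def sm_def sw_def)

text \<open>\<open>e\<close> is idempotent, so \<open>(A # H) e\<close> consists of the elements
  fixed by right multiplication by \<open>e\<close>. As \<open>e\<close> is also a left identity, it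
  is the identity of that algebra.\<close>

lemma SP_iff: "x \<in> carrier SP \<longleftrightarrow> x \<in> carrier AT \<and> sm x e = x"
proof
  assume "x \<in> carrier SP"
  then obtain y where y: "y \<in> carrier AT" "x = sm y e" by (auto simp: SP_simps)
  then show "x \<in> carrier AT \<and> sm x e = x"
    using sm_assoc[OF y(1) e_closed e_closed] sm_e_left[OF e_closed] sm_closed[OF y(1) e_closed] by simp
next
  show "x \<in> carrier SP" if "x \<in> carrier AT \<and> sm x e = x" using that by (auto simp: SP_simps)
qed

text \<open>Stated for a general subspace \<open>N\<close>, since it serves both for
  \<open>SP\<close> and for its finite-dimensional subalgebras.\<close>

lemma algebra_sub:
  assumes N: "N \<subseteq> carrier SP" "e \<in> N" "\<And>x y. \<lbrakk>x \<in> N; y \<in> N\<rbrakk> \<Longrightarrow> x \<oplus>\<^bsub>AT\<^esub> y \<in> N"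
    "\<And>c x. x \<in> N \<Longrightarrow> c \<odot>\<^bsub>AT\<^esub> x \<in> N" "\<And>x y. \<lbrakk>x \<in> N; y \<in> N\<rbrakk> \<Longrightarrow> sm x y \<in> N"
  shows "algebra_over_field (SP\<lparr>carrier := N\<rparr>)"
proof -
  let ?R = "SP\<lparr>carrier := N\<rparr>"
  interpret AT: abelian_group AT by (rule vspaceD(1)[OF vAT])
  note V = vspaceD[OF vAT]
  have c: "x \<in> carrier AT" "sm x e = x" if "x \<in> N" for x using N(1) that SP_iff by auto
  have z: "\<zero>\<^bsub>AT\<^esub> \<in> N" using N(4)[OF N(2), of 0] V(9)[OF c(1)[OF N(2)]] by simp
  have ab: "abelian_group ?R"
  proof (rule abelian_groupI)
    show "\<exists>y\<in>carrier ?R. y \<oplus>\<^bsub>?R\<^esub> x = \<zero>\<^bsub>?R\<^esub>" if "x \<in> carrier ?R" for x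
    proof (rule bexI)
      have "x \<in> carrier AT" using that c by simp
      then show "(- 1) \<odot>\<^bsub>AT\<^esub> x \<oplus>\<^bsub>?R\<^esub> x = \<zero>\<^bsub>?R\<^esub>" using V(5)[of x "- 1" 1] V(8,9) by (simp add: SP_simps)
      show "(- 1) \<odot>\<^bsub>AT\<^esub> x \<in> carrier ?R" using that N(4) by simp
    qed
  qed (use N z c in \<open>simp_all add: SP_simps AT.a_ac\<close>)
  have vs: "vspace ?R"
    by (rule vspaceI[OF ab]) (use N c V in \<open>simp_all add: SP_simps\<close>)
  have rg: "ring ?R"
  proof (rule ringI[OF ab])
    show "Group.monoid ?R"
      by (rule monoidI) (use N c sm_assoc sm_e_left in \<open>simp_all add: SP_simps\<close>)
  qed (use c linear_mapsD(2)[OF bilinear_mapD(1)[OF sm_bil]] linear_mapsD(2)[OF bilinear_mapD(2)[OF sm_bil]]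
      in \<open>simp_all add: SP_simps\<close>)
  show ?thesis
    by (intro algebra_over_field.intro algebra_over_field_axioms.intro vs rg)
      (use c linear_mapsD(3)[OF bilinear_mapD(1)[OF sm_bil]] linear_mapsD(3)[OF bilinear_mapD(2)[OF sm_bil]]
      in \<open>simp_all add: SP_simps\<close>)
qed

lemma SP_closed:
  "e \<in> carrier SP" "\<And>x y. \<lbrakk>x \<in> carrier SP; y \<in> carrier SP\<rbrakk> \<Longrightarrow> x \<oplus>\<^bsub>AT\<^esub> y \<in> carrier SP"
  "\<And>c x. x \<in> carrier SP \<Longrightarrow> c \<odot>\<^bsub>AT\<^esub> x \<in> carrier SP"
  "\<And>x y. \<lbrakk>x \<in> carrier AT; y \<in> carrier SP\<rbrakk> \<Longrightarrow> sm x y \<in> carrier SP"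
  "\<And>a. a \<in> carrier A \<Longrightarrow> el a \<one>\<^bsub>H\<^esub> \<in> carrier SP"
proof -
  note l = linear_mapsD[OF bilinear_mapD(2)[OF sm_bil e_closed]]
  show "e \<in> carrier SP" using e_closed sm_e_left[OF e_closed] by (simp add: SP_iff)
  show "x \<oplus>\<^bsub>AT\<^esub> y \<in> carrier SP" if "x \<in> carrier SP" "y \<in> carrier SP" for x y
    using that l(2)[of x y] vspaceD(3)[OF vAT] by (simp add: SP_iff)
  show "c \<odot>\<^bsub>AT\<^esub> x \<in> carrier SP" if "x \<in> carrier SP" for c x
    using that l(3)[of x c] vspaceD(2)[OF vAT] by (simp add: SP_iff)
  show "sm x y \<in> carrier SP" if "x \<in> carrier AT" "y \<in> carrier SP" for x y
    using that sm_assoc[of x y e] e_closed sm_closed by (simp add: SP_iff)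
  show "el a \<one>\<^bsub>H\<^esub> \<in> carrier SP" if "a \<in> carrier A" for a
    using that sm_el_one[OF that alg.one_closed one_closed] el_closed one_closed by (simp add: SP_iff)
qed

lemma algebra_SP: "algebra_over_field SP"
  using algebra_sub[OF subset_refl SP_closed(1-3)] SP_closed(4) SP_iff by simp

end

text \<open>Meant for functionals that are additive only on a subspace \<open>N\<close>, as those on
  a subalgebra given by a smaller carrier are, while the sums are still formed in
  \<open>X\<close>.\<close>

lemma finsum_functional_sub:
  fixes X :: "('k::field, 'x) module" and \<phi> :: "'x \<Rightarrow> 'k"
  assumes X: "vspace X" and N: "N \<subseteq> carrier X" "\<zero>\<^bsub>X\<^esub> \<in> N" "\<And>x y. \<lbrakk>x \<in> N; y \<in> N\<rbrakk> \<Longrightarrow> x \<oplus>\<^bsub>X\<^esub> y \<in> N"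
    and C: "finite C" "\<And>i. i \<in> C \<Longrightarrow> g i \<in> N"
  shows "(\<Oplus>\<^bsub>X\<^esub>i\<in>C. g i) \<in> N"
    "\<lbrakk>\<And>x y. \<lbrakk>x \<in> N; y \<in> N\<rbrakk> \<Longrightarrow> \<phi> (x \<oplus>\<^bsub>X\<^esub> y) = \<phi> x + \<phi> y; \<phi> \<zero>\<^bsub>X\<^esub> = 0\<rbrakk> \<Longrightarrow>
      \<phi> (\<Oplus>\<^bsub>X\<^esub>i\<in>C. g i) = (\<Sum>i\<in>C. \<phi> (g i))"
proof -
  interpret abelian_group X by (rule vspaceD(1)[OF X])
  have ins: "(\<Oplus>\<^bsub>X\<^esub>j\<in>insert i C. g j) = g i \<oplus>\<^bsub>X\<^esub> (\<Oplus>\<^bsub>X\<^esub>j\<in>C. g j)"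
    if "finite C" "i \<notin> C" "\<And>j. j \<in> insert i C \<Longrightarrow> g j \<in> N" for i C
    by (rule finsum_insert) (use that N(1) in auto)
  have mem: "(\<Oplus>\<^bsub>X\<^esub>i\<in>C. g i) \<in> N" if "finite C" "\<And>i. i \<in> C \<Longrightarrow> g i \<in> N" for C
    using that
  proof (induction C rule: finite_induct)
    case (insert i C)
    then show ?case using ins[OF insert.hyps insert.prems] N(3) by simp
  qed (simp add: N(2))
  show "(\<Oplus>\<^bsub>X\<^esub>i\<in>C. g i) \<in> N" by (rule mem[OF C])
  assume \<phi>: "\<And>x y. \<lbrakk>x \<in> N; y \<in> N\<rbrakk> \<Longrightarrow> \<phi> (x \<oplus>\<^bsub>X\<^esub> y) = \<phi> x + \<phi> y" "\<phi> \<zero>\<^bsub>X\<^esub> = 0"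
  show "\<phi> (\<Oplus>\<^bsub>X\<^esub>i\<in>C. g i) = (\<Sum>i\<in>C. \<phi> (g i))"
    using C
  proof (induction C rule: finite_induct)
    case (insert i C)
    then show ?case using ins[OF insert.hyps insert.prems] \<phi>(1)[of "g i"] mem[OF insert.hyps(1)] by simp
  qed (simp add: \<phi>(2))
qed

section \<open>The action of the dual of H on the partial smash product\<close>

context partial_smash begin

definition D :: "('h \<Rightarrow> 'k) \<Rightarrow> ('k, 'a, 'h) tensor \<Rightarrow> ('k, 'a, 'h) tensor" where
  "D f = tensor_lift AT (\<lambda>a h. el a (hit f h))"

lemma hit_lm: "\<lbrakk>f \<in> linear_maps H ground; g \<in> linear_maps Y H\<rbrakk> \<Longrightarrow> (\<lambda>x. hit f (g x)) \<in> linear_maps Y H"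
  by (rule lm_comp[OF hit_linear])

lemma D_bil: "f \<in> linear_maps H ground \<Longrightarrow> bilinear_map A H AT (\<lambda>a h. el a (hit f h))"
  by (rule bilinear_mapI) (intro lin hit_closed hit_lm; assumption)+

lemma D_linear: "f \<in> linear_maps H ground \<Longrightarrow> D f \<in> linear_maps AT AT"
  unfolding D_def by (rule AH.tensor_lift_linear[OF vAT D_bil])

lemma D_closed: "\<lbrakk>f \<in> linear_maps H ground; x \<in> carrier AT\<rbrakk> \<Longrightarrow> D f x \<in> carrier AT"
  by (rule linear_mapsD(1)[OF D_linear])

lemma D_el: "\<lbrakk>f \<in> linear_maps H ground; a \<in> carrier A; h \<in> carrier H\<rbrakk> \<Longrightarrow> D f (el a h) = el a (hit f h)"
  unfolding D_def by (rule AH.tensor_lift_elem[OF vAT D_bil])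

lemma D_e: "f \<in> linear_maps H ground \<Longrightarrow> D f e = f \<one>\<^bsub>H\<^esub> \<odot>\<^bsub>AT\<^esub> e"
  using D_el[of f "\<one>\<^bsub>A\<^esub>" "\<one>\<^bsub>H\<^esub>"] hit_one[of f]
    linear_mapsD(3)[OF bilinear_mapD(1)[OF AH.bilinear_telem alg.one_closed] one_closed] by simp

lemma D_counit: "x \<in> carrier AT \<Longrightarrow> D \<epsilon> x = x"
  by (rule AH.tensor_ext[OF D_linear[OF functional_\<epsilon>] lm_id vAT])
    (simp_all add: D_el[OF functional_\<epsilon>] hit_counit)

lemma D_D:
  assumes "f \<in> linear_maps H ground" "g \<in> linear_maps H ground" "x \<in> carrier AT"
  shows "D f (D g x) = D (conv f g) x"
  by (rule AH.tensor_ext[OF lm_comp[OF D_linear[OF assms(1)] D_linear[OF assms(2)]]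
        D_linear[OF conv_linear[OF assms(1,2)]] vAT _ assms(3)])
    (simp add: D_el assms conv_linear hit_closed hit_hit)

text \<open>Right multiplication by \<open>e\<close> uses up a first leg of \<open>h\<close> and
  \<open>D f\<close> a last one, so by coassociativity they commute. Hence \<open>D f\<close>
  preserves the partial smash product.\<close>

lemma D_sm_e:
  assumes "f \<in> linear_maps H ground" "x \<in> carrier AT" shows "D f (sm x e) = sm (D f x) e"
proof (rule AH.tensor_ext[OF lm_comp[OF D_linear[OF assms(1)] sm_lm_left[OF lm_id e_closed]]
      sm_lm_left[OF D_linear[OF assms(1)] e_closed] vAT _ assms(2)])
  fix a h assume a: "a \<in> carrier A" and h: "h \<in> carrier H"
  note b = bil_q[OF a alg.one_closed one_closed]
  have hf: "hit f h \<in> carrier H" by (rule hit_closed[OF assms(1) h])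
  have "D f (sm (el a h) e) = sw AT (\<lambda>h1 h2. D f (el (a \<otimes>\<^bsub>A\<^esub> act h1 \<one>\<^bsub>A\<^esub>) (h2 \<otimes>\<^bsub>H\<^esub> \<one>\<^bsub>H\<^esub>))) h"
    unfolding sm_el[OF a h alg.one_closed one_closed] by (rule sw_hom[OF vAT vAT b D_linear[OF assms(1)] h])
  also have "\<dots> = sw AT (\<lambda>h1 h2. el (a \<otimes>\<^bsub>A\<^esub> act h1 \<one>\<^bsub>A\<^esub>) (hit f h2 \<otimes>\<^bsub>H\<^esub> \<one>\<^bsub>H\<^esub>)) h"
  proof (rule sw_cong[OF vAT _ h, symmetric])
    show "bilinear_map H H AT (\<lambda>h1 h2. el (a \<otimes>\<^bsub>A\<^esub> act h1 \<one>\<^bsub>A\<^esub>) (hit f h2 \<otimes>\<^bsub>H\<^esub> \<one>\<^bsub>H\<^esub>))"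
      by (rule bilinear_mapI) (intro lin hit_closed hit_lm assms a alg.one_closed one_closed; assumption)+
  qed (simp add: D_el assms a act_closed hit_closed)
  also have "\<dots> = sm (D f (el a h)) e"
    unfolding D_el[OF assms(1) a h] sm_el[OF a hf alg.one_closed one_closed]
    by (rule sw_hit[OF vAT b assms(1) h, symmetric])
  finally show "D f (sm (el a h) e) = sm (D f (el a h)) e" .
qed

lemma D_SP: "\<lbrakk>f \<in> linear_maps H ground; x \<in> carrier SP\<rbrakk> \<Longrightarrow> D f x \<in> carrier SP"
  using D_sm_e[of f x] by (simp add: SP_iff D_closed)

text \<open>The product rule \<open>hit_mult\<close> carried over to the smash product; for matrix
  coefficients it becomes the assumption \<open>\<Lambda>_mult\<close> of a comodule
  algebra.\<close>

lemma D_sm: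
  assumes C: "finite C" and f: "f \<in> linear_maps H ground"
    and P: "\<And>c. c \<in> C \<Longrightarrow> P c \<in> linear_maps H ground" and Q: "\<And>c. c \<in> C \<Longrightarrow> Q c \<in> linear_maps H ground"
    and eq: "\<And>x y. \<lbrakk>x \<in> carrier H; y \<in> carrier H\<rbrakk> \<Longrightarrow> f (x \<otimes>\<^bsub>H\<^esub> y) = (\<Sum>c\<in>C. P c x * Q c y)"
    and x: "x \<in> carrier AT" and y: "y \<in> carrier AT"
  shows "D f (sm x y) = (\<Oplus>\<^bsub>AT\<^esub>c\<in>C. sm (D (P c) x) (D (Q c) y))"
proof -
  interpret AT: abelian_group AT by (rule vspaceD(1)[OF vAT])
  have el: "D f (sm (el a h) (el b g)) = (\<Oplus>\<^bsub>AT\<^esub>c\<in>C. sm (D (P c) (el a h)) (D (Q c) (el b g)))"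
    if a: "a \<in> carrier A" and h: "h \<in> carrier H" and b: "b \<in> carrier A" and g: "g \<in> carrier H" for a h b g
  proof -
    have hP: "hit (P c) h \<in> carrier H" and hQ: "hit (Q c) g \<in> carrier H" if "c \<in> C" for c
      using hit_closed[OF P h] hit_closed[OF Q g] that by auto
    let ?F = "\<lambda>c h1 h2. el (a \<otimes>\<^bsub>A\<^esub> act h1 b) (hit (P c) h2 \<otimes>\<^bsub>H\<^esub> hit (Q c) g)"
    have bF: "bilinear_map H H AT (?F c)" if "c \<in> C" for c
      by (rule bilinear_mapI) (intro lin hit_closed hit_lm P[OF that] hQ[OF that] a b; assumption)+
    have "D f (sm (el a h) (el b g)) = sw AT (\<lambda>h1 h2. D f (el (a \<otimes>\<^bsub>A\<^esub> act h1 b) (h2 \<otimes>\<^bsub>H\<^esub> g))) h"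
      unfolding sm_el[OF a h b g] by (rule sw_hom[OF vAT vAT bil_q[OF a b g] D_linear[OF f] h])
    also have "\<dots> = sw AT (\<lambda>h1 h2. \<Oplus>\<^bsub>AT\<^esub>c\<in>C. ?F c h1 h2) h"
    proof (rule sw_cong[OF vAT _ h, symmetric])
      show "bilinear_map H H AT (\<lambda>h1 h2. \<Oplus>\<^bsub>AT\<^esub>c\<in>C. ?F c h1 h2)"
        by (rule bilinear_mapI; rule lm_finsum[OF vAT C]; rule bilinear_mapD[OF bF])
      fix u v assume uv: "u \<in> carrier H" "v \<in> carrier H"
      have ab: "a \<otimes>\<^bsub>A\<^esub> act u b \<in> carrier A" by (intro lin a b uv)
      have "D f (el (a \<otimes>\<^bsub>A\<^esub> act u b) (v \<otimes>\<^bsub>H\<^esub> g))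
          = el (a \<otimes>\<^bsub>A\<^esub> act u b) (\<Oplus>\<^bsub>H\<^esub>c\<in>C. hit (P c) v \<otimes>\<^bsub>H\<^esub> hit (Q c) g)"
        using D_el[OF f ab m_closed[OF uv(2) g]] hit_mult[where P=P and Q=Q, OF C f P Q eq uv(2) g] by simp
      also have "\<dots> = (\<Oplus>\<^bsub>AT\<^esub>c\<in>C. ?F c u v)"
        by (rule linear_map_finsum[OF bilinear_mapD(1)[OF AH.bilinear_telem ab] vspace_A vAT C])
          (use hit_closed[OF P uv(2)] hQ in auto)
      finally show "(\<Oplus>\<^bsub>AT\<^esub>c\<in>C. ?F c u v) = D f (el (a \<otimes>\<^bsub>A\<^esub> act u b) (v \<otimes>\<^bsub>H\<^esub> g))" by simp
    qed
    also have "\<dots> = (\<Oplus>\<^bsub>AT\<^esub>c\<in>C. sw AT (?F c) h)" by (rule sw_finsum[OF vAT C bF h])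
    also have "\<dots> = (\<Oplus>\<^bsub>AT\<^esub>c\<in>C. sm (D (P c) (el a h)) (D (Q c) (el b g)))"
    proof (rule AT.finsum_cong'[OF refl])
      show "(\<lambda>c. sm (D (P c) (el a h)) (D (Q c) (el b g))) \<in> C \<rightarrow> carrier AT"
        using D_closed[OF P] D_closed[OF Q] el_closed a h b g sm_closed by auto
      show "sw AT (?F c) h = sm (D (P c) (el a h)) (D (Q c) (el b g))" if "c \<in> C" for c
        unfolding D_el[OF P[OF that] a h] D_el[OF Q[OF that] b g] sm_el[OF a hP[OF that] b hQ[OF that]]
        by (rule sw_hit[OF vAT bil_q[OF a b hQ[OF that]] P[OF that] h, symmetric])
    qed
    finally show ?thesis .
  qed
  have lin_y: "(\<lambda>y. \<Oplus>\<^bsub>AT\<^esub>c\<in>C. sm (D (P c) x) (D (Q c) y)) \<in> linear_maps AT AT" if "x \<in> carrier AT" for x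
    by (rule lm_finsum[OF vAT C sm_lm_right[OF D_linear[OF Q] D_closed[OF P that]]])
  have lin_x: "(\<lambda>x. \<Oplus>\<^bsub>AT\<^esub>c\<in>C. sm (D (P c) x) (D (Q c) y)) \<in> linear_maps AT AT"
    by (rule lm_finsum[OF vAT C sm_lm_left[OF D_linear[OF P] D_closed[OF Q y]]])
  show ?thesis
  proof (rule AH.tensor_ext[OF lm_comp[OF D_linear[OF f] sm_lm_left[OF lm_id y]] lin_x vAT _ x])
    fix a h assume ah: "a \<in> carrier A" "h \<in> carrier H"
    show "D f (sm (el a h) y) = (\<Oplus>\<^bsub>AT\<^esub>c\<in>C. sm (D (P c) (el a h)) (D (Q c) y))"
      by (rule AH.tensor_ext[OF lm_comp[OF D_linear[OF f] sm_lm_right[OF lm_id el_closed[OF ah]]] lin_y[OF el_closed[OF ah]] vAT el[OF ah] y])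
  qed
qed

lemma D_lincomb:
  assumes C: "finite C" and f: "f \<in> linear_maps H ground" and g: "\<And>i. i \<in> C \<Longrightarrow> g i \<in> linear_maps H ground"
    and eq: "\<And>h. h \<in> carrier H \<Longrightarrow> f h = (\<Sum>i\<in>C. c i * g i h)" and x: "x \<in> carrier AT"
  shows "D f x = (\<Oplus>\<^bsub>AT\<^esub>i\<in>C. c i \<odot>\<^bsub>AT\<^esub> D (g i) x)"
proof (rule AH.tensor_ext[OF D_linear[OF f] lm_finsum[OF vAT C lm_smult[OF D_linear[OF g] vAT]] vAT _ x])
  interpret AT: abelian_group AT by (rule vspaceD(1)[OF vAT])
  fix a h assume a: "a \<in> carrier A" and h: "h \<in> carrier H"
  have bg: "bilinear_map H H H (\<lambda>u v. c i \<odot>\<^bsub>H\<^esub> (g i v \<odot>\<^bsub>H\<^esub> u))" if "i \<in> C" for i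
    by (rule bilinear_mapI; rule lm_smult[OF _ vspace_A]; rule bilinear_mapD[OF bil_hit[OF g[OF that]]])
  have "hit f h = sw H (\<lambda>u v. \<Oplus>\<^bsub>H\<^esub>i\<in>C. c i \<odot>\<^bsub>H\<^esub> (g i v \<odot>\<^bsub>H\<^esub> u)) h"
    unfolding hit_def
  proof (rule sw_cong[OF vspace_A bil_hit[OF f] h])
    fix u v assume u: "u \<in> carrier H" and v: "v \<in> carrier H"
    have "f v \<odot>\<^bsub>H\<^esub> u = (\<Oplus>\<^bsub>H\<^esub>i\<in>C. (c i * g i v) \<odot>\<^bsub>H\<^esub> u)"
      using linear_map_finsum[OF lm_functional[OF lm_id vspace_A u] vspace_ground vspace_A C, of "\<lambda>i. c i * g i v"]
      by (simp add: finsum_ground[OF C] eq[OF v])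
    then show "f v \<odot>\<^bsub>H\<^esub> u = (\<Oplus>\<^bsub>H\<^esub>i\<in>C. c i \<odot>\<^bsub>H\<^esub> (g i v \<odot>\<^bsub>H\<^esub> u))"
      by (simp add: vspaceD(7)[OF vspace_A u])
  qed
  also have "\<dots> = (\<Oplus>\<^bsub>H\<^esub>i\<in>C. sw H (\<lambda>u v. c i \<odot>\<^bsub>H\<^esub> (g i v \<odot>\<^bsub>H\<^esub> u)) h)" by (rule sw_finsum[OF vspace_A C bg h])
  also have "\<dots> = (\<Oplus>\<^bsub>H\<^esub>i\<in>C. c i \<odot>\<^bsub>H\<^esub> hit (g i) h)"
    by (rule finsum_cong'[OF refl])
      (auto simp: hit_def sw_hom[OF vspace_A vspace_A bil_hit[OF g] lm_smult[OF lm_id vspace_A] h, symmetric]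
        intro!: smult_closed_H sw_closed[OF vspace_A bil_hit[OF g] h])
  finally have "el a (hit f h) = el a (\<Oplus>\<^bsub>H\<^esub>i\<in>C. c i \<odot>\<^bsub>H\<^esub> hit (g i) h)" by simp
  also have "\<dots> = (\<Oplus>\<^bsub>AT\<^esub>i\<in>C. el a (c i \<odot>\<^bsub>H\<^esub> hit (g i) h))"
    by (rule linear_map_finsum[OF bilinear_mapD(1)[OF AH.bilinear_telem a] vspace_A vAT C])
      (use hit_closed[OF g h] smult_closed_H in auto)
  also have "\<dots> = (\<Oplus>\<^bsub>AT\<^esub>i\<in>C. c i \<odot>\<^bsub>AT\<^esub> D (g i) (el a h))"
    by (rule AT.finsum_cong'[OF refl])
      (use hit_closed[OF g h] vspaceD(2)[OF vAT] el_closed[OF a] in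
        \<open>auto simp: D_el[OF g a h] linear_mapsD(3)[OF bilinear_mapD(1)[OF AH.bilinear_telem a]]\<close>)
  finally show "D f (el a h) = (\<Oplus>\<^bsub>AT\<^esub>i\<in>C. c i \<odot>\<^bsub>AT\<^esub> D (g i) (el a h))" by (simp add: D_el[OF f a h])
qed

lemma D_expand:
  assumes "f \<in> linear_maps H ground" "x \<in> carrier AT"
  shows "D f x = (\<Oplus>\<^bsub>AT\<^esub>b\<in>\<beta>. f b \<odot>\<^bsub>AT\<^esub> D (co b) x)"
  by (rule D_lincomb[OF finite_\<beta> assms(1) co_linear _ assms(2)])
    (simp_all add: functional_expand[OF assms(1)] mult.commute)

definition xi :: "('k, 'a, 'h) tensor \<Rightarrow> 'a" where
  "xi = tensor_lift A (\<lambda>a h. a \<otimes>\<^bsub>A\<^esub> act h \<one>\<^bsub>A\<^esub>)"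

lemma xi_bil: "bilinear_map A H A (\<lambda>a h. a \<otimes>\<^bsub>A\<^esub> act h \<one>\<^bsub>A\<^esub>)"
  by (rule bilinear_mapI) (intro lin alg.one_closed; assumption)+

lemma xi_linear: "xi \<in> linear_maps AT A"
  unfolding xi_def by (rule AH.tensor_lift_linear[OF alg.vspace_A xi_bil])

lemma xi_closed: "x \<in> carrier AT \<Longrightarrow> xi x \<in> carrier A"
  by (rule linear_mapsD(1)[OF xi_linear])

lemma xi_el: "\<lbrakk>a \<in> carrier A; h \<in> carrier H\<rbrakk> \<Longrightarrow> xi (el a h) = a \<otimes>\<^bsub>A\<^esub> act h \<one>\<^bsub>A\<^esub>"
  unfolding xi_def by (rule AH.tensor_lift_elem[OF alg.vspace_A xi_bil])

text \<open>Summing over dual bases inserts the second leg of \<open>h\<close> into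
  \<open>S\<close>, which leaves the sum of \<open>h1 S(h2)\<close>.\<close>

lemma hit_antipode:
  assumes h: "h \<in> carrier H"
  shows "(\<Oplus>\<^bsub>H\<^esub>b\<in>\<beta>. hit (co b) h \<otimes>\<^bsub>H\<^esub> S b) = \<epsilon> h \<odot>\<^bsub>H\<^esub> \<one>\<^bsub>H\<^esub>"
proof -
  have bb: "bilinear_map H H H (\<lambda>u v. co b v \<odot>\<^bsub>H\<^esub> (u \<otimes>\<^bsub>H\<^esub> S b))" if "b \<in> \<beta>" for b
    by (rule bil_functional_smult_left[OF co_linear[OF that] vspace_A vspace_A mult_lm_left[OF lm_id S_closed[OF \<beta>_mem[OF that]]]])
  have "(\<Oplus>\<^bsub>H\<^esub>b\<in>\<beta>. hit (co b) h \<otimes>\<^bsub>H\<^esub> S b) = (\<Oplus>\<^bsub>H\<^esub>b\<in>\<beta>. sw H (\<lambda>u v. co b v \<odot>\<^bsub>H\<^esub> (u \<otimes>\<^bsub>H\<^esub> S b)) h)"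
  proof (rule finsum_cong'[OF refl])
    show "(\<lambda>b. sw H (\<lambda>u v. co b v \<odot>\<^bsub>H\<^esub> (u \<otimes>\<^bsub>H\<^esub> S b)) h) \<in> \<beta> \<rightarrow> carrier H"
      using sw_closed[OF vspace_A bb h] by auto
    fix b assume b: "b \<in> \<beta>"
    have Sb: "S b \<in> carrier H" by (rule S_closed[OF \<beta>_mem[OF b]])
    have "hit (co b) h \<otimes>\<^bsub>H\<^esub> S b = sw H (\<lambda>u v. (co b v \<odot>\<^bsub>H\<^esub> u) \<otimes>\<^bsub>H\<^esub> S b) h"
      unfolding hit_def by (rule sw_hom[OF vspace_A vspace_A bil_hit[OF co_linear[OF b]] mult_lm_left[OF lm_id Sb] h])
    also have "\<dots> = sw H (\<lambda>u v. co b v \<odot>\<^bsub>H\<^esub> (u \<otimes>\<^bsub>H\<^esub> S b)) h"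
      by (rule sw_cong[OF vspace_A bb[OF b] h, symmetric]) (simp add: smult_mult_left Sb)
    finally show "hit (co b) h \<otimes>\<^bsub>H\<^esub> S b = sw H (\<lambda>u v. co b v \<odot>\<^bsub>H\<^esub> (u \<otimes>\<^bsub>H\<^esub> S b)) h" .
  qed
  also have "\<dots> = sw H (\<lambda>u v. \<Oplus>\<^bsub>H\<^esub>b\<in>\<beta>. co b v \<odot>\<^bsub>H\<^esub> (u \<otimes>\<^bsub>H\<^esub> S b)) h"
    by (rule sw_finsum[OF vspace_A finite_\<beta> bb h, symmetric])
  also have "\<dots> = sw H (\<lambda>u v. u \<otimes>\<^bsub>H\<^esub> S v) h"
    by (rule sw_cong[OF vspace_A bil_S_right h, symmetric])
      (rule linear_expand[OF mult_lm_right[OF antipode_linear] vspace_A])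
  finally show ?thesis using sw_antipode_right[OF vspace_A lm_id h] by simp
qed

text \<open>For \<open>a # h\<close> the left side is the sum of
  \<open>a (h1 \<cdot> 1) # h2 S(h3)\<close>, and the antipode removes the last two legs.\<close>

lemma xi_recover:
  assumes x: "x \<in> carrier AT"
  shows "(\<Oplus>\<^bsub>AT\<^esub>b\<in>\<beta>. sm (D (co b) x) (el \<one>\<^bsub>A\<^esub> (S b))) = el (xi x) \<one>\<^bsub>H\<^esub>"
proof (rule AH.tensor_ext[OF _ el_lm_left[OF xi_linear one_closed] vAT _ x])
  interpret AT: abelian_group AT by (rule vspaceD(1)[OF vAT])
  have elS: "el \<one>\<^bsub>A\<^esub> (S b) \<in> carrier AT" if "b \<in> \<beta>" for b
    by (rule el_closed[OF alg.one_closed S_closed[OF \<beta>_mem[OF that]]])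
  show "(\<lambda>x. \<Oplus>\<^bsub>AT\<^esub>b\<in>\<beta>. sm (D (co b) x) (el \<one>\<^bsub>A\<^esub> (S b))) \<in> linear_maps AT AT"
    by (rule lm_finsum[OF vAT finite_\<beta> sm_lm_left[OF D_linear[OF co_linear] elS]])
  fix a h assume a: "a \<in> carrier A" and h: "h \<in> carrier H"
  let ?F = "\<lambda>b u v. el (a \<otimes>\<^bsub>A\<^esub> act u \<one>\<^bsub>A\<^esub>) (hit (co b) v \<otimes>\<^bsub>H\<^esub> S b)"
  have bF: "bilinear_map H H AT (?F b)" if "b \<in> \<beta>" for b
    by (rule bilinear_mapI) (intro lin hit_closed hit_lm co_linear[OF that] S_closed[OF \<beta>_mem[OF that]] a alg.one_closed; assumption)+
  have lf: "(\<lambda>h. el (a \<otimes>\<^bsub>A\<^esub> act h \<one>\<^bsub>A\<^esub>) \<one>\<^bsub>H\<^esub>) \<in> linear_maps H AT"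
    by (intro lin a alg.one_closed one_closed)
  have "(\<Oplus>\<^bsub>AT\<^esub>b\<in>\<beta>. sm (D (co b) (el a h)) (el \<one>\<^bsub>A\<^esub> (S b))) = (\<Oplus>\<^bsub>AT\<^esub>b\<in>\<beta>. sw AT (?F b) h)"
  proof (rule AT.finsum_cong'[OF refl])
    show "(\<lambda>b. sw AT (?F b) h) \<in> \<beta> \<rightarrow> carrier AT" using sw_closed[OF vAT bF h] by auto
    fix b assume b: "b \<in> \<beta>"
    note cb = co_linear[OF b] and Sb = S_closed[OF \<beta>_mem[OF b]]
    show "sm (D (co b) (el a h)) (el \<one>\<^bsub>A\<^esub> (S b)) = sw AT (?F b) h"
      unfolding D_el[OF cb a h] sm_el[OF a hit_closed[OF cb h] alg.one_closed Sb]
      by (rule sw_hit[OF vAT bil_q[OF a alg.one_closed Sb] cb h])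
  qed
  also have "\<dots> = sw AT (\<lambda>u v. \<Oplus>\<^bsub>AT\<^esub>b\<in>\<beta>. ?F b u v) h"
    by (rule sw_finsum[OF vAT finite_\<beta> bF h, symmetric])
  also have "\<dots> = sw AT (\<lambda>u v. \<epsilon> v \<odot>\<^bsub>AT\<^esub> el (a \<otimes>\<^bsub>A\<^esub> act u \<one>\<^bsub>A\<^esub>) \<one>\<^bsub>H\<^esub>) h"
  proof (rule sw_cong[OF vAT _ h])
    show "bilinear_map H H AT (\<lambda>u v. \<Oplus>\<^bsub>AT\<^esub>b\<in>\<beta>. ?F b u v)"
      by (rule bilinear_mapI; rule lm_finsum[OF vAT finite_\<beta>]; rule bilinear_mapD[OF bF])
    fix u v assume uv: "u \<in> carrier H" "v \<in> carrier H"
    have au: "a \<otimes>\<^bsub>A\<^esub> act u \<one>\<^bsub>A\<^esub> \<in> carrier A" by (intro lin a uv alg.one_closed)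
    note l = bilinear_mapD(1)[OF AH.bilinear_telem au]
    have "(\<Oplus>\<^bsub>AT\<^esub>b\<in>\<beta>. ?F b u v) = el (a \<otimes>\<^bsub>A\<^esub> act u \<one>\<^bsub>A\<^esub>) (\<Oplus>\<^bsub>H\<^esub>b\<in>\<beta>. hit (co b) v \<otimes>\<^bsub>H\<^esub> S b)"
      by (rule linear_map_finsum[OF l vspace_A vAT finite_\<beta>, symmetric])
        (use hit_closed[OF co_linear uv(2)] S_closed[OF \<beta>_mem] in auto)
    then show "(\<Oplus>\<^bsub>AT\<^esub>b\<in>\<beta>. ?F b u v) = \<epsilon> v \<odot>\<^bsub>AT\<^esub> el (a \<otimes>\<^bsub>A\<^esub> act u \<one>\<^bsub>A\<^esub>) \<one>\<^bsub>H\<^esub>"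
      by (simp add: hit_antipode[OF uv(2)] linear_mapsD(3)[OF l one_closed])
  qed
  also have "\<dots> = el (xi (el a h)) \<one>\<^bsub>H\<^esub>"
    unfolding xi_el[OF a h] by (rule sw_counit_right[OF vAT lf h])
  finally show "(\<Oplus>\<^bsub>AT\<^esub>b\<in>\<beta>. sm (D (co b) (el a h)) (el \<one>\<^bsub>A\<^esub> (S b))) = el (xi (el a h)) \<one>\<^bsub>H\<^esub>" .
qed

text \<open>\<open>(a # h) e\<close> is the sum of \<open>a (h1 \<cdot> 1) # h2\<close>, and
  expanding \<open>h2\<close> in the basis produces the right side. Thus an element of the partial
  smash product is zero as soon as all its terms \<open>xi (D (co b) x)\<close> vanish.\<close>

lemma xi_expand:
  assumes x: "x \<in> carrier AT"
  shows "sm x e = (\<Oplus>\<^bsub>AT\<^esub>b\<in>\<beta>. el (xi (D (co b) x)) b)"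
proof (rule AH.tensor_ext[OF sm_lm_left[OF lm_id e_closed] _ vAT _ x])
  interpret AT: abelian_group AT by (rule vspaceD(1)[OF vAT])
  show "(\<lambda>x. \<Oplus>\<^bsub>AT\<^esub>b\<in>\<beta>. el (xi (D (co b) x)) b) \<in> linear_maps AT AT"
    by (rule lm_finsum[OF vAT finite_\<beta> el_lm_left[OF lm_comp[OF xi_linear D_linear[OF co_linear]] \<beta>_mem]])
  fix a h assume a: "a \<in> carrier A" and h: "h \<in> carrier H"
  let ?F = "\<lambda>b u v. co b v \<odot>\<^bsub>AT\<^esub> el (a \<otimes>\<^bsub>A\<^esub> act u \<one>\<^bsub>A\<^esub>) b"
  have lu: "(\<lambda>u. el (a \<otimes>\<^bsub>A\<^esub> act u \<one>\<^bsub>A\<^esub>) b) \<in> linear_maps H AT" if "b \<in> carrier H" for b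
    by (intro lin a alg.one_closed that)
  have bF: "bilinear_map H H AT (?F b)" if "b \<in> \<beta>" for b
    by (rule bil_functional_smult_left[OF co_linear[OF that] vAT vspace_A lu[OF \<beta>_mem[OF that]]])
  have "sm (el a h) e = sw AT (\<lambda>u v. el (a \<otimes>\<^bsub>A\<^esub> act u \<one>\<^bsub>A\<^esub>) (v \<otimes>\<^bsub>H\<^esub> \<one>\<^bsub>H\<^esub>)) h"
    by (rule sm_el[OF a h alg.one_closed one_closed])
  also have "\<dots> = sw AT (\<lambda>u v. \<Oplus>\<^bsub>AT\<^esub>b\<in>\<beta>. ?F b u v) h"
  proof (rule sw_cong[OF vAT bil_q[OF a alg.one_closed one_closed] h])
    fix u v assume uv: "u \<in> carrier H" "v \<in> carrier H"
    have au: "a \<otimes>\<^bsub>A\<^esub> act u \<one>\<^bsub>A\<^esub> \<in> carrier A" by (intro lin a uv alg.one_closed)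
    show "el (a \<otimes>\<^bsub>A\<^esub> act u \<one>\<^bsub>A\<^esub>) (v \<otimes>\<^bsub>H\<^esub> \<one>\<^bsub>H\<^esub>) = (\<Oplus>\<^bsub>AT\<^esub>b\<in>\<beta>. ?F b u v)"
      using linear_expand[OF bilinear_mapD(1)[OF AH.bilinear_telem au] vAT uv(2)] uv by simp
  qed
  also have "\<dots> = (\<Oplus>\<^bsub>AT\<^esub>b\<in>\<beta>. sw AT (?F b) h)" by (rule sw_finsum[OF vAT finite_\<beta> bF h])
  also have "\<dots> = (\<Oplus>\<^bsub>AT\<^esub>b\<in>\<beta>. el (xi (D (co b) (el a h))) b)"
  proof (rule AT.finsum_cong'[OF refl])
    show "(\<lambda>b. el (xi (D (co b) (el a h))) b) \<in> \<beta> \<rightarrow> carrier AT"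
      using el_closed[OF xi_closed[OF D_closed[OF co_linear el_closed[OF a h]]] \<beta>_mem] by auto
    fix b assume b: "b \<in> \<beta>"
    note cb = co_linear[OF b]
    have "el (xi (D (co b) (el a h))) b = el (a \<otimes>\<^bsub>A\<^esub> act (hit (co b) h) \<one>\<^bsub>A\<^esub>) b"
      by (simp add: D_el[OF cb a h] xi_el[OF a hit_closed[OF cb h]])
    also have "\<dots> = sw AT (\<lambda>u v. el (a \<otimes>\<^bsub>A\<^esub> act (co b v \<odot>\<^bsub>H\<^esub> u) \<one>\<^bsub>A\<^esub>) b) h"
      unfolding hit_def by (rule sw_hom[OF vspace_A vAT bil_hit[OF cb] lu[OF \<beta>_mem[OF b]] h])
    also have "\<dots> = sw AT (?F b) h"
      by (rule sw_cong[OF vAT bF[OF b] h, symmetric]) (simp add: linear_mapsD(3)[OF lu[OF \<beta>_mem[OF b]]])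
    finally show "sw AT (?F b) h = el (xi (D (co b) (el a h))) b" by simp
  qed
  finally show "sm (el a h) e = (\<Oplus>\<^bsub>AT\<^esub>b\<in>\<beta>. el (xi (D (co b) (el a h))) b)" .
qed

text \<open>The coefficient in \<open>A\<close> at the basis vector \<open>b\<close> of
  \<open>H\<close>.\<close>

definition cc :: "'h \<Rightarrow> ('k, 'a, 'h) tensor \<Rightarrow> 'a" where
  "cc b = tensor_lift A (\<lambda>a h. co b h \<odot>\<^bsub>A\<^esub> a)"

lemma cc_bil: "b \<in> \<beta> \<Longrightarrow> bilinear_map A H A (\<lambda>a h. co b h \<odot>\<^bsub>A\<^esub> a)"
  by (rule bil_functional_smult_left[OF co_linear alg.vspace_A alg.vspace_A lm_id])

lemma cc_linear: "b \<in> \<beta> \<Longrightarrow> cc b \<in> linear_maps AT A"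
  unfolding cc_def by (rule AH.tensor_lift_linear[OF alg.vspace_A cc_bil])

lemma cc_el: "\<lbrakk>b \<in> \<beta>; a \<in> carrier A; h \<in> carrier H\<rbrakk> \<Longrightarrow> cc b (el a h) = co b h \<odot>\<^bsub>A\<^esub> a"
  unfolding cc_def by (rule AH.tensor_lift_elem[OF alg.vspace_A cc_bil])

lemma cc_expand:
  assumes x: "x \<in> carrier AT" shows "x = (\<Oplus>\<^bsub>AT\<^esub>b\<in>\<beta>. el (cc b x) b)"
proof (rule AH.tensor_ext[OF lm_id lm_finsum[OF vAT finite_\<beta> el_lm_left[OF cc_linear \<beta>_mem]] vAT _ x])
  interpret AT: abelian_group AT by (rule vspaceD(1)[OF vAT])
  fix a h assume a: "a \<in> carrier A" and h: "h \<in> carrier H"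
  have "el a h = (\<Oplus>\<^bsub>AT\<^esub>b\<in>\<beta>. co b h \<odot>\<^bsub>AT\<^esub> el a b)"
    by (rule linear_expand[OF bilinear_mapD(1)[OF AH.bilinear_telem a] vAT h])
  also have "\<dots> = (\<Oplus>\<^bsub>AT\<^esub>b\<in>\<beta>. el (cc b (el a h)) b)"
    by (rule AT.finsum_cong'[OF refl])
      (use a h \<beta>_mem vspaceD(2)[OF alg.vspace_A] vspaceD(2)[OF vAT] el_closed in
        \<open>auto simp: cc_el linear_mapsD(3)[OF bilinear_mapD(2)[OF AH.bilinear_telem] a]\<close>)
  finally show "el a h = (\<Oplus>\<^bsub>AT\<^esub>b\<in>\<beta>. el (cc b (el a h)) b)" .
qed

end

text \<open>Only the finitely many coordinates that occur in a finite generating set can be nonzero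
  anywhere.\<close>

lemma fin_dim_coordinates:
  fixes X :: "('k::field, 'x) module"
  assumes X: "vspace X" and fd: "vectorspace.fin_dim class_ring X"
  shows "\<exists>(V :: 'x set) co. finite V \<and> (\<forall>v\<in>V. co v \<in> linear_maps X ground) \<and>
    (\<forall>x\<in>carrier X. \<forall>y\<in>carrier X. (\<forall>v\<in>V. co v x = co v y) \<longrightarrow> x = y)"
proof -
  interpret X: vectorspace class_ring X by (rule X)
  from ex_coordinates[OF X] obtain B where "\<exists>co. B \<subseteq> carrier X \<and> (\<forall>b\<in>B. co b \<in> linear_maps X ground) \<and>
    (\<forall>v\<in>carrier X. finite {b \<in> B. co b v \<noteq> 0} \<and> v = (\<Oplus>\<^bsub>X\<^esub>b\<in>{b \<in> B. co b v \<noteq> 0}. co b v \<odot>\<^bsub>X\<^esub> b)) \<and>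
    (\<forall>b\<in>B. \<forall>b'\<in>B. co b b' = (if b = b' then 1 else 0))" ..
  then obtain co where all: "B \<subseteq> carrier X \<and> (\<forall>b\<in>B. co b \<in> linear_maps X ground) \<and>
    (\<forall>v\<in>carrier X. finite {b \<in> B. co b v \<noteq> 0} \<and> v = (\<Oplus>\<^bsub>X\<^esub>b\<in>{b \<in> B. co b v \<noteq> 0}. co b v \<odot>\<^bsub>X\<^esub> b)) \<and>
    (\<forall>b\<in>B. \<forall>b'\<in>B. co b b' = (if b = b' then 1 else 0))" ..
  note lin = all[THEN conjunct2, THEN conjunct1, rule_format]
    and fin = all[THEN conjunct2, THEN conjunct2, THEN conjunct1, rule_format, THEN conjunct1]
    and exp = all[THEN conjunct2, THEN conjunct2, THEN conjunct1, rule_format, THEN conjunct2]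
    and BX = all[THEN conjunct1]
  obtain G where G: "finite G" "G \<subseteq> carrier X" "X.span G = carrier X"
    using fd unfolding X.fin_dim_def by blast
  define V where "V = (\<Union>g\<in>G. {b \<in> B. co b g \<noteq> 0})"
  have finV: "finite V" unfolding V_def using G(1,2) fin by blast
  let ?N = "{x \<in> carrier X. \<forall>b\<in>B - V. co b x = 0}"
  have co0: "co b \<zero>\<^bsub>X\<^esub> = 0" if "b \<in> B" for b
    using linear_mapsD(3)[OF lin[OF that] vspaceD(4)[OF X], of 0] vspaceD(10)[OF X] by simp
  have sub: "LinearCombinations.submodule class_ring ?N X"
    by (rule LinearCombinations.submodule.intro)
      (use X.module_axioms co0 vspaceD(2,3)[OF X] linear_mapsD(2,3)[OF lin] in auto)
  have "G \<subseteq> ?N" using G(2) by (auto simp: V_def)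
  then have "X.span G \<subseteq> ?N" by (rule X.span_is_subset[OF _ sub])
  then have N: "co b x = 0" if "x \<in> carrier X" "b \<in> B" "b \<notin> V" for b x
    unfolding G(3) using that by blast
  have sep: "x = y" if xy: "x \<in> carrier X" "y \<in> carrier X" and eq: "\<forall>v\<in>V. co v x = co v y" for x y
  proof -
    have e: "co b x = co b y" if "b \<in> B" for b
      using eq N[OF xy(1) that] N[OF xy(2) that] by (cases "b \<in> V") auto
    have "x = (\<Oplus>\<^bsub>X\<^esub>b\<in>{b \<in> B. co b x \<noteq> 0}. co b x \<odot>\<^bsub>X\<^esub> b)" by (rule exp[OF xy(1)])
    also have "\<dots> = (\<Oplus>\<^bsub>X\<^esub>b\<in>{b \<in> B. co b y \<noteq> 0}. co b y \<odot>\<^bsub>X\<^esub> b)"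
      by (rule X.finsum_cong') (use e BX vspaceD(2)[OF X] in auto)
    also have "\<dots> = y" by (rule exp[OF xy(2), symmetric])
    finally show ?thesis .
  qed
  have "V \<subseteq> B" by (auto simp: V_def)
  show ?thesis
  proof (intro exI conjI ballI impI)
    show "finite V" by (rule finV)
    show "co v \<in> linear_maps X ground" if "v \<in> V" for v using lin \<open>V \<subseteq> B\<close> that by blast
    show "x = y" if "x \<in> carrier X" "y \<in> carrier X" "\<forall>v\<in>V. co v x = co v y" for x y by (rule sep[OF that])
  qed
qed

lemma a_minus_smult:
  assumes "vspace V" "x \<in> carrier V" "y \<in> carrier V"
  shows "x \<ominus>\<^bsub>V\<^esub> y = x \<oplus>\<^bsub>V\<^esub> (- 1) \<odot>\<^bsub>V\<^esub> y"
proof -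
  interpret abelian_group V by (rule vspaceD(1)[OF assms(1)])
  note V = vspaceD[OF assms(1)]
  have "(- 1) \<odot>\<^bsub>V\<^esub> y \<oplus>\<^bsub>V\<^esub> y = \<zero>\<^bsub>V\<^esub>" using V(5)[OF assms(3), of "- 1" 1] V(8,9)[OF assms(3)] by simp
  then have "\<ominus>\<^bsub>V\<^esub> y = (- 1) \<odot>\<^bsub>V\<^esub> y" using minus_equality V(2) assms(3) by blast
  then show ?thesis by (simp add: a_minus_def)
qed

section \<open>Finite-dimensional subalgebras of the partial smash product\<close>

locale restricted_smash = partial_smash H \<Delta> \<epsilon> S t \<beta> co A act
  for H :: "('k::field, 'h) module" and \<Delta> :: "'h \<Rightarrow> ('k, 'h, 'h) tensor" and \<epsilon> :: "'h \<Rightarrow> 'k" and S :: "'h \<Rightarrow> 'h"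
    and t :: 'h and \<beta> :: "'h set" and co :: "'h \<Rightarrow> 'h \<Rightarrow> 'k"
    and A :: "('k, 'a) module" and act :: "'h \<Rightarrow> 'a \<Rightarrow> 'a" +
  fixes B :: "'a set" and V :: "'v set" and cB :: "'v \<Rightarrow> 'a \<Rightarrow> 'k"
  assumes B_sub: "B \<subseteq> carrier A" and B_one: "\<one>\<^bsub>A\<^esub> \<in> B"
    and B_add: "\<lbrakk>x \<in> B; y \<in> B\<rbrakk> \<Longrightarrow> x \<oplus>\<^bsub>A\<^esub> y \<in> B"
    and B_smult: "x \<in> B \<Longrightarrow> c \<odot>\<^bsub>A\<^esub> x \<in> B"
    and B_mult: "\<lbrakk>x \<in> B; y \<in> B\<rbrakk> \<Longrightarrow> x \<otimes>\<^bsub>A\<^esub> y \<in> B"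
    and B_act: "\<lbrakk>h \<in> carrier H; x \<in> B\<rbrakk> \<Longrightarrow> act h x \<in> B"
    and finite_V: "finite V"
    and cB_add: "\<lbrakk>v \<in> V; x \<in> B; y \<in> B\<rbrakk> \<Longrightarrow> cB v (x \<oplus>\<^bsub>A\<^esub> y) = cB v x + cB v y"
    and cB_smult: "\<lbrakk>v \<in> V; x \<in> B\<rbrakk> \<Longrightarrow> cB v (c \<odot>\<^bsub>A\<^esub> x) = c * cB v x"
    and cB_sep: "\<lbrakk>x \<in> B; y \<in> B; \<And>v. v \<in> V \<Longrightarrow> cB v x = cB v y\<rbrakk> \<Longrightarrow> x = y"
begin

text \<open>\<open>B \<otimes> H\<close> as a subspace of \<open>A \<otimes> H\<close>, described by
  coefficients; the tensor space formed from \<open>B\<close> itself would consist of different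
  cosets.\<close>

definition TB :: "('k, 'a, 'h) tensor set" where
  "TB = {x \<in> carrier AT. \<forall>b\<in>\<beta>. cc b x \<in> B}"

lemma B_mem: "x \<in> B \<Longrightarrow> x \<in> carrier A" using B_sub by blast

lemma TB_closed: "x \<in> TB \<Longrightarrow> x \<in> carrier AT" by (simp add: TB_def)

lemma TB_add: "\<lbrakk>x \<in> TB; y \<in> TB\<rbrakk> \<Longrightarrow> x \<oplus>\<^bsub>AT\<^esub> y \<in> TB"
  by (simp add: TB_def vspaceD(3)[OF vAT] linear_mapsD(2)[OF cc_linear] B_add)

lemma TB_smult: "x \<in> TB \<Longrightarrow> c \<odot>\<^bsub>AT\<^esub> x \<in> TB"
  by (simp add: TB_def vspaceD(2)[OF vAT] linear_mapsD(3)[OF cc_linear] B_smult)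

lemma TB_el: "\<lbrakk>a \<in> B; h \<in> carrier H\<rbrakk> \<Longrightarrow> el a h \<in> TB"
  by (simp add: TB_def el_closed B_mem cc_el B_smult)

lemma TB_e: "e \<in> TB" by (rule TB_el[OF B_one one_closed])

lemma TB_zero: "\<zero>\<^bsub>AT\<^esub> \<in> TB"
  using TB_smult[OF TB_e, of 0] vspaceD(9)[OF vAT e_closed] by simp

lemma TB_finsum: "\<lbrakk>finite C; \<And>i. i \<in> C \<Longrightarrow> g i \<in> TB\<rbrakk> \<Longrightarrow> (\<Oplus>\<^bsub>AT\<^esub>i\<in>C. g i) \<in> TB"
  by (rule finsum_functional_sub(1)[OF vAT _ TB_zero TB_add]) (use TB_closed in auto)

lemma TB_linear:
  assumes \<phi>: "\<phi> \<in> linear_maps AT AT" and x: "x \<in> TB"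
    and el: "\<And>a h. \<lbrakk>a \<in> B; h \<in> carrier H\<rbrakk> \<Longrightarrow> \<phi> (el a h) \<in> TB"
  shows "\<phi> x \<in> TB"
proof -
  have cB: "cc b x \<in> B" if "b \<in> \<beta>" for b using x that by (simp add: TB_def)
  have "\<phi> x = \<phi> (\<Oplus>\<^bsub>AT\<^esub>b\<in>\<beta>. el (cc b x) b)" using cc_expand[OF TB_closed[OF x]] by simp
  also have "\<dots> = (\<Oplus>\<^bsub>AT\<^esub>b\<in>\<beta>. \<phi> (el (cc b x) b))"
    by (rule linear_map_finsum[OF \<phi> vAT vAT finite_\<beta> el_closed[OF B_mem[OF cB] \<beta>_mem]])
  also have "\<dots> \<in> TB" by (rule TB_finsum[OF finite_\<beta> el[OF cB \<beta>_mem]])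
  finally show ?thesis .
qed

lemma TB_sm: "\<lbrakk>x \<in> TB; y \<in> TB\<rbrakk> \<Longrightarrow> sm x y \<in> TB"
proof (rule TB_linear[OF bilinear_mapD(2)[OF sm_bil TB_closed]])
  assume y: "y \<in> TB"
  fix a h assume ah: "a \<in> B" "h \<in> carrier H"
  show "sm (el a h) y \<in> TB"
  proof (rule TB_linear[OF bilinear_mapD(1)[OF sm_bil el_closed[OF B_mem[OF ah(1)] ah(2)]] y])
    fix b g assume bg: "b \<in> B" "g \<in> carrier H"
    show "sm (el a h) (el b g) \<in> TB"
      unfolding sm_el[OF B_mem[OF ah(1)] ah(2) B_mem[OF bg(1)] bg(2)]
      by (rule sw_in_subspace[OF vAT bil_q[OF B_mem[OF ah(1)] B_mem[OF bg(1)] bg(2)] ah(2) TB_zero TB_add])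
        (auto intro!: TB_el B_mult B_act ah bg)
  qed
qed

lemma TB_D: "\<lbrakk>f \<in> linear_maps H ground; x \<in> TB\<rbrakk> \<Longrightarrow> D f x \<in> TB"
  by (rule TB_linear[OF D_linear]) (simp_all add: D_el B_mem TB_el hit_closed)

definition N :: "('k, 'a, 'h) tensor set" where "N = TB \<inter> carrier SP"

abbreviation R :: "('k, ('k, 'a, 'h) tensor) module" where "R \<equiv> SP\<lparr>carrier := N\<rparr>"

lemma N_closed:
  "N \<subseteq> carrier SP" "N \<subseteq> carrier AT" "e \<in> N" "\<And>x y. \<lbrakk>x \<in> N; y \<in> N\<rbrakk> \<Longrightarrow> x \<oplus>\<^bsub>AT\<^esub> y \<in> N"
  "\<And>c x. x \<in> N \<Longrightarrow> c \<odot>\<^bsub>AT\<^esub> x \<in> N" "\<And>x y. \<lbrakk>x \<in> N; y \<in> N\<rbrakk> \<Longrightarrow> sm x y \<in> N"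
  "\<And>f x. \<lbrakk>f \<in> linear_maps H ground; x \<in> N\<rbrakk> \<Longrightarrow> D f x \<in> N" "\<zero>\<^bsub>AT\<^esub> \<in> N"
proof -
  show "\<zero>\<^bsub>AT\<^esub> \<in> N"
    using TB_zero SP_closed(3)[OF SP_closed(1), of 0] vspaceD(9)[OF vAT e_closed] by (simp add: N_def)
qed (auto simp: N_def TB_e TB_closed TB_add TB_smult TB_sm TB_D SP_closed D_SP)

lemma algebra_R: "algebra_over_field R"
  by (rule algebra_sub) (use N_closed in auto)

lemma R_simps:
  "carrier R = N" "x \<otimes>\<^bsub>R\<^esub> y = sm x y" "\<one>\<^bsub>R\<^esub> = e" "x \<oplus>\<^bsub>R\<^esub> y = x \<oplus>\<^bsub>AT\<^esub> y" "\<zero>\<^bsub>R\<^esub> = \<zero>\<^bsub>AT\<^esub>" "c \<odot>\<^bsub>R\<^esub> x = c \<odot>\<^bsub>AT\<^esub> x"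
  by (simp_all add: SP_simps(2-))

definition \<iota> :: "('k, 'a, 'h) tensor \<Rightarrow> 'h \<times> 'v \<Rightarrow> 'k" where
  "\<iota> x = (\<lambda>(b, v). if b \<in> \<beta> \<and> v \<in> V then cB v (cc b x) else 0)"

lemma N_cc: "\<lbrakk>x \<in> N; b \<in> \<beta>\<rbrakk> \<Longrightarrow> cc b x \<in> B"
  by (simp add: N_def TB_def)

lemma fd_R: "fd_algebra R \<iota>"
proof (intro fd_algebra.intro fd_algebra_axioms.intro algebra_R, unfold R_simps)
  show "inj_on \<iota> N"
  proof (rule inj_onI)
    fix x y assume x: "x \<in> N" and y: "y \<in> N" and eq: "\<iota> x = \<iota> y"
    have "cc b x = cc b y" if b: "b \<in> \<beta>" for b
    proof (rule cB_sep[OF N_cc[OF x b] N_cc[OF y b]])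
      show "cB v (cc b x) = cB v (cc b y)" if "v \<in> V" for v
        using fun_cong[OF eq, of "(b, v)"] b that by (simp add: \<iota>_def)
    qed
    then have eq: "(\<Oplus>\<^bsub>AT\<^esub>b\<in>\<beta>. el (cc b x) b) = (\<Oplus>\<^bsub>AT\<^esub>b\<in>\<beta>. el (cc b y) b)"
      by (intro abelian_monoid.finsum_cong'[OF abelian_group.axioms(1)[OF vspaceD(1)[OF vAT]]])
        (use N_cc[OF y] el_closed B_mem \<beta>_mem in auto)
    have "x = (\<Oplus>\<^bsub>AT\<^esub>b\<in>\<beta>. el (cc b x) b)" by (rule cc_expand) (use x N_closed(2) in blast)
    also note eq
    also have "(\<Oplus>\<^bsub>AT\<^esub>b\<in>\<beta>. el (cc b y) b) = y" by (rule cc_expand[symmetric]) (use y N_closed(2) in blast)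
    finally show "x = y" .
  qed
  show "\<iota> (x \<oplus>\<^bsub>AT\<^esub> y) = \<iota> x + \<iota> y" if "x \<in> N" "y \<in> N" for x y
  proof -
    have "x \<in> carrier AT" "y \<in> carrier AT" using that N_closed(2) by auto
    then show ?thesis using N_cc[OF that(1)] N_cc[OF that(2)]
      by (auto simp: \<iota>_def fun_eq_iff linear_mapsD(2)[OF cc_linear] cB_add)
  qed
  show "\<iota> (c \<odot>\<^bsub>AT\<^esub> x) = (\<lambda>i. c * \<iota> x i)" if "x \<in> N" for c x
  proof -
    have "x \<in> carrier AT" using that N_closed(2) by auto
    then show ?thesis using N_cc[OF that]
      by (auto simp: \<iota>_def fun_eq_iff linear_mapsD(3)[OF cc_linear] cB_smult)
  qed
  show "finite_dim (\<iota> ` N)"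
    by (rule finite_dim_subset[OF finite_dim_finite_support[of "\<beta> \<times> V"]])
      (auto simp: \<iota>_def finite_\<beta> finite_V)
qed

lemma functional_D:
  assumes \<phi>: "\<phi> \<in> linear_maps R ground" and f: "f \<in> linear_maps H ground" and x: "x \<in> N"
  shows "\<phi> (D f x) = (\<Sum>b\<in>\<beta>. f b * \<phi> (D (co b) x))"
proof -
  note \<phi>D = linear_mapsD[OF \<phi>, unfolded R_simps ground_simps]
  have Dx: "D (co b) x \<in> N" if "b \<in> \<beta>" for b by (rule N_closed(7)[OF co_linear[OF that] x])
  have \<phi>0: "\<phi> \<zero>\<^bsub>AT\<^esub> = 0" using \<phi>D(3)[OF x, of 0] vspaceD(9)[OF vAT] x N_closed(2) by auto
  have "\<phi> (D f x) = (\<Sum>b\<in>\<beta>. \<phi> (f b \<odot>\<^bsub>AT\<^esub> D (co b) x))"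
    using x N_closed(2) D_expand[OF f, of x]
      finsum_functional_sub(2)[OF vAT N_closed(2,8,4) finite_\<beta>, of "\<lambda>b. f b \<odot>\<^bsub>AT\<^esub> D (co b) x" \<phi>] \<phi>D(2) \<phi>0 N_closed(5)[OF Dx]
    by auto
  then show ?thesis by (simp add: \<phi>D(3) Dx)
qed

text \<open>Reduces relations among the maps \<open>D f\<close> to relations among the values of the
  functionals \<open>f\<close> on the basis, where those for \<open>lam\<close> and
  \<open>kap\<close> apply.\<close>

lemma functional_D_sum:
  assumes \<phi>: "\<phi> \<in> linear_maps R ground" and f: "\<And>i. i \<in> C \<Longrightarrow> f i \<in> linear_maps H ground" and x: "x \<in> N"
  shows "(\<Sum>i\<in>C. k i * \<phi> (D (f i) x)) = (\<Sum>b\<in>\<beta>. (\<Sum>i\<in>C. k i * f i b) * \<phi> (D (co b) x))"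
proof -
  have "(\<Sum>i\<in>C. k i * \<phi> (D (f i) x)) = (\<Sum>i\<in>C. \<Sum>b\<in>\<beta>. k i * (f i b * \<phi> (D (co b) x)))"
    by (rule sum.cong[OF refl]) (simp add: functional_D[OF \<phi> f x] sum_distrib_left)
  also have "\<dots> = (\<Sum>b\<in>\<beta>. \<Sum>i\<in>C. k i * (f i b * \<phi> (D (co b) x)))" by (rule sum.swap)
  finally show ?thesis by (simp add: sum_distrib_right mult.assoc)
qed

text \<open>Each assumption is a relation for \<open>lam\<close> or \<open>kap\<close> transported
  by \<open>D\<close>: composition becomes convolution, products are governed by \<open>D_sm\<close>
  with \<open>lam_mult\<close>, and \<open>D \<epsilon>\<close> is the identity.\<close>

lemma comodule_R: "comodule_algebra R \<iota> \<beta> (\<lambda>a b. D (lam a b)) (\<lambda>a. co a t) \<epsilon> kap kap'"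
proof (intro comodule_algebra.intro comodule_algebra_axioms.intro fd_R finite_\<beta> counit_co_t kap_inverse, unfold R_simps)
  have lam: "lam a b \<in> linear_maps H ground" if "a \<in> \<beta>" "b \<in> \<beta>" for a b
    by (rule lam_linear[OF \<beta>_mem[OF that(1)] that(2)])
  have NAT: "x \<in> carrier AT" if "x \<in> N" for x using that N_closed(2) by blast
  fix a b assume a: "a \<in> \<beta>" and b: "b \<in> \<beta>"
  note L = lam[OF a b]
  show "D (lam a b) x \<in> N" if "x \<in> N" for x by (rule N_closed(7)[OF L that])
  show "D (lam a b) (x \<oplus>\<^bsub>AT\<^esub> y) = D (lam a b) x \<oplus>\<^bsub>AT\<^esub> D (lam a b) y" if "x \<in> N" "y \<in> N" for x y
    by (rule linear_mapsD(2)[OF D_linear[OF L] NAT NAT]) (rule that)+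
  show "D (lam a b) (c \<odot>\<^bsub>AT\<^esub> x) = c \<odot>\<^bsub>AT\<^esub> D (lam a b) x" if "x \<in> N" for c x
    by (rule linear_mapsD(3)[OF D_linear[OF L] NAT[OF that]])
  show "D (lam a b) e = (if a = b then e else \<zero>\<^bsub>AT\<^esub>)"
    using D_e[OF L] lam_one[OF a b] vspaceD(8,9)[OF vAT e_closed] by simp
next
  have lam: "lam a b \<in> linear_maps H ground" if "a \<in> \<beta>" "b \<in> \<beta>" for a b
    by (rule lam_linear[OF \<beta>_mem[OF that(1)] that(2)])
  have NAT: "x \<in> carrier AT" if "x \<in> N" for x using that N_closed(2) by blast
  fix \<phi> assume \<phi>: "\<phi> \<in> linear_maps R ground"
  note \<phi>D = linear_mapsD[OF \<phi>, unfolded R_simps ground_simps]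
  {
    fix a b x y assume a: "a \<in> \<beta>" and b: "b \<in> \<beta>" and x: "x \<in> N" and y: "y \<in> N"
    have \<phi>0: "\<phi> \<zero>\<^bsub>AT\<^esub> = 0" using \<phi>D(3)[OF x, of 0] vspaceD(9)[OF vAT NAT[OF x]] by simp
    have "D (lam a b) (sm x y) = (\<Oplus>\<^bsub>AT\<^esub>c\<in>\<beta>. sm (D (lam a c) x) (D (lam c b) y))"
      by (rule D_sm[OF finite_\<beta> lam[OF a b] lam[OF a] lam[OF _ b] lam_mult[OF a b] NAT[OF x] NAT[OF y]])
    then show "\<phi> (D (lam a b) (sm x y)) = (\<Sum>c\<in>\<beta>. \<phi> (sm (D (lam a c) x) (D (lam c b) y)))"
      using finsum_functional_sub(2)[OF vAT N_closed(2,8,4) finite_\<beta>, of "\<lambda>c. sm (D (lam a c) x) (D (lam c b) y)" \<phi>]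
        \<phi>D(2) \<phi>0 N_closed(6)[OF N_closed(7)[OF lam[OF a] x] N_closed(7)[OF lam[OF _ b] y]]
      by auto
  next
    fix b x assume b: "b \<in> \<beta>" and x: "x \<in> N"
    have "(\<Sum>a\<in>\<beta>. co a t * \<phi> (D (lam a b) x)) = (\<Sum>d\<in>\<beta>. (co b t * \<epsilon> d) * \<phi> (D (co d) x))"
      using functional_D_sum[where f = "\<lambda>a. lam a b" and C = \<beta> and k = "\<lambda>a. co a t", OF \<phi> lam[OF _ b] x]
      by (simp add: lam_integral[OF b \<beta>_mem])
    also have "\<dots> = co b t * \<phi> (D \<epsilon> x)"
      by (simp add: functional_D[OF \<phi> functional_\<epsilon> x] sum_distrib_left mult.assoc)
    finally show "(\<Sum>a\<in>\<beta>. co a t * \<phi> (D (lam a b) x)) = co b t * \<phi> x" by (simp add: D_counit NAT x)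
  next
    fix a x assume a: "a \<in> \<beta>" and x: "x \<in> N"
    have "(\<Sum>b\<in>\<beta>. \<epsilon> b * \<phi> (D (lam a b) x)) = (\<Sum>d\<in>\<beta>. (\<epsilon> a * \<epsilon> d) * \<phi> (D (co d) x))"
      using functional_D_sum[where f = "\<lambda>b. lam a b" and C = \<beta> and k = \<epsilon>, OF \<phi> lam[OF a] x]
      by (simp add: lam_counit[OF \<beta>_mem[OF a] \<beta>_mem])
    also have "\<dots> = \<epsilon> a * \<phi> (D \<epsilon> x)"
      by (simp add: functional_D[OF \<phi> functional_\<epsilon> x] sum_distrib_left mult.assoc)
    finally show "(\<Sum>b\<in>\<beta>. \<epsilon> b * \<phi> (D (lam a b) x)) = \<epsilon> a * \<phi> x" by (simp add: D_counit NAT x)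
  next
    fix a g x b r assume a: "a \<in> \<beta>" and g: "g \<in> \<beta>" and x: "x \<in> \<beta>" and b: "b \<in> \<beta>" and r: "r \<in> N"
    have "(\<Sum>x'\<in>\<beta>. \<Sum>b'\<in>\<beta>. kap a g x' b' * \<phi> (D (lam x' x) (D (lam b' b) r)))
        = (\<Sum>x'\<in>\<beta>. \<Sum>b'\<in>\<beta>. kap a g x' b' * \<phi> (D (conv (lam x' x) (lam b' b)) r))"
      by (intro sum.cong refl) (simp add: D_D lam x b NAT r)
    also have "\<dots> = (\<Sum>x'\<in>\<beta>. \<Sum>d\<in>\<beta>. (\<Sum>b'\<in>\<beta>. kap a g x' b' * conv (lam x' x) (lam b' b) d) * \<phi> (D (co d) r))"
      by (rule sum.cong[OF refl], rule functional_D_sum[OF \<phi> _ r]) (intro conv_linear lam x b)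
    also have "\<dots> = (\<Sum>d\<in>\<beta>. (\<Sum>x'\<in>\<beta>. \<Sum>b'\<in>\<beta>. kap a g x' b' * conv (lam x' x) (lam b' b) d) * \<phi> (D (co d) r))"
      by (subst sum.swap) (simp add: sum_distrib_right)
    also have "\<dots> = (\<Sum>d\<in>\<beta>. (\<Sum>a'\<in>\<beta>. kap a' g x b * lam a a' d) * \<phi> (D (co d) r))"
      by (simp add: kap_intertwines[OF a g x b \<beta>_mem])
    also have "\<dots> = (\<Sum>a'\<in>\<beta>. kap a' g x b * \<phi> (D (lam a a') r))"
      by (rule functional_D_sum[OF \<phi> lam[OF a] r, symmetric])
    finally show "(\<Sum>x'\<in>\<beta>. \<Sum>b'\<in>\<beta>. kap a g x' b' * \<phi> (D (lam x' x) (D (lam b' b) r)))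
        = (\<Sum>a'\<in>\<beta>. kap a' g x b * \<phi> (D (lam a a') r))" .
  }
qed

lemma vR: "vspace R"
  using algebra_R by (simp add: algebra_over_field_def)

text \<open>The chain \<open>N u\<^sup>k\<close> of finite-dimensional spaces becomes stationary.\<close>

lemma right_inverse_mem:
  assumes u: "u \<in> N" and s: "s \<in> carrier SP" and us: "sm u s = e"
  shows "s \<in> N"
proof -
  interpret R: fd_algebra R \<iota> by (rule fd_R)
  \<comment> \<open>Right multiplication by \<open>u\<close> is injective on \<open>N\<close>,
    because \<open>(z u) s = z\<close>.\<close>
  define L where "L z = sm z u" for z
  have sAT: "s \<in> carrier AT" "u \<in> carrier AT" using s u N_closed(2) SP_iff by auto
  have NAT: "x \<in> carrier AT" if "x \<in> N" for x using that N_closed(2) by blast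
  have Ne: "sm x e = x" if "x \<in> N" for x using that N_closed(1) SP_iff by blast
  have cancel: "z = z'" if "z \<in> N" "z' \<in> N" "L z = L z'" for z z'
  proof -
    have "sm (L z) s = sm (L z') s" using that(3) by simp
    then have "sm z (sm u s) = sm z' (sm u s)"
      using sm_assoc[OF NAT[OF that(1)] sAT(2,1)] sm_assoc[OF NAT[OF that(2)] sAT(2,1)] by (simp add: L_def)
    then show ?thesis using Ne that by (simp add: us)
  qed
  note Llin = linear_mapsD(2,3)[OF bilinear_mapD(2)[OF sm_bil sAT(2)]]
  have L0: "L \<zero>\<^bsub>AT\<^esub> = \<zero>\<^bsub>AT\<^esub>"
    using Llin(2)[OF e_closed, of 0] vspaceD(9)[OF vAT] e_closed sm_closed[OF e_closed sAT(2)] by (simp add: L_def)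
  define M where "M k = (L ^^ k) ` N" for k
  have M_Suc: "M (Suc k) = L ` M k" for k by (simp add: M_def image_comp)
  have M: "M k \<subseteq> N \<and> \<zero>\<^bsub>AT\<^esub> \<in> M k \<and> (\<forall>x\<in>M k. \<forall>y\<in>M k. x \<oplus>\<^bsub>AT\<^esub> y \<in> M k) \<and> (\<forall>c. \<forall>x\<in>M k. c \<odot>\<^bsub>AT\<^esub> x \<in> M k)" for k
  proof (induction k)
    case 0
    then show ?case using N_closed by (simp add: M_def)
  next
    case (Suc k)
    note IH = Suc.IH[THEN conjunct1] Suc.IH[THEN conjunct2, THEN conjunct1]
      Suc.IH[THEN conjunct2, THEN conjunct2, THEN conjunct1, rule_format]
      Suc.IH[THEN conjunct2, THEN conjunct2, THEN conjunct2, rule_format]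
    have c: "x \<in> carrier AT" if "x \<in> M k" for x using that IH(1) NAT by blast
    have "L ` M k \<subseteq> N" using IH(1) N_closed(6)[OF _ u] by (auto simp: L_def)
    moreover have "\<zero>\<^bsub>AT\<^esub> \<in> L ` M k" using IH(2) L0 by (metis imageI)
    moreover have "L x \<oplus>\<^bsub>AT\<^esub> L y \<in> L ` M k" if "x \<in> M k" "y \<in> M k" for x y
      using IH(3)[OF that] Llin(1)[OF c[OF that(1)] c[OF that(2)]] by (metis L_def imageI)
    moreover have "c \<odot>\<^bsub>AT\<^esub> L x \<in> L ` M k" if "x \<in> M k" for c x
      using IH(4)[OF that] Llin(2)[OF c[OF that]] by (metis L_def imageI)
    ultimately show ?case unfolding M_Suc by auto
  qed
  have \<iota>0: "\<iota> \<zero>\<^bsub>AT\<^esub> = 0"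
    using R.\<iota>_smult[of "\<zero>\<^bsub>R\<^esub>" 0] N_closed(8) vspaceD(10)[OF vAT] by (simp add: SP_simps(2-) fun_eq_iff)
  have sub: "fv.subspace (\<iota> ` M k)" for k
  proof (rule subspaceI)
    have MN: "x \<in> N" if "x \<in> M k" for x using M[of k] that by blast
    show "0 \<in> \<iota> ` M k" using M[of k] \<iota>0 by (metis imageI)
    show "x + y \<in> \<iota> ` M k" if "x \<in> \<iota> ` M k" "y \<in> \<iota> ` M k" for x y
    proof -
      from that obtain x' y' where "x' \<in> M k" "y' \<in> M k" "x = \<iota> x'" "y = \<iota> y'" by blast
      then show ?thesis using R.\<iota>_add[of x' y'] M[of k] MN by (auto simp: SP_simps(4) intro!: image_eqI[of _ _ "x' \<oplus>\<^bsub>AT\<^esub> y'"])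
    qed
    show "(\<lambda>i. c * x i) \<in> \<iota> ` M k" if "x \<in> \<iota> ` M k" for c x
    proof -
      from that obtain x' where "x' \<in> M k" "x = \<iota> x'" by blast
      then show ?thesis using R.\<iota>_smult[of x' c] M[of k] MN by (auto simp: SP_simps(6) intro!: image_eqI[of _ _ "c \<odot>\<^bsub>AT\<^esub> x'"])
    qed
  qed
  obtain k where k: "\<And>j. fv.dim (\<iota> ` M k) \<le> fv.dim (\<iota> ` M j)"
    using ex_has_least_nat[of "\<lambda>_. True" undefined "\<lambda>j. fv.dim (\<iota> ` M j)"] by auto
  have decr: "M (Suc j) \<subseteq> M j" for j
  proof (induction j)
    case 0
    then show ?case using M[of 1] by (simp add: M_def)
  next
    case (Suc j)
    then show ?case unfolding M_Suc[of "Suc j"] M_Suc[of j] by blast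
  qed
  have "\<iota> ` M (Suc k) = \<iota> ` M k"
  proof (rule subspace_eq_of_dim[OF _ image_mono[OF decr] sub k])
    have "\<iota> ` M k \<subseteq> \<iota> ` carrier R" using M[of k] by (auto simp: R_simps)
    then show "finite_dim (\<iota> ` M k)" by (rule finite_dim_subset[OF R.finite_dim_\<iota>])
  qed
  then have "M (Suc k) = M k"
    using inj_on_image_eq_iff[OF R.inj_\<iota>, of "M (Suc k)" "M k"] M[of k] M[of "Suc k"] by (simp add: R_simps)
  \<comment> \<open>Where the chain is stationary, \<open>L^k e = L^k (z u)\<close> for some
    \<open>z\<close> in \<open>N\<close>. Injectivity gives \<open>e = z u\<close>, and therefore
    \<open>s = z u s = z\<close>.\<close>
  moreover have "(L ^^ k) e \<in> M k" using N_closed(3) by (simp add: M_def)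
  ultimately have "(L ^^ k) e \<in> (\<lambda>x. (L ^^ k) (L x)) ` N" by (simp add: M_def funpow_swap1)
  then obtain z where z: "z \<in> N" "(L ^^ k) e = (L ^^ k) (L z)" by blast
  have Lk: "(L ^^ j) x \<in> N" if "x \<in> N" for j x
    using that M[of j] by (auto simp: M_def)
  have inj: "x = y" if "x \<in> N" "y \<in> N" "(L ^^ j) x = (L ^^ j) y" for j x y
    using that(3)
  proof (induction j)
    case (Suc j)
    then show ?case using cancel[OF Lk[OF that(1), of j] Lk[OF that(2), of j]] by simp
  qed simp
  have LzN: "L z \<in> N" unfolding L_def by (rule N_closed(6)[OF z(1) u])
  have "e = sm z u" using inj[OF N_closed(3) LzN z(2)] by (simp add: L_def)
  then have "s = sm (sm z u) s" using sm_e_left[OF sAT(1)] by simp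
  also have "\<dots> = sm z (sm u s)" by (rule sm_assoc[OF NAT[OF z(1)] sAT(2,1)])
  also have "\<dots> = z" using Ne[OF z(1)] us by simp
  finally show ?thesis using z(1) by simp
qed

text \<open>Right inverses of elements of \<open>N\<close> stay in \<open>N\<close>, so
  \<open>y\<close> lies in the radical of the finite-dimensional \<open>R\<close>. There stability
  is known, and the right inverse required for \<open>D (lam a b) y\<close> and \<open>r\<close>
  already exists inside \<open>R\<close>.\<close>

lemma radical_restrict:
  assumes y: "y \<in> jacobson_radical SP" "y \<in> N" and a: "a \<in> \<beta>" "b \<in> \<beta>" and r: "r \<in> N"
  shows "\<exists>s\<in>carrier SP. (\<one>\<^bsub>SP\<^esub> \<ominus>\<^bsub>SP\<^esub> D (lam a b) y \<otimes>\<^bsub>SP\<^esub> r) \<otimes>\<^bsub>SP\<^esub> s = \<one>\<^bsub>SP\<^esub>"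
proof -
  interpret R: comodule_algebra R \<iota> \<beta> "\<lambda>a b. D (lam a b)" "\<lambda>a. co a t" \<epsilon> kap kap' by (rule comodule_R)
  interpret P: algebra_over_field SP by (rule algebra_SP)
  have NP: "x \<in> carrier SP" if "x \<in> N" for x using that N_closed(1) by blast
  have minus: "e \<ominus>\<^bsub>R\<^esub> x = e \<ominus>\<^bsub>SP\<^esub> x" if "x \<in> N" for x
    using a_minus_smult[OF vR, of e x] a_minus_smult[OF P.vspace_A, of e x] that N_closed(3) NP
    by (simp add: SP_simps(2-))
  have minusN: "e \<ominus>\<^bsub>R\<^esub> x \<in> N" if "x \<in> N" for x
    using R.minus_closed[of e x] that N_closed(3) by simp
  have yR: "y \<in> jacobson_radical R"
    unfolding R.jacobson_radical_iff
  proof (intro conjI ballI)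
    show "y \<in> carrier R" using y(2) by simp
    fix r' assume "r' \<in> carrier R"
    then have r': "r' \<in> N" by simp
    obtain s where s: "s \<in> carrier SP" "sm (e \<ominus>\<^bsub>SP\<^esub> sm y r') s = e"
      using y(1) NP[OF r'] unfolding P.jacobson_radical_iff by (auto simp: SP_simps(2-))
    have yr: "sm y r' \<in> N" by (rule N_closed(6)[OF y(2) r'])
    have us: "sm (e \<ominus>\<^bsub>R\<^esub> sm y r') s = e" using s(2) minus[OF yr] by simp
    have "s \<in> N" by (rule right_inverse_mem[OF minusN[OF yr] s(1) us])
    then show "\<exists>s\<in>carrier R. (\<one>\<^bsub>R\<^esub> \<ominus>\<^bsub>R\<^esub> y \<otimes>\<^bsub>R\<^esub> r') \<otimes>\<^bsub>R\<^esub> s = \<one>\<^bsub>R\<^esub>"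
      using us by (auto simp: SP_simps(2-))
  qed
  have "D (lam a b) y \<in> jacobson_radical R" by (rule R.jacobson_radical_stable[OF yR a])
  then obtain s where s: "s \<in> N" "sm (e \<ominus>\<^bsub>R\<^esub> sm (D (lam a b) y) r) s = e"
    unfolding R.jacobson_radical_iff using r by (auto simp: SP_simps(2-))
  have "D (lam a b) y \<in> N" by (rule N_closed(7)[OF lam_linear[OF \<beta>_mem[OF a(1)] a(2)] y(2)])
  then have "sm (D (lam a b) y) r \<in> N" using r N_closed(6) by blast
  then show ?thesis using s NP by (auto simp: SP_simps(2-) minus)
qed

end

subsection \<open>Stability of the radical of the smash product\<close>

context partial_smash begin

text \<open>Take a finite-dimensional subalgebra \<open>B0\<close> containing \<open>F\<close>, 1
  and all their translates by basis vectors of \<open>H\<close>, and let \<open>B\<close> consist of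
  the \<open>x\<close> in \<open>B0\<close> with \<open>H \<cdot> x\<close> inside
  \<open>B0\<close>. The action being partial, stability of \<open>B\<close> rests on
  \<open>h \<cdot> (g \<cdot> x) = (h1 \<cdot> 1)(h2 g \<cdot> x)\<close>; for this the translates
  of 1 have to be in \<open>B0\<close> as well.\<close>

lemma ex_restricted_smash:
  assumes lf: "locally_finite_algebra A" and F: "finite F" "F \<subseteq> carrier A"
  shows "\<exists>B (V :: 'a set) cB. restricted_smash H \<Delta> \<epsilon> S t \<beta> co A act B V cB \<and> F \<subseteq> B"
proof -
  let ?F = "(\<lambda>(b, x). act b x) ` (\<beta> \<times> insert \<one>\<^bsub>A\<^esub> F) \<union> insert \<one>\<^bsub>A\<^esub> F"
  have "finite ?F" "?F \<subseteq> carrier A"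
    using F finite_\<beta> act_closed[OF \<beta>_mem] by auto
  then have "\<exists>B0. subalgebra_of B0 A \<and> ?F \<subseteq> B0 \<and> vectorspace.fin_dim class_ring (A\<lparr>carrier := B0\<rparr>)"
    using lf[unfolded locally_finite_algebra_def, rule_format, of ?F] by simp
  then obtain B0 where B0: "subalgebra_of B0 A" "?F \<subseteq> B0" "vectorspace.fin_dim class_ring (A\<lparr>carrier := B0\<rparr>)"
    by (elim exE conjE)
  let ?X = "A\<lparr>carrier := B0\<rparr>"
  have B0s: "c \<odot>\<^bsub>A\<^esub> x \<in> B0" if "x \<in> B0" for c x
    using B0(1) that by (auto simp: subalgebra_of_def)
  have sr: "subring B0 A" using B0(1) by (simp add: subalgebra_of_def)
  note B0E = subringE[OF sr]
  have c: "x \<in> carrier A" if "x \<in> B0" for x using that B0E(1) by blast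
  note A = vspaceD[OF alg.vspace_A]
  have vX: "vspace ?X"
  proof (rule vspaceI)
    show "abelian_group ?X"
    proof (rule abelian_groupI)
      show "\<exists>y\<in>carrier ?X. y \<oplus>\<^bsub>?X\<^esub> x = \<zero>\<^bsub>?X\<^esub>" if "x \<in> carrier ?X" for x
        by (rule bexI[of _ "\<ominus>\<^bsub>A\<^esub> x"]) (use that c B0E(5) in \<open>auto simp: alg.l_neg\<close>)
    qed (use c B0E in \<open>auto simp: alg.a_ac\<close>)
  qed (use c B0s A in auto)
  obtain V :: "'a set" and cB where VcB: "finite V \<and> (\<forall>v\<in>V. cB v \<in> linear_maps ?X ground) \<and>
    (\<forall>x\<in>carrier ?X. \<forall>y\<in>carrier ?X. (\<forall>v\<in>V. cB v x = cB v y) \<longrightarrow> x = y)"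
    using fin_dim_coordinates[OF vX B0(3)] by (elim exE)
  have V: "finite V" "\<And>v. v \<in> V \<Longrightarrow> cB v \<in> linear_maps ?X ground"
    "\<And>x y. \<lbrakk>x \<in> B0; y \<in> B0; \<forall>v\<in>V. cB v x = cB v y\<rbrakk> \<Longrightarrow> x = y"
    using VcB by auto
  define B where "B = {x \<in> B0. \<forall>h\<in>carrier H. act h x \<in> B0}"
  have BB: "B \<subseteq> B0" by (auto simp: B_def)
  note actD = bilinear_mapD[OF alg.act_bilinear]
  have sw_B0: "sw A f h \<in> B0"
    if "bilinear_map H H A f" "h \<in> carrier H" "\<And>u v. \<lbrakk>u \<in> carrier H; v \<in> carrier H\<rbrakk> \<Longrightarrow> f u v \<in> B0" for f h
    by (rule sw_in_subspace[OF alg.vspace_A that(1,2) B0E(2,7) that(3)])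
  have bil: "bilinear_map H H A (\<lambda>u v. act u x \<otimes>\<^bsub>A\<^esub> act (v \<otimes>\<^bsub>H\<^esub> g) y)"
    if "x \<in> carrier A" "y \<in> carrier A" "g \<in> carrier H" for x y g
    by (rule bilinear_mapI) (intro lin that; assumption)+
  have am: "act h (x \<otimes>\<^bsub>A\<^esub> act g y) = sw A (\<lambda>u v. act u x \<otimes>\<^bsub>A\<^esub> act (v \<otimes>\<^bsub>H\<^esub> g) y) h"
    if "h \<in> carrier H" "g \<in> carrier H" "x \<in> carrier A" "y \<in> carrier A" for h g x y
    unfolding sw_def by (rule alg.act_mult[OF that])
  have B_basis: "x \<in> B" if x: "x \<in> insert \<one>\<^bsub>A\<^esub> F" for x
  proof -
    have xB0: "x \<in> B0" using x B0(2) by blast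
    have "act h x \<in> B0" if h: "h \<in> carrier H" for h
    proof -
      have "act h x = (\<Oplus>\<^bsub>A\<^esub>b\<in>\<beta>. co b h \<odot>\<^bsub>A\<^esub> act b x)"
        by (rule linear_expand[OF actD(2)[OF c[OF xB0]] alg.vspace_A h])
      also have "\<dots> \<in> B0"
        by (rule finsum_functional_sub(1)[OF alg.vspace_A B0E(1,2,7) finite_\<beta>])
          (use x B0(2) in \<open>auto intro!: B0s\<close>)
      finally show ?thesis .
    qed
    then show ?thesis using xB0 by (simp add: B_def)
  qed
  have BA: "x \<in> carrier A" "x \<in> B0" "\<And>h. h \<in> carrier H \<Longrightarrow> act h x \<in> B0" if "x \<in> B" for x
    using that c by (auto simp: B_def)
  have one: "\<one>\<^bsub>A\<^esub> \<in> B" by (rule B_basis) simp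
  have "restricted_smash H \<Delta> \<epsilon> S t \<beta> co A act B V cB"
  proof (intro restricted_smash.intro restricted_smash_axioms.intro partial_smash_axioms V(1) one)
    show "B \<subseteq> carrier A" using BA by blast
    show "x \<oplus>\<^bsub>A\<^esub> y \<in> B" if "x \<in> B" "y \<in> B" for x y
      using that B0E(7) BA[OF that(1)] BA[OF that(2)] linear_mapsD(2)[OF actD(1)] by (simp add: B_def)
    show "c \<odot>\<^bsub>A\<^esub> x \<in> B" if "x \<in> B" for c x
      using that B0s BA[OF that] linear_mapsD(3)[OF actD(1)] by (simp add: B_def)
    show "x \<otimes>\<^bsub>A\<^esub> y \<in> B" if xy: "x \<in> B" "y \<in> B" for x y
    proof -
      have "act h (x \<otimes>\<^bsub>A\<^esub> y) \<in> B0" if h: "h \<in> carrier H" for h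
      proof -
        \<comment> \<open>Replacing \<open>y\<close> by \<open>1 \<cdot> y\<close> turns the axiom
          of the partial action into a product rule for \<open>x y\<close>.\<close>
        have "act h (x \<otimes>\<^bsub>A\<^esub> act \<one>\<^bsub>H\<^esub> y) \<in> B0"
          unfolding am[OF h one_closed BA(1)[OF xy(1)] BA(1)[OF xy(2)]]
          by (rule sw_B0[OF bil[OF BA(1)[OF xy(1)] BA(1)[OF xy(2)] one_closed] h])
            (intro B0E(6) BA(3) xy m_closed one_closed; assumption)
        then show ?thesis by (simp add: alg.act_one BA(1) xy)
      qed
      then show ?thesis using B0E(6)[OF BA(2)[OF xy(1)] BA(2)[OF xy(2)]] by (simp add: B_def)
    qed
    show "act g x \<in> B" if g: "g \<in> carrier H" and x: "x \<in> B" for g x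
    proof -
      have "act h (act g x) \<in> B0" if h: "h \<in> carrier H" for h
      proof -
        have "act h (\<one>\<^bsub>A\<^esub> \<otimes>\<^bsub>A\<^esub> act g x) \<in> B0"
          unfolding am[OF h g alg.one_closed BA(1)[OF x]]
          by (rule sw_B0[OF bil[OF alg.one_closed BA(1)[OF x] g] h])
            (intro B0E(6) BA(3) x one m_closed g; assumption)
        then show ?thesis using act_closed[OF g BA(1)[OF x]] by simp
      qed
      then show ?thesis using BA(3)[OF x g] by (simp add: B_def)
    qed
    show "cB v (x \<oplus>\<^bsub>A\<^esub> y) = cB v x + cB v y" if "v \<in> V" "x \<in> B" "y \<in> B" for v x y
      using linear_mapsD(2)[OF V(2)[OF that(1)], of x y] BA(2) that by simp
    show "cB v (c \<odot>\<^bsub>A\<^esub> x) = c * cB v x" if "v \<in> V" "x \<in> B" for v c x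
      using linear_mapsD(3)[OF V(2)[OF that(1)], of x c] BA(2) that by simp
    show "x = y" if "x \<in> B" "y \<in> B" "\<And>v. v \<in> V \<Longrightarrow> cB v x = cB v y" for x y
      using V(3) BA(2) that by blast
  qed
  moreover have "F \<subseteq> B" using B_basis by blast
  ultimately show ?thesis by (intro exI conjI)
qed

text \<open>Membership in the radical is tested against one \<open>r\<close> at a time, so it is
  enough to work in a finite-dimensional subalgebra containing both \<open>y\<close> and
  \<open>r\<close>.\<close>

lemma radical_lam_stable:
  assumes lf: "locally_finite_algebra A" and y: "y \<in> jacobson_radical SP" and a: "a \<in> \<beta>" "b \<in> \<beta>"
  shows "D (lam a b) y \<in> jacobson_radical SP"
proof -
  interpret P: algebra_over_field SP by (rule algebra_SP)
  have yP: "y \<in> carrier SP" using y by (simp add: jacobson_radical_def)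
  show ?thesis unfolding P.jacobson_radical_iff
  proof (intro conjI ballI)
    show "D (lam a b) y \<in> carrier SP" by (rule D_SP[OF lam_linear[OF \<beta>_mem[OF a(1)] a(2)] yP])
    fix r assume r: "r \<in> carrier SP"
    let ?F = "(\<lambda>b. cc b y) ` \<beta> \<union> (\<lambda>b. cc b r) ` \<beta>"
    have yr: "y \<in> carrier AT" "r \<in> carrier AT" using yP r SP_iff by auto
    have "finite ?F" "?F \<subseteq> carrier A"
      using finite_\<beta> linear_mapsD(1)[OF cc_linear] yr by auto
    then obtain B and V :: "'a set" and cB where B: "restricted_smash H \<Delta> \<epsilon> S t \<beta> co A act B V cB" "?F \<subseteq> B"
      using ex_restricted_smash[OF lf, of ?F] by blast
    interpret B: restricted_smash H \<Delta> \<epsilon> S t \<beta> co A act B V cB by (rule B(1))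
    have N: "y \<in> B.N" "r \<in> B.N" using B(2) yr yP r by (auto simp: B.N_def B.TB_def)
    show "\<exists>s\<in>carrier SP. (\<one>\<^bsub>SP\<^esub> \<ominus>\<^bsub>SP\<^esub> D (lam a b) y \<otimes>\<^bsub>SP\<^esub> r) \<otimes>\<^bsub>SP\<^esub> s = \<one>\<^bsub>SP\<^esub>"
      by (rule B.radical_restrict[OF y N(1) a N(2)])
  qed
qed

lemma radical_closed:
  "\<zero>\<^bsub>AT\<^esub> \<in> jacobson_radical SP"
  "\<And>x y. \<lbrakk>x \<in> jacobson_radical SP; y \<in> jacobson_radical SP\<rbrakk> \<Longrightarrow> x \<oplus>\<^bsub>AT\<^esub> y \<in> jacobson_radical SP"
  "\<And>x y. \<lbrakk>x \<in> jacobson_radical SP; y \<in> carrier SP\<rbrakk> \<Longrightarrow> sm x y \<in> jacobson_radical SP"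
  "\<And>c x. x \<in> jacobson_radical SP \<Longrightarrow> c \<odot>\<^bsub>AT\<^esub> x \<in> jacobson_radical SP"
  "jacobson_radical SP \<subseteq> carrier AT"
proof -
  interpret P: algebra_over_field SP by (rule algebra_SP)
  note J = P.right_idealD[OF P.right_ideal_jacobson, unfolded SP_simps(2-)]
  show "\<zero>\<^bsub>AT\<^esub> \<in> jacobson_radical SP" by (rule J(2))
  show "x \<oplus>\<^bsub>AT\<^esub> y \<in> jacobson_radical SP" if "x \<in> jacobson_radical SP" "y \<in> jacobson_radical SP" for x y
    by (rule J(3)[OF that])
  show m: "sm x y \<in> jacobson_radical SP" if "x \<in> jacobson_radical SP" "y \<in> carrier SP" for x y
    by (rule J(4)[OF that])
  show JA: "jacobson_radical SP \<subseteq> carrier AT" using J(1) SP_iff by blast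
  show "c \<odot>\<^bsub>AT\<^esub> x \<in> jacobson_radical SP" if x: "x \<in> jacobson_radical SP" for c x
  proof -
    have xA: "x \<in> carrier AT" "sm x e = x" using x J(1) SP_iff by auto
    have "sm x (c \<odot>\<^bsub>AT\<^esub> e) = c \<odot>\<^bsub>AT\<^esub> x"
      using linear_mapsD(3)[OF bilinear_mapD(1)[OF sm_bil xA(1)] e_closed] xA(2) by simp
    then show ?thesis using m[OF x SP_closed(3)[OF SP_closed(1)], of c] by simp
  qed
qed

text \<open>Expanding 1 in \<open>h = 1 h\<close> writes \<open>co b\<close> as a linear combination
  of the matrix coefficients \<open>lam a b\<close>.\<close>

lemma radical_co_stable:
  assumes lf: "locally_finite_algebra A" and y: "y \<in> jacobson_radical SP" and b: "b \<in> \<beta>"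
  shows "D (co b) y \<in> jacobson_radical SP"
proof -
  have yA: "y \<in> carrier AT" using y radical_closed(5) by blast
  have eq: "co b h = (\<Sum>a\<in>\<beta>. co a \<one>\<^bsub>H\<^esub> * lam a b h)" if "h \<in> carrier H" for h
    using functional_expand[OF lm_comp[OF co_linear[OF b] mult_lm_left[OF lm_id that]] one_closed] that
    by (simp add: lam_def)
  have "D (co b) y = (\<Oplus>\<^bsub>AT\<^esub>a\<in>\<beta>. co a \<one>\<^bsub>H\<^esub> \<odot>\<^bsub>AT\<^esub> D (lam a b) y)"
    by (rule D_lincomb[where g = "\<lambda>a. lam a b" and c = "\<lambda>a. co a \<one>\<^bsub>H\<^esub>",
          OF finite_\<beta> co_linear[OF b] lam_linear[OF \<beta>_mem b] eq yA])
  also have "\<dots> \<in> jacobson_radical SP"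
    by (rule finsum_functional_sub(1)[OF vAT radical_closed(5,1,2) finite_\<beta>])
      (assumption | intro radical_closed(4) radical_lam_stable lf y b)+
  finally show ?thesis .
qed

text \<open>The factors \<open>1 # S(b)\<close> in \<open>xi_recover\<close> need not lie in the
  partial smash product. Multiplying the identity by \<open>e\<close> on the right moves them into
  it and does not change \<open>xi y # 1\<close>.\<close>

lemma radical_xi:
  assumes lf: "locally_finite_algebra A" and y: "y \<in> jacobson_radical SP"
  shows "el (xi y) \<one>\<^bsub>H\<^esub> \<in> jacobson_radical SP"
proof -
  interpret AT: abelian_group AT by (rule vspaceD(1)[OF vAT])
  have yA: "y \<in> carrier AT" using y radical_closed(5) by blast
  have S: "el \<one>\<^bsub>A\<^esub> (S b) \<in> carrier AT" and Dc: "D (co b) y \<in> carrier AT" if "b \<in> \<beta>" for b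
    using el_closed[OF alg.one_closed S_closed[OF \<beta>_mem[OF that]]] D_closed[OF co_linear[OF that] yA] by auto
  have "el (xi y) \<one>\<^bsub>H\<^esub> = sm (\<Oplus>\<^bsub>AT\<^esub>b\<in>\<beta>. sm (D (co b) y) (el \<one>\<^bsub>A\<^esub> (S b))) e"
    unfolding xi_recover[OF yA]
    using sm_el_one[OF xi_closed[OF yA] alg.one_closed one_closed] xi_closed[OF yA] by simp
  also have "\<dots> = (\<Oplus>\<^bsub>AT\<^esub>b\<in>\<beta>. sm (sm (D (co b) y) (el \<one>\<^bsub>A\<^esub> (S b))) e)"
    by (rule linear_map_finsum[OF bilinear_mapD(2)[OF sm_bil e_closed] vAT vAT finite_\<beta> sm_closed[OF Dc S]])
  also have "\<dots> = (\<Oplus>\<^bsub>AT\<^esub>b\<in>\<beta>. sm (D (co b) y) (sm (el \<one>\<^bsub>A\<^esub> (S b)) e))"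
    by (rule AT.finsum_cong'[OF refl]) (auto simp: sm_assoc[OF Dc S e_closed] intro!: sm_closed Dc S e_closed)
  also have "\<dots> \<in> jacobson_radical SP"
    by (rule finsum_functional_sub(1)[OF vAT radical_closed(5,1,2) finite_\<beta>])
      (assumption | intro radical_closed(3) radical_co_stable lf y SP_closed(4) SP_closed(1) S)+
  finally show ?thesis .
qed

end

subsection \<open>Partial modules as modules over the smash product\<close>

locale smash_module = partial_smash H \<Delta> \<epsilon> S t \<beta> co A act + M: right_partial_module H \<Delta> A act M ract hact
  for H :: "('k::field, 'h) module" and \<Delta> :: "'h \<Rightarrow> ('k, 'h, 'h) tensor" and \<epsilon> :: "'h \<Rightarrow> 'k" and S :: "'h \<Rightarrow> 'h"
    and t :: 'h and \<beta> :: "'h set" and co :: "'h \<Rightarrow> 'h \<Rightarrow> 'k"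
    and A :: "('k, 'a) module" and act :: "'h \<Rightarrow> 'a \<Rightarrow> 'a"
    and M :: "('k, 'm) module" and ract :: "'m \<Rightarrow> 'a \<Rightarrow> 'm" and hact :: "'m \<Rightarrow> 'h \<Rightarrow> 'm"
begin

lemma vM: "vspace M" by (rule M.vectorspace_axioms)

text \<open>\<open>zt m x\<close> is \<open>m x\<close> for \<open>M\<close> as a right module over the smash product.\<close>

definition zt :: "'m \<Rightarrow> ('k, 'a, 'h) tensor \<Rightarrow> 'm" where
  "zt m = tensor_lift M (\<lambda>a h. hact (ract m a) h)"

lemma ract_closed: "\<lbrakk>m \<in> carrier M; a \<in> carrier A\<rbrakk> \<Longrightarrow> ract m a \<in> carrier M"
  by (rule bilinear_mapD(3)[OF M.ract_bilinear])

lemma hact_closed: "\<lbrakk>m \<in> carrier M; h \<in> carrier H\<rbrakk> \<Longrightarrow> hact m h \<in> carrier M"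
  by (rule bilinear_mapD(3)[OF M.hact_bilinear])

lemmas mlin = lin lm_bil_left[OF M.ract_bilinear] lm_bil_right[OF M.ract_bilinear]
  lm_bil_left[OF M.hact_bilinear] lm_bil_right[OF M.hact_bilinear] ract_closed hact_closed

lemma zt_bil: "m \<in> carrier M \<Longrightarrow> bilinear_map A H M (\<lambda>a h. hact (ract m a) h)"
  by (rule bilinear_mapI) (intro mlin; assumption)+

lemma zt_linear: "m \<in> carrier M \<Longrightarrow> zt m \<in> linear_maps AT M"
  unfolding zt_def by (rule AH.tensor_lift_linear[OF vM zt_bil])

lemma zt_closed: "\<lbrakk>m \<in> carrier M; x \<in> carrier AT\<rbrakk> \<Longrightarrow> zt m x \<in> carrier M"
  by (rule linear_mapsD(1)[OF zt_linear])

lemma zt_linear_left: "x \<in> carrier AT \<Longrightarrow> (\<lambda>m. zt m x) \<in> linear_maps M M"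
  unfolding zt_def by (rule AH.lm_lift_param[OF vM zt_bil _ vM]) (assumption | intro mlin)+

lemma zt_el: "\<lbrakk>m \<in> carrier M; a \<in> carrier A; h \<in> carrier H\<rbrakk> \<Longrightarrow> zt m (el a h) = hact (ract m a) h"
  unfolding zt_def by (rule AH.tensor_lift_elem[OF vM zt_bil])

lemma zt_el_one: "\<lbrakk>m \<in> carrier M; a \<in> carrier A\<rbrakk> \<Longrightarrow> zt m (el a \<one>\<^bsub>H\<^esub>) = ract m a"
  by (simp add: zt_el M.hact_one ract_closed)

lemma zt_e: "m \<in> carrier M \<Longrightarrow> zt m e = m"
  by (simp add: zt_el_one M.ract_one)

text \<open>On pure tensors this is the compatibility axiom of a partial module, applied to
  \<open>ract m a\<close>.\<close>

lemma zt_sm: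
  assumes m: "m \<in> carrier M" and x: "x \<in> carrier AT" and y: "y \<in> carrier AT"
  shows "zt m (sm x y) = zt (zt m x) y"
proof -
  have el: "zt m (sm (el a h) (el b g)) = zt (zt m (el a h)) (el b g)"
    if a: "a \<in> carrier A" and h: "h \<in> carrier H" and b: "b \<in> carrier A" and g: "g \<in> carrier H" for a h b g
  proof -
    have "zt m (sm (el a h) (el b g)) = sw M (\<lambda>h1 h2. zt m (el (a \<otimes>\<^bsub>A\<^esub> act h1 b) (h2 \<otimes>\<^bsub>H\<^esub> g))) h"
      unfolding sm_el[OF a h b g] by (rule sw_hom[OF vAT vM bil_q[OF a b g] zt_linear[OF m] h])
    also have "\<dots> = sw M (\<lambda>h1 h2. hact (ract (ract m a) (act h1 b)) (h2 \<otimes>\<^bsub>H\<^esub> g)) h"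
    proof (rule sw_cong[OF vM _ h, symmetric])
      show "bilinear_map H H M (\<lambda>h1 h2. hact (ract (ract m a) (act h1 b)) (h2 \<otimes>\<^bsub>H\<^esub> g))"
        by (rule bilinear_mapI) (intro mlin a b g m; assumption)+
    qed (simp add: zt_el m a b g act_closed M.ract_mult)
    also have "\<dots> = hact (ract (hact (ract m a) h) b) g"
      unfolding sw_def by (rule M.hact_ract[OF ract_closed[OF m a] b h g, symmetric])
    also have "\<dots> = zt (zt m (el a h)) (el b g)"
      by (simp add: zt_el m a h b g hact_closed ract_closed)
    finally show ?thesis .
  qed
  show ?thesis
  proof (rule AH.tensor_ext[OF lm_comp[OF zt_linear[OF m] sm_lm_left[OF lm_id y]]
        lm_comp[OF zt_linear_left[OF y] zt_linear[OF m]] vM _ x])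
    fix a h assume ah: "a \<in> carrier A" "h \<in> carrier H"
    show "zt m (sm (el a h) y) = zt (zt m (el a h)) y"
      by (rule AH.tensor_ext[OF lm_comp[OF zt_linear[OF m] sm_lm_right[OF lm_id el_closed[OF ah]]]
            zt_linear[OF zt_closed[OF m el_closed[OF ah]]] vM el[OF ah] y])
  qed
qed

text \<open>The orbit is closed under \<open>A\<close> by way of \<open>a # 1\<close> and under
  \<open>H\<close> by way of \<open>(1 # h) e\<close>, so it is a partial submodule; it is nonzero
  since it contains \<open>m\<close>.\<close>

lemma irreducible_orbit:
  assumes irr: "\<And>N. partial_submodule H A M ract hact N \<Longrightarrow> N = {\<zero>\<^bsub>M\<^esub>} \<or> N = carrier M"
    and m: "m \<in> carrier M" "m \<noteq> \<zero>\<^bsub>M\<^esub>"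
  shows "zt m ` carrier SP = carrier M"
proof -
  note l = linear_mapsD[OF zt_linear[OF m(1)]]
  have AT: "x \<in> carrier AT" if "x \<in> carrier SP" for x using that SP_iff by blast
  have m_in: "m \<in> zt m ` carrier SP" using zt_e[OF m(1)] SP_closed(1) by (metis imageI)
  have act: "zt n x \<in> zt m ` carrier SP" if "n \<in> zt m ` carrier SP" "x \<in> carrier SP" for n x
  proof -
    from that(1) obtain y where y: "y \<in> carrier SP" "n = zt m y" by blast
    then have "zt n x = zt m (sm y x)" using zt_sm[OF m(1) AT[OF y(1)] AT[OF that(2)]] by simp
    then show ?thesis using SP_closed(4)[OF AT[OF y(1)] that(2)] by simp
  qed
  have sub: "zt m ` carrier SP \<subseteq> carrier M" using l(1) AT by auto
  have "partial_submodule H A M ract hact (zt m ` carrier SP)"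
    unfolding partial_submodule_def
  proof (intro conjI ballI)
    show "VectorSpace.subspace class_ring (zt m ` carrier SP) M"
    proof (intro VectorSpace.subspace.intro LinearCombinations.submodule.intro vM sub)
      show "Module.module class_ring M" by (rule M.module_axioms)
      show "\<zero>\<^bsub>M\<^esub> \<in> zt m ` carrier SP"
      proof -
        have "zt m (0 \<odot>\<^bsub>AT\<^esub> e) = \<zero>\<^bsub>M\<^esub>" using l(3)[OF e_closed, of 0] vspaceD(9)[OF vM l(1)[OF e_closed]] by simp
        then show ?thesis using SP_closed(3)[OF SP_closed(1), of 0] by (metis imageI)
      qed
      show "v \<oplus>\<^bsub>M\<^esub> w \<in> zt m ` carrier SP" if vw: "v \<in> zt m ` carrier SP" "w \<in> zt m ` carrier SP" for v w
      proof -
        from vw obtain x y where "x \<in> carrier SP" "y \<in> carrier SP" "v = zt m x" "w = zt m y" by blast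
        then show ?thesis using l(2)[of x y] AT SP_closed(2) by (metis imageI)
      qed
      show "c \<odot>\<^bsub>M\<^esub> v \<in> zt m ` carrier SP" if v: "v \<in> zt m ` carrier SP" for c v
      proof -
        from v obtain x where "x \<in> carrier SP" "v = zt m x" by blast
        then show ?thesis using l(3)[of x c] AT SP_closed(3) by (metis imageI)
      qed
    qed
    fix n assume n: "n \<in> zt m ` carrier SP"
    then have nM: "n \<in> carrier M" using sub by blast
    show "ract n a \<in> zt m ` carrier SP" if "a \<in> carrier A" for a
      using act[OF n SP_closed(5)[OF that]] zt_el_one[OF nM that] by simp
    show "hact n h \<in> zt m ` carrier SP" if h: "h \<in> carrier H" for h
    proof -
      have h1: "el \<one>\<^bsub>A\<^esub> h \<in> carrier AT" by (rule el_closed[OF alg.one_closed h])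
      have "zt n (sm (el \<one>\<^bsub>A\<^esub> h) e) = hact n h"
        using zt_sm[OF nM h1 e_closed] zt_el[OF nM alg.one_closed h] zt_e[OF hact_closed[OF nM h]]
        by (simp add: M.ract_one nM)
      then show ?thesis using act[OF n SP_closed(4)[OF h1 SP_closed(1)]] by simp
    qed
  qed
  then show ?thesis using irr m_in m(2) by blast
qed

text \<open>By \<open>irreducible_orbit\<close>, each \<open>y\<close> outside the annihilator of
  \<open>m\<close> admits an \<open>r\<close> with \<open>m y r = m\<close>. Then
  \<open>1 - y r\<close> annihilates \<open>m\<close>, so a right ideal containing \<open>y\<close>
  and the annihilator contains 1.\<close>

lemma irreducible_maximal:
  assumes irr: "\<And>N. partial_submodule H A M ract hact N \<Longrightarrow> N = {\<zero>\<^bsub>M\<^esub>} \<or> N = carrier M"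
    and m: "m \<in> carrier M" "m \<noteq> \<zero>\<^bsub>M\<^esub>"
  shows "maximal_right_ideal {x \<in> carrier SP. zt m x = \<zero>\<^bsub>M\<^esub>} SP"
proof -
  interpret P: algebra_over_field SP by (rule algebra_SP)
  let ?I = "{x \<in> carrier SP. zt m x = \<zero>\<^bsub>M\<^esub>}"
  have AT: "x \<in> carrier AT" if "x \<in> carrier SP" for x using that SP_iff by blast
  note l = linear_mapsD[OF zt_linear[OF m(1)]]
  note M0 = vspaceD(4)[OF vM]
  have minus1: "zt m (x \<ominus>\<^bsub>SP\<^esub> y) = \<zero>\<^bsub>M\<^esub>" if "x \<in> carrier SP" "y \<in> carrier SP" "zt m x = zt m y" for x y
  proof -
    have "x \<ominus>\<^bsub>SP\<^esub> y = x \<oplus>\<^bsub>AT\<^esub> (- 1) \<odot>\<^bsub>AT\<^esub> y"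
      using a_minus_smult[OF P.vspace_A that(1,2)] by (simp add: SP_simps(2-))
    then have "zt m (x \<ominus>\<^bsub>SP\<^esub> y) = zt m y \<oplus>\<^bsub>M\<^esub> (- 1) \<odot>\<^bsub>M\<^esub> zt m y"
      using l(2)[OF AT[OF that(1)] vspaceD(2)[OF vAT AT[OF that(2)]], of "- 1"] l(3)[OF AT[OF that(2)]] that(3) by simp
    also have "\<dots> = (1 + - 1) \<odot>\<^bsub>M\<^esub> zt m y"
      using vspaceD(5)[OF vM l(1)[OF AT[OF that(2)]], of 1 "- 1"] vspaceD(8)[OF vM l(1)[OF AT[OF that(2)]]] by simp
    also have "\<dots> = \<zero>\<^bsub>M\<^esub>" using vspaceD(9)[OF vM l(1)[OF AT[OF that(2)]]] by simp
    finally show ?thesis .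
  qed
  have z0: "zt m \<zero>\<^bsub>AT\<^esub> = \<zero>\<^bsub>M\<^esub>" by (rule AH.linear_map_zero[OF zt_linear[OF m(1)] vAT vM])
  have zz: "zt \<zero>\<^bsub>M\<^esub> x = \<zero>\<^bsub>M\<^esub>" if "x \<in> carrier AT" for x
    by (rule AH.linear_map_zero[OF zt_linear_left[OF that] vM vM])
  have rI: "right_ideal ?I SP"
  proof (rule P.right_idealI)
    show "\<zero>\<^bsub>SP\<^esub> \<in> ?I" using z0 P.zero_closed by (simp add: SP_simps(5))
    show "x \<oplus>\<^bsub>SP\<^esub> y \<in> ?I" if "x \<in> ?I" "y \<in> ?I" for x y
      using that l(2)[OF AT AT] SP_closed(2) vspaceD(8)[OF vM M0] abelian_group.axioms(1)[OF vspaceD(1)[OF vM]]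
      by (simp add: SP_simps(4) abelian_monoid.l_zero[OF _ M0])
    show "x \<otimes>\<^bsub>SP\<^esub> r \<in> ?I" if "x \<in> ?I" "r \<in> carrier SP" for x r
      using that zt_sm[OF m(1) AT AT] zz[OF AT] SP_closed(4)[OF AT] by (simp add: SP_simps(2))
  qed (auto simp: SP_simps(2-))
  have "e \<notin> ?I" using zt_e[OF m(1)] m(2) by simp
  then have ne: "?I \<noteq> carrier SP" using SP_closed(1) by blast
  have "J = ?I \<or> J = carrier SP" if J: "right_ideal J SP" "?I \<subseteq> J" for J
  proof (cases "J \<subseteq> ?I")
    case False
    note JD = P.right_idealD[OF J(1)]
    from False obtain y where y: "y \<in> J" "y \<notin> ?I" by blast
    then have yP: "y \<in> carrier SP" using JD(1) by blast
    then have n: "zt m y \<in> carrier M" "zt m y \<noteq> \<zero>\<^bsub>M\<^esub>" using y(2) l(1) AT by auto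
    have "m \<in> zt (zt m y) ` carrier SP" using irreducible_orbit[OF irr n] m(1) by simp
    then obtain r where r: "r \<in> carrier SP" "m = zt (zt m y) r" by blast
    have yr: "sm y r \<in> carrier SP" by (rule SP_closed(4)[OF AT[OF yP] r(1)])
    have yrJ: "sm y r \<in> J" using JD(4)[OF y(1) r(1)] by (simp add: SP_simps(2))
    have "zt m e = zt m (sm y r)" using zt_sm[OF m(1) AT[OF yP] AT[OF r(1)]] r(2) zt_e[OF m(1)] by simp
    then have "zt m (e \<ominus>\<^bsub>SP\<^esub> sm y r) = \<zero>\<^bsub>M\<^esub>" by (rule minus1[OF SP_closed(1) yr])
    moreover have "e \<ominus>\<^bsub>SP\<^esub> sm y r \<in> carrier SP" by (rule P.minus_closed[OF SP_closed(1) yr])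
    ultimately have "e \<ominus>\<^bsub>SP\<^esub> sm y r \<in> J" using J(2) by blast
    then have "(e \<ominus>\<^bsub>SP\<^esub> sm y r) \<oplus>\<^bsub>SP\<^esub> sm y r \<in> J" using JD(3) yrJ by blast
    then have "e \<in> J" using SP_closed(1) yr by (simp add: P.minus_eq P.a_assoc P.l_neg)
    then show ?thesis using P.right_ideal_one[OF J(1)] by (simp add: SP_simps(3))
  qed (use J(2) in blast)
  then show ?thesis using rI ne unfolding maximal_right_ideal_def by blast
qed

lemma radical_kills:
  assumes irr: "\<And>N. partial_submodule H A M ract hact N \<Longrightarrow> N = {\<zero>\<^bsub>M\<^esub>} \<or> N = carrier M"
    and m: "m \<in> carrier M" and a: "a \<in> carrier A" "el a \<one>\<^bsub>H\<^esub> \<in> jacobson_radical SP"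
  shows "ract m a = \<zero>\<^bsub>M\<^esub>"
proof (cases "m = \<zero>\<^bsub>M\<^esub>")
  case True
  then show ?thesis
    using AH.linear_map_zero[OF bilinear_mapD(2)[OF M.ract_bilinear a(1)] vM vM] by simp
next
  case False
  then have "el a \<one>\<^bsub>H\<^esub> \<in> {x \<in> carrier SP. zt m x = \<zero>\<^bsub>M\<^esub>}"
    using irreducible_maximal[OF irr m False] a(2) unfolding jacobson_radical_def by blast
  then show ?thesis using zt_el_one[OF m a(1)] by simp
qed

end

subsection \<open>Partial modules over quotients\<close>

context partial_smash begin

context
  fixes I :: "'a set"
  assumes I: "ideal I A" and stable: "H_stable H act I"
begin

abbreviation (input) "Q \<equiv> quotient_algebra A I"
abbreviation (input) "\<pi> \<equiv> (\<lambda>a. I +>\<^bsub>A\<^esub> a)"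

text \<open>Scalar multiplication and action on the quotient are defined as unions over
  representatives; for a linear map preserving \<open>I\<close> all members of the union
  coincide.\<close>

lemma coset_UN:
  assumes a: "a \<in> carrier A" and \<phi>: "\<phi> \<in> linear_maps A A" "\<And>i. i \<in> I \<Longrightarrow> \<phi> i \<in> I"
  shows "(\<Union>x\<in>\<pi> a. \<pi> (\<phi> x)) = \<pi> (\<phi> a)"
proof -
  interpret ideal I A by (rule I)
  have sg: "abelian_subgroup I A" by (rule abelian_subgroupI3[OF is_additive_subgroup alg.is_abelian_group])
  have "\<pi> (\<phi> x) = \<pi> (\<phi> a)" if x: "x \<in> \<pi> a" for x
  proof -
    obtain i where i: "i \<in> I" "x = i \<oplus>\<^bsub>A\<^esub> a" using x by (auto simp: a_r_coset_def')
    have "\<phi> x = \<phi> i \<oplus>\<^bsub>A\<^esub> \<phi> a" using linear_mapsD(2)[OF \<phi>(1) Icarr[OF i(1)] a] i(2) by simp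
    then have "\<phi> x \<in> \<pi> (\<phi> a)" using \<phi>(2)[OF i(1)] by (auto simp: a_r_coset_def')
    then show ?thesis using abelian_subgroup.a_repr_independence'[OF sg _ linear_mapsD(1)[OF \<phi>(1) a]] by simp
  qed
  moreover have "a \<in> \<pi> a" by (rule abelian_subgroup.a_rcos_self[OF sg a])
  ultimately show ?thesis by blast
qed

lemma Q_simps:
  "carrier Q = a_rcosets\<^bsub>A\<^esub> I" "\<one>\<^bsub>Q\<^esub> = \<pi> \<one>\<^bsub>A\<^esub>" "\<zero>\<^bsub>Q\<^esub> = I"
  by (simp_all add: quotient_algebra_def ring.defs module.defs FactRing_def)

lemma Q_ops:
  assumes "a \<in> carrier A" "b \<in> carrier A"
  shows "\<pi> a \<in> carrier Q" "\<pi> a \<oplus>\<^bsub>Q\<^esub> \<pi> b = \<pi> (a \<oplus>\<^bsub>A\<^esub> b)" "\<pi> a \<otimes>\<^bsub>Q\<^esub> \<pi> b = \<pi> (a \<otimes>\<^bsub>A\<^esub> b)"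
    "c \<odot>\<^bsub>Q\<^esub> \<pi> a = \<pi> (c \<odot>\<^bsub>A\<^esub> a)"
proof -
  interpret ideal I A by (rule I)
  show "\<pi> a \<in> carrier Q" unfolding Q_simps by (rule alg.a_rcosetsI[OF a_subset assms(1)])
  show "\<pi> a \<oplus>\<^bsub>Q\<^esub> \<pi> b = \<pi> (a \<oplus>\<^bsub>A\<^esub> b)"
    using a_rcos_sum[OF assms] by (simp add: quotient_algebra_def ring.defs module.defs FactRing_def)
  show "\<pi> a \<otimes>\<^bsub>Q\<^esub> \<pi> b = \<pi> (a \<otimes>\<^bsub>A\<^esub> b)"
    using rcoset_mult_add[OF assms] by (simp add: quotient_algebra_def ring.defs module.defs FactRing_def)
  have "c \<odot>\<^bsub>A\<^esub> i \<in> I" if "i \<in> I" for i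
    using alg.smult_mult_left[OF alg.one_closed Icarr[OF that], of c] I_l_closed[OF that vspaceD(2)[OF alg.vspace_A alg.one_closed, of c]]
      Icarr[OF that] by simp
  then show "c \<odot>\<^bsub>Q\<^esub> \<pi> a = \<pi> (c \<odot>\<^bsub>A\<^esub> a)"
    using coset_UN[OF assms(1) lm_smult[OF lm_id alg.vspace_A], of c]
    by (simp add: quotient_algebra_def ring.defs module.defs FactRing_def)
qed

lemma quotient_action_coset:
  assumes "h \<in> carrier H" "a \<in> carrier A"
  shows "quotient_action A I act h (\<pi> a) = \<pi> (act h a)"
  unfolding quotient_action_def
  by (rule coset_UN[OF assms(2) bilinear_mapD(1)[OF alg.act_bilinear assms(1)]])
    (use stable assms(1) in \<open>simp add: H_stable_def\<close>)

text \<open>The modules that define \<open>H\<close>-primitive ideals are modules over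
  \<open>A/I\<close>. Pulling them back along the projection makes them modules over the smash
  product of \<open>A\<close>.\<close>

lemma lift_partial_module:
  assumes M: "right_partial_module H \<Delta> Q (quotient_action A I act) M ract hact"
  shows "right_partial_module H \<Delta> A act M (\<lambda>m a. ract m (\<pi> a)) hact"
proof -
  interpret M: right_partial_module H \<Delta> Q "quotient_action A I act" M ract hact by (rule M)
  have vM: "vspace M" by (rule M.vectorspace_axioms)
  have \<pi>: "\<pi> \<in> linear_maps A Q" by (rule linear_mapsI) (simp_all add: Q_ops)
  have bil: "bilinear_map M A M (\<lambda>m a. ract m (\<pi> a))"
    by (rule bilinear_mapI)
      (auto intro: lm_bil_right[OF M.ract_bilinear \<pi>] bilinear_mapD(2)[OF M.ract_bilinear] Q_ops)
  show ?thesis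
  proof (intro right_partial_module.intro right_partial_module_axioms.intro M.vectorspace_axioms bil M.hact_bilinear M.hact_one)
    show "ract m (\<pi> \<one>\<^bsub>A\<^esub>) = m" if "m \<in> carrier M" for m
      using M.ract_one[OF that] by (simp add: Q_simps)
    show "ract m (\<pi> (a \<otimes>\<^bsub>A\<^esub> b)) = ract (ract m (\<pi> a)) (\<pi> b)" if "m \<in> carrier M" "a \<in> carrier A" "b \<in> carrier A" for m a b
      using M.ract_mult[OF that(1) Q_ops(1)[OF that(2,2)] Q_ops(1)[OF that(3,3)]] by (simp add: Q_ops that)
    fix m a h g assume m: "m \<in> carrier M" and a: "a \<in> carrier A" and h: "h \<in> carrier H" and g: "g \<in> carrier H"
    have b: "bilinear_map H H M (\<lambda>h1 h2. hact (ract m (\<pi> (act h1 a))) (h2 \<otimes>\<^bsub>H\<^esub> g))"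
      by (rule bilinear_mapI)
        (intro lm_bil_left[OF M.hact_bilinear] lm_bil_right[OF M.hact_bilinear] lm_bil_right[OF bil]
          bilinear_mapD(3)[OF bil] lin m a g; assumption)+
    have "hact (ract (hact m h) (\<pi> a)) g
        = tensor_lift M (\<lambda>h1 h2. hact (ract m (quotient_action A I act h1 (\<pi> a))) (h2 \<otimes>\<^bsub>H\<^esub> g)) (\<Delta> h)"
      by (rule M.hact_ract[OF m Q_ops(1)[OF a a] h g])
    also have "\<dots> = tensor_lift M (\<lambda>h1 h2. hact (ract m (\<pi> (act h1 a))) (h2 \<otimes>\<^bsub>H\<^esub> g)) (\<Delta> h)"
      unfolding sw_def[symmetric] by (rule sw_cong[OF vM b h, symmetric]) (simp add: quotient_action_coset a)
    finally show "hact (ract (hact m h) (\<pi> a)) g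
        = tensor_lift M (\<lambda>h1 h2. hact (ract m (\<pi> (act h1 a))) (h2 \<otimes>\<^bsub>H\<^esub> g)) (\<Delta> h)" .
  qed
qed

lemma lift_partial_submodule:
  assumes "partial_submodule H A M (\<lambda>m a. ract m (\<pi> a)) hact N"
  shows "partial_submodule H Q M ract hact N"
  using assms by (auto simp: partial_submodule_def Q_simps A_RCOSETS_def')

end

text \<open>\<open>radical_kills\<close> shows that \<open>a\<close> acts as zero on a faithful
  module over \<open>A/I\<close>, so its coset vanishes.\<close>

lemma radical_in_primitive:
  assumes a: "a \<in> carrier A" "el a \<one>\<^bsub>H\<^esub> \<in> jacobson_radical SP"
    and prim: "right_H_primitive_ideal TYPE('m) H \<Delta> A act I"
  shows "a \<in> I"
proof -
  from prim have I: "ideal I A" and stable: "H_stable H act I"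
    and "\<exists>(M :: ('k, 'm) module) ract hact.
        irreducible_partial_module H \<Delta> (quotient_algebra A I) (quotient_action A I act) M ract hact \<and>
        module_annihilator (quotient_algebra A I) M ract = {\<zero>\<^bsub>quotient_algebra A I\<^esub>}"
    by (simp_all add: right_H_primitive_ideal_def)
  then obtain M :: "('k, 'm) module" and ract hact where
    irr: "irreducible_partial_module H \<Delta> (quotient_algebra A I) (quotient_action A I act) M ract hact"
    and ann: "module_annihilator (quotient_algebra A I) M ract = {\<zero>\<^bsub>quotient_algebra A I\<^esub>}" by (elim exE conjE)
  interpret smash_module H \<Delta> \<epsilon> S t \<beta> co A act M "\<lambda>m a. ract m (I +>\<^bsub>A\<^esub> a)" hact
    by (intro smash_module.intro partial_smash_axioms lift_partial_module[OF I stable])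
      (use irr in \<open>simp add: irreducible_partial_module_def\<close>)
  have "ract m (I +>\<^bsub>A\<^esub> a) = \<zero>\<^bsub>M\<^esub>" if "m \<in> carrier M" for m
  proof (rule radical_kills[OF _ that a])
    fix N assume "partial_submodule H A M (\<lambda>m a. ract m (I +>\<^bsub>A\<^esub> a)) hact N"
    then have "partial_submodule H (quotient_algebra A I) M ract hact N" by (rule lift_partial_submodule[OF I stable])
    then show "N = {\<zero>\<^bsub>M\<^esub>} \<or> N = carrier M" using irr by (simp add: irreducible_partial_module_def)
  qed
  then have "I +>\<^bsub>A\<^esub> a \<in> module_annihilator (quotient_algebra A I) M ract"
    using Q_ops(1)[OF I stable a(1) a(1)] by (simp add: module_annihilator_def)
  then have "I +>\<^bsub>A\<^esub> a = I" using ann Q_simps(3)[OF I stable] by simp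
  moreover have "a \<in> I +>\<^bsub>A\<^esub> a"
    by (rule abelian_subgroup.a_rcos_self[OF abelian_subgroupI3[OF ideal.axioms(1)[OF I] alg.is_abelian_group] a(1)])
  ultimately show ?thesis by simp
qed

lemma semiprimitive:
  assumes "H_semiprimitive TYPE('m) H \<Delta> A act" and lf: "locally_finite_algebra A"
  shows "semiprimitive_ring SP"
proof -
  interpret AT: abelian_group AT by (rule vspaceD(1)[OF vAT])
  have zero: "x = \<zero>\<^bsub>AT\<^esub>" if x: "x \<in> jacobson_radical SP" for x
  proof -
    have xP: "x \<in> carrier SP" using x by (simp add: jacobson_radical_def)
    then have xA: "x \<in> carrier AT" "sm x e = x" by (simp_all add: SP_iff)
    have xi0: "xi (D (co b) x) = \<zero>\<^bsub>A\<^esub>" if b: "b \<in> \<beta>" for b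
    proof -
      have DA: "D (co b) x \<in> carrier AT" by (rule D_closed[OF co_linear[OF b] xA(1)])
      have "el (xi (D (co b) x)) \<one>\<^bsub>H\<^esub> \<in> jacobson_radical SP"
        by (rule radical_xi[OF lf radical_co_stable[OF lf x b]])
      then have "xi (D (co b) x) \<in> H_jacobson_radical TYPE('m) H \<Delta> A act"
        using radical_in_primitive xi_closed[OF DA] unfolding H_jacobson_radical_def by blast
      then show ?thesis using assms(1) by (simp add: H_semiprimitive_def)
    qed
    have "x = (\<Oplus>\<^bsub>AT\<^esub>b\<in>\<beta>. el (xi (D (co b) x)) b)" using xi_expand[OF xA(1)] xA(2) by simp
    also have "\<dots> = (\<Oplus>\<^bsub>AT\<^esub>b\<in>\<beta>. \<zero>\<^bsub>AT\<^esub>)"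
      by (rule AT.finsum_cong'[OF refl])
        (auto simp: xi0 AH.linear_map_zero[OF bilinear_mapD(2)[OF AH.bilinear_telem \<beta>_mem] alg.vspace_A vAT])
    finally show ?thesis by simp
  qed
  then show ?thesis using radical_closed(1) unfolding semiprimitive_ring_def SP_simps(5) by blast
qed

end

theorem theorem5p5:
  fixes H :: "('k::field, 'h) module"
    and \<Delta> :: "'h \<Rightarrow> ('k, 'h, 'h) tensor"
    and \<epsilon> :: "'h \<Rightarrow> 'k"
    and S :: "'h \<Rightarrow> 'h"
    and A :: "('k, 'a) module"
    and act :: "'h \<Rightarrow> 'a \<Rightarrow> 'a"
  assumes "hopf_algebra H \<Delta> \<epsilon> S"
    and "semisimple_ring H"
    and "partial_module_algebra H \<Delta> A act"
    and "H_semiprimitive TYPE('m) H \<Delta> A act"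
    and "locally_finite_algebra A"
  shows "semiprimitive_ring (partial_smash_product H \<Delta> A act)"
proof -
  interpret hopf_algebra H \<Delta> \<epsilon> S by fact
  show ?thesis
  proof (rule exists_integral[OF assms(2)])
    fix t assume t: "t \<in> carrier H" "\<epsilon> t = 1" "\<And>g. g \<in> carrier H \<Longrightarrow> t \<otimes>\<^bsub>H\<^esub> g = \<epsilon> g \<odot>\<^bsub>H\<^esub> t"
    show ?thesis
    proof (rule finite_basis[OF t])
      fix \<beta> co assume b: "finite \<beta>" "\<beta> \<subseteq> carrier H" "\<And>b. b \<in> \<beta> \<Longrightarrow> co b \<in> linear_maps H ground"
        "\<And>h. h \<in> carrier H \<Longrightarrow> h = (\<Oplus>\<^bsub>H\<^esub>b\<in>\<beta>. co b h \<odot>\<^bsub>H\<^esub> b)"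
        "\<And>b b'. \<lbrakk>b \<in> \<beta>; b' \<in> \<beta>\<rbrakk> \<Longrightarrow> co b b' = (if b = b' then 1 else 0)"
      interpret partial_smash H \<Delta> \<epsilon> S t \<beta> co A act
        by (intro partial_smash.intro based_hopf_algebra.intro based_hopf_algebra_axioms.intro assms(1,3) t b)
      show ?thesis by (rule semiprimitive[OF assms(4,5)])
    qed
  qed
qed

end
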